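(* Let $\alpha<0$ and $\varepsilon\in\{0,1\}$. Then the initial value problem $$\begin{cases} i\partial_t u+\varepsilon\partial_x^2u+\partial_y^2u+\alpha\partial_x^4u=\pm|u|^2u, & t\in\mathbb{R},\ (x,y)\in\mathbb{T}\times\mathbb{R},\\ u(0,x,y)=\phi(x,y),\end{cases}$$ (with either choice of sign) is globally well-posed for sufficiently small initial data $\phi\in L^2(\mathbb{T}\times\mathbb{R})$; that is, there is $\delta>0$ such that the problem is globally well-posed for all $\phi$ with $\|\phi\|_{L^2(\mathbb{T}\times\mathbb{R})}\le\delta$.
   Context: $\mathbb{T}=\mathbb{R}/2\pi\mathbb{Z}$; $u$ is complex valued. The group $S_{\alpha,\varepsilon}(t)=e^{it(\varepsilon\partial_x^2+\partial_y^2+\alpha\partial_x^4)}$ is given by $[S_{\alpha,\varepsilon}(t)f]^{\wedge}(n,\xi)=e^{-it(\varepsilon n^2-\alpha n^4+\xi^2)}\widehat f(n,\xi)$ for $(n,\xi)\in\mathbb{Z}\times\mathbb{R}$. Solutions are understood as solutions of the integral equation $$u(t)=S_{\alpha,\varepsilon}(t)\phi\mp i\int_0^tS_{\alpha,\varepsilon}(t-t')|u(t')|^2u(t')\,dt'.$$ Well-posedness is in the usual sense: existence of a solution, which is continuous in time with values in $L^2(\mathbb{T}\times\mathbb{R})$, uniqueness in a suitable function space (here $C(I;L^2(\mathbb{T}\times\mathbb{R}))\cap L^4(I\times\mathbb{T}\times\mathbb{R})$ on bounded time intervals $I\ni 0$), and continuous dependence on the initial data; "global" means the solution exists for all $t\in\mathbb{R}$.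 *)

theory Defs
  imports "HOL-Analysis.Analysis"
begin

text \<open>
  Elements of Lebesgue spaces are represented by measurable functions; equality of two elements
  is equality almost everywhere. The circle is represented by the fundamental domain
  \<open>[0, 2\<pi>)\<close>.
\<close>

definition Lp_space :: "real \<Rightarrow> 'a measure \<Rightarrow> ('a \<Rightarrow> complex) set" where
  "Lp_space p M = {f \<in> borel_measurable M. integrable M (\<lambda>x. cmod (f x) powr p)}"

definition Lp_norm :: "real \<Rightarrow> 'a measure \<Rightarrow> ('a \<Rightarrow> complex) \<Rightarrow> real" where
  "Lp_norm p M f = (LINT x|M. cmod (f x) powr p) powr (1 / p)"

definition tendsto_Lp ::
    "real \<Rightarrow> 'a measure \<Rightarrow> ('i \<Rightarrow> 'a \<Rightarrow> complex) \<Rightarrow> ('a \<Rightarrow> complex) \<Rightarrow> 'i filter \<Rightarrow> bool" where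
  "tendsto_Lp p M f g A \<longleftrightarrow>
     (\<forall>\<^sub>F i in A. (\<lambda>x. f i x - g x) \<in> Lp_space p M) \<and>
     ((\<lambda>i. Lp_norm p M (\<lambda>x. f i x - g x)) \<longlongrightarrow> 0) A"

definition TR :: "(real \<times> real) measure" where
  "TR = restrict_space lborel {0..<2 * pi} \<Otimes>\<^sub>M lborel"

definition ZR :: "(int \<times> real) measure" where
  "ZR = count_space UNIV \<Otimes>\<^sub>M lborel"

definition truncated_fourier :: "real \<Rightarrow> (real \<times> real \<Rightarrow> complex) \<Rightarrow> int \<times> real \<Rightarrow> complex" where
  "truncated_fourier R f = (\<lambda>(n, \<xi>).
     LINT (x, y)|TR. indicator {-R..R} y * f (x, y) * cis (- (of_int n * x + \<xi> * y)))"

text \<open>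
  The Fourier transform on \<open>L\<^sup>p\<close> of the cylinder, \<open>1 < p \<le> 2\<close> (Plancherel for \<open>p = 2\<close>,
  Hausdorff--Young in general): the limit in \<open>L\<^sup>q\<close>, \<open>1/p + 1/q = 1\<close>, of the transforms of the
  truncations to \<open>\<bar>y\<bar> \<le> R\<close>, which are integrable. It is a relation because the transform is
  only determined almost everywhere.
\<close>

definition is_fourier ::
    "real \<Rightarrow> (real \<times> real \<Rightarrow> complex) \<Rightarrow> (int \<times> real \<Rightarrow> complex) \<Rightarrow> bool" where
  "is_fourier p f F \<longleftrightarrow>
     f \<in> Lp_space p TR \<and> F \<in> Lp_space (p / (p - 1)) ZR \<and>
     tendsto_Lp (p / (p - 1)) ZR (\<lambda>R. truncated_fourier R f) F at_top"

definition multiplier :: "real \<Rightarrow> real \<Rightarrow> real \<Rightarrow> int \<times> real \<Rightarrow> complex" where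
  "multiplier \<alpha> \<epsilon> t = (\<lambda>(n, \<xi>).
     exp (- \<i> * complex_of_real
       (t * (\<epsilon> * (of_int n)\<^sup>2 - \<alpha> * (of_int n) ^ 4 + \<xi>\<^sup>2))))"

text \<open>\<open>is_group \<alpha> \<epsilon> t f g\<close> says that \<open>g = S(t) f\<close> in \<open>L\<^sup>2\<close>, for the group with the above symbol.\<close>

definition is_group ::
    "real \<Rightarrow> real \<Rightarrow> real \<Rightarrow> (real \<times> real \<Rightarrow> complex) \<Rightarrow> (real \<times> real \<Rightarrow> complex) \<Rightarrow> bool" where
  "is_group \<alpha> \<epsilon> t f g \<longleftrightarrow>
     (\<exists>F. is_fourier 2 f F \<and> is_fourier 2 g (\<lambda>k. multiplier \<alpha> \<epsilon> t k * F k))"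

text \<open>
  \<open>is_duhamel \<alpha> \<epsilon> t h d\<close> says that \<open>d\<close> is an \<open>L\<^sup>2\<close> function which equals
  \<open>\<integral>\<^sub>0\<^sup>t S(t - s) h(s) ds\<close>. The forcing \<open>h(s)\<close> will be the cubic term of a solution, which lies in
  \<open>L\<^sup>4\<^sup>/\<^sup>3\<close> for almost every \<open>s\<close> but in general not in \<open>L\<^sup>2\<close>, so that \<open>S(t - s) h(s)\<close> is only a
  tempered distribution; its Fourier transform is however the function
  \<open>multiplier \<alpha> \<epsilon> (t - s) * H s\<close>, with \<open>H s\<close> the \<open>L\<^sup>4\<close> transform of \<open>h s\<close>. The integral of this
  distribution-valued map is therefore taken on the Fourier side. Joint measurability of \<open>H\<close>
  makes the result independent, up to null sets, of the representatives chosen for the \<open>H s\<close>.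
  For \<open>t < 0\<close> the integral is oriented.
\<close>

definition is_duhamel ::
    "real \<Rightarrow> real \<Rightarrow> real \<Rightarrow> (real \<Rightarrow> real \<times> real \<Rightarrow> complex) \<Rightarrow> (real \<times> real \<Rightarrow> complex) \<Rightarrow> bool" where
  "is_duhamel \<alpha> \<epsilon> t h d \<longleftrightarrow>
     (\<exists>H :: real \<Rightarrow> int \<times> real \<Rightarrow> complex.
        (\<lambda>(s, k). H s k) \<in> borel_measurable (lborel \<Otimes>\<^sub>M ZR) \<and>
        (AE s in lborel. s \<in> closed_segment 0 t \<longrightarrow> is_fourier (4 / 3) (h s) (H s)) \<and>
        (AE k in ZR. interval_lebesgue_integrable lborel (ereal 0) (ereal t)
                       (\<lambda>s. multiplier \<alpha> \<epsilon> (t - s) k * H s k)) \<and>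
        is_fourier 2 d (\<lambda>k. LBINT s=ereal 0..ereal t. multiplier \<alpha> \<epsilon> (t - s) k * H s k))"

text \<open>
  The space \<open>C(I; L\<^sup>2) \<inter> L\<^sup>4(I \<times> \<T> \<times> \<real>)\<close>. Joint measurability, implied by the second conjunct, only
  concerns the choice of representatives: every curve in \<open>C(I; L\<^sup>2)\<close> has a jointly measurable one.
\<close>

definition solution_space :: "real set \<Rightarrow> (real \<Rightarrow> real \<times> real \<Rightarrow> complex) set" where
  "solution_space I = {u.
     (\<forall>t\<in>I. u t \<in> Lp_space 2 TR \<and> tendsto_Lp 2 TR u (u t) (at t within I)) \<and>
     (\<lambda>(t, z). u t z) \<in> Lp_space 4 (restrict_space lborel I \<Otimes>\<^sub>M TR)}"

text \<open>
  The parameter \<open>\<sigma>\<close> is the sign in front of the nonlinearity: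
  \<open>i u\<^sub>t + \<epsilon> u\<^sub>x\<^sub>x + u\<^sub>y\<^sub>y + \<alpha> u\<^sub>x\<^sub>x\<^sub>x\<^sub>x = \<sigma> \<bar>u\<bar>\<^sup>2 u\<close>.
\<close>

definition is_solution ::
    "real \<Rightarrow> real \<Rightarrow> real \<Rightarrow> real set \<Rightarrow> (real \<times> real \<Rightarrow> complex) \<Rightarrow>
     (real \<Rightarrow> real \<times> real \<Rightarrow> complex) \<Rightarrow> bool" where
  "is_solution \<alpha> \<epsilon> \<sigma> I \<phi> u \<longleftrightarrow>
     u \<in> solution_space I \<and>
     (\<forall>t\<in>I. \<exists>w d.
        is_group \<alpha> \<epsilon> t \<phi> w \<and>
        is_duhamel \<alpha> \<epsilon> t (\<lambda>s z. complex_of_real ((cmod (u s z))\<^sup>2) * u s z) d \<and>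
        (AE z in TR. u t z = w z - complex_of_real \<sigma> * \<i> * d z))"

definition time_interval :: "real set \<Rightarrow> bool" where
  "time_interval I \<longleftrightarrow> is_interval I \<and> bounded I \<and> 0 \<in> I"

text \<open>
  Global well-posedness for all initial data in a set \<open>D\<close>: existence of a solution on the whole
  line, uniqueness on every bounded time interval, and continuity on \<open>D\<close> (with the \<open>L\<^sup>2\<close> distance)
  of the map from data to solutions in \<open>C(I; L\<^sup>2) \<inter> L\<^sup>4(I \<times> \<T> \<times> \<real>)\<close> for every bounded \<open>I\<close>.
\<close>

definition globally_well_posed ::
    "real \<Rightarrow> real \<Rightarrow> real \<Rightarrow> (real \<times> real \<Rightarrow> complex) set \<Rightarrow> bool" where
  "globally_well_posed \<alpha> \<epsilon> \<sigma> D \<longleftrightarrow>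
     (\<forall>\<phi>\<in>D. \<exists>u. \<forall>I. time_interval I \<longrightarrow> is_solution \<alpha> \<epsilon> \<sigma> I \<phi> u) \<and>
     (\<forall>\<phi>\<in>D. \<forall>I u v. time_interval I \<longrightarrow>
        is_solution \<alpha> \<epsilon> \<sigma> I \<phi> u \<longrightarrow> is_solution \<alpha> \<epsilon> \<sigma> I \<phi> v \<longrightarrow>
        (\<forall>t\<in>I. AE z in TR. u t z = v t z)) \<and>
     (\<forall>\<phi>\<in>D. \<forall>I. time_interval I \<longrightarrow>
        (\<forall>e>0. \<exists>d>0. \<forall>\<psi>\<in>D. Lp_norm 2 TR (\<lambda>z. \<psi> z - \<phi> z) < d \<longrightarrow>
           (\<forall>u v. is_solution \<alpha> \<epsilon> \<sigma> I \<phi> u \<longrightarrow> is_solution \<alpha> \<epsilon> \<sigma> I \<psi> v \<longrightarrow>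
              (\<forall>t\<in>I. Lp_norm 2 TR (\<lambda>z. v t z - u t z) < e) \<and>
              Lp_norm 4 (restrict_space lborel I \<Otimes>\<^sub>M TR) (\<lambda>(t, z). v t z - u t z) < e)))"

end

theory Submission
  imports Defs
begin

text \<open>
 For \<open>\<alpha> < 0\<close> the phase \<open>\<omega>(l) + \<omega>(k - l)\<close> is, up to a constant, a convex quartic in \<open>l\<^sub>1 - k\<^sub>1 / 2\<close> plus
 \<open>2 (l\<^sub>2 - k\<^sub>2 / 2)\<^sup>2\<close>. Integrating out the second variable leaves a convergent sum over the first
 one, so the weight \<open>1 / (1 + (c - phase)\<^sup>2)\<close> has mass bounded uniformly in \<open>c\<close> and \<open>k\<close>. Schur's test on
 \<open>\<parallel>u\<^sup>2\<parallel>\<^sub>2\<close> then gives the Strichartz estimate \<open>L\<^sup>2 \<rightarrow> L\<^sup>4\<close> on unit time intervals, without loss of derivatives.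
 Duality gives the estimate for the Duhamel integral with forcing in \<open>L\<^sup>4\<^sup>/\<^sup>3\<close>; the retarded integral is
 reached by repeatedly bisecting the interval into halves with equal forcing, which gains \<open>2\<^sup>-\<^sup>1\<^sup>/\<^sup>2\<close> per step.
 Hence the cubic equation is solved in \<open>L\<^sup>4\<close> by contraction on unit intervals when the data are small, and
 conservation of the \<open>L\<^sup>2\<close> norm allows the same step to be repeated forever. A priori smallness in \<open>L\<^sup>4\<close> of
 an arbitrary solution with small data follows from the same estimate by continuity in the length of the
 interval; uniqueness and the Lipschitz bound in the data follow.
\<close>

\<comment> \<open>The estimates carry no positive power of the length of the time interval, so a
  shorter interval does not make the nonlinear map contract. Smallness of the data has to do it, and
  every later step must start from data no larger than the first; hence the need for conservation of
  the \<open>L^2\<close> norm. The forcing lies only in \<open>L^(4/3)\<close>, too weak for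
  integrating the energy balance over frequencies, so conservation is proved for forcing cut off in
  height and carried over by the linear estimates. The exponent 4 being even, \<open>L^4\<close>
  norms are \<open>L^2\<close> norms of squares, and both Strichartz and Hausdorff-Young come from
  Plancherel without interpolation. Linear solutions are written as the group applied to a profile:
  the transform of the data plus a time integral without outer group factor. Differences of profiles
  see only the forcing between two times, so estimates may start anywhere in an interval and run in
  both directions. Transforms and solutions are chosen jointly measurable in time and space, as the
  integral equation asks; completeness is therefore proved with a parameter.\<close>
syntax "_nn_integral_ascii" :: "pttrn => 'a measure => ennreal => ennreal" ("(NN _|_./ _)" [0, 110, 10] 10)
translations "NN x|M. f" == "CONST nn_integral M (%x. f)"

abbreviation bm :: "'a measure => ('a => 'b::topological_space) set" where
 "bm M \<equiv> borel_measurable M"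

subsection \<open>Lebesgue spaces\<close>

text \<open>With values in \<open>ennreal\<close>, it is infinite where \<open>Lp_norm\<close>,
  built on the Bochner integral, would silently return 0. A finite bound on it gives membership in
  \<open>Lp_space\<close> and the norm estimate together, which is what \<open>Lp_normI\<close>
  packages.\<close>

definition pint :: "real => 'a measure => ('a => complex) => ennreal" where
 "pint p M f = (NN x|M. ennreal (cmod (f x) powr p))"

lemma Lp_space_iff: "f \<in> Lp_space p M \<longleftrightarrow> f \<in> bm M \<and> pint p M f < \<infinity>"
 unfolding Lp_space_def pint_def by (auto simp: integrable_iff_bounded)

lemma Lp_measurable [measurable_dest]: "f \<in> Lp_space p M ==> f \<in> bm M"
 by (simp add: Lp_space_def)

lemma Lp_norm_nonneg [simp]: "0 <= Lp_norm p M f"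
 by (simp add: Lp_norm_def)

lemma pint_eq:
 assumes "f \<in> Lp_space p M" "p > 0"
 shows "pint p M f = ennreal (Lp_norm p M f powr p)"
proof -
 have "pint p M f = ennreal (LINT x|M. cmod (f x) powr p)"
  unfolding pint_def using assms
  by (intro nn_integral_eq_integral) (auto simp: Lp_space_def)
 thus ?thesis
  using assms by (simp add: Lp_norm_def powr_powr)
qed

lemma Lp_normI:
 assumes "f \<in> bm M" "p > 0" "0 <= B" "pint p M f <= ennreal (B powr p)"
 shows "f \<in> Lp_space p M" "Lp_norm p M f <= B"
proof -
 show 1: "f \<in> Lp_space p M"
  using assms by (auto simp: Lp_space_iff intro: le_less_trans)
 have "Lp_norm p M f powr p <= B powr p"
  using pint_eq[OF 1 \<open>p > 0\<close>] assms(4) by (simp add: ennreal_le_iff)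
 thus "Lp_norm p M f <= B"
  using assms by (metis Lp_norm_nonneg powr_less_mono2 not_less)
qed

lemma pint_cong_AE: "AE x in M. f x = g x ==> pint p M f = pint p M g"
 unfolding pint_def by (intro nn_integral_cong_AE) auto

lemma Lp_norm_cong_AE:
 assumes "AE x in M. f x = g x" "f \<in> bm M" "g \<in> bm M"
 shows "Lp_norm p M f = Lp_norm p M g"
 unfolding Lp_norm_def using assms by (intro arg_cong2[where f = "(powr)"] integral_cong_AE) auto

lemma Lp_space_cong_AE:
 assumes "AE x in M. f x = g x" "f \<in> Lp_space p M" "g \<in> bm M"
 shows "g \<in> Lp_space p M"
 using assms pint_cong_AE[OF assms(1)] by (simp add: Lp_space_iff)

lemma pint_mono_AE:
 assumes "AE x in M. cmod (f x) <= cmod (g x)" "p >= 0"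
 shows "pint p M f <= pint p M g"
 unfolding pint_def using assms
 by (intro nn_integral_mono_AE) (auto intro!: ennreal_leI powr_mono2 elim!: eventually_mono)

lemma Lp_mono:
 assumes "AE x in M. cmod (f x) <= cmod (g x)" "p > 0" "g \<in> Lp_space p M"
  "f \<in> bm M"
 shows "f \<in> Lp_space p M" "Lp_norm p M f <= Lp_norm p M g"
proof -
 have "pint p M f <= ennreal (Lp_norm p M g powr p)"
  using pint_mono_AE[OF assms(1), of p] pint_eq[OF assms(3,2)] assms(2) by auto
 thus "f \<in> Lp_space p M" "Lp_norm p M f <= Lp_norm p M g"
  using Lp_normI[OF assms(4,2) Lp_norm_nonneg] by auto
qed

lemma pint_cmult:
 assumes [measurable]: "f \<in> bm M"
 shows "pint p M (%x. c * f x) = ennreal (cmod c powr p) * pint p M f"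
 unfolding pint_def by (simp add: norm_mult powr_mult ennreal_mult' nn_integral_cmult)

lemma Lp_cmult:
 assumes "f \<in> Lp_space p M" "p > 0"
 shows "(%x. c * f x) \<in> Lp_space p M" "Lp_norm p M (%x. c * f x) = cmod c * Lp_norm p M f"
proof -
 have [measurable]: "f \<in> bm M" using assms by (simp add: Lp_space_def)
 show "(%x. c * f x) \<in> Lp_space p M"
  using assms pint_cmult[of f M p c] by (auto simp: Lp_space_iff ennreal_mult_less_top)
 show "Lp_norm p M (%x. c * f x) = cmod c * Lp_norm p M f"
  unfolding Lp_norm_def using assms by (simp add: norm_mult powr_mult powr_powr)
qed

lemma Lp_uminus:
 "f \<in> Lp_space p M ==> (%x. - f x) \<in> Lp_space p M" "Lp_norm p M (%x. - f x) = Lp_norm p M f"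
 by (auto simp: Lp_space_def Lp_norm_def)

lemma Lp_norm_minus_commute: "Lp_norm p M (%x. f x - g x) = Lp_norm p M (%x. g x - f x)"
 by (auto simp: Lp_norm_def norm_minus_commute)

text \<open>In the interior this is convexity of the power; on the boundary, where convexity on
  \<open>{0<..}\<close> says nothing, it reduces to \<open>c powr p <= c\<close> for
  \<open>c\<close> in the unit interval.\<close>

lemma powr_convex_comb:
 fixes s t l p :: real
 assumes "p >= 1" "s >= 0" "t >= 0" "0 <= l" "l <= 1"
 shows "(l * s + (1 - l) * t) powr p <= l * s powr p + (1 - l) * t powr p"
proof (cases "s = 0 \<or> t = 0 \<or> l = 0 \<or> l = 1")
 case True
 have *: "c powr p <= c" if "0 <= c" "c <= 1" for c :: real
  using that assms by (metis powr_mono' powr_one)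
 show ?thesis
  using True *[of l] *[of "1 - l"] assms by (auto simp: powr_mult intro!: mult_right_mono)
next
 case False
 hence "convex_on {0<..} (%x::real. x powr p)" "s > 0" "t > 0"
  using powr_convex[OF assms(1)] assms by auto
 from convex_onD[OF this(1), of l t s] this(2,3) assms show ?thesis
  by (simp add: algebra_simps)
qed

text \<open>Minkowski's inequality: \<open>f + g\<close> is \<open>A + B\<close> times the convex
  combination of \<open>f / A\<close> and \<open>g / B\<close> with weights proportional to
  \<open>A\<close> and \<open>B\<close>. Strict positivity of the bounds permits the division, so
  \<open>Lp_add\<close> enlarges both norms by \<open>e\<close> first.\<close>

lemma pint_add:
 assumes [measurable]: "f \<in> bm M" "g \<in> bm M"
  and p: "p >= 1" and A: "A > 0" "pint p M f <= ennreal (A powr p)"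
  and B: "B > 0" "pint p M g <= ennreal (B powr p)"
 shows "pint p M (%x. f x + g x) <= ennreal ((A + B) powr p)"
proof -
 define l where "l = A / (A + B)"
 have l: "0 <= l" "l <= 1" "1 - l = B / (A + B)" using A B by (auto simp: l_def field_simps)
 have *: "cmod (f x + g x) powr p <=
   (A + B) powr p * (l * A powr (-p) * cmod (f x) powr p + (1 - l) * B powr (-p) * cmod (g x) powr p)" for x
 proof -
  have "l * (cmod (f x) / A) + (1 - l) * (cmod (g x) / B) = (cmod (f x) + cmod (g x)) / (A + B)"
  proof -
   have "l * (cmod (f x) / A) = cmod (f x) / (A + B)" using A by (simp add: l_def)
   moreover have "(1 - l) * (cmod (g x) / B) = cmod (g x) / (A + B)" using B by (simp add: l(3))
   ultimately show ?thesis by (simp add: add_divide_distrib)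
  qed
  hence "((cmod (f x) + cmod (g x)) / (A + B)) powr p
    <= l * (cmod (f x) / A) powr p + (1 - l) * (cmod (g x) / B) powr p"
   using powr_convex_comb[OF p _ _ l(1,2), of "cmod (f x) / A" "cmod (g x) / B"] A B by simp
  also have "... = l * A powr (-p) * cmod (f x) powr p + (1 - l) * B powr (-p) * cmod (g x) powr p"
   using A B by (simp add: powr_divide powr_minus_divide)
  finally have "(cmod (f x) + cmod (g x)) powr p / (A + B) powr p <= ..."
   using A B by (simp add: powr_divide)
  hence "(cmod (f x) + cmod (g x)) powr p <=
    (A + B) powr p * (l * A powr (-p) * cmod (f x) powr p + (1 - l) * B powr (-p) * cmod (g x) powr p)"
   using A B by (simp add: field_simps)
  moreover have "cmod (f x + g x) powr p <= (cmod (f x) + cmod (g x)) powr p"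
   using p by (intro powr_mono2 norm_triangle_ineq) auto
  ultimately show ?thesis by simp
 qed
 have "pint p M (%x. f x + g x) <= (NN x|M. ennreal ((A + B) powr p) *
   (ennreal (l * A powr (-p)) * ennreal (cmod (f x) powr p)
    + ennreal ((1 - l) * B powr (-p)) * ennreal (cmod (g x) powr p)))"
  unfolding pint_def
 proof (intro nn_integral_mono)
  fix x
  show "ennreal (cmod (f x + g x) powr p) <= ennreal ((A + B) powr p) *
   (ennreal (l * A powr (-p)) * ennreal (cmod (f x) powr p)
    + ennreal ((1 - l) * B powr (-p)) * ennreal (cmod (g x) powr p))"
   using ennreal_leI[OF *[of x]] l(1,2) by (simp add: ennreal_mult ennreal_plus)
 qed
 also have "... = ennreal ((A + B) powr p) *
   (ennreal (l * A powr (-p)) * pint p M f + ennreal ((1 - l) * B powr (-p)) * pint p M g)"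
  unfolding pint_def by (simp add: nn_integral_cmult nn_integral_add)
 also have "... <= ennreal ((A + B) powr p) *
   (ennreal (l * A powr (-p)) * ennreal (A powr p) + ennreal ((1 - l) * B powr (-p)) * ennreal (B powr p))"
  using A B by (intro mult_left_mono add_mono) auto
 also have "... = ennreal ((A + B) powr p * (l * A powr (-p) * A powr p + (1 - l) * B powr (-p) * B powr p))"
  using l(1,2) by (simp add: ennreal_mult ennreal_plus)
 also have "l * A powr (-p) * A powr p + (1 - l) * B powr (-p) * B powr p = 1"
 proof -
  have "A powr p \<noteq> 0" "B powr p \<noteq> 0" using A B by auto
  thus ?thesis by (simp add: powr_minus mult.assoc)
 qed
 finally show ?thesis by simp
qed

lemma Lp_add:
 assumes f: "f \<in> Lp_space p M" and g: "g \<in> Lp_space p M" and p: "p >= 1"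
 shows "(%x. f x + g x) \<in> Lp_space p M"
  "Lp_norm p M (%x. f x + g x) <= Lp_norm p M f + Lp_norm p M g"
proof -
 have [measurable]: "f \<in> bm M" "g \<in> bm M"
  using f g by (auto simp: Lp_space_def)
 have *: "(%x. f x + g x) \<in> Lp_space p M \<and>
   Lp_norm p M (%x. f x + g x) <= (Lp_norm p M f + e) + (Lp_norm p M g + e)" if "e > 0" for e
 proof -
  have "pint p M (%x. f x + g x) <= ennreal (((Lp_norm p M f + e) + (Lp_norm p M g + e)) powr p)"
   using p that pint_eq[OF f] pint_eq[OF g]
   by (intro pint_add) (auto intro!: ennreal_leI powr_mono2 add_nonneg_pos)
  with Lp_normI[OF _ _ _ this] p that show ?thesis by simp
 qed
 from *[of 1] show "(%x. f x + g x) \<in> Lp_space p M" by simp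
 show "Lp_norm p M (%x. f x + g x) <= Lp_norm p M f + Lp_norm p M g"
 proof (rule field_le_epsilon)
  fix e :: real assume "e > 0"
  with *[of "e / 2"] show "Lp_norm p M (%x. f x + g x) <= Lp_norm p M f + Lp_norm p M g + e" by simp
 qed
qed

lemma Lp_diff:
 assumes f: "f \<in> Lp_space p M" and g: "g \<in> Lp_space p M" and p: "p >= 1"
 shows "(%x. f x - g x) \<in> Lp_space p M"
  "Lp_norm p M (%x. f x - g x) <= Lp_norm p M f + Lp_norm p M g"
 using Lp_add[OF f Lp_uminus(1)[OF g] p] Lp_uminus(2)[where f = g] by auto

lemma Lp_norm_triangle:
 assumes "f \<in> Lp_space p M" "g \<in> Lp_space p M" "h \<in> Lp_space p M" "p >= 1"
 shows "Lp_norm p M (%x. f x - h x) <= Lp_norm p M (%x. f x - g x) + Lp_norm p M (%x. g x - h x)"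
 using Lp_add(2)[OF Lp_diff(1)[OF assms(1,2)] Lp_diff(1)[OF assms(2,3)]] assms by simp

lemma Lp_norm_rev_triangle:
 assumes "f \<in> Lp_space p M" "g \<in> Lp_space p M" "p >= 1"
 shows "\<bar>Lp_norm p M f - Lp_norm p M g\<bar> <= Lp_norm p M (%x. f x - g x)"
 using Lp_add(2)[OF Lp_diff(1)[OF assms] assms(2)] assms
  Lp_add(2)[OF Lp_diff(1)[OF assms(2,1)] assms(1)] Lp_norm_minus_commute[of p M f g] by auto

lemma Lp_norm_eq_0_AE:
 assumes "f \<in> Lp_space p M" "p > 0" "Lp_norm p M f = 0"
 shows "AE x in M. f x = 0"
proof -
 have [measurable]: "f \<in> bm M" using assms by (auto simp: Lp_space_def)
 have "(NN x|M. ennreal (cmod (f x) powr p)) = 0"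
  using pint_eq[OF assms(1,2)] assms by (simp add: pint_def)
 thus ?thesis
  by (subst (asm) nn_integral_0_iff_AE) auto
qed

lemma Lp_zero [simp]: "(%x. 0) \<in> Lp_space p M" "Lp_norm p M (%x. 0) = 0"
 by (auto simp: Lp_space_def Lp_norm_def)

lemma Lp_norm_zero_AE:
 assumes "AE x in M. f x = 0" "f \<in> bm M"
 shows "f \<in> Lp_space p M" "Lp_norm p M f = 0"
proof -
 have "AE x in M. 0 = f x" using assms(1) by eventually_elim simp
 from Lp_space_cong_AE[OF this _ assms(2), of p] show "f \<in> Lp_space p M" by simp
 from Lp_norm_cong_AE[OF assms] show "Lp_norm p M f = 0" by simp
qed

text \<open>Young's inequality for \<open>f / A\<close> and \<open>g / B\<close>, with
  \<open>A\<close> and \<open>B\<close> strictly above the norms so that the division is legitimate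
  when a norm vanishes; then \<open>A\<close> and \<open>B\<close> decrease to the norms.\<close>

lemma holder_nn:
 assumes f: "f \<in> Lp_space p M" and g: "g \<in> Lp_space q M"
  and pq: "p > 1" "q > 1" "1 / p + 1 / q = 1"
 shows "(NN x|M. ennreal (cmod (f x) * cmod (g x))) <= ennreal (Lp_norm p M f * Lp_norm q M g)"
proof -
 have [measurable]: "f \<in> bm M" "g \<in> bm M"
  using f g by (auto simp: Lp_space_def)
 have *: "(NN x|M. ennreal (cmod (f x) * cmod (g x))) <= ennreal (A * B)"
  if A: "A > Lp_norm p M f" and B: "B > Lp_norm q M g" for A B
 proof -
  have A0: "A > 0" using A Lp_norm_nonneg[of p M f] by linarith
  have B0: "B > 0" using B Lp_norm_nonneg[of q M g] by linarith
  have "cmod (f x) * cmod (g x) <=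
    A * B * (A powr (-p) / p * cmod (f x) powr p + B powr (-q) / q * cmod (g x) powr q)" for x
   using Youngs_inequality[OF pq, of "cmod (f x) / A" "cmod (g x) / B"] A0 B0
   by (simp add: field_simps powr_divide powr_minus)
  hence "(NN x|M. ennreal (cmod (f x) * cmod (g x))) <= (NN x|M. ennreal (A * B) *
    (ennreal (A powr (-p) / p) * ennreal (cmod (f x) powr p)
    + ennreal (B powr (-q) / q) * ennreal (cmod (g x) powr q)))"
   using A0 B0 pq
   by (intro nn_integral_mono) (auto simp flip: ennreal_mult ennreal_plus intro!: ennreal_leI)
  also have "... = ennreal (A * B) *
    (ennreal (A powr (-p) / p) * pint p M f + ennreal (B powr (-q) / q) * pint q M g)"
   unfolding pint_def by (simp add: nn_integral_cmult nn_integral_add)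
  also have "... <= ennreal (A * B) *
    (ennreal (A powr (-p) / p) * ennreal (A powr p) + ennreal (B powr (-q) / q) * ennreal (B powr q))"
   using pint_eq[OF f] pint_eq[OF g] pq A B
   by (intro mult_left_mono add_mono) (auto intro!: ennreal_leI powr_mono2)
  also have "... = ennreal (A * B * (A powr (-p) / p * A powr p + B powr (-q) / q * B powr q))"
   using A0 B0 pq by (simp flip: ennreal_mult ennreal_plus)
  also have "A powr (-p) / p * A powr p + B powr (-q) / q * B powr q = 1"
   using A0 B0 pq by (simp add: powr_minus)
  finally show ?thesis by simp
 qed
 have lim: "((%e. ennreal ((Lp_norm p M f + e) * (Lp_norm q M g + e))) \<longlongrightarrow>
   ennreal ((Lp_norm p M f + 0) * (Lp_norm q M g + 0))) (at_right 0)"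
  by (intro tendsto_intros tendsto_ennrealI)
 have ev: "\<forall>\<^sub>F e in at_right 0. (NN x|M. ennreal (cmod (f x) * cmod (g x))) <=
   ennreal ((Lp_norm p M f + e) * (Lp_norm q M g + e))"
  using eventually_at_right_less[of 0] by eventually_elim (rule *, auto)
 show ?thesis
  using tendsto_lowerbound[OF lim ev] by simp
qed

lemma holder:
 assumes f: "f \<in> Lp_space p M" and g: "g \<in> Lp_space q M"
  and pq: "p > 1" "q > 1" "1 / p + 1 / q = 1"
 shows "integrable M (%x. f x * g x)"
  "(LINT x|M. cmod (f x * g x)) <= Lp_norm p M f * Lp_norm q M g"
  "cmod (LINT x|M. f x * g x) <= Lp_norm p M f * Lp_norm q M g"
proof -
 have [measurable]: "f \<in> bm M" "g \<in> bm M"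
  using f g by (auto simp: Lp_space_def)
 have nn: "(NN x|M. ennreal (cmod (f x * g x))) <= ennreal (Lp_norm p M f * Lp_norm q M g)"
  using holder_nn[OF assms] by (simp add: norm_mult)
 show i: "integrable M (%x. f x * g x)"
  unfolding integrable_iff_bounded using nn by (auto intro: le_less_trans)
 have "ennreal (LINT x|M. cmod (f x * g x)) <= ennreal (Lp_norm p M f * Lp_norm q M g)"
  using nn i by (subst (asm) nn_integral_eq_integral) auto
 thus *: "(LINT x|M. cmod (f x * g x)) <= Lp_norm p M f * Lp_norm q M g"
  by (subst (asm) ennreal_le_iff) auto
 show "cmod (LINT x|M. f x * g x) <= Lp_norm p M f * Lp_norm q M g"
  using integral_norm_bound[of M "%x. f x * g x"] * by linarith
qed

section \<open>Almost everywhere limits and completeness\<close>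

lemma Lp_subseq_AE:
 assumes f: "\<And>n. (%x. f n x - g x) \<in> Lp_space p M" and p: "p > 0"
  and lim: "(%n. Lp_norm p M (%x. f n x - g x)) \<longlonglongrightarrow> 0"
 shows "\<exists>r. strict_mono r \<and> (AE x in M. (%n. f (r n) x) \<longlonglongrightarrow> g x)"
proof -
 have int: "integrable M (%x. cmod (f n x - g x) powr p)" for n
  using f[of n] by (simp add: Lp_space_def)
 have "(%n. Lp_norm p M (%x. f n x - g x) powr p) \<longlonglongrightarrow> 0 powr p"
  using p by (intro tendsto_powr2[OF lim]) auto
 hence "(%n. LINT x|M. norm (cmod (f n x - g x) powr p)) \<longlonglongrightarrow> 0"
  using p by (simp add: Lp_norm_def powr_powr)
 from tendsto_L1_AE_subseq[OF int this] obtain r where r: "strict_mono r"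
  "AE x in M. (%n. cmod (f (r n) x - g x) powr p) \<longlonglongrightarrow> 0" by auto
 have "(%n. f (r n) x) \<longlonglongrightarrow> g x" if "(%n. cmod (f (r n) x - g x) powr p) \<longlonglongrightarrow> 0" for x
 proof -
  have "(%n. (cmod (f (r n) x - g x) powr p) powr (1 / p)) \<longlonglongrightarrow> 0 powr (1 / p)"
   using p by (intro tendsto_powr2[OF that]) auto
  thus ?thesis using p
   by (simp add: powr_powr tendsto_norm_zero_iff LIM_zero_iff)
 qed
 with r show ?thesis by (auto elim!: eventually_mono)
qed

lemma pint_fatou:
 assumes [measurable]: "\<And>n. f n \<in> bm M" "g \<in> bm M"
  and lim: "AE x in M. (%n. f n x) \<longlonglongrightarrow> g x" and q: "q > 0"
  and B: "\<forall>\<^sub>F n in sequentially. pint q M (f n) <= B"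
 shows "pint q M g <= B"
proof -
 have "pint q M g = (NN x|M. liminf (%n. ennreal (cmod (f n x) powr q)))"
  unfolding pint_def
 proof (intro nn_integral_cong_AE)
  show "AE x in M. ennreal (cmod (g x) powr q) = liminf (%n. ennreal (cmod (f n x) powr q))"
   using lim
  proof eventually_elim
   case (elim x)
   have "(%n. ennreal (cmod (f n x) powr q)) \<longlonglongrightarrow> ennreal (cmod (g x) powr q)"
    using q elim by (intro tendsto_ennrealI tendsto_powr2 tendsto_norm tendsto_const) auto
   thus ?case by (rule lim_imp_Liminf[OF sequentially_bot, symmetric])
  qed
 qed
 also have "... <= liminf (%n. pint q M (f n))"
  unfolding pint_def by (intro nn_integral_liminf) auto
 also have "... <= B"
  using Liminf_le[OF sequentially_bot B] by simp
 finally show ?thesis .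
qed

text \<open>Riesz-Fischer with a parameter, so that limits taken separately for each time remain
  jointly measurable. A subsequence depending on \<open>t\<close> stays measurable when its indices
  are least integers defined by measurable conditions. Where the sequence is not Cauchy, nothing is
  claimed about \<open>g t\<close>.\<close>

lemma Lp_limit_param:
 fixes f :: "nat => 't => 'a => complex"
 assumes "sigma_finite_measure M" and p: "p >= 1"
  and meas: "\<And>n. (%(t, x). f n t x) \<in> bm (T \<Otimes>\<^sub>M M)"
 obtains g where "(%(t, x). g t x) \<in> bm (T \<Otimes>\<^sub>M M)"
  "\<And>t. t \<in> space T ==> (\<And>n. f n t \<in> Lp_space p M) ==>
   (\<And>e. e > 0 ==> \<exists>N. \<forall>m\<ge>N. \<forall>n\<ge>N. Lp_norm p M (%x. f m t x - f n t x) < e) ==>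
   g t \<in> Lp_space p M \<and> (%n. Lp_norm p M (%x. f n t x - g t x)) \<longlonglongrightarrow> 0"
proof -
 interpret M: sigma_finite_measure M by fact
 note meas [measurable]
 have [measurable]: "f n t \<in> bm M" if "t \<in> space T" for n t
  using measurable_Pair2[OF meas that] by simp
 define D where "D = (%m n t. pint p M (%x. f m t x - f n t x))"
 have [measurable]: "D m n \<in> bm T" for m n
  unfolding D_def pint_def by measurable
 define N where "N = (%j t. LEAST N. \<forall>m\<ge>N. \<forall>n\<ge>N. D m n t <= ennreal ((1 / 4 ^ j) powr p))"
 have [measurable]: "N j \<in> measurable T (count_space UNIV)" for j
  unfolding N_def by measurable
 define F where "F = (%j t x. f (N j t) t x)"
 have [measurable]: "(%(t, x). F j t x) \<in> bm (T \<Otimes>\<^sub>M M)" for j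
 proof -
  have "(%z. (%n z. f n (fst z) (snd z)) (N j (fst z)) z) \<in> bm (T \<Otimes>\<^sub>M M)"
   by (rule measurable_compose_countable) measurable
  thus ?thesis by (simp add: F_def case_prod_beta)
 qed
 define g where "g = (%t x. lim (%j. F j t x))"
 have gm [measurable]: "(%(t, x). g t x) \<in> bm (T \<Otimes>\<^sub>M M)"
 proof -
  have "(%z. lim (%j. (%(t, x). F j t x) z)) \<in> bm (T \<Otimes>\<^sub>M M)"
   by (rule borel_measurable_lim_metric) measurable
  thus ?thesis by (simp add: g_def case_prod_beta)
 qed
 show ?thesis
 proof (rule that[OF gm])
  fix t assume t [measurable]: "t \<in> space T" and L: "\<And>n. f n t \<in> Lp_space p M"
   and C: "\<And>e. e > 0 ==> \<exists>N. \<forall>m\<ge>N. \<forall>n\<ge>N. Lp_norm p M (%x. f m t x - f n t x) < e"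
  have Ft [measurable]: "F j t \<in> bm M" for j
   using t by (simp add: F_def)
  have gt [measurable]: "g t \<in> bm M"
   using measurable_Pair2[OF gm t] by simp
  have N: "D m n t <= ennreal ((1 / 4 ^ j) powr p)" if "m >= N j t" "n >= N j t" for j m n
  proof -
   obtain K where K: "\<forall>m\<ge>K. \<forall>n\<ge>K. Lp_norm p M (%x. f m t x - f n t x) < 1 / 4 ^ j"
    using C[of "1 / 4 ^ j"] by auto
   have "\<forall>m\<ge>K. \<forall>n\<ge>K. D m n t <= ennreal ((1 / 4 ^ j) powr p)"
    unfolding D_def using K p pint_eq[OF Lp_diff(1)[OF L L p]]
    by (auto intro!: ennreal_leI powr_mono2 intro: less_imp_le)
   hence "\<forall>m\<ge>N j t. \<forall>n\<ge>N j t. D m n t <= ennreal ((1 / 4 ^ j) powr p)"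
    unfolding N_def by (rule LeastI)
   with that show ?thesis by blast
  qed
  have Nmono: "N j t <= N (Suc j) t" for j
   unfolding N_def[of ]
  proof (rule Least_le, intro allI impI)
   fix m n assume "(LEAST N. \<forall>m\<ge>N. \<forall>n\<ge>N. D m n t <= ennreal ((1 / 4 ^ Suc j) powr p)) <= m"
    "(LEAST N. \<forall>m\<ge>N. \<forall>n\<ge>N. D m n t <= ennreal ((1 / 4 ^ Suc j) powr p)) <= n"
   hence "D m n t <= ennreal ((1 / 4 ^ Suc j) powr p)"
    using N[of "Suc j" m n] by (simp add: N_def)
   also have "... <= ennreal ((1 / 4 ^ j) powr p)"
    using p by (intro ennreal_leI powr_mono2) (auto simp: field_simps)
   finally show "D m n t <= ennreal ((1 / 4 ^ j) powr p)" .
  qed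
  have Nmono': "N i t <= N j t" if "i <= j" for i j
   using lift_Suc_mono_le[of "%j. N j t", OF Nmono that] .
  have AEc: "AE x in M. (%j. F j t x) \<longlonglongrightarrow> g t x"
  proof -
   \<comment> \<open>Distances at most \<open>4^-j\<close>, weighted by \<open>2^j\<close>, leave
     \<open>2^-j\<close>. The weighted series is therefore finite almost everywhere, and the
     increments are eventually below \<open>2^-j\<close>.\<close>
   have "(NN x|M. (\<Sum>j. ennreal ((2 ^ j * cmod (F (Suc j) t x - F j t x)) powr p)))
     = (\<Sum>j. ennreal ((2 ^ j) powr p) * D (N (Suc j) t) (N j t) t)"
    unfolding D_def pint_def F_def using t
    by (subst nn_integral_suminf) (auto simp: powr_mult ennreal_mult' nn_integral_cmult)
   also have "... <= (\<Sum>j. ennreal ((1 / 2) ^ j))"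
   proof (intro suminf_le)
    fix j
    have "ennreal ((2 ^ j) powr p) * D (N (Suc j) t) (N j t) t <= ennreal ((2 ^ j) powr p) * ennreal ((1 / 4 ^ j) powr p)"
     by (intro mult_left_mono N Nmono) auto
    also have "... = ennreal (((1 / 2) ^ j) powr p)"
    proof -
     have "(2 ^ j :: real) * (1 / 4 ^ j) = (1 / 2) ^ j"
      by (simp add: power_one_over flip: power_mult_distrib) (simp add: field_simps flip: power_mult_distrib)
     thus ?thesis by (simp flip: ennreal_mult powr_mult)
    qed
    also have "... <= ennreal (((1 / 2) ^ j) powr 1)"
     using p by (intro ennreal_leI powr_mono') (auto simp: power_le_one)
    finally show "ennreal ((2 ^ j) powr p) * D (N (Suc j) t) (N j t) t <= ennreal ((1 / 2) ^ j)" by simp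
   qed auto
   also have "... < \<infinity>"
    by (subst suminf_ennreal2) (auto intro!: summable_geometric)
   finally have "AE x in M. (\<Sum>j. ennreal ((2 ^ j * cmod (F (Suc j) t x - F j t x)) powr p)) \<noteq> \<infinity>"
    by (intro nn_integral_PInf_AE) auto
   thus ?thesis
   proof eventually_elim
    case (elim x)
    have sm: "summable (%j. (2 ^ j * cmod (F (Suc j) t x - F j t x)) powr p)"
     by (rule summable_suminf_not_top) (use elim in auto)
    from summable_LIMSEQ_zero[OF this]
    have "\<forall>\<^sub>F j in sequentially. (2 ^ j * cmod (F (Suc j) t x - F j t x)) powr p < 1"
     by (rule order_tendstoD) auto
    hence "\<forall>\<^sub>F j in sequentially. norm (F (Suc j) t x - F j t x) <= (1 / 2) ^ j"
    proof eventually_elim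
     case (elim j)
     hence "2 ^ j * cmod (F (Suc j) t x - F j t x) < 1"
      using p by (metis ge_one_powr_ge_zero leD leI le_less_trans less_numeral_extra(1) not_less order.trans zero_le_one)
     thus ?case by (simp add: field_simps power_one_over)
    qed
    hence "summable (%j. F (Suc j) t x - F j t x)"
     by (rule summable_comparison_test_ev) (auto intro!: summable_geometric)
    hence "convergent (%n. \<Sum>j<n. F (Suc j) t x - F j t x)"
     by (simp add: summable_iff_convergent)
    hence "convergent (%n. F n t x - F 0 t x)"
     using sum_lessThan_telescope[of "%j. F j t x"] by simp
    hence "convergent (%n. F n t x)"
     by (simp add: convergent_diff_const_right_iff)
    thus ?case by (simp add: g_def convergent_LIMSEQ_iff)
   qed
  qed
  have bd: "pint p M (%x. f n t x - g t x) <= ennreal ((1 / 4 ^ j) powr p)" if "n >= N j t" for n j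
  proof (rule pint_fatou)
   show "AE x in M. (%i. f n t x - F i t x) \<longlonglongrightarrow> f n t x - g t x"
    using AEc by eventually_elim (intro tendsto_intros)
   show "\<forall>\<^sub>F i in sequentially. pint p M (%x. f n t x - F i t x) <= ennreal ((1 / 4 ^ j) powr p)"
    using eventually_ge_at_top[of j]
   proof eventually_elim
    case (elim i)
    show ?case using N[OF that, of "N i t"] Nmono'[OF elim] by (simp add: D_def F_def)
   qed
  qed (use p t in auto)
  have nb: "(%x. f n t x - g t x) \<in> Lp_space p M \<and> Lp_norm p M (%x. f n t x - g t x) <= 1 / 4 ^ j"
   if "n >= N j t" for n j
   using Lp_normI[OF _ _ _ bd[OF that]] p t by auto
  have "g t \<in> Lp_space p M"
   using Lp_diff(1)[OF L[of "N 0 t"] conjunct1[OF nb[of 0 "N 0 t"]] p] by simp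
  moreover have "(%n. Lp_norm p M (%x. f n t x - g t x)) \<longlonglongrightarrow> 0"
  proof (rule LIMSEQ_I)
   fix e :: real assume "e > 0"
   then obtain j where j: "(1 / 4) ^ j < e"
    using real_arch_pow_inv[of e "1 / 4"] by auto
   show "\<exists>no. \<forall>n\<ge>no. norm (Lp_norm p M (%x. f n t x - g t x) - 0) < e"
    using nb[where j = j] j by (intro exI[of _ "N j t"]) (auto simp: power_one_over intro: le_less_trans)
  qed
  ultimately show "g t \<in> Lp_space p M \<and> (%n. Lp_norm p M (%x. f n t x - g t x)) \<longlonglongrightarrow> 0" ..
 qed
qed

subsection \<open>Parseval's identity on the circle\<close>

lemma cis_measurable [measurable]: "cis \<in> bm borel"
 by (intro borel_measurable_continuous_onI continuous_intros)

definition circle :: "real measure" where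
 "circle = restrict_space lborel {0..<2 * pi}"

lemma space_circle [simp]: "space circle = {0..<2 * pi}"
 by (simp add: circle_def space_restrict_space)

lemma emeasure_circle [simp]: "emeasure circle {0..<2 * pi} = ennreal (2 * pi)"
 by (simp add: circle_def emeasure_restrict_space space_restrict_space)

lemma finite_measure_circle: "finite_measure circle"
 by standard simp

lemma sigma_finite_circle: "sigma_finite_measure circle"
 using finite_measure_circle by (simp add: finite_measure_def)

lemma measurable_circle [measurable (raw)]:
 "f \<in> bm borel ==> f \<in> bm circle"
 by (simp add: circle_def measurable_restrict_space1)

lemma integrable_circle_bounded:
 assumes "f \<in> bm circle" "\<And>x. norm (f x) <= B"
 shows "integrable circle (f :: real => 'b::{banach, second_countable_topology})"
 using assms by (intro finite_measure.integrable_const_bound[OF finite_measure_circle, of _ B]) auto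

lemma circle_exp_integral:
 "(LINT x|circle. cis (of_int n * x)) = (if n = 0 then 2 * pi else 0)"
proof (cases "n = 0")
 case True
 thus ?thesis
  by (simp add: measure_def scaleR_conv_of_real)
next
 case False
 have "(LINT x|circle. cis (of_int n * x)) = (LINT x:{0..<2*pi}|lborel. cis (of_int n * x))"
  unfolding circle_def set_lebesgue_integral_def by (subst integral_restrict_space) auto
 also have "... = (LINT x:{0..2*pi}|lborel. cis (of_int n * x))"
  unfolding set_lebesgue_integral_def
  by (intro integral_cong_AE) (auto intro!: AE_I[of _ _ "{2 * pi}"] split: split_indicator)
 also have "... = (LINT x|lborel. indicator {0..2*pi} x *\<^sub>R cis (of_int n * x))"
  by (simp add: set_lebesgue_integral_def)
 also have "... = cis (of_int n * (2 * pi)) / (\<i> * of_int n) - cis (of_int n * 0) / (\<i> * of_int n)"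
 proof (rule integral_FTC_Icc)
  fix x :: real
  have "((%x. cis (of_int n * x) / (\<i> * of_int n)) has_vector_derivative
    (of_int n *\<^sub>R (\<i> * cis (of_int n * x))) / (\<i> * of_int n)) (at x within {0..2*pi})"
   unfolding cis_conv_exp
   by (auto intro!: derivative_eq_intros has_vector_derivative_real_field
     simp: scaleR_conv_of_real mult.commute[of _ \<i>])
  thus "((%x. cis (of_int n * x) / (\<i> * of_int n)) has_vector_derivative cis (of_int n * x)) (at x within {0..2*pi})"
   using False by (simp add: scaleR_conv_of_real)
 qed (auto intro!: continuous_intros)
 also have "... = 0"
  using cis_multiple_2pi[of "of_int n"] by (simp add: mult.commute)
 finally show ?thesis using False by simp
qed

definition trig_poly :: "int set => (int => complex) => real => complex" where
 "trig_poly F c x = (\<Sum>n\<in>F. c n * cis (of_int n * x))"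

lemma trig_poly_measurable [measurable]: "trig_poly F c \<in> bm borel"
 unfolding trig_poly_def by measurable

lemma trig_poly_bounded: "cmod (trig_poly F c x) <= (\<Sum>n\<in>F. cmod (c n))"
 unfolding trig_poly_def by (rule order_trans[OF norm_sum]) (simp add: norm_mult)

lemma trig_poly_norm_square:
 assumes "finite F"
 shows "(LINT x|circle. (cmod (trig_poly F c x))\<^sup>2) = 2 * pi * (\<Sum>n\<in>F. (cmod (c n))\<^sup>2)"
proof -
 let ?D = "%x. \<Sum>n\<in>F. \<Sum>m\<in>F. c n * cnj (c m) * cis (of_int (n - m) * x)"
 have "complex_of_real (LINT x|circle. (cmod (trig_poly F c x))\<^sup>2)
   = (LINT x|circle. complex_of_real ((cmod (trig_poly F c x))\<^sup>2))"
  by (rule integral_complex_of_real[symmetric])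
 also have "... = (LINT x|circle. (?D x))"
 proof (intro Bochner_Integration.integral_cong refl)
  fix x
  have "trig_poly F c x * cnj (trig_poly F c x) =
   (\<Sum>n\<in>F. \<Sum>m\<in>F. (c n * cis (of_int n * x)) * (cnj (c m) * cis (- (of_int m * x))))"
   by (simp add: trig_poly_def sum_product cis_cnj)
  also have "... = (?D x)"
  proof (intro sum.cong refl)
   fix n m
   have "cis (of_int n * x) * cis (- (of_int m * x)) = cis (of_int (n - m) * x)"
    by (simp add: cis_mult left_diff_distrib)
   thus "(c n * cis (of_int n * x)) * (cnj (c m) * cis (- (of_int m * x)))
     = c n * cnj (c m) * cis (of_int (n - m) * x)"
    by (metis (no_types, lifting) mult.assoc mult.left_commute)
  qed
  finally show "complex_of_real ((cmod (trig_poly F c x))\<^sup>2) =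
    (?D x)"
   unfolding complex_norm_square .
 qed
 also have "... = (\<Sum>n\<in>F. \<Sum>m\<in>F. c n * cnj (c m) * (LINT x|circle. cis (of_int (n - m) * x)))"
 proof -
  have i: "integrable circle (%x. c n * cnj (c m) * cis (of_int (n - m) * x))" for n m
   by (intro integrable_mult_right integrable_circle_bounded[where B = 1]) auto
  have "(LINT x|circle. (?D x)) =
    (\<Sum>n\<in>F. LINT x|circle. (\<Sum>m\<in>F. c n * cnj (c m) * cis (of_int (n - m) * x)))"
   by (intro Bochner_Integration.integral_sum Bochner_Integration.integrable_sum i)
  also have "... = (\<Sum>n\<in>F. \<Sum>m\<in>F. LINT x|circle. c n * cnj (c m) * cis (of_int (n - m) * x))"
   by (intro sum.cong refl Bochner_Integration.integral_sum i)
  finally show ?thesis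
   by (simp only: integral_mult_right_zero)
 qed
 also have "... = (\<Sum>n\<in>F. \<Sum>m\<in>F. if n = m then c n * cnj (c n) * (2 * pi) else 0)"
  unfolding circle_exp_integral by (intro sum.cong refl) auto
 also have "... = (\<Sum>n\<in>F. c n * cnj (c n) * (2 * pi))"
  using assms by simp
 also have "... = complex_of_real (2 * pi * (\<Sum>n\<in>F. (cmod (c n))\<^sup>2))"
  unfolding of_real_mult of_real_sum complex_norm_square by (simp add: sum_distrib_left mult.commute)
 finally show ?thesis by (subst (asm) of_real_eq_iff)
qed

definition circle_coeff :: "(real => complex) => int => complex" where
 "circle_coeff f n = (LINT x|circle. f x * cis (- (of_int n * x)))"

lemma L2_circle_integrable:
 assumes "f \<in> Lp_space 2 circle"
 shows "integrable circle f"
proof -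
 have "(%x. 1) \<in> Lp_space 2 circle"
  by (auto simp: Lp_space_def intro!: integrable_circle_bounded[where B = 1])
 from holder(1)[OF assms this] show ?thesis by simp
qed

text \<open>Completing the square coefficient by coefficient. The last sum vanishes when
  \<open>c\<close> is built from the Fourier coefficients, which gives Bessel; being nonnegative in
  general, it turns any good approximation into a lower bound for the sum of the squared
  coefficients.\<close>

lemma trig_poly_distance:
 assumes f: "f \<in> Lp_space 2 circle" and F: "finite F"
 shows "(LINT x|circle. (cmod (f x - trig_poly F c x))\<^sup>2) =
   (LINT x|circle. (cmod (f x))\<^sup>2) - (\<Sum>n\<in>F. (cmod (circle_coeff f n))\<^sup>2) / (2 * pi)
   + 2 * pi * (\<Sum>n\<in>F. (cmod (c n - circle_coeff f n / (2 * pi)))\<^sup>2)"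
proof -
 have [measurable]: "f \<in> bm circle" using f by (simp add: Lp_space_def)
 note fi = L2_circle_integrable[OF f]
 have f2: "integrable circle (%x. (cmod (f x))\<^sup>2)" using f by (simp add: Lp_space_def)
 have q2: "integrable circle (%x. (cmod (trig_poly F c x))\<^sup>2)"
  by (intro integrable_circle_bounded[where B = "(\<Sum>n\<in>F. cmod (c n))\<^sup>2"])
    (auto intro!: power_mono trig_poly_bounded)
 have fe: "integrable circle (%x. f x * cis (- (of_int n * x)))" for n
  by (rule Bochner_Integration.integrable_bound[OF fi]) (auto simp: norm_mult)
 have eq: "f x * cnj (trig_poly F c x) = (\<Sum>n\<in>F. cnj (c n) * (f x * cis (- (of_int n * x))))" for x
  by (simp add: trig_poly_def sum_distrib_left cis_cnj algebra_simps)
 have fqi: "integrable circle (%x. f x * cnj (trig_poly F c x))"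
  unfolding eq by (intro Bochner_Integration.integrable_sum integrable_mult_right fe)
 have fq: "(LINT x|circle. f x * cnj (trig_poly F c x)) = (\<Sum>n\<in>F. cnj (c n) * circle_coeff f n)"
  unfolding eq circle_coeff_def
  by (subst Bochner_Integration.integral_sum) (auto intro!: integrable_mult_right fe)
 have "(cmod (f x - trig_poly F c x))\<^sup>2 =
   (cmod (f x))\<^sup>2 - 2 * Re (f x * cnj (trig_poly F c x)) + (cmod (trig_poly F c x))\<^sup>2" for x
  by (simp only: cmod_power2) (simp add: power2_eq_square algebra_simps)
 hence "(LINT x|circle. (cmod (f x - trig_poly F c x))\<^sup>2) = (LINT x|circle. (cmod (f x))\<^sup>2)
   - 2 * Re (LINT x|circle. f x * cnj (trig_poly F c x)) + (LINT x|circle. (cmod (trig_poly F c x))\<^sup>2)"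
  using f2 q2 integrable_Re[OF fqi] integral_Re[OF fqi] by (simp del: times_complex.simps)
 also have "... = (LINT x|circle. (cmod (f x))\<^sup>2) + (\<Sum>n\<in>F. - 2 * Re (cnj (c n) * circle_coeff f n)
   + 2 * pi * (cmod (c n))\<^sup>2)"
  unfolding fq trig_poly_norm_square[OF F]
  by (simp add: sum.distrib sum_distrib_left sum_subtractf sum_negf)
 also have "(\<Sum>n\<in>F. - 2 * Re (cnj (c n) * circle_coeff f n) + 2 * pi * (cmod (c n))\<^sup>2)
  = (\<Sum>n\<in>F. 2 * pi * (cmod (c n - circle_coeff f n / (2 * pi)))\<^sup>2 - (cmod (circle_coeff f n))\<^sup>2 / (2 * pi))"
 proof (intro sum.cong refl)
  fix n
  have eq2: "(cmod (a - b / (2 * pi)))\<^sup>2 = (cmod a)\<^sup>2 - 2 * Re (cnj a * b) / (2 * pi) + (cmod b)\<^sup>2 / (2 * pi)\<^sup>2"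
   for a b :: complex
  proof -
   define r where "r = 1 / (2 * pi)"
   have "b / (2 * pi) = complex_of_real r * b" by (simp add: r_def)
   hence "(cmod (a - b / (2 * pi)))\<^sup>2 = (Re a - r * Re b)\<^sup>2 + (Im a - r * Im b)\<^sup>2"
    by (simp add: cmod_power2)
   also have "... = (Re a)\<^sup>2 + (Im a)\<^sup>2 - 2 * r * (Re a * Re b + Im a * Im b)
     + r\<^sup>2 * ((Re b)\<^sup>2 + (Im b)\<^sup>2)"
    by (simp add: power2_eq_square algebra_simps)
   finally show ?thesis by (simp add: cmod_power2 r_def power_divide add_divide_distrib)
  qed
  show "- 2 * Re (cnj (c n) * circle_coeff f n) + 2 * pi * (cmod (c n))\<^sup>2 =
   2 * pi * (cmod (c n - circle_coeff f n / (2 * pi)))\<^sup>2 - (cmod (circle_coeff f n))\<^sup>2 / (2 * pi)"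
   unfolding eq2 by (simp add: field_simps power2_eq_square)
 qed
 finally show ?thesis
  by (simp add: sum_subtractf sum_distrib_left sum_divide_distrib)
qed

section \<open>Density of trigonometric polynomials in \<open>L^2\<close> of the circle\<close>

definition trig_approx :: "(real => complex) => bool" where
 "trig_approx f \<longleftrightarrow> f \<in> Lp_space 2 circle \<and>
   (\<forall>e>0. \<exists>F c. finite F \<and> Lp_norm 2 circle (%x. f x - trig_poly F c x) < e)"

lemma trig_poly_Lp: "trig_poly F c \<in> Lp_space 2 circle"
 unfolding Lp_space_def
 by (auto intro!: integrable_circle_bounded[where B = "(\<Sum>n\<in>F. cmod (c n))\<^sup>2"] power_mono trig_poly_bounded)

lemma trig_poly_add:
 assumes "finite F" "finite G"
 shows "trig_poly F c x + trig_poly G d x =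
  trig_poly (F \<union> G) (%n. (if n \<in> F then c n else 0) + (if n \<in> G then d n else 0)) x"
proof -
 have "trig_poly F c x = (\<Sum>n\<in>F \<union> G. (if n \<in> F then c n else 0) * cis (of_int n * x))"
  unfolding trig_poly_def using assms by (intro sum.mono_neutral_cong_left) auto
 moreover have "trig_poly G d x = (\<Sum>n\<in>F \<union> G. (if n \<in> G then d n else 0) * cis (of_int n * x))"
  unfolding trig_poly_def using assms by (intro sum.mono_neutral_cong_left) auto
 ultimately show ?thesis
  by (simp add: trig_poly_def sum.distrib distrib_right)
qed

lemma trig_poly_cmult: "a * trig_poly F c x = trig_poly F (%n. a * c n) x"
 by (simp add: trig_poly_def sum_distrib_left mult.assoc)

lemma trig_poly_mult:
 assumes "finite F" "finite G"
 shows "\<exists>H h. finite H \<and> (\<forall>x. trig_poly F c x * trig_poly G d x = trig_poly H h x)"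
 using assms(1)
proof (induction F arbitrary: c)
 case empty
 thus ?case by (intro exI[of _ "{}"]) (auto simp: trig_poly_def)
next
 case (insert m F)
 from insert(3)[of c] obtain H h where H: "finite H" "\<And>x. trig_poly F c x * trig_poly G d x = trig_poly H h x"
  by auto
 have "c m * cis (of_int m * x) * trig_poly G d x = trig_poly ((%n. m + n) ` G) (%k. c m * d (k - m)) x" for x
  by (simp add: trig_poly_def sum_distrib_left sum.reindex algebra_simps flip: cis_mult)
 hence eq: "trig_poly (insert m F) c x * trig_poly G d x =
   trig_poly ((%n. m + n) ` G) (%k. c m * d (k - m)) x + trig_poly H h x" for x
  using insert(1,2) H(2)[of x] by (simp add: trig_poly_def distrib_right)
 have "finite ((%n. m + n) ` G \<union> H)" using H(1) assms(2) by simp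
 moreover note eq[unfolded trig_poly_add[OF finite_imageI[OF assms(2)] H(1)]]
 ultimately show ?case by (intro exI conjI allI)
qed

lemma trig_approx_add:
 assumes "trig_approx f" "trig_approx g"
 shows "trig_approx (%x. f x + g x)"
 unfolding trig_approx_def
proof (intro conjI allI impI)
 note L = assms[unfolded trig_approx_def, THEN conjunct1]
 show "(%x. f x + g x) \<in> Lp_space 2 circle" using Lp_add(1)[OF L] by simp
 fix e :: real assume "e > 0"
 then obtain F c G d where *: "finite F" "Lp_norm 2 circle (%x. f x - trig_poly F c x) < e / 2"
  "finite G" "Lp_norm 2 circle (%x. g x - trig_poly G d x) < e / 2"
  using assms unfolding trig_approx_def by (metis half_gt_zero)
 have "Lp_norm 2 circle (%x. (f x - trig_poly F c x) + (g x - trig_poly G d x)) < e"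
  using Lp_add(2)[OF Lp_diff(1)[OF L(1) trig_poly_Lp] Lp_diff(1)[OF L(2) trig_poly_Lp], of F c G d] *
  by simp
 thus "\<exists>F c. finite F \<and> Lp_norm 2 circle (%x. f x + g x - trig_poly F c x) < e"
  using *(1,3) trig_poly_add[OF *(1,3), of c _ d]
  by (intro exI[of _ "F \<union> G"] exI) (auto simp: algebra_simps)
qed

lemma trig_approx_cmult:
 assumes "trig_approx f"
 shows "trig_approx (%x. a * f x)"
 unfolding trig_approx_def
proof (intro conjI allI impI)
 have L: "f \<in> Lp_space 2 circle" using assms by (simp add: trig_approx_def)
 show "(%x. a * f x) \<in> Lp_space 2 circle" using Lp_cmult(1)[OF L] by simp
 fix e :: real assume "e > 0"
 then obtain F c where *: "finite F" "Lp_norm 2 circle (%x. f x - trig_poly F c x) < e / (cmod a + 1)"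
  using assms unfolding trig_approx_def by (metis add_nonneg_pos divide_pos_pos norm_ge_zero zero_less_one)
 have "Lp_norm 2 circle (%x. a * (f x - trig_poly F c x)) = cmod a * Lp_norm 2 circle (%x. f x - trig_poly F c x)"
  by (rule Lp_cmult(2)[OF Lp_diff(1)[OF L trig_poly_Lp]]) auto
 also have "... <= cmod a * (e / (cmod a + 1))"
  using * by (intro mult_left_mono) auto
 also have "... < e" using \<open>e > 0\<close> by (simp add: field_simps add_pos_nonneg)
 finally have "Lp_norm 2 circle (%x. a * (f x - trig_poly F c x)) < e" .
 thus "\<exists>F c. finite F \<and> Lp_norm 2 circle (%x. a * f x - trig_poly F c x) < e"
  using *(1) by (intro exI[of _ F] exI[of _ "%n. a * c n"]) (auto simp: trig_poly_cmult right_diff_distrib)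
qed

lemma trig_approx_limit:
 assumes f: "f \<in> Lp_space 2 circle" and g: "\<And>n. trig_approx (g n)"
  and lim: "(%n. Lp_norm 2 circle (%x. f x - g n x)) \<longlonglongrightarrow> 0"
 shows "trig_approx f"
 unfolding trig_approx_def
proof (intro conjI allI impI f)
 fix e :: real assume "e > 0"
 hence "\<forall>\<^sub>F n in sequentially. Lp_norm 2 circle (%x. f x - g n x) < e / 2"
  using order_tendstoD(2)[OF lim, of "e / 2"] by auto
 then obtain n where n: "Lp_norm 2 circle (%x. f x - g n x) < e / 2"
  by (auto simp: eventually_sequentially)
 from g[of n] \<open>e > 0\<close> obtain F c where F: "finite F" "Lp_norm 2 circle (%x. g n x - trig_poly F c x) < e / 2"
  unfolding trig_approx_def by (metis half_gt_zero)
 have "g n \<in> Lp_space 2 circle" using g by (simp add: trig_approx_def)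
 from Lp_norm_triangle[OF f this trig_poly_Lp[of F c]] n F
 show "\<exists>F c. finite F \<and> Lp_norm 2 circle (%x. f x - trig_poly F c x) < e"
  by (intro exI[of _ F] exI[of _ c]) auto
qed

lemma Lp_dominated:
 assumes [measurable]: "\<And>n. g n \<in> bm M" "f \<in> bm M"
  and w: "w \<in> Lp_space p M" and p: "p >= 1"
  and bd: "\<And>n. AE x in M. cmod (f x - g n x) <= cmod (w x)"
  and lim: "AE x in M. (%n. g n x) \<longlonglongrightarrow> f x"
 shows "(%n. Lp_norm p M (%x. f x - g n x)) \<longlonglongrightarrow> 0"
proof -
 have [measurable]: "w \<in> bm M" using w by (simp add: Lp_space_def)
 have "(%n. LINT x|M. cmod (f x - g n x) powr p) \<longlonglongrightarrow> (LINT x|M. 0)"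
 proof (rule integral_dominated_convergence)
  show "integrable M (%x. cmod (w x) powr p)" using w by (simp add: Lp_space_def)
  show "AE x in M. (%n. cmod (f x - g n x) powr p) \<longlonglongrightarrow> 0"
   using lim
  proof eventually_elim
   case (elim x)
   have "(%n. cmod (f x - g n x) powr p) \<longlonglongrightarrow> (cmod (f x - f x)) powr p"
    using p by (intro tendsto_powr2 tendsto_intros elim) auto
   thus ?case using p by simp
  qed
  show "AE x in M. norm (cmod (f x - g n x) powr p) <= cmod (w x) powr p" for n
   using bd[of n] p by (auto elim!: eventually_mono intro!: powr_mono2)
 qed auto
 hence "(%n. (LINT x|M. cmod (f x - g n x) powr p) powr (1 / p)) \<longlonglongrightarrow> 0 powr (1 / p)"
  using p by (intro tendsto_powr2) (auto intro!: always_eventually)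
 thus ?thesis using p by (simp add: Lp_norm_def)
qed

text \<open>On the unit circle a linear form is a combination of \<open>cos\<close> and
  \<open>sin\<close>, hence of \<open>cis x\<close> and \<open>cis (-x)\<close>, and trigonometric
  polynomials form an algebra. This is what makes Stone-Weierstrass on the sphere
  applicable.\<close>

lemma real_polynomial_trig_poly:
 assumes "real_polynomial_function (g :: complex => real)"
 shows "\<exists>F c. finite F \<and> (\<forall>x. complex_of_real (g (cis x)) = trig_poly F c x)"
 using assms
proof (induction g rule: real_polynomial_function.induct)
 case (linear h)
 then interpret bounded_linear h .
 have h: "h (cis x) = cos x * h 1 + sin x * h \<i>" for x
 proof -
  have "cis x = cos x *\<^sub>R 1 + sin x *\<^sub>R \<i>" by (simp add: complex_eq_iff)
  thus ?thesis by (simp only: add scaleR real_scaleR_def)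
 qed
 have cs: "complex_of_real (cos x) = (cis x + cis (-x)) / 2"
  "complex_of_real (sin x) = (cis x - cis (-x)) / (2 * \<i>)" for x
  by (auto simp: complex_eq_iff)
 have "complex_of_real (h (cis x)) =
   trig_poly {-1, 1} (%n. if n = 1 then h 1 / 2 + h \<i> / (2 * \<i>) else h 1 / 2 - h \<i> / (2 * \<i>)) x" for x
  unfolding h of_real_add of_real_mult cs
  by (simp add: trig_poly_def add_divide_distrib diff_divide_distrib algebra_simps)
 moreover have "finite {-1, 1 :: int}" by simp
 ultimately show ?case by (intro exI conjI allI)
next
 case (const c)
 show ?case by (intro exI[of _ "{0}"] exI[of _ "%_. of_real c"]) (auto simp: trig_poly_def)
next
 case (add f g)
 then obtain F c G d where *: "finite F" "\<And>x. complex_of_real (f (cis x)) = trig_poly F c x"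
  "finite G" "\<And>x. complex_of_real (g (cis x)) = trig_poly G d x" by auto
 have "complex_of_real (f (cis x) + g (cis x)) = trig_poly F c x + trig_poly G d x" for x
  using * by simp
 note this[unfolded trig_poly_add[OF *(1,3)]]
 moreover have "finite (F \<union> G)" using * by simp
 ultimately show ?case by (intro exI conjI allI)
next
 case (mult f g)
 then obtain F c G d where *: "finite F" "\<And>x. complex_of_real (f (cis x)) = trig_poly F c x"
  "finite G" "\<And>x. complex_of_real (g (cis x)) = trig_poly G d x" by auto
 show ?case
  unfolding of_real_mult * using trig_poly_mult[OF *(1,3)] .
qed

lemma Lp_norm_circle_bounded:
 assumes "f \<in> bm circle" "\<And>x. cmod (f x) <= B"
 shows "f \<in> Lp_space 2 circle" "Lp_norm 2 circle f <= B * sqrt (2 * pi)"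
proof -
 have B: "0 <= B" using norm_ge_zero[of "f 0"] assms(2)[of 0] by linarith
 have "pint 2 circle f <= (NN x|circle. ennreal (B\<^sup>2))"
  unfolding pint_def using assms(2) by (intro nn_integral_mono) (auto intro!: ennreal_leI power_mono)
 also have "... = ennreal (B\<^sup>2 * (2 * pi))"
  by (simp add: ennreal_mult)
 also have "... = ennreal ((B * sqrt (2 * pi)) powr 2)"
  using B by (simp add: power_mult_distrib)
 finally have *: "pint 2 circle f <= ennreal ((B * sqrt (2 * pi)) powr 2)" .
 show "f \<in> Lp_space 2 circle" "Lp_norm 2 circle f <= B * sqrt (2 * pi)"
  using Lp_normI[OF assms(1) _ _ *] B by auto
qed

lemma trig_approx_continuous:
 fixes G :: "complex => real"
 assumes G: "continuous_on (sphere 0 1) G" and [measurable]: "(%x. G (cis x)) \<in> bm borel"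
  and bd: "\<And>x. \<bar>G (cis x)\<bar> <= B"
 shows "trig_approx (%x. complex_of_real (G (cis x)))"
 unfolding trig_approx_def
proof (intro conjI allI impI)
 show "(%x. complex_of_real (G (cis x))) \<in> Lp_space 2 circle"
  by (rule Lp_norm_circle_bounded(1)[of _ B]) (use bd in auto)
 fix e :: real assume e: "e > 0"
 obtain g where g: "real_polynomial_function g" "\<And>z. z \<in> sphere 0 1 ==> \<bar>G z - g z\<bar> < e / 6"
  using Stone_Weierstrass_real_polynomial_function[OF compact_sphere G, of "e / 6"] e by auto
 from real_polynomial_trig_poly[OF g(1)] obtain F c where
  F: "finite F" "\<And>x. complex_of_real (g (cis x)) = trig_poly F c x" by auto
 have "cmod (complex_of_real (G (cis x)) - trig_poly F c x) <= e / 6" for x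
  using g(2)[of "cis x"] unfolding F(2)[symmetric] by (simp flip: of_real_diff)
 hence "Lp_norm 2 circle (%x. complex_of_real (G (cis x)) - trig_poly F c x) <= e / 6 * sqrt (2 * pi)"
  by (intro Lp_norm_circle_bounded(2)) auto
 also have "... < e"
 proof -
  have "sqrt (2 * pi) < sqrt 36" using pi_less_4 by (intro real_sqrt_less_mono) auto
  thus ?thesis using e by simp
 qed
 finally show "\<exists>F c. finite F \<and> Lp_norm 2 circle (%x. complex_of_real (G (cis x)) - trig_poly F c x) < e"
  using F(1) by auto
qed

lemma cis_inj_open:
 assumes "cis x = cis y" "x \<in> {0<..<2 * pi}" "y \<in> {0..2 * pi}"
 shows "x = y"
proof -
 have "exp (\<i> * complex_of_real x) = exp (\<i> * complex_of_real y)" using assms(1) by (simp add: cis_conv_exp)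
 then obtain n :: int where n: "\<i> * complex_of_real x = \<i> * complex_of_real y + (of_int (2 * n) * pi) * \<i>"
  unfolding exp_eq by auto
 hence *: "x = y + 2 * of_int n * pi"
  by (auto simp: complex_eq_iff)
 have "\<bar>x - y\<bar> < 2 * pi" using assms(2,3) by auto
 hence "\<bar>real_of_int n\<bar> * (2 * pi) < 1 * (2 * pi)"
  using * by (simp add: abs_mult)
 hence "\<bar>real_of_int n\<bar> < 1" by (rule mult_right_less_imp_less) simp
 hence "n = 0" by linarith
 thus ?thesis using * by simp
qed

text \<open>The indicator is the pointwise limit of \<open>min 1 (n * infdist z K)\<close>, with
  \<open>K\<close> the image on the unit circle of the complement of the interval. The points 0 and
  \<open>2 * pi\<close>, identified on the circle, both lie in that complement, and
  \<open>cis_inj_open\<close> keeps the image of the open interval off \<open>K\<close>.\<close>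

lemma trig_approx_interval:
 assumes "0 <= a" "b <= 2 * pi"
 shows "trig_approx (indicator {a<..<b})"
proof -
 define K where "K = cis ` ({0..2 * pi} - {a<..<b})"
 have "compact ({0..2 * pi} - {a<..<b})" by (intro compact_diff) auto
 hence K: "closed K"
  unfolding K_def by (intro compact_imp_closed compact_continuous_image continuous_intros)
 have Kne: "K \<noteq> {}"
 proof -
  have "0 \<in> {0..2 * pi} - {a<..<b}" using assms by auto
  thus ?thesis unfolding K_def by blast
 qed
 define G where "G = (%(n::nat) z. min 1 (real n * infdist z K))"
 have cont: "continuous_on S (%x. G n (f x))" if "continuous_on S f" for S n and f :: "real => complex"
  unfolding G_def using that by (intro continuous_intros)
 have ind: "(%n. G n (cis x)) \<longlonglongrightarrow> indicator {a<..<b} x" if "x \<in> {0..<2 * pi}" for x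
 proof (cases "x \<in> {a<..<b}")
  case True
  hence "cis x \<notin> K"
   unfolding K_def using assms cis_inj_open[of x] that by auto
  hence "infdist (cis x) K > 0"
   using K Kne by (simp add: infdist_pos_not_in_closed)
  hence "G n (cis x) = 1" if "n > nat \<lceil>1 / infdist (cis x) K\<rceil>" for n
  proof -
   have "1 / infdist (cis x) K < real n" using that by linarith
   thus ?thesis using \<open>infdist (cis x) K > 0\<close> by (simp add: G_def field_simps)
  qed
  hence "\<forall>\<^sub>F n in sequentially. G n (cis x) = 1"
   by (intro eventually_mono[OF eventually_gt_at_top[of "nat \<lceil>1 / infdist (cis x) K\<rceil>"]])
  thus ?thesis using True by (simp add: tendsto_eventually)
 next
  case False
  hence "cis x \<in> K" using that unfolding K_def by auto
  thus ?thesis using False by (simp add: G_def)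
 qed
 have bdG: "0 <= G n z" "G n z <= 1" for n z
  by (auto simp: G_def infdist_nonneg)
 have [measurable]: "(%x. G n (cis x)) \<in> bm borel" for n
  by (intro borel_measurable_continuous_onI cont continuous_intros)
 have "continuous_on (sphere 0 1) (G n)" for n
  unfolding G_def by (intro continuous_intros)
 hence ta: "trig_approx (%x. complex_of_real (G n (cis x)))" for n
  by (rule trig_approx_continuous[where B = 1]) (use bdG in \<open>auto simp: abs_le_iff intro: order_trans[of _ 0]\<close>)
 have w: "(%x. 1) \<in> Lp_space 2 circle" by (rule Lp_norm_circle_bounded(1)[of _ 1]) auto
 have ae: "AE x in circle. (%n. complex_of_real (G n (cis x))) \<longlonglongrightarrow> indicator {a<..<b} x"
 proof (intro AE_I2)
  fix x assume "x \<in> space circle"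
  hence "(%n. complex_of_real (G n (cis x))) \<longlonglongrightarrow> complex_of_real (indicator {a<..<b} x)"
   by (intro tendsto_of_real ind) simp
  thus "(%n. complex_of_real (G n (cis x))) \<longlonglongrightarrow> indicator {a<..<b} x"
   by (simp only: of_real_indicator)
 qed
 show ?thesis
 proof (rule trig_approx_limit[OF _ ta])
  show "indicator {a<..<b} \<in> Lp_space 2 circle"
   by (rule Lp_norm_circle_bounded(1)[of _ 1]) (auto split: split_indicator)
  show "(%n. Lp_norm 2 circle (%x. indicator {a<..<b} x - complex_of_real (G n (cis x)))) \<longlonglongrightarrow> 0"
  proof (rule Lp_dominated[OF _ _ w _ _ ae])
   fix n show "AE x in circle. cmod (indicator {a<..<b} x - complex_of_real (G n (cis x))) <= cmod 1"
   proof (intro AE_I2)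
    fix x
    have "\<bar>indicator {a<..<b} x - G n (cis x)\<bar> <= 1" using bdG[of n "cis x"] by (auto split: split_indicator)
    moreover have "indicator {a<..<b} x - complex_of_real (G n (cis x))
      = complex_of_real (indicator {a<..<b} x - G n (cis x))"
     by (simp only: of_real_diff of_real_indicator)
    ultimately show "cmod (indicator {a<..<b} x - complex_of_real (G n (cis x))) <= cmod 1"
     by (simp only: norm_of_real norm_one)
   qed
  qed auto
 qed
qed

lemma trig_approx_cong:
 assumes "trig_approx f" "\<And>x. x \<in> {0..<2 * pi} ==> f x = g x"
 shows "trig_approx g"
proof -
 have "Lp_norm 2 circle (%x. g x - trig_poly F c x) = Lp_norm 2 circle (%x. f x - trig_poly F c x)" for F c
  unfolding Lp_norm_def using assms(2) by (intro arg_cong2[where f = "(powr)"] Bochner_Integration.integral_cong) auto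
 moreover have "g \<in> Lp_space 2 circle"
 proof -
  have "g \<in> bm circle \<longleftrightarrow> f \<in> bm circle"
   using assms(2) by (intro measurable_cong) auto
  moreover have "integrable circle (%x. cmod (g x) powr 2) \<longleftrightarrow> integrable circle (%x. cmod (f x) powr 2)"
   using assms(2) by (intro Bochner_Integration.integrable_cong) auto
  ultimately show ?thesis using assms(1) by (simp add: trig_approx_def Lp_space_def)
 qed
 ultimately show ?thesis using assms(1) by (simp add: trig_approx_def)
qed

lemma trig_approx_const: "trig_approx (%_. a)"
 unfolding trig_approx_def
proof (intro conjI allI impI)
 show "(%_. a) \<in> Lp_space 2 circle" by (rule Lp_norm_circle_bounded(1)[of _ "cmod a"]) auto
 fix e :: real assume "e > 0"
 thus "\<exists>F c. finite F \<and> Lp_norm 2 circle (%x. a - trig_poly F c x) < e"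
  by (intro exI[of _ "{0}"] exI[of _ "%_. a"]) (auto simp: trig_poly_def)
qed

text \<open>Open intervals are stable under intersection and generate the Borel sets; complements
  and disjoint unions preserve approximability by linearity and dominated convergence.\<close>

lemma trig_approx_indicator:
 assumes "A \<in> sets borel"
 shows "trig_approx (indicator A)"
proof -
 let ?G = "range (%(a, b). {a<..<b::real})"
 have borel: "sets borel = sigma_sets UNIV ?G"
 proof -
  have eq: "(%(a, b). box a b :: real set) = (%(a, b). {a<..<b})"
   by (simp add: fun_eq_iff)
  show ?thesis unfolding borel_eq_box eq by simp
 qed
 have "Int_stable ?G"
  by (auto simp: Int_stable_def intro!: image_eqI[where x = "(max a c, min b d)" for a b c d])
 moreover have "?G \<subseteq> Pow UNIV" by auto
 moreover have "A \<in> sigma_sets UNIV ?G"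
  using assms by (simp add: borel)
 ultimately show ?thesis
 proof (induction rule: sigma_sets_induct_disjoint)
  case (basic A)
  then obtain a b where A: "A = {a<..<b}" by auto
  show ?case
  proof (cases "a < 0")
   case False
   show ?thesis
    by (rule trig_approx_cong[OF trig_approx_interval[of "max a 0" "min b (2 * pi)"]])
      (use False A in \<open>auto split: split_indicator\<close>)
  next
   case True
   \<comment> \<open>On the circle the given interval differs from this one at most at the point 0,
     a null set, so \<open>trig_approx_limit\<close> with a constant sequence transfers the
     approximation.\<close>
   have ta: "trig_approx (%x. indicator {0<..<min b (2 * pi)} x)"
    by (rule trig_approx_interval) auto
   show ?thesis
   proof (rule trig_approx_limit[of _ "%n x. indicator {0<..<min b (2 * pi)} x"])
    show "indicator A \<in> Lp_space 2 circle"
     by (rule Lp_norm_circle_bounded(1)[of _ 1]) (auto simp: A split: split_indicator)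
    have "AE x in circle. x \<noteq> 0"
     unfolding circle_def by (subst AE_restrict_space_iff) (auto intro!: AE_I[of _ _ "{0}"])
    hence "AE x in circle. indicator A x - indicator {0<..<min b (2 * pi)} x = (0::complex)"
     using AE_space[of circle]
     by eventually_elim (use True in \<open>auto simp: A split: split_indicator\<close>)
    hence "Lp_norm 2 circle (%x. indicator A x - indicator {0<..<min b (2 * pi)} x) = 0"
     by (rule Lp_norm_zero_AE) (simp add: A)
    thus "(%n::nat. Lp_norm 2 circle (%x. indicator A x - indicator {0<..<min b (2 * pi)} x)) \<longlonglongrightarrow> 0"
     by simp
   qed (use ta in auto)
  qed
 next
  case empty
  show ?case using trig_approx_const[of 0] by (simp add: indicator_def)
 next
  case (compl A)
  have "trig_approx (%x. 1 + (- 1) * indicator A x)"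
   by (intro trig_approx_add trig_approx_const trig_approx_cmult compl)
  thus ?case by (rule trig_approx_cong) (auto split: split_indicator)
 next
  case (union A)
  have [measurable]: "A i \<in> sets borel" for i
   using union(2) by (auto simp: borel)
  have w: "(%x. 1) \<in> Lp_space 2 circle" by (rule Lp_norm_circle_bounded(1)[of _ 1]) auto
  have fin: "trig_approx (%x. \<Sum>i<n. indicator (A i) x)" for n
   by (induction n) (auto intro!: trig_approx_const trig_approx_add union)
  have eq: "(\<Sum>i<n. indicator (A i) x) = (indicator (\<Union>i<n. A i) x :: complex)" for n x
   using union(1) by (subst indicator_UN_disjoint) (auto simp: disjoint_family_on_def)
  show ?case
  proof (rule trig_approx_limit[OF _ fin])
   show "indicator (\<Union>i. A i) \<in> Lp_space 2 circle"
    by (rule Lp_norm_circle_bounded(1)[of _ 1]) (auto split: split_indicator)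
   show "(%n. Lp_norm 2 circle (%x. indicator (\<Union>i. A i) x - (\<Sum>i<n. indicator (A i) x))) \<longlonglongrightarrow> 0"
    unfolding eq
    by (rule Lp_dominated[OF _ _ w]) (auto simp: LIMSEQ_indicator_UN split: split_indicator)
  qed
 qed
qed

lemma trig_approx_nonneg:
 fixes u :: "real => real"
 assumes "u \<in> bm borel" "\<And>x. 0 <= u x"
  and "(%x. complex_of_real (u x)) \<in> Lp_space 2 circle"
 shows "trig_approx (%x. complex_of_real (u x))"
 using assms
proof (induction u rule: borel_measurable_induct_real)
 case (set A)
 thus ?case using trig_approx_indicator[of A] by (simp add: of_real_indicator)
next
 case (mult u c)
 show ?case
 proof (cases "c = 0")
  case True
  thus ?thesis using trig_approx_const[of 0] by simp
 next
  case False
  have "(%x. complex_of_real (u x)) \<in> Lp_space 2 circle"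
   using Lp_cmult(1)[OF mult.prems, of "of_real (1 / c)"] False by simp
  from trig_approx_cmult[OF mult.IH[OF this], of "of_real c"] show ?thesis by simp
 qed
next
 case (add u v)
 have "(%x. complex_of_real (u x)) \<in> Lp_space 2 circle"
  by (rule Lp_mono(1)[OF _ _ add.prems]) (use add.hyps in \<open>auto simp flip: of_real_add\<close>)
 moreover have "(%x. complex_of_real (v x)) \<in> Lp_space 2 circle"
  by (rule Lp_mono(1)[OF _ _ add.prems]) (use add.hyps in \<open>auto simp flip: of_real_add\<close>)
 ultimately show ?case
  using trig_approx_add[OF add.IH(2) add.IH(1)] by simp
next
 case (seq U)
 have le: "U i x <= u x" for i x
 proof -
  have "incseq (%i. U i x)" using seq.hyps(3) by (auto simp: incseq_def le_fun_def)
  from incseq_le[OF this seq.hyps(4)] show ?thesis by simp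
 qed
 note [measurable] = seq.hyps(1)
 have [measurable]: "u \<in> bm borel"
  by (rule borel_measurable_LIMSEQ_real[OF seq.hyps(4)]) auto
 have unn: "0 <= u x" for x using le[of 0 x] seq.hyps(2)[of 0 x] by linarith
 have "trig_approx (%x. complex_of_real (U i x))" for i
  using seq.hyps(2) le unn by (intro seq.IH Lp_mono(1)[OF _ _ seq.prems]) auto
 thus ?case
 proof (rule trig_approx_limit[OF seq.prems])
  show "(%n. Lp_norm 2 circle (%x. complex_of_real (u x) - complex_of_real (U n x))) \<longlonglongrightarrow> 0"
  proof (rule Lp_dominated[OF _ _ seq.prems])
   show "AE x in circle. (%n. complex_of_real (U n x)) \<longlonglongrightarrow> complex_of_real (u x)"
    using seq.hyps(4) by (auto intro!: tendsto_intros)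
  qed (use seq.hyps(2) le unn in \<open>auto simp flip: of_real_diff\<close>)
 qed
qed

lemma trig_approx_L2:
 assumes f: "f \<in> Lp_space 2 circle"
 shows "trig_approx f"
proof -
 \<comment> \<open>Extension by 0 makes the function Borel on the whole line, as
   \<open>trig_approx_nonneg\<close> asks for its positive and negative parts.\<close>
 define g where "g = (%x. if x \<in> {0..<2 * pi} then f x else 0)"
 have "f \<in> bm circle" using f by (simp add: Lp_space_def)
 hence [measurable]: "g \<in> bm borel"
  unfolding circle_def g_def by (subst (asm) borel_measurable_restrict_space_iff)
   (auto simp: indicator_scaleR_eq_if cong: if_cong)
 have gL: "g \<in> Lp_space 2 circle"
 proof (rule Lp_mono(1)[OF _ _ f])
  show "AE x in circle. cmod (g x) <= cmod (f x)" by (auto simp: g_def)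
 qed auto
 have part: "trig_approx (%x. complex_of_real (h x))"
  if [measurable]: "h \<in> bm borel" and "\<And>x. 0 <= h x" "\<And>x. h x <= cmod (g x)" for h
  using that by (intro trig_approx_nonneg Lp_mono(1)[OF _ _ gL]) auto
 have "trig_approx (%x. (complex_of_real (max 0 (Re (g x))) + (- 1) * complex_of_real (max 0 (- Re (g x))))
   + \<i> * (complex_of_real (max 0 (Im (g x))) + (- 1) * complex_of_real (max 0 (- Im (g x)))))"
  by (intro trig_approx_add trig_approx_cmult part)
    (auto intro: order_trans[OF _ abs_Re_le_cmod] order_trans[OF _ abs_Im_le_cmod])
 thus ?thesis
  by (rule trig_approx_cong) (auto simp: g_def complex_eq_iff max_def)
qed

theorem parseval_circle:
 assumes f: "f \<in> Lp_space 2 circle"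
 shows "(NN n|count_space UNIV. ennreal ((cmod (circle_coeff f n))\<^sup>2)) =
  ennreal (2 * pi) * (NN x|circle. ennreal ((cmod (f x))\<^sup>2))"
proof -
 define X where "X = (LINT x|circle. (cmod (f x))\<^sup>2)"
 have sq: "(Lp_norm 2 circle h)\<^sup>2 = (LINT x|circle. (cmod (h x))\<^sup>2)" for h
  by (simp add: Lp_norm_def powr_half_sqrt)
 have nnX: "(NN x|circle. ennreal ((cmod (f x))\<^sup>2)) = ennreal X"
  unfolding X_def using f by (intro nn_integral_eq_integral) (auto simp: Lp_space_def)
 let ?c = "%n. cmod (circle_coeff f n)"
 have bessel: "(\<Sum>n\<in>F. (?c n)\<^sup>2) <= 2 * pi * X" if "finite F" for F
 proof -
  have "0 <= (LINT x|circle. (cmod (f x - trig_poly F (%n. circle_coeff f n / (2 * pi)) x))\<^sup>2)"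
   by simp
  thus ?thesis
   unfolding trig_poly_distance[OF f that] X_def by (simp add: field_simps)
 qed
 let ?S = "(NN n|count_space UNIV. ennreal ((?c n)\<^sup>2))"
 have fin: "(NN n|count_space UNIV. ennreal ((?c n)\<^sup>2) * indicator F n)
   = ennreal (\<Sum>n\<in>F. (?c n)\<^sup>2)" if "finite F" for F
  using that by (simp add: nn_integral_count_space_indicator[symmetric] nn_integral_count_space_finite sum_ennreal)
 have le: "?S <= ennreal (2 * pi * X)"
 proof (rule LIMSEQ_le_const2)
  show "(%j::nat. (NN n|count_space UNIV. ennreal ((?c n)\<^sup>2) * indicator {- int j..int j} n))
    \<longlonglongrightarrow> ?S"
  proof (rule nn_integral_LIMSEQ)
   show "(%j. ennreal ((?c n)\<^sup>2) * indicator {- int j..int j} n)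
     \<longlonglongrightarrow> ennreal ((?c n)\<^sup>2)" for n
    by (intro tendsto_eventually eventually_mono[OF eventually_ge_at_top[of "nat \<bar>n\<bar>"]])
      (auto split: split_indicator)
  qed (auto simp: incseq_def le_fun_def split: split_indicator)
  show "\<exists>N. \<forall>j\<ge>N. (NN n|count_space UNIV. ennreal ((?c n)\<^sup>2) * indicator {- int j..int j} n)
    <= ennreal (2 * pi * X)"
   unfolding fin[OF finite_atLeastAtMost_int] using bessel by (auto intro!: ennreal_leI)
 qed
 have ge: "ennreal (2 * pi * X) <= ?S"
 proof (rule ennreal_le_epsilon)
  fix e :: real assume e: "e > 0"
  \<comment> \<open>Chosen so that an approximation error below \<open>d\<close> in norm costs at
    most \<open>e\<close> in the bound for \<open>2 * pi * X\<close>.\<close>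
  define d where "d = sqrt (e / (2 * pi))"
  have d: "d > 0" "2 * pi * d\<^sup>2 = e" using e by (auto simp: d_def)
  obtain F c where F: "finite F" "Lp_norm 2 circle (%x. f x - trig_poly F c x) < d"
   using trig_approx_L2[OF f] d unfolding trig_approx_def by metis
  have "X - (\<Sum>n\<in>F. (?c n)\<^sup>2) / (2 * pi)
    <= (LINT x|circle. (cmod (f x - trig_poly F c x))\<^sup>2)"
   unfolding trig_poly_distance[OF f F(1)] X_def by (simp add: sum_nonneg)
  also have "... <= d\<^sup>2"
   unfolding sq[symmetric] using F(2) by (intro power_mono) auto
  finally have "2 * pi * X <= (\<Sum>n\<in>F. (?c n)\<^sup>2) + 2 * pi * d\<^sup>2"
   by (simp add: field_simps)
  hence "ennreal (2 * pi * X) <= ennreal (\<Sum>n\<in>F. (?c n)\<^sup>2) + ennreal e"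
   using d e by (simp flip: ennreal_plus add: sum_nonneg)
  also have "ennreal (\<Sum>n\<in>F. (?c n)\<^sup>2) <= ?S"
   unfolding fin[OF F(1), symmetric] by (intro nn_integral_mono) (auto split: split_indicator)
  finally show "ennreal (2 * pi * X) <= ?S + ennreal e" by (simp add: add_right_mono)
 qed
 show ?thesis
  using le ge unfolding nnX by (simp add: ennreal_mult' antisym)
qed

lemma ennreal_mult_merge:
 "0 <= a ==> 0 <= b ==> ennreal a * (ennreal b * X) = ennreal (a * b) * X"
 by (simp add: ennreal_mult mult.assoc)

subsection \<open>Plancherel's identity for compactly supported functions on the line\<close>

text \<open>For each \<open>z\<close> exactly one integer translate falls into
  \<open>{0..<1}\<close>, the one by the floor of \<open>z\<close>; Tonelli and translation
  invariance do the rest. Besides Plancherel it serves to compare sums over the integers with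
  integrals.\<close>

lemma nn_integral_periodize:
 assumes [measurable]: "F \<in> bm (borel :: real measure)"
 shows "(NN x|lborel. F x) =
  (NN \<theta>|lborel. (NN n|count_space UNIV. F (\<theta> + of_int n)) * indicator {0..<1} \<theta>)"
proof -
 interpret c: sigma_finite_measure "count_space (UNIV :: int set)"
  by (rule sigma_finite_measure_count_space)
 interpret P: pair_sigma_finite "lborel :: real measure" "count_space (UNIV :: int set)"
  by unfold_locales
 have fl: "indicator {0..<1} (z - of_int n) = (indicator {\<lfloor>z\<rfloor>} n :: ennreal)" for z :: real and n
  by (auto split: split_indicator) linarith+
 have [measurable]: "(%p. F (fst p) * indicator {0..<1} (fst p - real_of_int (snd p)))
    \<in> bm (lborel \<Otimes>\<^sub>M count_space UNIV)"
  by measurable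
 have "(NN z|lborel. F z) = (NN z|lborel. (NN n|count_space UNIV. F z * indicator {0..<1} (z - of_int n)))"
  unfolding fl by (simp add: nn_integral_cmult nn_integral_count_space_indicator[symmetric])
 also have "... = (NN n|count_space UNIV. (NN z|lborel. F z * indicator {0..<1} (z - of_int n)))"
  by (rule P.Fubini'[symmetric]) (simp add: case_prod_beta)
 also have "... = (NN n|count_space UNIV. (NN \<theta>|lborel. F (\<theta> + of_int n) * indicator {0..<1} \<theta>))"
 proof (rule nn_integral_cong)
  fix n :: int
  show "(NN z|lborel. F z * indicator {0..<1} (z - of_int n))
    = (NN \<theta>|lborel. F (\<theta> + of_int n) * indicator {0..<1} \<theta>)"
   using nn_integral_real_affine[of "%z. F z * indicator {0..<1} (z - of_int n)" 1 "of_int n"]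
   by (simp add: add.commute)
 qed
 also have "... = (NN \<theta>|lborel. (NN n|count_space UNIV. F (\<theta> + of_int n) * indicator {0..<1} \<theta>))"
  by (rule P.Fubini') (simp add: case_prod_beta)
 finally show ?thesis
  by (simp add: nn_integral_multc)
qed

lemma integral_circle_eq_lborel:
 fixes h :: "real => complex"
 assumes [measurable]: "h \<in> bm borel" and "\<And>x. x \<notin> {0..2 * pi} ==> h x = 0"
 shows "(LINT x|circle. h x) = (LINT x|lborel. h x)"
proof -
 have "(LINT x|circle. h x) = (LINT x|lborel. indicator {0..<2 * pi} x *\<^sub>R h x)"
  unfolding circle_def by (subst integral_restrict_space) auto
 also have "... = (LINT x|lborel. h x)"
 proof (intro integral_cong_AE)
  have "AE x in lborel. x \<noteq> 2 * pi" by (intro AE_I[of _ _ "{2 * pi}"]) auto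
  thus "AE x in lborel. indicator {0..<2 * pi} x *\<^sub>R h x = h x"
   by eventually_elim (use assms(2) in \<open>auto split: split_indicator\<close>)
 qed auto
 finally show ?thesis .
qed

lemma nn_integral_circle_eq_lborel:
 assumes [measurable]: "h \<in> bm borel" and "\<And>x. x \<notin> {0..2 * pi} ==> h x = 0"
 shows "(NN x|circle. h x) = (NN x|lborel. h x)"
proof -
 have "(NN x|circle. h x) = (NN x|lborel. h x * indicator {0..<2 * pi} x)"
  unfolding circle_def by (subst nn_integral_restrict_space) auto
 also have "... = (NN x|lborel. h x)"
 proof (intro nn_integral_cong_AE)
  have "AE x in lborel. x \<noteq> 2 * pi" by (intro AE_I[of _ _ "{2 * pi}"]) auto
  thus "AE x in lborel. h x * indicator {0..<2 * pi} x = h x"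
   by eventually_elim (use assms(2) in \<open>auto split: split_indicator\<close>)
 qed
 finally show ?thesis .
qed

definition fourier_line :: "(real => complex) => real => complex" where
 "fourier_line g y = (LINT \<xi>|lborel. g \<xi> * cis (\<xi> * y))"

lemma fourier_line_measurable [measurable]:
 assumes [measurable]: "g \<in> bm borel"
 shows "fourier_line g \<in> bm borel"
proof -
 have "(%y. LINT \<xi>|lborel. g \<xi> * cis (\<xi> * y)) \<in> bm borel" by measurable
 thus ?thesis by (simp add: fourier_line_def[abs_def])
qed

text \<open>
 The samples of the transform at \<open>(\<theta> + n) / a\<close> are the Fourier coefficients of a modulation of the
 rescaled function, so Parseval's identity on the circle, integrated over \<open>\<theta>\<close>, gives Plancherel.
\<close>

theorem plancherel_line:
 assumes g: "g \<in> Lp_space 2 lborel" and N: "N > 0" and supp: "\<And>\<xi>. \<bar>\<xi>\<bar> > N ==> g \<xi> = 0"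
 shows "(NN y|lborel. ennreal ((cmod (fourier_line g y))\<^sup>2)) =
  ennreal (2 * pi) * (NN \<xi>|lborel. ennreal ((cmod (g \<xi>))\<^sup>2))"
proof -
 have [measurable]: "g \<in> bm borel" using g by (simp add: Lp_space_def)
 \<comment> \<open>The affine map sending \<open>x\<close> to \<open>N - a * x\<close> carries
   \<open>[0, 2 pi]\<close> onto the support interval \<open>[-N, N]\<close>. The reversal of
   orientation turns \<open>cis (\<xi> * y)\<close> into the exponentials with negative sign that
   occur in \<open>circle_coeff\<close>.\<close>
 define a where "a = N / pi"
 have a: "a > 0" using N by (simp add: a_def)
 define f where "f = (%\<theta> x. g (N - a * x) * cis (- (\<theta> * x)))"
 have [measurable]: "f \<theta> \<in> bm borel" for \<theta> unfolding f_def by measurable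
 have f0: "f \<theta> x = 0" if "x \<notin> {0..2 * pi}" for \<theta> x
 proof -
  have "\<bar>N - a * x\<bar> > N"
  proof (cases "x < 0")
   case True
   hence "a * x < 0" using a by (simp add: mult_pos_neg)
   thus ?thesis using N by simp
  next
   case False
   hence "a * x > a * (2 * pi)" using that a by (intro mult_strict_left_mono) auto
   thus ?thesis using N by (simp add: a_def)
  qed
  thus ?thesis using supp by (simp add: f_def)
 qed
 let ?N = "NN \<xi>|lborel. ennreal ((cmod (g \<xi>))\<^sup>2)"
 have nf: "(NN x|circle. ennreal ((cmod (f \<theta> x))\<^sup>2)) = ennreal (1 / a) * ?N" for \<theta>
 proof -
  have "(NN x|circle. ennreal ((cmod (f \<theta> x))\<^sup>2)) = (NN x|lborel. ennreal ((cmod (f \<theta> x))\<^sup>2))"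
   by (rule nn_integral_circle_eq_lborel) (auto simp: f0)
  also have "... = (NN x|lborel. ennreal ((cmod (g (N + (- a) * x)))\<^sup>2))"
   by (simp add: f_def norm_mult)
  also have "... = ennreal (1 / a) * (ennreal \<bar>- a\<bar> * (NN x|lborel. ennreal ((cmod (g (N + (- a) * x)))\<^sup>2)))"
   using a by (simp add: mult.assoc[symmetric] flip: ennreal_mult)
  also have "ennreal \<bar>- a\<bar> * (NN x|lborel. ennreal ((cmod (g (N + (- a) * x)))\<^sup>2)) = ?N"
   using a by (subst nn_integral_real_affine[where c = "- a" and t = N, of "%\<xi>. ennreal ((cmod (g \<xi>))\<^sup>2)"]) auto
  finally show ?thesis .
 qed
 have gfin: "?N < \<infinity>"
  using g by (simp add: Lp_space_iff pint_def)
 have fL: "f \<theta> \<in> Lp_space 2 circle" for \<theta>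
  using nf[of \<theta>] gfin by (simp add: Lp_space_iff pint_def ennreal_mult_less_top)
 let ?q = "%\<theta> n. (\<theta> + of_int n) / a"
 have coeff: "cmod (fourier_line g (?q \<theta> n)) = a * cmod (circle_coeff (f \<theta>) n)" for \<theta> n
 proof -
  have "fourier_line g (?q \<theta> n)
    = a *\<^sub>R (LINT x|lborel. g (N + (- a) * x) * cis ((N + (- a) * x) * (?q \<theta> n)))"
   unfolding fourier_line_def using a
   by (subst lborel_integral_real_affine[where c = "- a" and t = N]) auto
  also have "(%x. g (N + (- a) * x) * cis ((N + (- a) * x) * (?q \<theta> n)))
    = (%x. cis (N * (?q \<theta> n)) * (f \<theta> x * cis (- (of_int n * x))))"
  proof
   fix x
   have "(N + (- a) * x) * (?q \<theta> n) = N * (?q \<theta> n) + (- (\<theta> * x) + - (of_int n * x))"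
    using a by (simp add: field_simps)
   thus "g (N + (- a) * x) * cis ((N + (- a) * x) * (?q \<theta> n))
    = cis (N * (?q \<theta> n)) * (f \<theta> x * cis (- (of_int n * x)))"
    by (simp only: cis_mult[symmetric]) (simp add: f_def mult_ac)
  qed
  also have "(LINT x|lborel. cis (N * (?q \<theta> n)) * (f \<theta> x * cis (- (of_int n * x))))
    = cis (N * (?q \<theta> n)) * circle_coeff (f \<theta>) n"
   unfolding circle_coeff_def by (subst integral_circle_eq_lborel) (auto simp: f0)
  finally show ?thesis using a by (simp add: norm_mult)
 qed
 have sum: "(NN n|count_space UNIV. ennreal ((cmod (fourier_line g (?q \<theta> n)))\<^sup>2))
   = ennreal (2 * pi * a) * ?N" for \<theta>
 proof -
  have "(NN n|count_space UNIV. ennreal ((cmod (fourier_line g (?q \<theta> n)))\<^sup>2))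
   = ennreal (a\<^sup>2) * (NN n|count_space UNIV. ennreal ((cmod (circle_coeff (f \<theta>) n))\<^sup>2))"
   unfolding coeff by (simp add: power_mult_distrib ennreal_mult' nn_integral_cmult)
  also have "... = ennreal (a\<^sup>2) * (ennreal (2 * pi) * (ennreal (1 / a) * ?N))"
   unfolding parseval_circle[OF fL] nf ..
  also have "... = ennreal (a\<^sup>2 * (2 * pi) * (1 / a)) * ?N"
   using a by (subst ennreal_mult_merge, simp, simp)+ (simp add: mult.assoc)
  also have "a\<^sup>2 * (2 * pi) * (1 / a) = 2 * pi * a"
   using a by (simp add: power2_eq_square)
  finally show ?thesis .
 qed
 have "(NN y|lborel. ennreal ((cmod (fourier_line g y))\<^sup>2))
  = ennreal (1 / a) * (NN z|lborel. ennreal ((cmod (fourier_line g (z / a)))\<^sup>2))"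
  using a by (subst nn_integral_real_affine[where c = "1 / a" and t = 0]) auto
 also have "(NN z|lborel. ennreal ((cmod (fourier_line g (z / a)))\<^sup>2)) =
   (NN (\<theta>::real)|lborel. ennreal (2 * pi * a) * ?N * indicator {0..<1} \<theta>)"
  by (subst nn_integral_periodize) (auto simp: sum)
 also have "... = ennreal (2 * pi * a) * ?N"
  by (subst nn_integral_cmult_indicator) auto
 also have "ennreal (1 / a) * ... = ennreal (1 / a * (2 * pi * a)) * ?N"
  using a by (subst ennreal_mult_merge) auto
 finally show ?thesis using a by simp
qed

lemma nn_integral_reflect:
 assumes [measurable]: "f \<in> bm borel"
 shows "(NN x|lborel. f (- x)) = (NN x|lborel. f (x :: real))"
 by (subst (2) nn_integral_real_affine[where c = "-1" and t = 0]) auto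

subsection \<open>The cylinder and its dual\<close>

lemma TR_eq: "TR = circle \<Otimes>\<^sub>M lborel"
 by (simp add: TR_def circle_def)

lemma sigma_finite_lborel: "sigma_finite_measure (lborel :: real measure)"
 by unfold_locales

lemma sigma_finite_TR: "sigma_finite_measure TR"
proof -
 interpret pair_sigma_finite circle "lborel :: real measure"
  by (intro pair_sigma_finite.intro sigma_finite_circle sigma_finite_lborel)
 show ?thesis unfolding TR_eq by unfold_locales
qed

lemma pair_ZR: "pair_sigma_finite (count_space (UNIV :: int set)) (lborel :: real measure)"
 by (intro pair_sigma_finite.intro sigma_finite_measure_count_space sigma_finite_lborel)

lemma sigma_finite_ZR: "sigma_finite_measure ZR"
proof -
 interpret pair_sigma_finite "count_space (UNIV :: int set)" "lborel :: real measure" by (rule pair_ZR)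
 show ?thesis unfolding ZR_def by unfold_locales
qed

lemma pair_TR: "pair_sigma_finite circle (lborel :: real measure)"
 by (intro pair_sigma_finite.intro sigma_finite_circle sigma_finite_lborel)

lemma pair_TR_ZR: "pair_sigma_finite TR ZR"
 by (intro pair_sigma_finite.intro sigma_finite_TR sigma_finite_ZR)

interpretation TR: sigma_finite_measure TR by (rule sigma_finite_TR)

interpretation ZR: sigma_finite_measure ZR by (rule sigma_finite_ZR)

interpretation Q: pair_sigma_finite "count_space (UNIV :: int set)" "lborel :: real measure" by (rule pair_ZR)

abbreviation LZ :: "(real \<times> int \<times> real) measure" where
 "LZ \<equiv> lborel \<Otimes>\<^sub>M ZR"

interpretation LT: pair_sigma_finite "lborel :: real measure" TR
 by (intro pair_sigma_finite.intro sigma_finite_TR sigma_finite_lborel)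

interpretation LZ: pair_sigma_finite "lborel :: real measure" ZR
 by (intro pair_sigma_finite.intro sigma_finite_ZR sigma_finite_lborel)

lemma space_ZR [simp]: "space ZR = UNIV"
 by (simp add: ZR_def space_pair_measure)

lemma sets_ZR [measurable_cong]: "sets ZR = sets (count_space UNIV \<Otimes>\<^sub>M borel)"
 unfolding ZR_def by (intro sets_pair_measure_cong) auto

lemma sets_TR [measurable_cong]: "sets TR = sets (circle \<Otimes>\<^sub>M borel)"
 unfolding TR_eq by (intro sets_pair_measure_cong) auto

lemma measurable_fst_circle [measurable]: "(%x. x) \<in> measurable circle borel"
 by measurable

lemma integrable_pair_mult:
 fixes f :: "'a => complex" and g :: "'b => complex"
 assumes "sigma_finite_measure B" and f: "integrable A f" and g: "integrable B g"
  and h: "h \<in> bm (A \<Otimes>\<^sub>M B)"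
  and bd: "\<And>x y. cmod (h (x, y)) <= cmod (f x) * cmod (g y)"
 shows "integrable (A \<Otimes>\<^sub>M B) (h :: 'a \<times> 'b => complex)"
proof -
 interpret sigma_finite_measure B by fact
 have [measurable]: "f \<in> bm A" "g \<in> bm B" using f g by auto
 note h [measurable]
 have "(NN z|(A \<Otimes>\<^sub>M B). ennreal (cmod (h z))) <= (NN z|(A \<Otimes>\<^sub>M B). ennreal (cmod (f (fst z))) * ennreal (cmod (g (snd z))))"
  using bd by (intro nn_integral_mono) (auto simp flip: ennreal_mult' intro!: ennreal_leI)
 also have "... = (NN x|A. ennreal (cmod (f x))) * (NN y|B. ennreal (cmod (g y)))"
  by (subst nn_integral_fst[symmetric]) (auto simp: nn_integral_cmult nn_integral_multc)
 also have "... < \<infinity>"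
  using f g by (auto simp: integrable_iff_bounded ennreal_mult_less_top)
 finally show ?thesis by (simp add: integrable_iff_bounded)
qed

definition cchar :: "int \<times> real => real \<times> real => complex" where
 "cchar k z = cis (of_int (fst k) * fst z + snd k * snd z)"

lemma norm_cchar [simp]: "cmod (cchar k z) = 1"
 by (simp add: cchar_def)

lemma cchar_add: "cchar (k + l) z = cchar k z * cchar l z"
 by (simp add: cchar_def cis_mult algebra_simps)

lemma cchar_measurable [measurable]:
 assumes [measurable]: "f \<in> measurable M ZR" "g \<in> measurable M TR"
 shows "(%w. cchar (f w) (g w)) \<in> bm M"
proof -
 have "f \<in> measurable M (count_space UNIV \<Otimes>\<^sub>M borel)" "g \<in> measurable M (circle \<Otimes>\<^sub>M borel)"
  using assms by (simp_all cong: measurable_cong_sets add: sets_ZR sets_TR)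
 note [measurable] = this
 have "(%w. fst (f w)) \<in> measurable M (count_space UNIV)" "(%w. snd (f w)) \<in> bm M"
  "(%w. fst (g w)) \<in> measurable M circle" "(%w. snd (g w)) \<in> bm M"
  by measurable
 hence [measurable]: "(%w. fst (f w)) \<in> measurable M (count_space UNIV)" "(%w. snd (f w)) \<in> bm M"
  "(%w. fst (g w)) \<in> bm M" "(%w. snd (g w)) \<in> bm M"
  by (auto intro: measurable_compose[OF _ measurable_fst_circle])
 have [measurable]: "(%w. real_of_int (fst (f w))) \<in> bm M"
  by (rule measurable_compose[OF \<open>(%w. fst (f w)) \<in> measurable M (count_space UNIV)\<close>]) auto
 show ?thesis unfolding cchar_def by measurable
qed

text \<open>Unnormalised: the adjoint of \<open>fourier1\<close>, and \<open>(2 * pi)^2\<close>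
  times its inverse.\<close>

definition synth :: "(int \<times> real => complex) => real \<times> real => complex" where
 "synth G z = (LINT k|ZR. G k * cchar k z)"

definition fourier1 :: "(real \<times> real => complex) => int \<times> real => complex" where
 "fourier1 f k = (LINT z|TR. f z * cnj (cchar k z))"

text \<open>Bounded frequency regions of finite measure that meet only finitely many integers.
  Functions of class \<open>L^p\<close>, \<open>p > 1\<close>, supported there are integrable, so
  \<open>synth\<close> is an honest integral for them.\<close>

definition band :: "real => (int \<times> real) set" where
 "band N = {k. \<bar>real_of_int (fst k)\<bar> <= N \<and> \<bar>snd k\<bar> <= N}"

lemma cnj_measurable [measurable (raw)]:
 "f \<in> bm M ==> (%x. cnj (f x)) \<in> bm M"
 by (rule borel_measurable_continuous_on[where g = f and f = cnj]) (auto intro!: continuous_intros)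

lemma synth_measurable [measurable]:
 assumes [measurable]: "G \<in> bm ZR"
 shows "synth G \<in> bm TR"
proof -
 interpret sigma_finite_measure ZR by (rule sigma_finite_ZR)
 have "(%z. LINT k|ZR. G k * cchar k z) \<in> bm TR" by measurable
 thus ?thesis by (simp add: synth_def[abs_def])
qed

lemma fourier1_measurable [measurable]:
 assumes [measurable]: "f \<in> bm TR"
 shows "fourier1 f \<in> bm ZR"
proof -
 interpret sigma_finite_measure TR by (rule sigma_finite_TR)
 have "(%k. LINT z|TR. f z * cnj (cchar k z)) \<in> bm ZR" by measurable
 thus ?thesis by (simp add: fourier1_def[abs_def])
qed

lemma pairing_integrable:
 assumes f: "integrable TR f" and G: "integrable ZR G"
 shows "(LINT k|ZR. fourier1 f k * cnj (G k)) = (LINT z|TR. f z * cnj (synth G z))"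
proof -
 interpret P: pair_sigma_finite TR ZR by (rule pair_TR_ZR)
 have [measurable]: "f \<in> bm TR" "G \<in> bm ZR" using f G by auto
 have int: "integrable (TR \<Otimes>\<^sub>M ZR) (%(z, k). f z * cnj (cchar k z) * cnj (G k))"
  by (rule integrable_pair_mult[OF sigma_finite_ZR f G]) (auto simp: norm_mult)
 have "(LINT k|ZR. fourier1 f k * cnj (G k)) = (LINT k|ZR. LINT z|TR. f z * cnj (cchar k z) * cnj (G k))"
  by (simp add: fourier1_def)
 also have "... = (LINT z|TR. LINT k|ZR. f z * cnj (cchar k z) * cnj (G k))"
  by (rule P.Fubini_integral[OF int])
 also have "... = (LINT z|TR. f z * cnj (synth G z))"
 proof (intro Bochner_Integration.integral_cong refl)
  fix z
  have "(LINT k|ZR. f z * cnj (cchar k z) * cnj (G k)) = (LINT k|ZR. f z * cnj (G k * cchar k z))"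
   by (simp add: mult_ac)
  also have "... = f z * (LINT k|ZR. cnj (G k * cchar k z))"
   by (rule integral_mult_right_zero)
  also have "... = f z * cnj (synth G z)"
   by (simp only: synth_def Bochner_Integration.integral_cnj)
  finally show "(LINT k|ZR. f z * cnj (cchar k z) * cnj (G k)) = f z * cnj (synth G z)" .
 qed
 finally show ?thesis .
qed

subsection \<open>Plancherel's identity on the cylinder\<close>

lemma pint_TR:
 assumes [measurable]: "f \<in> bm TR"
 shows "pint p TR f = (NN y|lborel. (NN x|circle. ennreal (cmod (f (x, y)) powr p)))"
proof -
 interpret pair_sigma_finite circle "lborel :: real measure" by (rule pair_TR)
 have "(%z. ennreal (cmod (f z) powr p)) \<in> bm (circle \<Otimes>\<^sub>M lborel)"
  unfolding TR_eq[symmetric] by measurable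
 from nn_integral_snd[OF this] show ?thesis by (simp add: pint_def TR_eq)
qed

lemma pint_ZR:
 assumes [measurable]: "f \<in> bm ZR"
 shows "pint p ZR f = (NN n|count_space UNIV. (NN \<xi>|lborel. ennreal (cmod (f (n, \<xi>)) powr p)))"
proof -
 interpret pair_sigma_finite "count_space (UNIV :: int set)" "lborel :: real measure" by (rule pair_ZR)
 have "(%z. ennreal (cmod (f z) powr p)) \<in> bm (count_space UNIV \<Otimes>\<^sub>M lborel)"
  unfolding ZR_def[symmetric] by measurable
 from lborel.nn_integral_fst[OF this] show ?thesis by (simp add: pint_def ZR_def)
qed

lemma TR_sections [measurable]:
 assumes [measurable]: "f \<in> bm TR"
 shows "(%x. f (x, y)) \<in> bm circle"
proof -
 have "f \<in> bm (circle \<Otimes>\<^sub>M borel)"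
  using assms by (simp cong: measurable_cong_sets add: sets_TR)
 from measurable_Pair1[OF this, of y] show ?thesis by simp
qed

lemma ZR_sections [measurable]:
 assumes [measurable]: "f \<in> bm ZR"
 shows "(%\<xi>. f (n, \<xi>)) \<in> bm borel"
proof -
 have "f \<in> bm (count_space UNIV \<Otimes>\<^sub>M borel)"
  using assms by (simp cong: measurable_cong_sets add: sets_ZR)
 from measurable_Pair2[OF this, of n] show ?thesis by simp
qed

lemma snd_TR_measurable [measurable]: "snd \<in> bm TR"
proof -
 have "snd \<in> bm (circle \<Otimes>\<^sub>M borel)" by measurable
 thus ?thesis by (simp cong: measurable_cong_sets add: sets_TR)
qed

lemma strip_finite: "emeasure TR {z \<in> space TR. \<bar>snd z\<bar> <= R} < \<infinity>"
proof -
 interpret pair_sigma_finite circle "lborel :: real measure" by (rule pair_TR)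
 have "{z \<in> space TR. \<bar>snd z\<bar> <= R} = {0..<2 * pi} \<times> {-R..R}"
  by (auto simp: TR_eq space_pair_measure)
 moreover have "emeasure TR ({0..<2 * pi} \<times> {-R..R}) = emeasure circle {0..<2 * pi} * emeasure lborel {-R..R}"
  unfolding TR_eq by (rule lborel.emeasure_pair_measure_Times) (use sets.top[of circle] in auto)
 ultimately have "emeasure TR {z \<in> space TR. \<bar>snd z\<bar> <= R} = emeasure circle {0..<2 * pi} * emeasure lborel {-R..R}"
  by simp
 also have "... < \<infinity>" by (simp add: ennreal_mult_less_top emeasure_lborel_Icc_eq)
 finally show ?thesis .
qed

lemma Lp_finite_support_integrable:
 assumes f: "f \<in> Lp_space p M" and p: "p > 1" and A: "A \<in> sets M" "emeasure M A < \<infinity>"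
  and supp: "\<And>x. x \<in> space M ==> x \<notin> A ==> f x = 0"
 shows "integrable M f"
proof -
 define q where "q = p / (p - 1)"
 have q: "q > 1" "1 / p + 1 / q = 1" using p by (auto simp: q_def field_simps)
 have "pint q M (indicator A) = emeasure M A"
 proof -
  have "pint q M (indicator A) = (NN x|M. indicator A x)"
   unfolding pint_def using q by (intro nn_integral_cong) (auto split: split_indicator)
  thus ?thesis using A by simp
 qed
 hence "(indicator A :: _ => complex) \<in> Lp_space q M" using A by (simp add: Lp_space_iff)
 from holder(1)[OF f this p q] have "integrable M (%x. f x * indicator A x)" .
 thus ?thesis
  by (rule Bochner_Integration.integrable_cong[OF refl, THEN iffD1, rotated]) (use supp in \<open>auto split: split_indicator\<close>)
qed

text \<open>Parseval in \<open>x\<close> for almost every \<open>y\<close>, then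
  \<open>plancherel_line\<close> in \<open>y\<close> for every integer \<open>n\<close>; the bounded
  support in \<open>y\<close> is what the latter asks for. Since \<open>fourier_line\<close> has the
  opposite sign in its exponent, a reflection of \<xi> enters.\<close>

theorem plancherel_forward:
 assumes f: "f \<in> Lp_space 2 TR" and supp: "\<And>z. \<bar>snd z\<bar> > R ==> f z = 0" and R: "R > 0"
 shows "pint 2 ZR (fourier1 f) = ennreal ((2 * pi)\<^sup>2) * pint 2 TR f"
proof -
 interpret P: pair_sigma_finite circle "lborel :: real measure" by (rule pair_TR)
 have [measurable]: "f \<in> bm TR" using f by (simp add: Lp_space_def)
 have fm: "f \<in> bm (circle \<Otimes>\<^sub>M lborel)" unfolding TR_eq[symmetric] by simp
 have fint: "integrable TR f"
  by (rule Lp_finite_support_integrable[OF f _ _ strip_finite[of R]]) (use supp in \<open>auto simp: not_le\<close>)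
 define a where "a = (%n y. circle_coeff (%x. f (x, y)) n)"
 have [measurable]: "(%p. f (snd p, fst p)) \<in> bm (borel \<Otimes>\<^sub>M circle)"
 proof -
  have "(%p. (snd p, fst p)) \<in> measurable (borel \<Otimes>\<^sub>M circle) (circle \<Otimes>\<^sub>M borel)" by measurable
  moreover have "f \<in> bm (circle \<Otimes>\<^sub>M borel)"
   using \<open>f \<in> bm TR\<close> by (simp cong: measurable_cong_sets add: sets_TR)
  ultimately show ?thesis by (rule measurable_compose)
 qed
 have am [measurable]: "a n \<in> bm borel" for n
  unfolding a_def circle_coeff_def by measurable
 have a0: "a n y = 0" if "\<bar>y\<bar> > R" for n y
  using supp that by (simp add: a_def circle_coeff_def)
 have sq: "(NN y|lborel. (NN x|circle. ennreal ((cmod (f (x, y)))\<^sup>2))) = pint 2 TR f"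
  by (simp add: pint_TR)
 have fin: "pint 2 TR f < \<infinity>" using f by (simp add: Lp_space_iff)
 have m2: "(%y. (NN x|circle. ennreal ((cmod (f (x, y)))\<^sup>2))) \<in> bm lborel"
  using fm by measurable
 have L2: "AE y in lborel. (%x. f (x, y)) \<in> Lp_space 2 circle"
 proof -
  have "AE y in lborel. (NN x|circle. ennreal ((cmod (f (x, y)))\<^sup>2)) \<noteq> \<infinity>"
   by (rule nn_integral_PInf_AE[OF m2]) (use fin sq in auto)
  thus ?thesis
   by eventually_elim (auto simp: Lp_space_iff pint_def less_top)
 qed
 let ?N = "%n. NN y|lborel. ennreal ((cmod (a n y))\<^sup>2)"
 have tot: "(NN n|count_space UNIV. (?N n)) = ennreal (2 * pi) * pint 2 TR f"
 proof -
  have "(NN n|count_space UNIV. (?N n))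
    = (NN y|lborel. (NN n|count_space UNIV. ennreal ((cmod (a n y))\<^sup>2)))"
   by (rule Q.Fubini'[symmetric]) (intro measurable_pair_measure_countable1, auto)
  also have "... = (NN y|lborel. ennreal (2 * pi) * (NN x|circle. ennreal ((cmod (f (x, y)))\<^sup>2)))"
   using L2 by (intro nn_integral_cong_AE) (auto elim!: eventually_mono simp: a_def parseval_circle)
  also have "... = ennreal (2 * pi) * pint 2 TR f"
   using m2 by (simp add: nn_integral_cmult sq)
  finally show ?thesis .
 qed
 have aL: "a n \<in> Lp_space 2 lborel" for n
 proof -
  have "(?N n) = (NN m|count_space UNIV. (NN y|lborel. ennreal ((cmod (a m y))\<^sup>2)) * indicator {n} m)"
   by (simp add: nn_integral_count_space_indicator[symmetric] nn_integral_count_space_finite)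
  also have "... <= (NN n|count_space UNIV. (?N n))"
   by (intro nn_integral_mono) (auto split: split_indicator)
  also have "... < \<infinity>" unfolding tot using fin by (auto simp: ennreal_mult_less_top)
  finally show ?thesis by (simp add: Lp_space_iff pint_def)
 qed
 have ft: "fourier1 f (n, \<xi>) = fourier_line (a n) (- \<xi>)" for n \<xi>
 proof -
  have int: "integrable (circle \<Otimes>\<^sub>M lborel) (%(x, y). f (x, y) * cnj (cchar (n, \<xi>) (x, y)))"
  proof (rule Bochner_Integration.integrable_bound)
   show "integrable (circle \<Otimes>\<^sub>M lborel) f" using fint by (simp add: TR_eq)
   have "(%z. f z * cnj (cchar (n, \<xi>) z)) \<in> bm TR" by measurable
   thus "(%(x, y). f (x, y) * cnj (cchar (n, \<xi>) (x, y))) \<in> bm (circle \<Otimes>\<^sub>M lborel)"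
    by (simp add: TR_eq case_prod_beta)
  qed (auto simp: norm_mult)
  have "fourier1 f (n, \<xi>) = (LINT y|lborel. LINT x|circle. f (x, y) * cnj (cchar (n, \<xi>) (x, y)))"
   using P.integral_snd[OF int] by (simp add: fourier1_def TR_eq split_beta')
  also have "... = (LINT y|lborel. LINT x|circle. cis (y * (- \<xi>)) * (f (x, y) * cis (- (of_int n * x))))"
   by (intro Bochner_Integration.integral_cong refl)
     (auto simp: cchar_def cis_cnj cis_mult[symmetric] mult_ac minus_add_distrib simp del: minus_add_distrib)
  also have "... = fourier_line (a n) (- \<xi>)"
   by (simp only: integral_mult_right_zero) (simp add: fourier_line_def a_def circle_coeff_def mult.commute)
  finally show ?thesis .
 qed
 have "pint 2 ZR (fourier1 f) = (NN n|count_space UNIV. (NN \<xi>|lborel. ennreal ((cmod (fourier_line (a n) (- \<xi>)))\<^sup>2)))"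
  by (simp add: pint_ZR ft)
 also have "... = (NN n|count_space UNIV. ennreal (2 * pi) * (?N n))"
  by (rule nn_integral_cong, subst nn_integral_reflect[of "%x. ennreal ((cmod (fourier_line (a n) x))\<^sup>2)" for n])
    (auto simp: plancherel_line[OF aL R a0])
 also have "... = ennreal (2 * pi) * (ennreal (2 * pi) * pint 2 TR f)"
  by (simp add: nn_integral_cmult tot)
 also have "... = ennreal ((2 * pi)\<^sup>2) * pint 2 TR f"
  by (subst ennreal_mult_merge) (auto simp: power2_eq_square)
 finally show ?thesis .
qed

lemma finite_int_band: "finite {n. \<bar>real_of_int n\<bar> <= N}"
proof (rule finite_subset)
 show "{n. \<bar>real_of_int n\<bar> <= N} \<subseteq> {- \<lceil>N\<rceil>..\<lceil>N\<rceil>}" by auto linarith+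
qed simp

lemma fst_ZR_measurable [measurable]: "(%k. real_of_int (fst k)) \<in> bm ZR"
proof -
 have "fst \<in> measurable (count_space UNIV \<Otimes>\<^sub>M (borel :: real measure)) (count_space (UNIV :: int set))" by measurable
 from measurable_compose[OF this, of real_of_int borel]
 have "(%k. real_of_int (fst k)) \<in> bm (count_space UNIV \<Otimes>\<^sub>M (borel :: real measure))" by simp
 thus ?thesis by (simp cong: measurable_cong_sets add: sets_ZR)
qed

lemma snd_ZR_measurable [measurable]: "snd \<in> bm ZR"
proof -
 have "snd \<in> bm (count_space (UNIV :: int set) \<Otimes>\<^sub>M (borel :: real measure))" by measurable
 thus ?thesis by (simp cong: measurable_cong_sets add: sets_ZR)
qed

lemma band_sets [measurable]: "band N \<in> sets ZR"
proof -
 have "{k \<in> space ZR. \<bar>real_of_int (fst k)\<bar> <= N \<and> \<bar>snd k\<bar> <= N} \<in> sets ZR" by measurable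
 thus ?thesis by (simp add: band_def)
qed

lemma band_finite: "emeasure ZR (band N) < \<infinity>"
proof -
 have "band N = {n. \<bar>real_of_int n\<bar> <= N} \<times> {-N..N}" by (auto simp: band_def)
 moreover have "emeasure ZR ({n. \<bar>real_of_int n\<bar> <= N} \<times> {-N..N})
   = emeasure (count_space UNIV) {n. \<bar>real_of_int n\<bar> <= N} * emeasure lborel {-N..N}"
  unfolding ZR_def by (rule lborel.emeasure_pair_measure_Times) auto
 ultimately show ?thesis
  using finite_int_band[of N] by (cases "N >= 0") (auto simp: ennreal_mult_less_top ennreal_of_nat_eq_real_of_nat)
qed

lemma band_integrable:
 assumes "G \<in> Lp_space p ZR" "p > 1" "\<And>k. k \<notin> band N ==> G k = 0"
 shows "integrable ZR G"
 by (rule Lp_finite_support_integrable[OF assms(1,2) band_sets band_finite]) (use assms(3) in auto)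

text \<open>For fixed \<open>y\<close> the synthesis is a trigonometric polynomial in
  \<open>x\<close> whose coefficients are line transforms of the slices of \<open>G\<close>.
  Orthogonality in \<open>x\<close> and \<open>plancherel_line\<close> in \<open>y\<close>
  contribute one factor \<open>2 * pi\<close> each.\<close>

theorem plancherel_synth:
 assumes G: "G \<in> Lp_space 2 ZR" and supp: "\<And>k. k \<notin> band N ==> G k = 0" and N: "N > 0"
 shows "pint 2 TR (synth G) = ennreal ((2 * pi)\<^sup>2) * pint 2 ZR G"
proof -
 interpret P: pair_sigma_finite circle "lborel :: real measure" by (rule pair_TR)
 have [measurable]: "G \<in> bm ZR" using G by (simp add: Lp_space_def)
 have Gi: "integrable ZR G" by (rule band_integrable[OF G _ supp]) auto
 define F where "F = {n. \<bar>real_of_int n\<bar> <= N}"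
 have F: "finite F" unfolding F_def by (rule finite_int_band)
 define b where "b = (%n. fourier_line (%\<xi>. G (n, \<xi>)))"
 have [measurable]: "b n \<in> bm borel" for n unfolding b_def by measurable
 have b0: "b n y = 0" if "n \<notin> F" for n y
  using that supp by (simp add: b_def fourier_line_def F_def band_def)
 have fin: "pint 2 ZR G < \<infinity>" using G by (simp add: Lp_space_iff)
 have GL: "(%\<xi>. G (n, \<xi>)) \<in> Lp_space 2 lborel" for n
 proof -
  have "(NN \<xi>|lborel. ennreal (cmod (G (n, \<xi>)) powr 2)) =
    (NN m|count_space UNIV. (NN \<xi>|lborel. ennreal (cmod (G (m, \<xi>)) powr 2)) * indicator {n} m)"
   by (simp add: nn_integral_count_space_indicator[symmetric] nn_integral_count_space_finite)
  also have "... <= (NN m|count_space UNIV. (NN \<xi>|lborel. ennreal (cmod (G (m, \<xi>)) powr 2)))"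
   by (rule nn_integral_mono) (auto split: split_indicator)
  also have "... = pint 2 ZR G" by (simp add: pint_ZR)
  finally show ?thesis using fin by (simp add: Lp_space_iff pint_def)
 qed
 have sy: "synth G (x, y) = trig_poly F (%n. b n y) x" if "x \<in> space circle" for x y
 proof -
  have int: "integrable (count_space UNIV \<Otimes>\<^sub>M lborel) (%(n, \<xi>). G (n, \<xi>) * cchar (n, \<xi>) (x, y))"
  proof (rule Bochner_Integration.integrable_bound)
   show "integrable (count_space UNIV \<Otimes>\<^sub>M lborel) G" using Gi by (simp add: ZR_def)
   have "(x, y) \<in> space TR" using that by (simp add: TR_eq space_pair_measure)
   hence "(%k. G k * cchar k (x, y)) \<in> bm ZR" by measurable
   thus "(%(n, \<xi>). G (n, \<xi>) * cchar (n, \<xi>) (x, y)) \<in> bm (count_space UNIV \<Otimes>\<^sub>M lborel)"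
    by (simp add: ZR_def case_prod_beta)
  qed (auto simp: norm_mult)
  have "synth G (x, y) = (LINT n|count_space UNIV. LINT \<xi>|lborel. G (n, \<xi>) * cchar (n, \<xi>) (x, y))"
   using Q.integral_fst[OF int] by (simp add: synth_def ZR_def split_beta')
  also have "... = (LINT n|count_space UNIV. LINT \<xi>|lborel. cis (of_int n * x) * (G (n, \<xi>) * cis (\<xi> * y)))"
   by (intro Bochner_Integration.integral_cong refl) (auto simp: cchar_def cis_mult[symmetric])
  also have "... = (LINT n|count_space UNIV. cis (of_int n * x) * b n y)"
   by (simp add: b_def fourier_line_def)
  also have "... = (\<Sum>n\<in>F. cis (of_int n * x) * b n y)"
  proof (subst lebesgue_integral_count_space_finite_support)
   show fin: "finite {n \<in> UNIV. cis (of_int n * x) * b n y \<noteq> 0}"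
    by (rule finite_subset[OF _ F]) (use b0 in auto)
   show "(\<Sum>n | n \<in> UNIV \<and> cis (of_int n * x) * b n y \<noteq> 0. cis (of_int n * x) * b n y)
    = (\<Sum>n\<in>F. cis (of_int n * x) * b n y)"
    using F b0 by (intro sum.mono_neutral_left) auto
  qed
  finally show ?thesis by (simp add: trig_poly_def mult.commute)
 qed
 have inner: "(NN x|circle. ennreal ((cmod (synth G (x, y)))\<^sup>2)) = (\<Sum>n\<in>F. ennreal (2 * pi) * ennreal ((cmod (b n y))\<^sup>2))" for y
 proof -
  have "(NN x|circle. ennreal ((cmod (synth G (x, y)))\<^sup>2))
   = (NN x|circle. ennreal ((cmod (trig_poly F (%n. b n y) x))\<^sup>2))"
   using sy by (intro nn_integral_cong) auto
  also have "... = ennreal (2 * pi * (\<Sum>n\<in>F. (cmod (b n y))\<^sup>2))"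
   using trig_poly_Lp[of F "%n. b n y"]
   by (subst nn_integral_eq_integral) (auto simp: Lp_space_def trig_poly_norm_square[OF F])
  finally show ?thesis
   by (simp add: sum_distrib_left ennreal_mult' flip: sum_ennreal)
 qed
 let ?N = "%n. NN \<xi>|lborel. ennreal ((cmod (G (n, \<xi>)))\<^sup>2)"
 have "pint 2 TR (synth G) = (NN y|lborel. (\<Sum>n\<in>F. ennreal (2 * pi) * ennreal ((cmod (b n y))\<^sup>2)))"
  by (simp add: pint_TR inner)
 also have "... = (\<Sum>n\<in>F. ennreal (2 * pi) * (NN y|lborel. ennreal ((cmod (b n y))\<^sup>2)))"
  by (simp add: nn_integral_sum nn_integral_cmult)
 also have "... = (\<Sum>n\<in>F. ennreal (2 * pi) * (ennreal (2 * pi) * (?N n)))"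
 proof (intro sum.cong refl)
  fix n
  have "G (n, \<xi>) = 0" if "\<bar>\<xi>\<bar> > N" for \<xi> using supp that by (simp add: band_def)
  from plancherel_line[OF GL N this]
  show "ennreal (2 * pi) * (NN y|lborel. ennreal ((cmod (b n y))\<^sup>2)) = ennreal (2 * pi) * (ennreal (2 * pi) * (?N n))"
   by (simp add: b_def)
 qed
 also have "... = ennreal ((2 * pi)\<^sup>2) * (\<Sum>n\<in>F. (?N n))"
  by (subst ennreal_mult_merge) (auto simp: power2_eq_square sum_distrib_left)
 also have "(\<Sum>n\<in>F. (?N n)) = pint 2 ZR G"
 proof -
  have "G (n, \<xi>) = 0" if "n \<notin> F" for n \<xi> using that supp by (simp add: F_def band_def)
  hence "pint 2 ZR G = (NN n|count_space UNIV. (?N n) * indicator F n)"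
   by (auto simp: pint_ZR intro!: nn_integral_cong split: split_indicator)
  also have "... = (\<Sum>n\<in>F. (?N n))"
   using F by (simp add: nn_integral_count_space_indicator[symmetric] nn_integral_count_space_finite)
  finally show ?thesis by simp
 qed
 finally show ?thesis .
qed

subsection \<open>Convolution and the Hausdorff--Young inequality\<close>

text \<open>Invariance of Haar measure on the dual group. Translation invariance is then obtained by
  composing two reflections.\<close>

lemma distr_ZR_reflect: "distr ZR ZR (%k. c - k) = ZR"
proof (rule measure_eqI)
 have m [measurable]: "(%k. c - k) \<in> measurable ZR ZR"
 proof -
  have "(%k. (fst c - fst k, snd c - snd k)) \<in> measurable (count_space UNIV \<Otimes>\<^sub>M borel) (count_space (UNIV :: int set) \<Otimes>\<^sub>M (borel :: real measure))"
   by (intro measurable_Pair measurable_compose[OF measurable_fst]) measurable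
  thus ?thesis by (simp cong: measurable_cong_sets add: sets_ZR minus_prod_def)
 qed
 show "sets (distr ZR ZR (%k. c - k)) = sets ZR" by simp
 fix A assume "A \<in> sets (distr ZR ZR (%k. c - k))"
 hence A: "A \<in> sets ZR" by simp
 have Am: "(%k. indicator A k :: ennreal) \<in> bm (count_space UNIV \<Otimes>\<^sub>M lborel)"
  using A by (simp add: ZR_def)
 have Am': "(%k. indicator A (c - k) :: ennreal) \<in> bm (count_space UNIV \<Otimes>\<^sub>M lborel)"
  using measurable_compose[OF m borel_measurable_indicator[OF A]] by (simp add: ZR_def)
 have sec [measurable]: "(%\<xi>. indicator A (n, \<xi>) :: ennreal) \<in> bm borel" for n
  using measurable_Pair2[OF Am, of n] by simp
 have "emeasure (distr ZR ZR (%k. c - k)) A = (NN k|ZR. indicator A (c - k))"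
 proof -
  have "emeasure (distr ZR ZR (%k. c - k)) A = (NN k|(distr ZR ZR (%k. c - k)). indicator A k)"
   using A by simp
  also have "... = (NN k|ZR. indicator A (c - k))"
   by (rule nn_integral_distr[OF m]) (use A in auto)
  finally show ?thesis .
 qed
 also have "... = (NN n|count_space UNIV. (NN \<xi>|lborel. indicator A (fst c - n, snd c - \<xi>)))"
  unfolding ZR_def by (subst lborel.nn_integral_fst[symmetric, OF Am']) (simp add: minus_prod_def)
 also have "... = (NN n|count_space UNIV. (NN \<xi>|lborel. indicator A (fst c - n, \<xi>)))"
 proof (rule nn_integral_cong)
  fix n
  show "(NN \<xi>|lborel. indicator A (fst c - n, snd c - \<xi>)) = (NN \<xi>|lborel. indicator A (fst c - n, \<xi>))"
   by (subst (2) nn_integral_real_affine[where c = "-1" and t = "snd c"]) auto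
 qed
 also have "... = (NN n|count_space UNIV. (NN \<xi>|lborel. indicator A (n, \<xi>)))"
  by (rule nn_integral_bij_count_space[where g = "%n. fst c - n" and f = "%n. (NN \<xi>|lborel. indicator A (n, \<xi>))"])
    (auto simp: bij_betw_def inj_on_def surj_def intro: exI[of _ "fst c - _"])
 also have "... = emeasure ZR A"
  using A unfolding ZR_def by (subst lborel.nn_integral_fst[OF Am]) simp
 finally show "emeasure (distr ZR ZR (%k. c - k)) A = emeasure ZR A" .
qed

lemma ZR_reflect_measurable [measurable]: "(%k. c - k) \<in> measurable ZR ZR"
proof -
 have "(%k. (fst c - fst k, snd c - snd k)) \<in> measurable (count_space UNIV \<Otimes>\<^sub>M borel) (count_space (UNIV :: int set) \<Otimes>\<^sub>M (borel :: real measure))"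
  by (intro measurable_Pair measurable_compose[OF measurable_fst]) measurable
 thus ?thesis by (simp cong: measurable_cong_sets add: sets_ZR minus_prod_def)
qed

lemma ZR_shift_measurable [measurable]: "(%k. k - c) \<in> measurable ZR ZR"
 using measurable_compose[OF ZR_reflect_measurable[of c] ZR_reflect_measurable[of 0]] by simp

lemma distr_ZR_shift: "distr ZR ZR (%k. k - c) = ZR"
proof -
 have "distr ZR ZR (%k. k - c) = distr (distr ZR ZR (%k. c - k)) ZR (%k. 0 - k)"
  by (subst distr_distr) (auto simp: comp_def)
 thus ?thesis by (simp only: distr_ZR_reflect)
qed

lemma ZR_diff_measurable [measurable]:
 assumes [measurable]: "f \<in> measurable M ZR" "g \<in> measurable M ZR"
 shows "(%x. f x - g x) \<in> measurable M ZR"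
proof -
 have fg: "f \<in> measurable M (count_space UNIV \<Otimes>\<^sub>M borel)" "g \<in> measurable M (count_space UNIV \<Otimes>\<^sub>M borel)"
  using assms by (simp_all cong: measurable_cong_sets add: sets_ZR)
 note [measurable] = fg
 have i: "(%x. fst (f x) - fst (g x)) \<in> measurable M (count_space UNIV)"
 proof -
  have "(%x. (fst (f x), fst (g x))) \<in> measurable M (count_space UNIV \<Otimes>\<^sub>M count_space UNIV)" by measurable
  hence "(%x. (fst (f x), fst (g x))) \<in> measurable M (count_space (UNIV \<times> UNIV))"
   by (subst (asm) pair_measure_countable) auto
  from measurable_compose[OF this, of "%(a, b). a - b"] show ?thesis by simp
 qed
 hence "(%x. (fst (f x) - fst (g x), snd (f x) - snd (g x))) \<in> measurable M (count_space UNIV \<Otimes>\<^sub>M borel)"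
  by (intro measurable_Pair) measurable
 thus ?thesis by (simp cong: measurable_cong_sets add: sets_ZR minus_prod_def)
qed

definition conv :: "(int \<times> real => complex) => (int \<times> real => complex) => int \<times> real => complex" where
 "conv G H k = (LINT l|ZR. G l * H (k - l))"

lemma conv_measurable [measurable]:
 assumes [measurable]: "G \<in> bm ZR" "H \<in> bm ZR"
 shows "conv G H \<in> bm ZR"
proof -
 interpret sigma_finite_measure ZR by (rule sigma_finite_ZR)
 have "(%k. LINT l|ZR. G l * H (k - l)) \<in> bm ZR" by measurable
 thus ?thesis by (simp add: conv_def[abs_def])
qed

text \<open>Characters are multiplicative in the frequency, so shifting \<open>k\<close> by
  \<open>l\<close> separates the double integral; translation invariance also supplies its absolute
  convergence.\<close>

lemma synth_mult:
 assumes G: "integrable ZR G" and H: "integrable ZR H" and z: "z \<in> space TR"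
 shows "synth G z * synth H z = synth (conv G H) z"
proof -
 interpret pair_sigma_finite ZR ZR
  by (intro pair_sigma_finite.intro sigma_finite_ZR)
 have [measurable]: "G \<in> bm ZR" "H \<in> bm ZR" using G H by auto
 note z [measurable]
 have sh: "(NN k|ZR. ennreal (cmod (H (k - l)))) = (NN k|ZR. ennreal (cmod (H k)))" for l
  by (subst (2) distr_ZR_shift[symmetric, of l]) (simp add: nn_integral_distr)
 have int: "integrable (ZR \<Otimes>\<^sub>M ZR) (%(l, k). G l * H (k - l) * cchar k z)"
  unfolding integrable_iff_bounded
 proof (intro conjI)
  have "(NN p|(ZR \<Otimes>\<^sub>M ZR). ennreal (norm ((%(l, k). G l * H (k - l) * cchar k z) p)))
    = (NN l|ZR. (NN k|ZR. ennreal (cmod (G l)) * ennreal (cmod (H (k - l)))))"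
   by (subst ZR.nn_integral_fst[symmetric]) (auto simp: norm_mult ennreal_mult)
  also have "... = (NN l|ZR. ennreal (cmod (G l))) * (NN k|ZR. ennreal (cmod (H k)))"
   by (simp add: nn_integral_cmult nn_integral_multc sh)
  also have "... < \<infinity>" using G H by (auto simp: integrable_iff_bounded ennreal_mult_less_top)
  finally show "(NN p|(ZR \<Otimes>\<^sub>M ZR). ennreal (norm ((%(l, k). G l * H (k - l) * cchar k z) p))) < \<infinity>" .
 qed measurable
 have "synth (conv G H) z = (LINT k|ZR. LINT l|ZR. G l * H (k - l) * cchar k z)"
  by (simp add: synth_def conv_def)
 also have "... = (LINT l|ZR. LINT k|ZR. G l * H (k - l) * cchar k z)"
  by (rule Fubini_integral[OF int])
 also have "... = (LINT l|ZR. G l * cchar l z * synth H z)"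
 proof (intro Bochner_Integration.integral_cong refl)
  fix l
  have "cchar k z = cchar l z * cchar (k - l) z" for k
   by (simp flip: cchar_add)
  hence "(LINT k|ZR. G l * H (k - l) * cchar k z) = (LINT k|ZR. G l * cchar l z * (H (k - l) * cchar (k - l) z))"
   by (intro Bochner_Integration.integral_cong refl) (metis (no_types, lifting) mult.assoc mult.left_commute)
  also have "... = G l * cchar l z * (LINT k|distr ZR ZR (%k. k - l). H k * cchar k z)"
   by (simp add: integral_distr)
  finally show "(LINT k|ZR. G l * H (k - l) * cchar k z) = G l * cchar l z * synth H z"
   by (simp add: distr_ZR_shift synth_def)
 qed
 finally show ?thesis by (simp add: synth_def)
qed

text \<open>The square of \<open>synth G\<close> is the synthesis of \<open>conv G G\<close>,
  supported in the band of twice the width, so the fourth power is handled by Plancherel. If the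
  convolution is not square integrable the right side is infinite.\<close>

theorem synth_quartic:
 assumes G: "integrable ZR G" and supp: "\<And>k. k \<notin> band N ==> G k = 0" and N: "N > 0"
 shows "pint 4 TR (synth G) <= ennreal ((2 * pi)\<^sup>2) * pint 2 ZR (conv G G)"
proof (cases "pint 2 ZR (conv G G) = \<infinity>")
 case True
 thus ?thesis by (simp add: ennreal_mult_top)
next
 case False
 have [measurable]: "G \<in> bm ZR" using G by auto
 have L: "conv G G \<in> Lp_space 2 ZR" using False by (auto simp: Lp_space_iff less_top)
 have s: "conv G G k = 0" if "k \<notin> band (2 * N)" for k
 proof -
  have "G l * G (k - l) = 0" for l
  proof (rule ccontr)
   assume "G l * G (k - l) \<noteq> 0"
   hence "G l \<noteq> 0" "G (k - l) \<noteq> 0" by auto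
   hence "l \<in> band N" "k - l \<in> band N" using supp by blast+
   thus False using that by (auto simp: band_def)
  qed
  hence "conv G G k = (LINT l|ZR. 0)"
   unfolding conv_def by (intro Bochner_Integration.integral_cong refl)
  thus ?thesis by simp
 qed
 have "pint 4 TR (synth G) = pint 2 TR (synth (conv G G))"
  unfolding pint_def
 proof (intro nn_integral_cong)
  fix z assume "z \<in> space TR"
  have "(cmod (synth G z))^4 = (cmod (synth G z * synth G z))\<^sup>2"
   by (simp add: norm_mult power_mult_distrib flip: power_add)
  thus "ennreal (cmod (synth G z) powr 4) = ennreal (cmod (synth (conv G G) z) powr 2)"
   by (simp add: synth_mult[OF G G \<open>z \<in> space TR\<close>])
 qed
 also have "... = ennreal ((2 * pi)\<^sup>2) * pint 2 ZR (conv G G)"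
 proof -
  have "2 * N > 0" using N by simp
  from plancherel_synth[OF L s this] show ?thesis .
 qed
 finally show ?thesis by simp
qed

text \<open>Cauchy--Schwarz for \<open>\<bar>G(l) G(k - l)\<bar> = (a b)\<^bsup>1/2\<^esup> (a b)\<^bsup>1/4\<^esup>\<close>, with \<open>a, b\<close> the values of
 \<open>\<bar>G\<bar>\<^bsup>4/3\<^esup>\<close>, and \<open>(a b)\<^bsup>1/2\<^esup> \<le> (a + b) / 2\<close> in the second factor.\<close>

lemma young_conv:
 assumes [measurable]: "G \<in> bm ZR"
 shows "pint 2 ZR (conv G G) <= pint (4/3) ZR G ^ 3"
proof -
 interpret pair_sigma_finite ZR ZR
  by (intro pair_sigma_finite.intro sigma_finite_ZR)
 define X where "X = pint (4/3) ZR G"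
 define a where "a = (%k. cmod (G k) powr (4/3))"
 have [measurable]: "a \<in> bm ZR" unfolding a_def by measurable
 have a0: "a k >= 0" for k by (simp add: a_def)
 have Xa: "(NN k|ZR. ennreal (a k)) = X" by (simp add: X_def pint_def a_def)
 have refl: "(NN l|ZR. ennreal (a (k - l))) = X" for k
  unfolding Xa[symmetric] by (subst (2) distr_ZR_reflect[symmetric, of k]) (simp add: nn_integral_distr)
 have shift: "(NN k|ZR. ennreal (a (k - l))) = X" for l
  unfolding Xa[symmetric] by (subst (2) distr_ZR_shift[symmetric, of l]) (simp add: nn_integral_distr)
 let ?C = "%k. NN l|ZR. ennreal (a l) * ennreal (a (k - l))"
 have pt: "ennreal ((cmod (conv G G k))\<^sup>2) <= (?C k) * X" for k
 proof -
  let ?f = "%l. ennreal (sqrt (a l * a (k - l)))" and ?g = "%l. ennreal ((a l * a (k - l)) powr (1/4))"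
  have m: "?f \<in> bm ZR" "?g \<in> bm ZR" by measurable
  have "ennreal (cmod (conv G G k)) <= (NN l|ZR. ennreal (cmod (G l * G (k - l))))"
   unfolding conv_def
   by (cases "integrable ZR (%l. G l * G (k - l))")
     (auto intro!: integral_norm_bound_ennreal simp: not_integrable_integral_eq)
  also have "... = (NN l|ZR. ?f l * ?g l)"
  proof (intro nn_integral_cong)
   fix l
   have "cmod (G l * G (k - l)) = (cmod (G l * G (k - l)) powr (4/3)) powr (1/2) * (cmod (G l * G (k - l)) powr (4/3)) powr (1/4)"
    by (simp add: powr_powr flip: powr_add)
   also have "cmod (G l * G (k - l)) powr (4/3) = a l * a (k - l)"
    by (simp add: a_def norm_mult powr_mult)
   finally show "ennreal (cmod (G l * G (k - l))) = ?f l * ?g l"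
    using a0 by (simp add: powr_half_sqrt flip: ennreal_mult)
  qed
  finally have "(ennreal (cmod (conv G G k)))\<^sup>2 <= (NN l|ZR. ?f l * ?g l)\<^sup>2"
   by (intro power_mono) auto
  also have "... <= (NN l|ZR. (?f l)\<^sup>2) * (NN l|ZR. (?g l)\<^sup>2)"
   by (rule Cauchy_Schwarz_nn_integral[OF m])
  also have "(NN l|ZR. (?f l)\<^sup>2) = (?C k)"
   using a0 by (intro nn_integral_cong) (simp add: ennreal_power flip: ennreal_mult)
  also have "(NN l|ZR. (?g l)\<^sup>2) <= (NN l|ZR. ennreal (1/2) * (ennreal (a l) + ennreal (a (k - l))))"
  proof (intro nn_integral_mono)
   fix l
   have "((a l * a (k - l)) powr (1/4))\<^sup>2 = sqrt (a l * a (k - l))"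
    using a0 by (simp add: power2_eq_square powr_half_sqrt flip: powr_add)
   also have "... <= 1/2 * (a l + a (k - l))"
    using arith_geo_mean_sqrt[OF a0 a0] by simp
   finally have "ennreal (((a l * a (k - l)) powr (1/4))\<^sup>2) <= ennreal (1/2 * (a l + a (k - l)))"
    by (rule ennreal_leI)
   also have "... = ennreal (1/2) * (ennreal (a l) + ennreal (a (k - l)))"
    using a0[of l] a0[of "k - l"] by (simp only: ennreal_mult'' ennreal_plus add_nonneg_nonneg)
   finally show "(?g l)\<^sup>2 <= ennreal (1/2) * (ennreal (a l) + ennreal (a (k - l)))"
    by (simp only: ennreal_power powr_ge_zero)
  qed
  also have "... = ennreal (1/2) * (X + X)"
   by (simp add: nn_integral_cmult nn_integral_add Xa refl)
  also have "... = X"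
  proof -
   have "X + X = ennreal 2 * X" by (metis ennreal_numeral mult_2)
   thus ?thesis by (simp only: ennreal_mult_merge[of "1/2" 2]) simp
  qed
  finally show ?thesis by (simp add: ennreal_power mult_left_mono)
 qed
 have "pint 2 ZR (conv G G) <= (NN k|ZR. (?C k) * X)"
  unfolding pint_def using pt by (intro nn_integral_mono) simp
 also have "... = (NN k|ZR. (?C k)) * X"
  by (rule nn_integral_multc) measurable
 also have "(NN k|ZR. (?C k))
   = (NN l|ZR. (NN k|ZR. ennreal (a l) * ennreal (a (k - l))))"
  by (rule Fubini') measurable
 also have "... = X * X"
  by (simp add: nn_integral_cmult nn_integral_multc shift Xa)
 finally show ?thesis by (simp add: X_def power3_eq_cube)
qed

lemma Lp_norm_le_of_pint:
 assumes "f \<in> bm M" "g \<in> Lp_space q N" "p > 0" "q > 0" "C >= 0"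
  and "pint p M f <= ennreal ((C * Lp_norm q N g) powr p)"
 shows "f \<in> Lp_space p M" "Lp_norm p M f <= C * Lp_norm q N g"
 using Lp_normI[OF assms(1,3) _ assms(6)] assms by auto

text \<open>The dual exponent 4 is even, so \<open>synth_quartic\<close> and Young's convolution
  inequality suffice. The cube of the integral of the power \<open>4/3\<close> is the fourth power
  of the norm, which explains the exponents.\<close>

theorem hausdorff_young_synth:
 assumes G: "G \<in> Lp_space (4/3) ZR" and supp: "\<And>k. k \<notin> band N ==> G k = 0" and N: "N > 0"
 shows "synth G \<in> Lp_space 4 TR" "Lp_norm 4 TR (synth G) <= sqrt (2 * pi) * Lp_norm (4/3) ZR G"
proof -
 have [measurable]: "G \<in> bm ZR" using G by (simp add: Lp_space_def)
 have Gi: "integrable ZR G" by (rule band_integrable[OF G _ supp]) auto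
 define A where "A = Lp_norm (4/3) ZR G"
 have "pint 4 TR (synth G) <= ennreal ((2 * pi)\<^sup>2) * pint (4/3) ZR G ^ 3"
  by (rule order_trans[OF synth_quartic[OF Gi supp N] mult_left_mono[OF young_conv]]) auto
 also have "... = ennreal ((2 * pi)\<^sup>2 * (A powr (4/3)) ^ 3)"
  using pint_eq[OF G] by (simp add: A_def ennreal_power ennreal_mult)
 also have "(2 * pi)\<^sup>2 * (A powr (4/3)) ^ 3 = (sqrt (2 * pi) * A) powr 4"
 proof -
  have "(A powr (4/3)) ^ 3 = A ^ 4"
  proof (cases "A = 0")
   case False
   hence "A > 0" by (simp add: A_def order_less_le)
   thus ?thesis by (simp add: powr_power)
  qed simp
  moreover have "(sqrt (2 * pi)) ^ 4 = (2 * pi)\<^sup>2"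
   by (simp add: power4_eq_xxxx power2_eq_square)
  ultimately show ?thesis by (simp add: A_def power_mult_distrib)
 qed
 finally have *: "pint 4 TR (synth G) <= ennreal ((sqrt (2 * pi) * Lp_norm (4/3) ZR G) powr 4)"
  by (simp add: A_def)
 show "synth G \<in> Lp_space 4 TR" "Lp_norm 4 TR (synth G) <= sqrt (2 * pi) * Lp_norm (4/3) ZR G"
  using Lp_norm_le_of_pint[OF _ G _ _ _ *] by auto
qed

lemma pint_band_limit:
 assumes [measurable]: "F \<in> bm ZR" and p: "p > 0"
  and B: "\<And>n::nat. n > 0 ==> pint p ZR (%k. indicator (band (real n)) k * F k) <= B"
 shows "pint p ZR F <= B"
proof (rule pint_fatou[where f = "%n k. indicator (band (real n)) k * F k"])
 show "AE k in ZR. (%n. indicator (band (real n)) k * F k) \<longlonglongrightarrow> F k"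
 proof (intro AE_I2 tendsto_eventually)
  fix k
  show "\<forall>\<^sub>F n in sequentially. indicator (band (real n)) k * F k = F k"
   by (intro eventually_mono[OF eventually_ge_at_top[of "nat \<lceil>max \<bar>real_of_int (fst k)\<bar> \<bar>snd k\<bar>\<rceil>"]])
     (auto simp: band_def indicator_def)
 qed
 show "\<forall>\<^sub>F n in sequentially. pint p ZR (%k. indicator (band (real n)) k * F k) <= B"
  using B by (intro eventually_mono[OF eventually_gt_at_top[of 0]])
qed (use p in auto)

lemma Lp_band_bounded:
 assumes [measurable]: "F \<in> bm ZR" and "\<And>k. cmod (F k) <= B" and supp: "\<And>k. k \<notin> band N ==> F k = 0"
  and p: "p > 0"
 shows "F \<in> Lp_space p ZR"
proof -
 have B: "B >= 0" using assms(2)[of undefined] norm_ge_zero[of "F undefined"] by linarith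
 have "pint p ZR F <= (NN k|ZR. ennreal (B powr p) * indicator (band N) k)"
  unfolding pint_def using assms(2) supp p
  by (intro nn_integral_mono) (auto intro!: ennreal_leI powr_mono2 split: split_indicator)
 also have "... = ennreal (B powr p) * emeasure ZR (band N)"
  by (simp add: nn_integral_cmult_indicator)
 also have "... < \<infinity>" using band_finite by (simp add: ennreal_mult_less_top)
 finally show ?thesis by (simp add: Lp_space_iff)
qed

text \<open>Duality: \<open>fourier1 f\<close> is tested against \<open>\<bar>F\<bar>\<^sup>2 F\<close>, with \<open>F\<close> its restriction to a band.\<close>

theorem hausdorff_young:
 assumes f: "f \<in> Lp_space (4/3) TR" and supp: "\<And>z. \<bar>snd z\<bar> > R ==> f z = 0"
 shows "fourier1 f \<in> Lp_space 4 ZR" "Lp_norm 4 ZR (fourier1 f) <= sqrt (2 * pi) * Lp_norm (4/3) TR f"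
proof -
 have [measurable]: "f \<in> bm TR" using f by (simp add: Lp_space_def)
 have fint: "integrable TR f"
  by (rule Lp_finite_support_integrable[OF f _ _ strip_finite[of R]]) (use supp in \<open>auto simp: not_le\<close>)
 define B where "B = (LINT z|TR. cmod (f z))"
 have bd: "cmod (fourier1 f k) <= B" for k
 proof -
  have "cmod (fourier1 f k) <= (LINT z|TR. cmod (f z * cnj (cchar k z)))"
   unfolding fourier1_def by (rule integral_norm_bound)
  thus ?thesis by (simp add: B_def norm_mult)
 qed
 define c where "c = sqrt (2 * pi) * Lp_norm (4/3) TR f"
 have c: "c >= 0" by (simp add: c_def)
 have "pint 4 ZR (fourier1 f) <= ennreal (c powr 4)"
 proof (rule pint_band_limit)
  fix n :: nat assume n: "n > 0"
  define F where "F = (%k. indicator (band (real n)) k * fourier1 f k)"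
  have [measurable]: "F \<in> bm ZR" unfolding F_def by measurable
  have F0: "F k = 0" if "k \<notin> band (real n)" for k using that by (simp add: F_def)
  have Fb: "cmod (F k) <= B" for k
   using bd[of k] order_trans[OF norm_ge_zero bd[of k]] by (auto simp: F_def norm_mult split: split_indicator)
  define G where "G = (%k. complex_of_real ((cmod (F k))\<^sup>2) * F k)"
  have [measurable]: "G \<in> bm ZR" unfolding G_def by measurable
  have G0: "G k = 0" if "k \<notin> band (real n)" for k using F0[OF that] by (simp add: G_def)
  have Gn: "cmod (G k) = cmod (F k) ^ 3" for k
   by (simp add: G_def norm_mult norm_power power3_eq_cube power2_eq_square)
  have Gb: "cmod (G k) <= B ^ 3" for k
   unfolding Gn by (intro power_mono Fb) auto
  have GL: "G \<in> Lp_space (4/3) ZR" by (rule Lp_band_bounded[OF _ Gb G0]) auto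
  have FL: "F \<in> Lp_space 4 ZR" by (rule Lp_band_bounded[OF _ Fb F0]) auto
  have Gi: "integrable ZR G" by (rule band_integrable[OF GL _ G0]) auto
  define X where "X = Lp_norm 4 ZR F"
  have Gnorm: "Lp_norm (4/3) ZR G = X ^ 3"
  proof -
   have "(cmod (F k) ^ 3) powr (4/3) = cmod (F k) powr 4" for k
   proof -
    have "cmod (F k) ^ 3 = cmod (F k) powr 3" by simp
    thus ?thesis by (simp only: powr_powr) simp
   qed
   hence "Lp_norm (4/3) ZR G = (LINT k|ZR. cmod (F k) powr 4) powr (3/4)"
    by (simp add: Lp_norm_def Gn)
   also have "... = ((LINT k|ZR. cmod (F k) powr 4) powr (1/4)) powr 3"
    by (simp add: powr_powr)
   finally show ?thesis by (simp add: X_def Lp_norm_def)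
  qed
  have X4: "complex_of_real (X ^ 4) = (LINT k|ZR. fourier1 f k * cnj (G k))"
  proof -
   have "X ^ 4 = (LINT k|ZR. (cmod (F k)) ^ 4)"
    using powr_powr[of "LINT k|ZR. cmod (F k) powr 4" "1/4" 4] by (simp add: X_def Lp_norm_def)
   hence "complex_of_real (X ^ 4) = (LINT k|ZR. complex_of_real ((cmod (F k)) ^ 4))"
    by (simp only: integral_complex_of_real)
   also have "... = (LINT k|ZR. fourier1 f k * cnj (G k))"
   proof (intro Bochner_Integration.integral_cong refl)
    fix k
    have "complex_of_real ((cmod (F k)) ^ 4) = complex_of_real ((cmod (F k))\<^sup>2) * complex_of_real ((cmod (F k))\<^sup>2)"
     by (simp flip: power_add)
    also have "... = complex_of_real ((cmod (F k))\<^sup>2) * (F k * cnj (F k))"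
     by (simp only: complex_norm_square)
    also have "... = fourier1 f k * cnj (G k)"
     by (cases "k \<in> band (real n)") (auto simp: G_def F_def)
    finally show "complex_of_real ((cmod (F k)) ^ 4) = fourier1 f k * cnj (G k)" .
   qed
   finally show ?thesis .
  qed
  have hs: "synth G \<in> Lp_space 4 TR" "Lp_norm 4 TR (synth G) <= sqrt (2 * pi) * X ^ 3"
   using hausdorff_young_synth[OF GL G0] n by (auto simp: Gnorm)
  have hs': "(%z. cnj (synth G z)) \<in> Lp_space 4 TR" "Lp_norm 4 TR (%z. cnj (synth G z)) = Lp_norm 4 TR (synth G)"
   using hs(1) by (auto simp: Lp_space_def Lp_norm_def)
  have "X ^ 4 = cmod (LINT k|ZR. fourier1 f k * cnj (G k))"
   unfolding X4[symmetric] norm_of_real by (simp add: X_def)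
  also have "... = cmod (LINT z|TR. f z * cnj (synth G z))"
   by (simp add: pairing_integrable[OF fint Gi])
  also have "... <= Lp_norm (4/3) TR f * Lp_norm 4 TR (%z. cnj (synth G z))"
   by (rule holder(3)[OF f hs'(1)]) auto
  also have "... <= Lp_norm (4/3) TR f * (sqrt (2 * pi) * X ^ 3)"
   using hs hs' by (intro mult_left_mono) auto
  \<comment> \<open>Cancelling \<open>X ^ 3\<close> is legitimate because \<open>F\<close> is
    bounded and band limited, so that \<open>X\<close> is a genuine finite norm.\<close>
  finally have "X ^ 3 * X <= X ^ 3 * c"
   by (simp add: c_def power4_eq_xxxx power3_eq_cube mult_ac)
  moreover have "X >= 0" by (simp add: X_def)
  ultimately have "X <= c" using c by (cases "X = 0") auto
  thus "pint 4 ZR (%k. indicator (band (real n)) k * fourier1 f k) <= ennreal (c powr 4)"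
   using pint_eq[OF FL] \<open>X >= 0\<close> unfolding F_def[symmetric] X_def[symmetric]
   by (auto intro!: ennreal_leI power_mono)
 qed auto
 from Lp_normI[OF _ _ c this] show "fourier1 f \<in> Lp_space 4 ZR"
  "Lp_norm 4 ZR (fourier1 f) <= sqrt (2 * pi) * Lp_norm (4/3) TR f"
  by (auto simp: c_def)
qed

subsection \<open>The Fourier transform on \<open>L\<^sup>2\<close> and \<open>L\<^sup>4\<^sup>/\<^sup>3\<close>\<close>

definition cutoff :: "real => (real \<times> real => complex) => real \<times> real => complex" where
 "cutoff R f z = indicator {-R..R} (snd z) * f z"

lemma truncated_fourier_eq: "truncated_fourier R f = fourier1 (cutoff R f)"
 by (rule ext) (simp add: truncated_fourier_def fourier1_def cutoff_def cchar_def cis_cnj split_beta')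

lemma cutoff_measurable [measurable]:
 assumes [measurable]: "f \<in> bm TR"
 shows "cutoff R f \<in> bm TR"
 unfolding cutoff_def[abs_def] by measurable

lemma cutoff_supp: "\<bar>snd z\<bar> > R ==> cutoff R f z = 0"
 by (auto simp: cutoff_def split: split_indicator)

lemma cutoff_le: "cmod (cutoff R f z) <= cmod (f z)"
 by (auto simp: cutoff_def norm_mult split: split_indicator)

lemma cutoff_Lp:
 assumes "f \<in> Lp_space p TR" "p > 0"
 shows "cutoff R f \<in> Lp_space p TR"
proof -
 have [measurable]: "f \<in> bm TR" using assms by (simp add: Lp_space_def)
 show ?thesis by (rule Lp_mono(1)[OF _ assms(2,1)]) (auto simp: cutoff_le)
qed

lemma cutoff_integrable:
 assumes f: "f \<in> Lp_space p TR" and p: "p > 1"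
 shows "integrable TR (cutoff R f)"
 by (rule Lp_finite_support_integrable[OF cutoff_Lp[OF f] p _ strip_finite[of R]])
   (use p cutoff_supp in \<open>auto simp: not_le\<close>)

lemma cutoff_diff: "cutoff R (%z. f z - g z) z = cutoff R f z - cutoff R g z"
 by (simp add: cutoff_def algebra_simps)

lemma cutoff_cmult: "cutoff R (%z. c * f z) z = c * cutoff R f z"
 by (simp add: cutoff_def)

lemma cutoff_tendsto:
 assumes f: "f \<in> Lp_space p TR" and p: "p >= 1"
 shows "((%R. Lp_norm p TR (%z. f z - cutoff R f z)) \<longlongrightarrow> 0) at_top"
proof (rule tendsto_at_topI_sequentially)
 fix X :: "nat => real" assume X: "filterlim X at_top sequentially"
 have [measurable]: "f \<in> bm TR" using f by (simp add: Lp_space_def)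
 show "(%n. Lp_norm p TR (%z. f z - cutoff (X n) f z)) \<longlonglongrightarrow> 0"
 proof (rule Lp_dominated[OF _ _ f p])
  show "AE z in TR. cmod (f z - cutoff (X n) f z) <= cmod (f z)" for n
   by (auto simp: cutoff_def split: split_indicator)
  show "AE z in TR. (%n. cutoff (X n) f z) \<longlonglongrightarrow> f z"
  proof (intro AE_I2 tendsto_eventually)
   fix z :: "real \<times> real"
   have "\<forall>\<^sub>F n in sequentially. \<bar>snd z\<bar> <= X n"
    using X by (simp add: filterlim_at_top)
   thus "\<forall>\<^sub>F n in sequentially. cutoff (X n) f z = f z"
    by eventually_elim (auto simp: cutoff_def split: split_indicator)
  qed
 qed auto
qed

lemma fourier1_diff:
 assumes f: "integrable TR f" and g: "integrable TR g"
 shows "fourier1 (%z. f z - g z) k = fourier1 f k - fourier1 g k"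
proof -
 have [measurable]: "f \<in> bm TR" "g \<in> bm TR" using f g by auto
 have k: "k \<in> space ZR" by simp
 note k [measurable]
 have "integrable TR (%z. f z * cnj (cchar k z))" "integrable TR (%z. g z * cnj (cchar k z))"
  by (rule Bochner_Integration.integrable_bound[OF f], auto simp: norm_mult)
    (rule Bochner_Integration.integrable_bound[OF g], auto simp: norm_mult)
 thus ?thesis by (simp add: fourier1_def left_diff_distrib)
qed

lemma truncated_diff:
 assumes "f \<in> Lp_space p TR" "g \<in> Lp_space p TR" "p > 1"
 shows "truncated_fourier R (%z. f z - g z) k = truncated_fourier R f k - truncated_fourier R g k"
 using fourier1_diff[OF cutoff_integrable[OF assms(1,3)] cutoff_integrable[OF assms(2,3)], of R R k]
 by (simp add: truncated_fourier_eq cutoff_diff[abs_def])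

lemma truncated_cmult: "truncated_fourier R (%z. c * f z) k = c * truncated_fourier R f k"
 by (simp add: truncated_fourier_eq cutoff_cmult[abs_def] fourier1_def mult.assoc)

text \<open>The two exponents in use: 2 for data and solutions at a fixed time, \<open>4/3\<close>
  for the cubic term. Their conjugates are 2 and 4.\<close>

definition fexp :: "real => bool" where
 "fexp p \<longleftrightarrow> p = 2 \<or> p = 4/3"

lemma fexp_simps [simp]: "fexp 2" "fexp (4/3)"
 by (auto simp: fexp_def)

lemma fexpD:
 assumes "fexp p"
 shows "p > 1" "p / (p - 1) > 1" "1 / p + 1 / (p / (p - 1)) = 1"
 using assms unfolding fexp_def by (elim disjE; hypsubst; simp)+

lemma fourier1_bound:
 assumes p: "fexp p" and f: "f \<in> Lp_space p TR" and supp: "\<And>z. \<bar>snd z\<bar> > R ==> f z = 0"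
 shows "fourier1 f \<in> Lp_space (p / (p - 1)) ZR"
  "Lp_norm (p / (p - 1)) ZR (fourier1 f) <= 2 * pi * Lp_norm p TR f"
  "p = 2 ==> Lp_norm 2 ZR (fourier1 f) = 2 * pi * Lp_norm 2 TR f"
proof -
 have [measurable]: "f \<in> bm TR" using f by (simp add: Lp_space_def)
 have two: "fourier1 f \<in> Lp_space 2 ZR \<and> Lp_norm 2 ZR (fourier1 f) = 2 * pi * Lp_norm 2 TR f"
  if p2: "p = 2"
 proof -
  have f2: "f \<in> Lp_space 2 TR" using f p2 by simp
  have s: "f z = 0" if "\<bar>snd z\<bar> > max R 1" for z using supp that by simp
  have eq: "pint 2 ZR (fourier1 f) = ennreal ((2 * pi)\<^sup>2) * pint 2 TR f"
   by (rule plancherel_forward[OF f2, where R = "max R 1"]) (use s in auto)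
  also have "... = ennreal ((2 * pi * Lp_norm 2 TR f)\<^sup>2)"
   using pint_eq[OF f2] by (simp add: power_mult_distrib ennreal_mult)
  finally have *: "pint 2 ZR (fourier1 f) = ennreal ((2 * pi * Lp_norm 2 TR f)\<^sup>2)" .
  hence L: "fourier1 f \<in> Lp_space 2 ZR" by (simp add: Lp_space_iff)
  have "(Lp_norm 2 ZR (fourier1 f))\<^sup>2 = (2 * pi * Lp_norm 2 TR f)\<^sup>2"
   using * pint_eq[OF L] by simp
  thus ?thesis using L by (simp add: power2_eq_iff_nonneg)
 qed
 have ft: "fourier1 f \<in> Lp_space 4 ZR \<and> Lp_norm 4 ZR (fourier1 f) <= 2 * pi * Lp_norm (4/3) TR f"
  if p4: "p = 4/3"
 proof -
  have f4: "f \<in> Lp_space (4/3) TR" using f p4 by simp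
  have "sqrt (2 * pi) <= 2 * pi"
   using pi_gt3 by (intro real_le_lsqrt) (auto simp: power2_eq_square)
  hence "sqrt (2 * pi) * Lp_norm (4/3) TR f <= 2 * pi * Lp_norm (4/3) TR f"
   by (intro mult_right_mono) auto
  moreover have "fourier1 f \<in> Lp_space 4 ZR" "Lp_norm 4 ZR (fourier1 f) <= sqrt (2 * pi) * Lp_norm (4/3) TR f"
   by (rule hausdorff_young[OF f4, where R = R], erule supp)+
  ultimately show ?thesis by auto
 qed
 show "fourier1 f \<in> Lp_space (p / (p - 1)) ZR" "Lp_norm (p / (p - 1)) ZR (fourier1 f) <= 2 * pi * Lp_norm p TR f"
  "p = 2 ==> Lp_norm 2 ZR (fourier1 f) = 2 * pi * Lp_norm 2 TR f"
  using p two ft unfolding fexp_def by (elim disjE; hypsubst; simp)+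
qed

lemma truncated_measurable [measurable]:
 "f \<in> bm TR ==> truncated_fourier R f \<in> bm ZR"
 by (simp add: truncated_fourier_eq)

lemma truncated_bound:
 assumes p: "fexp p" and f: "f \<in> Lp_space p TR"
 shows "truncated_fourier R f \<in> Lp_space (p / (p - 1)) ZR"
  "Lp_norm (p / (p - 1)) ZR (truncated_fourier R f) <= 2 * pi * Lp_norm p TR f"
proof -
 have p0: "p > 0" using fexpD[OF p] by simp
 have [measurable]: "f \<in> bm TR" using f by (simp add: Lp_space_def)
 have b: "fourier1 (cutoff R f) \<in> Lp_space (p / (p - 1)) ZR"
  "Lp_norm (p / (p - 1)) ZR (fourier1 (cutoff R f)) <= 2 * pi * Lp_norm p TR (cutoff R f)"
  by (rule fourier1_bound(1,2)[OF p cutoff_Lp[OF f p0], where R1 = R], erule cutoff_supp)+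
 show "truncated_fourier R f \<in> Lp_space (p / (p - 1)) ZR" using b(1) by (simp add: truncated_fourier_eq)
 have "Lp_norm p TR (cutoff R f) <= Lp_norm p TR f"
  by (rule Lp_mono(2)[OF _ p0 f]) (auto simp: cutoff_le)
 hence "2 * pi * Lp_norm p TR (cutoff R f) <= 2 * pi * Lp_norm p TR f" by simp
 thus "Lp_norm (p / (p - 1)) ZR (truncated_fourier R f) <= 2 * pi * Lp_norm p TR f"
  unfolding truncated_fourier_eq using b(2) by linarith
qed

lemma truncated_increment:
 assumes p: "fexp p" and f: "f \<in> Lp_space p TR"
 shows "Lp_norm (p / (p - 1)) ZR (%k. truncated_fourier R f k - truncated_fourier S f k)
  <= 2 * pi * (Lp_norm p TR (%z. f z - cutoff R f z) + Lp_norm p TR (%z. f z - cutoff S f z))"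
proof -
 note pp = fexpD[OF p]
 have p0: "p > 0" "p >= 1" using pp by auto
 note c = cutoff_Lp[OF f p0(1)]
 have "(%k. truncated_fourier R f k - truncated_fourier S f k) = fourier1 (%z. cutoff R f z - cutoff S f z)"
  by (rule ext) (simp add: truncated_fourier_eq fourier1_diff[OF cutoff_integrable[OF f pp(1)] cutoff_integrable[OF f pp(1)]])
 hence "Lp_norm (p / (p - 1)) ZR (%k. truncated_fourier R f k - truncated_fourier S f k)
   = Lp_norm (p / (p - 1)) ZR (fourier1 (%z. cutoff R f z - cutoff S f z))" by simp
 also have "... <= 2 * pi * Lp_norm p TR (%z. cutoff R f z - cutoff S f z)"
  by (rule fourier1_bound(2)[OF p Lp_diff(1)[OF c c p0(2)], where R = "max R S"])
    (auto simp: cutoff_supp)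
 also have "... <= 2 * pi * (Lp_norm p TR (%z. cutoff R f z - f z) + Lp_norm p TR (%z. f z - cutoff S f z))"
  by (intro mult_left_mono Lp_norm_triangle c f p0) auto
 finally show ?thesis by (simp add: Lp_norm_minus_commute[of p TR f])
qed

text \<open>By \<open>truncated_increment\<close> the truncated transforms are Cauchy in the real
  parameter. Letting the integer tend to infinity therefore bounds the error at every real
  \<open>R\<close> by the tail of \<open>f\<close>, and convergence along the integers is
  enough.\<close>

lemma is_fourierI:
 assumes p: "fexp p" and f: "f \<in> Lp_space p TR" and F: "F \<in> Lp_space (p / (p - 1)) ZR"
  and lim: "(%n::nat. Lp_norm (p / (p - 1)) ZR (%k. truncated_fourier (real n) f k - F k)) \<longlonglongrightarrow> 0"
 shows "is_fourier p f F"
proof -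
 note pp = fexpD[OF p]
 have p0: "p > 0" "p >= 1" "p / (p - 1) >= 1" using pp by auto
 note t = truncated_bound(1)[OF p f]
 let ?d = "%R. Lp_norm p TR (%z. f z - cutoff R f z)"
 have dlim: "(%n::nat. ?d (real n)) \<longlonglongrightarrow> 0"
  by (rule filterlim_compose[OF cutoff_tendsto[OF f p0(2)] filterlim_real_sequentially])
 have bd: "Lp_norm (p / (p - 1)) ZR (%k. truncated_fourier R f k - F k) <= 2 * pi * ?d R" for R
 proof (rule LIMSEQ_le_const)
  show "(%n::nat. 2 * pi * (?d R + ?d (real n)) + Lp_norm (p / (p - 1)) ZR (%k. truncated_fourier (real n) f k - F k))
    \<longlonglongrightarrow> 2 * pi * ?d R"
   by (rule tendsto_eq_rhs[OF tendsto_add[OF tendsto_mult_left[OF tendsto_add[OF tendsto_const dlim]] lim]]) simp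
  show "\<exists>N. \<forall>n\<ge>N. Lp_norm (p / (p - 1)) ZR (%k. truncated_fourier R f k - F k) <=
    2 * pi * (?d R + ?d (real n)) + Lp_norm (p / (p - 1)) ZR (%k. truncated_fourier (real n) f k - F k)"
   using order_trans[OF Lp_norm_triangle[OF t t F p0(3)] add_right_mono[OF truncated_increment[OF p f]]]
   by blast
 qed
 have "((%R. Lp_norm (p / (p - 1)) ZR (%k. truncated_fourier R f k - F k)) \<longlongrightarrow> 0) at_top"
 proof (rule tendsto_sandwich[of "%_. 0" _ _ "%R. 2 * pi * ?d R"])
  show "((%R. 2 * pi * ?d R) \<longlongrightarrow> 0) at_top"
   using tendsto_mult_left[OF cutoff_tendsto[OF f p0(2)], of "2 * pi"] by simp
 qed (use bd in auto)
 thus ?thesis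
  unfolding is_fourier_def tendsto_Lp_def using f F Lp_diff(1)[OF t F p0(3)] by auto
qed

lemma is_fourierD:
 assumes "is_fourier p f F"
 shows "f \<in> Lp_space p TR" "F \<in> Lp_space (p / (p - 1)) ZR"
  "(%n::nat. Lp_norm (p / (p - 1)) ZR (%k. truncated_fourier (real n) f k - F k)) \<longlonglongrightarrow> 0"
 using assms filterlim_compose[OF _ filterlim_real_sequentially]
 unfolding is_fourier_def tendsto_Lp_def by auto

definition Lp_cauchy :: "real => 'a measure => (nat => 'a => complex) => bool" where
 "Lp_cauchy p M f \<longleftrightarrow> (\<forall>n. f n \<in> Lp_space p M) \<and>
   (\<forall>e>0. \<exists>N. \<forall>m\<ge>N. \<forall>n\<ge>N. Lp_norm p M (%x. f m x - f n x) < e)"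

lemma Lp_cauchyI:
 assumes f: "\<And>n. f n \<in> Lp_space p M" and d: "d \<longlonglongrightarrow> 0"
  and bd: "\<And>m n. Lp_norm p M (%x. f m x - f n x) <= d m + d n"
 shows "Lp_cauchy p M f"
 unfolding Lp_cauchy_def
proof (intro conjI allI impI f)
 fix e :: real assume "e > 0"
 hence "e / 2 > 0" by simp
 from order_tendstoD(2)[OF d this] obtain N where N: "\<And>n. n >= N ==> d n < e / 2"
  by (auto simp: eventually_sequentially)
 show "\<exists>N. \<forall>m\<ge>N. \<forall>n\<ge>N. Lp_norm p M (%x. f m x - f n x) < e"
 proof (intro exI[of _ N] allI impI)
  fix m n assume "m >= N" "n >= N"
  thus "Lp_norm p M (%x. f m x - f n x) < e"
   using bd[of m n] N[of m] N[of n] by linarith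
 qed
qed

lemma Lp_limit_ex:
 fixes f :: "nat => 't => 'a => complex"
 assumes "sigma_finite_measure M" "p >= 1" "\<And>n. (%(t, x). f n t x) \<in> bm (T \<Otimes>\<^sub>M M)"
 shows "\<exists>g. (%(t, x). g t x) \<in> bm (T \<Otimes>\<^sub>M M) \<and>
  (\<forall>t\<in>space T. Lp_cauchy p M (%n. f n t) -->
   g t \<in> Lp_space p M \<and> (%n. Lp_norm p M (%x. f n t x - g t x)) \<longlonglongrightarrow> 0)"
proof (rule Lp_limit_param[OF assms])
 fix g assume g: "(%(t, x). g t x) \<in> bm (T \<Otimes>\<^sub>M M)"
  and c: "\<And>t. t \<in> space T ==> (\<And>n. f n t \<in> Lp_space p M) ==>
   (\<And>e. e > 0 ==> \<exists>N. \<forall>m\<ge>N. \<forall>n\<ge>N. Lp_norm p M (%x. f m t x - f n t x) < e) ==>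
   g t \<in> Lp_space p M \<and> (%n. Lp_norm p M (%x. f n t x - g t x)) \<longlonglongrightarrow> 0"
 show ?thesis
 proof (intro exI[of _ g] conjI[OF g] ballI impI)
  fix t assume "t \<in> space T" "Lp_cauchy p M (%n. f n t)"
  thus "g t \<in> Lp_space p M \<and> (%n. Lp_norm p M (%x. f n t x - g t x)) \<longlonglongrightarrow> 0"
   by (intro c) (auto simp: Lp_cauchy_def)
 qed
qed

text \<open>\<open>is_duhamel\<close> demands transforms that are jointly measurable in time and
  frequency. They are obtained as parametrised limits of truncated transforms, which are integrals
  and hence measurable in both variables.\<close>

lemma is_fourier_param:
 assumes p: "fexp p" and hm: "(%(t, z). h t z) \<in> bm (T \<Otimes>\<^sub>M TR)"
 obtains H where "(%(t, k). H t k) \<in> bm (T \<Otimes>\<^sub>M ZR)"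
  "\<And>t. t \<in> space T ==> h t \<in> Lp_space p TR ==> is_fourier p (h t) (H t)"
proof -
 note pp = fexpD[OF p]
 have p0: "p >= 1" "p / (p - 1) >= 1" using pp by auto
 have meas: "(%(t, k). truncated_fourier (real n) (h t) k) \<in> bm (T \<Otimes>\<^sub>M ZR)" for n
 proof -
  have *: "(%w. h (fst (fst w)) (snd w)) \<in> bm ((T \<Otimes>\<^sub>M ZR) \<Otimes>\<^sub>M TR)"
  proof -
   have "(%w. (fst (fst w), snd w)) \<in> measurable ((T \<Otimes>\<^sub>M ZR) \<Otimes>\<^sub>M TR) (T \<Otimes>\<^sub>M TR)" by measurable
   from measurable_compose[OF this hm] show ?thesis by simp
  qed
  note * [measurable]
  have "(%w. LINT z|TR. indicator {- real n..real n} (snd z) * h (fst w) z * cnj (cchar (snd w) z))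
   \<in> bm (T \<Otimes>\<^sub>M ZR)"
   by measurable
  thus ?thesis by (simp add: truncated_fourier_eq fourier1_def cutoff_def split_beta')
 qed
 obtain H where H: "(%(t, k). H t k) \<in> bm (T \<Otimes>\<^sub>M ZR)"
  "\<And>t. t \<in> space T ==> Lp_cauchy (p / (p - 1)) ZR (%n. truncated_fourier (real n) (h t)) ==>
   H t \<in> Lp_space (p / (p - 1)) ZR \<and>
   (%n. Lp_norm (p / (p - 1)) ZR (%x. truncated_fourier (real n) (h t) x - H t x)) \<longlonglongrightarrow> 0"
  using Lp_limit_ex[where f = "%n t. truncated_fourier (real n) (h t)", OF sigma_finite_ZR p0(2) meas] by auto
 show ?thesis
 proof (rule that[OF H(1)])
  fix t assume t: "t \<in> space T" and L: "h t \<in> Lp_space p TR"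
  let ?d = "%n::nat. 2 * pi * Lp_norm p TR (%z. h t z - cutoff (real n) (h t) z)"
  have "(%n::nat. Lp_norm p TR (%z. h t z - cutoff (real n) (h t) z)) \<longlonglongrightarrow> 0"
   by (rule filterlim_compose[OF cutoff_tendsto[OF L p0(1)] filterlim_real_sequentially])
  hence dlim: "?d \<longlonglongrightarrow> 0" using tendsto_mult_left[of _ 0 sequentially "2 * pi"] by simp
  have "Lp_cauchy (p / (p - 1)) ZR (%n. truncated_fourier (real n) (h t))"
   using truncated_increment[OF p L]
   by (intro Lp_cauchyI[OF truncated_bound(1)[OF p L] dlim]) (simp add: distrib_left)
  from H(2)[OF t this] show "is_fourier p (h t) (H t)" using is_fourierI[OF p L] by auto
 qed
qed

lemma is_fourier_exists:
 assumes p: "fexp p" and f: "f \<in> Lp_space p TR"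
 shows "\<exists>F. is_fourier p f F"
proof -
 have [measurable]: "f \<in> bm TR" using f by (simp add: Lp_space_def)
 have "(%(t, z). f z) \<in> bm (count_space {()} \<Otimes>\<^sub>M TR)" by measurable
 from is_fourier_param[OF p this] obtain H where
  "\<And>t. t \<in> space (count_space {()}) ==> f \<in> Lp_space p TR ==> is_fourier p f (H t)" by metis
 thus ?thesis using f by auto
qed

lemma is_fourier_diff:
 assumes p: "fexp p" and fF: "is_fourier p f F" and gG: "is_fourier p g G"
 shows "is_fourier p (%z. f z - g z) (%k. F k - G k)"
proof -
 note pp = fexpD[OF p]
 have p0: "p >= 1" "p / (p - 1) >= 1" using pp by auto
 note f = is_fourierD[OF fF] and g = is_fourierD[OF gG]
 let ?D = "%n. %k. truncated_fourier (real n) (%z. f z - g z) k - (F k - G k)"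
 have "(%n. Lp_norm (p / (p - 1)) ZR (?D n)) \<longlonglongrightarrow> 0"
 proof (rule tendsto_sandwich[of "%_. 0"])
  show "(%n. Lp_norm (p / (p - 1)) ZR (%k. truncated_fourier (real n) f k - F k) +
    Lp_norm (p / (p - 1)) ZR (%k. truncated_fourier (real n) g k - G k)) \<longlonglongrightarrow> 0"
   using tendsto_add[OF f(3) g(3)] by simp
  show "\<forall>\<^sub>F n in sequentially. Lp_norm (p / (p - 1)) ZR (?D n)
   <= Lp_norm (p / (p - 1)) ZR (%k. truncated_fourier (real n) f k - F k) +
    Lp_norm (p / (p - 1)) ZR (%k. truncated_fourier (real n) g k - G k)"
  proof (intro always_eventually allI)
   fix n
   have "(?D n) =
     (%k. (truncated_fourier (real n) f k - F k) - (truncated_fourier (real n) g k - G k))"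
    by (simp add: truncated_diff[OF f(1) g(1) pp(1)] algebra_simps)
   thus "Lp_norm (p / (p - 1)) ZR (?D n)
   <= Lp_norm (p / (p - 1)) ZR (%k. truncated_fourier (real n) f k - F k) +
    Lp_norm (p / (p - 1)) ZR (%k. truncated_fourier (real n) g k - G k)"
    using Lp_diff(2)[OF Lp_diff(1)[OF truncated_bound(1)[OF p f(1)] f(2) p0(2)]
      Lp_diff(1)[OF truncated_bound(1)[OF p g(1)] g(2) p0(2)] p0(2)] by simp
  qed
 qed auto
 thus ?thesis
  by (intro is_fourierI[OF p] Lp_diff(1) f g p0)
qed

lemma is_fourier_cmult:
 assumes p: "fexp p" and fF: "is_fourier p f F"
 shows "is_fourier p (%z. c * f z) (%k. c * F k)"
proof -
 note pp = fexpD[OF p]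
 have p0: "p > 0" "p / (p - 1) > 0" "p / (p - 1) >= 1" using pp by auto
 note f = is_fourierD[OF fF]
 have "Lp_norm (p / (p - 1)) ZR (%k. truncated_fourier (real n) (%z. c * f z) k - c * F k)
   = cmod c * Lp_norm (p / (p - 1)) ZR (%k. truncated_fourier (real n) f k - F k)" for n
  using Lp_cmult(2)[OF Lp_diff(1)[OF truncated_bound(1)[OF p f(1), of "real n"] f(2) p0(3)] p0(2), of c]
  by (simp add: truncated_cmult right_diff_distrib)
 hence "(%n. Lp_norm (p / (p - 1)) ZR (%k. truncated_fourier (real n) (%z. c * f z) k - c * F k)) \<longlonglongrightarrow> 0"
  using tendsto_mult_left[OF f(3), of "cmod c"] by simp
 thus ?thesis
  by (intro is_fourierI[OF p] Lp_cmult(1) f p0)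
qed

lemma is_fourier_add:
 assumes p: "fexp p" and fF: "is_fourier p f F" and gG: "is_fourier p g G"
 shows "is_fourier p (%z. f z + g z) (%k. F k + G k)"
 using is_fourier_diff[OF p fF is_fourier_cmult[OF p gG, of "-1"]] by simp

lemma is_fourier_norm:
 assumes p: "fexp p" and fF: "is_fourier p f F"
 shows "Lp_norm (p / (p - 1)) ZR F <= 2 * pi * Lp_norm p TR f"
  "p = 2 ==> Lp_norm 2 ZR F = 2 * pi * Lp_norm 2 TR f"
proof -
 note pp = fexpD[OF p]
 have p0: "p > 0" "p >= 1" "p / (p - 1) >= 1" using pp by auto
 note f = is_fourierD[OF fF]
 have l1: "(%n::nat. Lp_norm (p / (p - 1)) ZR (truncated_fourier (real n) f)) \<longlonglongrightarrow> Lp_norm (p / (p - 1)) ZR F"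
 proof (rule Lim_null_comparison[OF _ f(3), THEN LIM_zero_cancel])
  show "\<forall>\<^sub>F n in sequentially. norm (Lp_norm (p / (p - 1)) ZR (truncated_fourier (real n) f) - Lp_norm (p / (p - 1)) ZR F)
   <= Lp_norm (p / (p - 1)) ZR (%k. truncated_fourier (real n) f k - F k)"
   using Lp_norm_rev_triangle[OF truncated_bound(1)[OF p f(1)] f(2) p0(3)] by simp
 qed
 show "Lp_norm (p / (p - 1)) ZR F <= 2 * pi * Lp_norm p TR f"
  using truncated_bound(2)[OF p f(1)] by (intro LIMSEQ_le_const2[OF l1]) auto
 show "Lp_norm 2 ZR F = 2 * pi * Lp_norm 2 TR f" if p2: "p = 2"
 proof (rule LIMSEQ_unique)
  show "(%n::nat. Lp_norm 2 ZR (truncated_fourier (real n) f)) \<longlonglongrightarrow> Lp_norm 2 ZR F" using l1 p2 by simp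
  have "(%n::nat. Lp_norm 2 TR (cutoff (real n) f)) \<longlonglongrightarrow> Lp_norm 2 TR f"
  proof (rule Lim_null_comparison[THEN LIM_zero_cancel])
   show "(%n::nat. Lp_norm 2 TR (%z. f z - cutoff (real n) f z)) \<longlonglongrightarrow> 0"
    using filterlim_compose[OF cutoff_tendsto[OF f(1) p0(2)] filterlim_real_sequentially] p2 by simp
   show "\<forall>\<^sub>F n in sequentially. norm (Lp_norm 2 TR (cutoff (real n) f) - Lp_norm 2 TR f)
    <= Lp_norm 2 TR (%z. f z - cutoff (real n) f z)"
    using Lp_norm_rev_triangle[OF f(1) cutoff_Lp[OF f(1) p0(1)] p0(2)] p2
    by (auto simp: abs_minus_commute)
  qed
  from tendsto_mult_left[OF this, of "2 * pi"]
  have lim2: "(%n::nat. 2 * pi * Lp_norm 2 TR (cutoff (real n) f)) \<longlonglongrightarrow> 2 * pi * Lp_norm 2 TR f" .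
  show "(%n::nat. Lp_norm 2 ZR (truncated_fourier (real n) f)) \<longlonglongrightarrow> 2 * pi * Lp_norm 2 TR f"
  proof -
   have "Lp_norm 2 ZR (fourier1 (cutoff R f)) = 2 * pi * Lp_norm 2 TR (cutoff R f)" for R
    by (rule fourier1_bound(3)[where R = R, OF p cutoff_Lp[OF f(1) p0(1)] _ p2]) (erule cutoff_supp)
   thus ?thesis using lim2 by (simp add: truncated_fourier_eq)
  qed
 qed
qed

lemma is_fourier_cong_AE:
 assumes p: "fexp p" and fF: "is_fourier p f F"
  and "AE z in TR. f z = g z" "g \<in> bm TR" "AE k in ZR. F k = G k" "G \<in> bm ZR"
 shows "is_fourier p g G"
proof (rule is_fourierI[OF p])
 note f = is_fourierD[OF fF]
 note [measurable] = f(1,2)[THEN Lp_measurable] assms(4,6)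
 show "g \<in> Lp_space p TR" "G \<in> Lp_space (p / (p - 1)) ZR"
  using Lp_space_cong_AE[OF assms(3) f(1)] Lp_space_cong_AE[OF assms(5) f(2)] assms(4,6) by auto
 have "truncated_fourier R f = truncated_fourier R g" for R
 proof
  fix k :: "int \<times> real"
  have k: "k \<in> space ZR" by simp
  note k [measurable]
  show "truncated_fourier R f k = truncated_fourier R g k"
   unfolding truncated_fourier_eq fourier1_def cutoff_def
   using assms(3) by (intro integral_cong_AE) (auto elim!: eventually_mono)
 qed
 moreover have "Lp_norm (p / (p - 1)) ZR (%k. truncated_fourier R f k - F k)
   = Lp_norm (p / (p - 1)) ZR (%k. truncated_fourier R f k - G k)" for R
  using assms(5) by (intro Lp_norm_cong_AE) (auto elim!: eventually_mono)
 ultimately show "(%n::nat. Lp_norm (p / (p - 1)) ZR (%k. truncated_fourier (real n) g k - G k)) \<longlonglongrightarrow> 0"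
  using f(3) by simp
qed

lemma is_fourier_unique:
 assumes p: "fexp p" and "is_fourier p f F" "is_fourier p g G" "AE z in TR. f z = g z"
 shows "AE k in ZR. F k = G k"
proof -
 note d = is_fourier_diff[OF p assms(2,3)]
 note pp = fexpD[OF p]
 have [measurable]: "f \<in> bm TR" "g \<in> bm TR"
  using assms(2,3)[THEN is_fourierD(1)] by (auto simp: Lp_space_def)
 have "Lp_norm p TR (%z. f z - g z) = 0"
  using assms(4) by (intro Lp_norm_zero_AE) (auto elim!: eventually_mono)
 with is_fourier_norm(1)[OF p d] have "Lp_norm (p / (p - 1)) ZR (%k. F k - G k) = 0"
  by (simp add: order_antisym)
 from Lp_norm_eq_0_AE[OF is_fourierD(2)[OF d] _ this] pp have "AE k in ZR. F k - G k = 0" by simp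
 thus ?thesis by eventually_elim simp
qed

lemma is_fourier_inject:
 assumes "is_fourier 2 f F" "is_fourier 2 g G" "AE k in ZR. F k = G k"
 shows "AE z in TR. f z = g z"
proof -
 note d = is_fourier_diff[OF _ assms(1,2)]
 have [measurable]: "F \<in> bm ZR" "G \<in> bm ZR"
  using assms(1,2)[THEN is_fourierD(2)] by (auto simp: Lp_space_def)
 have "Lp_norm 2 ZR (%k. F k - G k) = 0"
  using assms(3) by (intro Lp_norm_zero_AE) (auto elim!: eventually_mono)
 with is_fourier_norm(2)[OF _ d] have "Lp_norm 2 TR (%k. f k - g k) = 0" by simp
 from Lp_norm_eq_0_AE[OF is_fourierD(1)[OF d] _ this] have "AE z in TR. f z - g z = 0" by simp
 thus ?thesis by eventually_elim simp
qed

text \<open>Closedness of the graph: the limit has some transform \<open>H\<close>, and the norm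
  bound for differences forces \<open>H\<close> to lie at distance 0 from \<open>G\<close>.\<close>

lemma is_fourier_limit:
 assumes p: "fexp p" and fF: "\<And>n. is_fourier p (f n) (F n)"
  and g: "g \<in> Lp_space p TR" and G: "G \<in> Lp_space (p / (p - 1)) ZR"
  and flim: "(%n. Lp_norm p TR (%z. f n z - g z)) \<longlonglongrightarrow> 0"
  and Flim: "(%n. Lp_norm (p / (p - 1)) ZR (%k. F n k - G k)) \<longlonglongrightarrow> 0"
 shows "is_fourier p g G"
proof -
 note pp = fexpD[OF p]
 have p0: "p > 0" "p >= 1" "p / (p - 1) >= 1" "p / (p - 1) > 0" using pp by auto
 obtain H where H: "is_fourier p g H" using is_fourier_exists[OF p g] by auto
 note HL = is_fourierD(2)[OF H]
 have "Lp_norm (p / (p - 1)) ZR (%k. H k - G k) <= 0"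
 proof (rule LIMSEQ_le_const)
  show "(%n. 2 * pi * Lp_norm p TR (%z. f n z - g z) + Lp_norm (p / (p - 1)) ZR (%k. F n k - G k)) \<longlonglongrightarrow> 0"
   using tendsto_add[OF tendsto_mult_left[OF flim, of "2 * pi"] Flim] by simp
  have "Lp_norm (p / (p - 1)) ZR (%k. H k - G k) <=
    2 * pi * Lp_norm p TR (%z. f n z - g z) + Lp_norm (p / (p - 1)) ZR (%k. F n k - G k)" for n
   using Lp_norm_triangle[OF HL is_fourierD(2)[OF fF[of n]] G p0(3)]
    is_fourier_norm(1)[OF p is_fourier_diff[OF p fF[of n] H]]
   by (simp add: Lp_norm_minus_commute[of _ ZR H])
  thus "\<exists>N. \<forall>n\<ge>N. Lp_norm (p / (p - 1)) ZR (%k. H k - G k) <=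
    2 * pi * Lp_norm p TR (%z. f n z - g z) + Lp_norm (p / (p - 1)) ZR (%k. F n k - G k)" by blast
 qed
 hence "Lp_norm (p / (p - 1)) ZR (%k. H k - G k) = 0" by (simp add: order_antisym)
 from Lp_norm_eq_0_AE[OF Lp_diff(1)[OF HL G p0(3)] p0(4) this] have "AE k in ZR. H k = G k" by simp
 thus ?thesis
  using is_fourier_cong_AE[OF p H _ Lp_measurable[OF g] _ Lp_measurable[OF G]] by auto
qed

lemma L2_norm_square_add:
 assumes f: "f \<in> Lp_space 2 M" and g: "g \<in> Lp_space 2 M"
 shows "(Lp_norm 2 M (%x. f x + g x))\<^sup>2 = (Lp_norm 2 M f)\<^sup>2 + (Lp_norm 2 M g)\<^sup>2 + 2 * Re (LINT x|M. f x * cnj (g x))"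
proof -
 have sq: "(Lp_norm 2 M h)\<^sup>2 = (LINT x|M. (cmod (h x))\<^sup>2)" for h
  by (simp add: Lp_norm_def powr_half_sqrt)
 have g': "(%x. cnj (g x)) \<in> Lp_space 2 M" using g by (auto simp: Lp_space_def)
 have i: "integrable M (%x. f x * cnj (g x))" by (rule holder(1)[OF f g']) auto
 have fg: "integrable M (%x. (cmod (f x))\<^sup>2)" "integrable M (%x. (cmod (g x))\<^sup>2)"
  using f g by (auto simp: Lp_space_def)
 have "(cmod (f x + g x))\<^sup>2 = (cmod (f x))\<^sup>2 + (cmod (g x))\<^sup>2 + 2 * Re (f x * cnj (g x))" for x
  by (simp only: cmod_power2) (simp add: power2_eq_square algebra_simps)
 thus ?thesis
  unfolding sq using fg integrable_Re[OF i] integral_Re[OF i] by (simp del: times_complex.simps)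
qed

text \<open>Polarisation of Plancherel. Comparing the norms of sums yields real parts only, and the
  energy identity uses nothing more.\<close>

lemma is_fourier_inner:
 assumes "is_fourier 2 f F" "is_fourier 2 g G"
 shows "Re (LINT k|ZR. F k * cnj (G k)) = (2 * pi)\<^sup>2 * Re (LINT z|TR. f z * cnj (g z))"
proof -
 have L: "f \<in> Lp_space 2 TR" "g \<in> Lp_space 2 TR" "F \<in> Lp_space 2 ZR" "G \<in> Lp_space 2 ZR"
  using assms[THEN is_fourierD(1)] assms[THEN is_fourierD(2)] by auto
 show ?thesis
  using L2_norm_square_add[OF L(1,2)] L2_norm_square_add[OF L(3,4)]
   is_fourier_norm(2)[OF _ is_fourier_add[OF _ assms]] is_fourier_norm(2)[OF _ assms(1)]
   is_fourier_norm(2)[OF _ assms(2)]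
  by (simp add: power_mult_distrib algebra_simps)
qed

section \<open>Inverse transform and duality with band-limited functions\<close>

definition bandsynth :: "nat => (int \<times> real => complex) => real \<times> real => complex" where
 "bandsynth n F z = synth (%k. indicator (band (real n)) k * F k) z / (2 * pi)\<^sup>2"

lemma band_cut_Lp:
 assumes "F \<in> Lp_space p ZR" "p > 0"
 shows "(%k. indicator (band N) k * F k) \<in> Lp_space p ZR"
proof -
 have [measurable]: "F \<in> bm ZR" using assms by (simp add: Lp_space_def)
 show ?thesis by (rule Lp_mono(1)[OF _ assms(2,1)]) (auto split: split_indicator)
qed

lemma band_cut_tendsto:
 assumes F: "F \<in> Lp_space p ZR" and p: "p >= 1"
 shows "(%n. Lp_norm p ZR (%k. F k - indicator (band (real n)) k * F k)) \<longlonglongrightarrow> 0"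
proof -
 have [measurable]: "F \<in> bm ZR" using F by (simp add: Lp_space_def)
 show ?thesis
 proof (rule Lp_dominated[OF _ _ F p])
  show "AE k in ZR. (%n. indicator (band (real n)) k * F k) \<longlonglongrightarrow> F k"
  proof (intro AE_I2 tendsto_eventually)
   fix k
   show "\<forall>\<^sub>F n in sequentially. indicator (band (real n)) k * F k = F k"
    by (intro eventually_mono[OF eventually_ge_at_top[of "nat \<lceil>max \<bar>real_of_int (fst k)\<bar> \<bar>snd k\<bar>\<rceil>"]])
      (auto simp: band_def indicator_def)
  qed
 qed (auto split: split_indicator)
qed

lemma synth_L2:
 assumes G: "G \<in> Lp_space 2 ZR" and supp: "\<And>k. k \<notin> band N ==> G k = 0"
 shows "synth G \<in> Lp_space 2 TR" "Lp_norm 2 TR (synth G) = 2 * pi * Lp_norm 2 ZR G"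
proof -
 have [measurable]: "G \<in> bm ZR" using G by (simp add: Lp_space_def)
 have s: "G k = 0" if "k \<notin> band (max N 1)" for k
  by (rule supp) (use that in \<open>auto simp: band_def\<close>)
 have "pint 2 TR (synth G) = ennreal ((2 * pi)\<^sup>2) * pint 2 ZR G"
  by (rule plancherel_synth[OF G, where N = "max N 1"]) (use s in auto)
 also have "... = ennreal ((2 * pi * Lp_norm 2 ZR G)\<^sup>2)"
  using pint_eq[OF G] by (simp add: power_mult_distrib ennreal_mult)
 finally have *: "pint 2 TR (synth G) = ennreal ((2 * pi * Lp_norm 2 ZR G)\<^sup>2)" .
 thus L: "synth G \<in> Lp_space 2 TR" by (simp add: Lp_space_iff)
 have "(Lp_norm 2 TR (synth G))\<^sup>2 = (2 * pi * Lp_norm 2 ZR G)\<^sup>2"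
  using * pint_eq[OF L] by simp
 thus "Lp_norm 2 TR (synth G) = 2 * pi * Lp_norm 2 ZR G" by (simp add: power2_eq_iff_nonneg)
qed

text \<open>
 With \<open>g\<close> the synthesis of \<open>G\<close> and \<open>G\<^sub>R\<close> the transform of its truncation \<open>g\<^sub>R\<close>, expanding the square
 gives \<open>\<parallel>G\<^sub>R - G\<parallel>\<^sup>2 = (2\<pi>)\<^sup>2 (\<parallel>g\<parallel>\<^sup>2 - \<parallel>g\<^sub>R\<parallel>\<^sup>2)\<close> up to normalisation.
\<close>

lemma is_fourier_synth:
 assumes G: "G \<in> Lp_space 2 ZR" and supp: "\<And>k. k \<notin> band N ==> G k = 0"
 shows "is_fourier 2 (%z. synth G z / (2 * pi)\<^sup>2) G"
proof -
 have [measurable]: "G \<in> bm ZR" using G by (simp add: Lp_space_def)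
 have Gi: "integrable ZR G" by (rule band_integrable[OF G _ supp]) auto
 define g where "g = (%z. synth G z / (2 * pi)\<^sup>2)"
 have gc: "g = (%z. complex_of_real (1 / (2 * pi)\<^sup>2) * synth G z)" by (simp add: g_def)
 have gL: "g \<in> Lp_space 2 TR" unfolding gc by (intro Lp_cmult(1) synth_L2[OF G supp]) auto
 have gn: "Lp_norm 2 ZR G = 2 * pi * Lp_norm 2 TR g"
  unfolding gc using Lp_cmult(2)[OF synth_L2(1)[OF G supp], where c = "complex_of_real (1 / (2 * pi)\<^sup>2)"] synth_L2(2)[OF G supp]
  by (simp add: power2_eq_square norm_divide norm_mult)
 define gR where "gR = (%n::nat. cutoff (real n) g)"
 have gRL: "gR n \<in> Lp_space 2 TR" for n unfolding gR_def by (rule cutoff_Lp[OF gL]) simp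
 have gRi: "integrable TR (gR n)" for n unfolding gR_def by (rule cutoff_integrable[OF gL]) simp
 have TL: "truncated_fourier (real n) g \<in> Lp_space 2 ZR" for n
  using truncated_bound(1)[OF fexp_simps(1) gL] by simp
 have Tn: "Lp_norm 2 ZR (truncated_fourier (real n) g) = 2 * pi * Lp_norm 2 TR (gR n)" for n
  unfolding truncated_fourier_eq gR_def
  by (rule fourier1_bound(3)[OF fexp_simps(1) gRL[of n, unfolded gR_def] _ refl, where R = "real n"])
    (erule cutoff_supp)
 have sq: "(Lp_norm 2 TR h)\<^sup>2 = (LINT x|TR. (cmod (h x))\<^sup>2)" for h
  by (simp add: Lp_norm_def powr_half_sqrt)
 have pair: "Re (LINT k|ZR. truncated_fourier (real n) g k * cnj (G k)) = (2 * pi)\<^sup>2 * (Lp_norm 2 TR (gR n))\<^sup>2" for n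
 proof -
  have "(LINT k|ZR. truncated_fourier (real n) g k * cnj (G k)) = (LINT z|TR. gR n z * cnj (synth G z))"
   unfolding truncated_fourier_eq using pairing_integrable[OF gRi[of n] Gi] by (simp add: gR_def)
  also have "... = (LINT z|TR. complex_of_real ((2 * pi)\<^sup>2 * (cmod (gR n z))\<^sup>2))"
  proof (intro Bochner_Integration.integral_cong refl)
   fix z
   have "gR n z * cnj (g z) = gR n z * cnj (gR n z)"
    by (auto simp: gR_def cutoff_def split: split_indicator)
   hence "gR n z * cnj (synth G z) = complex_of_real ((2 * pi)\<^sup>2) * (gR n z * cnj (gR n z))"
    by (simp add: g_def field_simps)
   thus "gR n z * cnj (synth G z) = complex_of_real ((2 * pi)\<^sup>2 * (cmod (gR n z))\<^sup>2)"
    by (simp only: complex_norm_square of_real_mult)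
  qed
  also have "... = complex_of_real ((2 * pi)\<^sup>2 * (Lp_norm 2 TR (gR n))\<^sup>2)"
   by (simp only: integral_complex_of_real sq integral_mult_right_zero)
  finally show ?thesis by (simp only: Re_complex_of_real)
 qed
 have eq: "(Lp_norm 2 ZR (%k. truncated_fourier (real n) g k - G k))\<^sup>2 =
   (2 * pi)\<^sup>2 * ((Lp_norm 2 TR g)\<^sup>2 - (Lp_norm 2 TR (gR n))\<^sup>2)" for n
  using L2_norm_square_add[OF TL[of n] Lp_uminus(1)[OF G]] pair[of n] Tn[of n] gn
  by (simp add: Lp_uminus(2) power_mult_distrib algebra_simps)
 have "(%n. Lp_norm 2 TR (gR n)) \<longlonglongrightarrow> Lp_norm 2 TR g"
 proof (rule Lim_null_comparison[THEN LIM_zero_cancel])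
  show "(%n::nat. Lp_norm 2 TR (%z. g z - cutoff (real n) g z)) \<longlonglongrightarrow> 0"
   by (rule filterlim_compose[OF cutoff_tendsto[OF gL] filterlim_real_sequentially]) simp
  show "\<forall>\<^sub>F n in sequentially. norm (Lp_norm 2 TR (gR n) - Lp_norm 2 TR g) <= Lp_norm 2 TR (%z. g z - cutoff (real n) g z)"
   using Lp_norm_rev_triangle[OF gL gRL] by (auto simp: abs_minus_commute gR_def)
 qed
 hence "(%n. (2 * pi)\<^sup>2 * ((Lp_norm 2 TR g)\<^sup>2 - (Lp_norm 2 TR (gR n))\<^sup>2)) \<longlonglongrightarrow> (2 * pi)\<^sup>2 * ((Lp_norm 2 TR g)\<^sup>2 - (Lp_norm 2 TR g)\<^sup>2)"
  by (intro tendsto_intros)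
 hence "(%n. sqrt ((Lp_norm 2 ZR (%k. truncated_fourier (real n) g k - G k))\<^sup>2)) \<longlonglongrightarrow> sqrt 0"
  unfolding eq by (intro tendsto_real_sqrt) simp
 hence "(%n. Lp_norm 2 ZR (%k. truncated_fourier (real n) g k - G k)) \<longlonglongrightarrow> 0" by simp
 thus ?thesis
  unfolding g_def[symmetric] using is_fourierI[OF fexp_simps(1) gL, of G] G by simp
qed

lemma is_fourier_bandsynth:
 assumes "F \<in> Lp_space 2 ZR"
 shows "is_fourier 2 (bandsynth n F) (%k. indicator (band (real n)) k * F k)"
 unfolding bandsynth_def[abs_def]
 by (rule is_fourier_synth[OF band_cut_Lp[OF assms], where N = "real n"]) auto

lemma bandsynth_tendsto:
 assumes fF: "is_fourier 2 f F"
 shows "(%n. Lp_norm 2 TR (%z. bandsynth n F z - f z)) \<longlonglongrightarrow> 0"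
proof -
 have F: "F \<in> Lp_space 2 ZR" using is_fourierD(2)[OF fF] by simp
 have "Lp_norm 2 TR (%z. f z - bandsynth n F z) = Lp_norm 2 ZR (%k. F k - indicator (band (real n)) k * F k) / (2 * pi)" for n
  using is_fourier_norm(2)[OF _ is_fourier_diff[OF _ fF is_fourier_bandsynth[OF F, of n]]] by simp
 thus ?thesis
  using tendsto_divide[OF band_cut_tendsto[OF F, simplified] tendsto_const[of "2 * pi"]]
  by (simp add: Lp_norm_minus_commute[of 2 TR f])
qed

lemma bandsynth_param_measurable [measurable]:
 assumes Gm: "(%(t, k). G t k) \<in> bm (T \<Otimes>\<^sub>M ZR)"
 shows "(%(t, z). bandsynth n (G t) z) \<in> bm (T \<Otimes>\<^sub>M TR)"
proof -
 have *: "(%w. G (fst (fst w)) (snd w)) \<in> bm ((T \<Otimes>\<^sub>M TR) \<Otimes>\<^sub>M ZR)"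
 proof -
  have "(%w. (fst (fst w), snd w)) \<in> measurable ((T \<Otimes>\<^sub>M TR) \<Otimes>\<^sub>M ZR) (T \<Otimes>\<^sub>M ZR)" by measurable
  from measurable_compose[OF this Gm] show ?thesis by simp
 qed
 note * [measurable]
 have "(%w. (LINT k|ZR. indicator (band (real n)) k * G (fst w) k * cchar k (snd w)) / (2 * pi)\<^sup>2)
  \<in> bm (T \<Otimes>\<^sub>M TR)"
  by measurable
 thus ?thesis by (simp add: bandsynth_def synth_def split_beta')
qed

text \<open>Synthesis of band truncations is isometric up to \<open>2 * pi\<close>, so these pieces
  form a Cauchy sequence for every \<open>t\<close> and the parametrised limit applies. The graph of
  the transform being closed, the limit has transform \<open>G t\<close>.\<close>

lemma inverse_fourier_param:
 assumes Gm: "(%(t, k). G t k) \<in> bm (T \<Otimes>\<^sub>M ZR)"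
 obtains g where "(%(t, z). g t z) \<in> bm (T \<Otimes>\<^sub>M TR)"
  "\<And>t. t \<in> space T ==> G t \<in> Lp_space 2 ZR ==> is_fourier 2 (g t) (G t)"
proof -
 have bm: "(%(t, z). bandsynth n (G t) z) \<in> bm (T \<Otimes>\<^sub>M TR)" for n
  by (rule bandsynth_param_measurable[OF Gm])
 obtain g where g: "(%(t, z). g t z) \<in> bm (T \<Otimes>\<^sub>M TR)"
  "\<And>t. t \<in> space T ==> Lp_cauchy 2 TR (%n. bandsynth n (G t)) ==>
   g t \<in> Lp_space 2 TR \<and> (%n. Lp_norm 2 TR (%x. bandsynth n (G t) x - g t x)) \<longlonglongrightarrow> 0"
  using Lp_limit_ex[where f = "%n t. bandsynth n (G t)" and p = 2, OF sigma_finite_TR _ bm] by auto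
 show ?thesis
 proof (rule that[OF g(1)])
  fix t assume t: "t \<in> space T" and L: "G t \<in> Lp_space 2 ZR"
  note b = is_fourier_bandsynth[OF L]
  have bL: "bandsynth n (G t) \<in> Lp_space 2 TR" for n using is_fourierD(1)[OF b] .
  let ?c = "%n k. indicator (band (real n)) k * G t k"
  have cL: "?c n \<in> Lp_space 2 ZR" for n using band_cut_Lp[OF L] by simp
  let ?d = "%n. Lp_norm 2 ZR (%k. G t k - ?c n k)"
  have dlim: "?d \<longlonglongrightarrow> 0" by (rule band_cut_tendsto[OF L]) simp
  have inc: "Lp_norm 2 TR (%x. bandsynth m (G t) x - bandsynth n (G t) x) <= ?d m + ?d n" for m n
  proof -
   have "1 * Lp_norm 2 TR (%x. bandsynth m (G t) x - bandsynth n (G t) x) <= 2 * pi * Lp_norm 2 TR (%x. bandsynth m (G t) x - bandsynth n (G t) x)"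
    using pi_gt3 by (intro mult_right_mono) auto
   also have "... = Lp_norm 2 ZR (%k. ?c m k - ?c n k)"
    using is_fourier_norm(2)[OF _ is_fourier_diff[OF _ b[of m] b[of n]]] by simp
   also have "... <= Lp_norm 2 ZR (%k. ?c m k - G t k) + ?d n"
    by (rule Lp_norm_triangle[OF cL L cL]) simp
   finally show ?thesis by (simp add: Lp_norm_minus_commute[of 2 ZR "G t"])
  qed
  note g(2)[OF t Lp_cauchyI[OF bL dlim inc]]
  thus "is_fourier 2 (g t) (G t)"
   using dlim L
   by (intro is_fourier_limit[OF _ b]) (auto simp: Lp_norm_minus_commute[of 2 ZR "G t"])
 qed
qed

lemma inverse_fourier_exists:
 assumes "G \<in> Lp_space 2 ZR"
 shows "\<exists>g. is_fourier 2 g G"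
proof -
 have [measurable]: "G \<in> bm ZR" using assms by (simp add: Lp_space_def)
 have "(%(t, k). G k) \<in> bm (count_space {()} \<Otimes>\<^sub>M ZR)" by measurable
 from inverse_fourier_param[OF this] obtain g where
  "\<And>t. t \<in> space (count_space {()}) ==> G \<in> Lp_space 2 ZR ==> is_fourier 2 (g t) G" by metis
 thus ?thesis using assms by auto
qed

text \<open>Holder with exponents \<open>3/2\<close> and 3, applied to
  \<open>cmod (G k) powr (4/3)\<close> and the indicator of the band.\<close>

lemma band_L2_L43:
 assumes G: "G \<in> Lp_space 2 ZR" and supp: "\<And>k. k \<notin> band N ==> G k = 0"
 shows "G \<in> Lp_space (4/3) ZR"
  "Lp_norm (4/3) ZR G <= Lp_norm 2 ZR G * measure ZR (band N) powr (1/4)"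
proof -
 have [measurable]: "G \<in> bm ZR" using G by (simp add: Lp_space_def)
 define m where "m = measure ZR (band N)"
 have m: "emeasure ZR (band N) = ennreal m" unfolding m_def
  using band_finite[of N] by (intro emeasure_eq_ennreal_measure) auto
 let ?g = "%k. complex_of_real (cmod (G k) powr (4/3))"
 have pw: "(x powr (4/3)) powr (3/2) = x powr 2" if "x >= 0" for x :: real by (simp add: powr_powr)
 have gL: "?g \<in> Lp_space (3/2) ZR"
  using G by (simp add: Lp_space_def powr_powr)
 have gn: "Lp_norm (3/2) ZR ?g = Lp_norm 2 ZR G powr (4/3)"
  by (simp add: Lp_norm_def powr_powr)
 have p3: "pint 3 ZR (indicator (band N)) = ennreal m"
 proof -
  have "pint 3 ZR (indicator (band N)) = (NN k|ZR. indicator (band N) k)"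
   unfolding pint_def by (intro nn_integral_cong) (auto split: split_indicator)
  thus ?thesis by (simp add: m)
 qed
 have iL: "(indicator (band N) :: _ => complex) \<in> Lp_space 3 ZR" using p3 by (simp add: Lp_space_iff)
 have inorm: "Lp_norm 3 ZR (indicator (band N)) = m powr (1/3)"
 proof -
  have "Lp_norm 3 ZR (indicator (band N)) powr 3 = m"
   using pint_eq[OF iL] p3 by (simp add: m_def del: powr_numeral)
  hence "(Lp_norm 3 ZR (indicator (band N)) powr 3) powr (1/3) = m powr (1/3)" by simp
  thus ?thesis by (simp add: powr_powr del: powr_numeral)
 qed
 have "pint (4/3) ZR G = (NN k|ZR. ennreal (cmod (?g k) * cmod (indicator (band N) k :: complex)))"
  unfolding pint_def using supp by (intro nn_integral_cong) (auto split: split_indicator)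
 also have "... <= ennreal (Lp_norm (3/2) ZR ?g * Lp_norm 3 ZR (indicator (band N)))"
  by (rule holder_nn[OF gL iL]) auto
 also have "Lp_norm (3/2) ZR ?g * Lp_norm 3 ZR (indicator (band N)) = (Lp_norm 2 ZR G * m powr (1/4)) powr (4/3)"
  unfolding gn inorm by (simp add: powr_mult powr_powr)
 finally have *: "pint (4/3) ZR G <= ennreal ((Lp_norm 2 ZR G * m powr (1/4)) powr (4/3))" .
 show "G \<in> Lp_space (4/3) ZR" "Lp_norm (4/3) ZR G <= Lp_norm 2 ZR G * measure ZR (band N) powr (1/4)"
  using Lp_normI[OF _ _ _ *] by (auto simp: m_def)
qed

text \<open>Extends \<open>pairing_integrable\<close> to transforms defined as limits: both sides
  are limits of the corresponding expressions for the truncated \<open>f\<close>. A band-limited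
  square integrable \<open>G\<close> lies in \<open>L^p\<close> for both exponents, and its
  synthesis in both conjugate spaces.\<close>

lemma is_fourier_pairing:
 assumes p: "fexp p" and fF: "is_fourier p f F"
  and G: "G \<in> Lp_space 2 ZR" and supp: "\<And>k. k \<notin> band N ==> G k = 0"
 shows "(LINT k|ZR. F k * cnj (G k)) = (LINT z|TR. f z * cnj (synth G z))"
proof -
 note pp = fexpD[OF p] and f = is_fourierD[OF fF]
 define q where "q = p / (p - 1)"
 have q: "q > 1" "1 / p + 1 / q = 1" "1 / q + 1 / p = 1" "q >= 1" "p >= 1" using pp by (auto simp: q_def)
 have Gi: "integrable ZR G" by (rule band_integrable[OF G _ supp]) auto
 have GL: "(%k. cnj (G k)) \<in> Lp_space p ZR"
 proof -
  have "G \<in> Lp_space (4/3) ZR" by (rule band_L2_L43(1)[OF G supp])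
  hence "G \<in> Lp_space p ZR"
   using p G unfolding fexp_def by (elim disjE; hypsubst; simp)
  thus ?thesis by (auto simp: Lp_space_def)
 qed
 have s1: "G k = 0" if "k \<notin> band (max N 1)" for k
  by (rule supp) (use that in \<open>auto simp: band_def\<close>)
 have "synth G \<in> Lp_space q TR"
 proof -
  have "synth G \<in> Lp_space 2 TR" by (rule synth_L2(1)[OF G supp])
  moreover have "synth G \<in> Lp_space 4 TR"
   by (rule hausdorff_young_synth(1)[OF band_L2_L43(1)[OF G supp], where N = "max N 1"]) (use s1 in auto)
  ultimately show ?thesis
   using p unfolding fexp_def q_def by (elim disjE; hypsubst; simp)
 qed
 hence sL: "(%z. cnj (synth G z)) \<in> Lp_space q TR" by (auto simp: Lp_space_def)
 note tL = truncated_bound(1)[OF p f(1), folded q_def]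
 note f' = f(2,3)[folded q_def]
 have c: "cutoff R f \<in> Lp_space p TR" for R using cutoff_Lp[OF f(1)] q by simp
 let ?P = "%n. LINT k|ZR. truncated_fourier (real n) f k * cnj (G k)"
 have "(%n::nat. LINT k|ZR. truncated_fourier (real n) f k * cnj (G k)) \<longlonglongrightarrow> (LINT k|ZR. F k * cnj (G k))"
 proof (rule Lim_null_comparison[THEN LIM_zero_cancel])
  show "\<forall>\<^sub>F n in sequentially. norm ((?P n) - (LINT k|ZR. F k * cnj (G k)))
   <= Lp_norm q ZR (%k. truncated_fourier (real n) f k - F k) * Lp_norm p ZR (%k. cnj (G k))"
  proof (intro always_eventually allI)
   fix n
   have "(?P n) - (LINT k|ZR. F k * cnj (G k))
     = (LINT k|ZR. (truncated_fourier (real n) f k - F k) * cnj (G k))"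
    using holder(1)[OF tL[of "real n"] GL q(1) pp(1) q(3)] holder(1)[OF f'(1) GL q(1) pp(1) q(3)]
    by (simp add: left_diff_distrib)
   thus "norm ((?P n) - (LINT k|ZR. F k * cnj (G k)))
   <= Lp_norm q ZR (%k. truncated_fourier (real n) f k - F k) * Lp_norm p ZR (%k. cnj (G k))"
    using holder(3)[OF Lp_diff(1)[OF tL[of "real n"] f'(1) q(4)] GL q(1) pp(1) q(3)] by simp
  qed
  show "(%n::nat. Lp_norm q ZR (%k. truncated_fourier (real n) f k - F k) * Lp_norm p ZR (%k. cnj (G k))) \<longlonglongrightarrow> 0"
   using tendsto_mult_right[OF f'(2)] by fastforce
 qed
 moreover have "(%n::nat. LINT k|ZR. truncated_fourier (real n) f k * cnj (G k)) \<longlonglongrightarrow> (LINT z|TR. f z * cnj (synth G z))"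
 proof (rule Lim_null_comparison[THEN LIM_zero_cancel])
  show "\<forall>\<^sub>F n in sequentially. norm ((?P n) - (LINT z|TR. f z * cnj (synth G z)))
   <= Lp_norm p TR (%z. f z - cutoff (real n) f z) * Lp_norm q TR (%z. cnj (synth G z))"
  proof (intro always_eventually allI)
   fix n
   have "(?P n) = (LINT z|TR. cutoff (real n) f z * cnj (synth G z))"
    unfolding truncated_fourier_eq by (rule pairing_integrable[OF cutoff_integrable[OF f(1) pp(1)] Gi])
   hence "(?P n) - (LINT z|TR. f z * cnj (synth G z))
     = - (LINT z|TR. (f z - cutoff (real n) f z) * cnj (synth G z))"
    using holder(1)[OF f(1) sL pp(1) q(1,2)] holder(1)[OF c sL pp(1) q(1,2)]
    by (simp add: left_diff_distrib)
   thus "norm ((?P n) - (LINT z|TR. f z * cnj (synth G z)))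
   <= Lp_norm p TR (%z. f z - cutoff (real n) f z) * Lp_norm q TR (%z. cnj (synth G z))"
    using holder(3)[OF Lp_diff(1)[OF f(1) c q(5)] sL pp(1) q(1,2), of "real n"] by simp
  qed
  show "(%n::nat. Lp_norm p TR (%z. f z - cutoff (real n) f z) * Lp_norm q TR (%z. cnj (synth G z))) \<longlonglongrightarrow> 0"
   using tendsto_mult_right[OF filterlim_compose[OF cutoff_tendsto[OF f(1) q(5)] filterlim_real_sequentially]] by fastforce
 qed
 ultimately show ?thesis by (rule LIMSEQ_unique)
qed

text \<open>Both transforms are limits of the same truncated transforms, in different norms; along a
  common subsequence these converge almost everywhere to each of the two.\<close>

lemma is_fourier_consistent:
 assumes "is_fourier (4/3) f F" "is_fourier 2 f G"
 shows "AE k in ZR. F k = G k"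
proof -
 note F = is_fourierD[OF assms(1), simplified] and G = is_fourierD[OF assms(2), simplified]
 have t: "truncated_fourier R f \<in> Lp_space 4 ZR" "truncated_fourier R f \<in> Lp_space 2 ZR" for R
  using truncated_bound(1)[OF fexp_simps(2) F(1)] truncated_bound(1)[OF fexp_simps(1) G(1)] by simp_all
 have "\<exists>r. strict_mono r \<and> (AE k in ZR. (%n. truncated_fourier (real (r n)) f k) \<longlonglongrightarrow> F k)"
  by (rule Lp_subseq_AE[OF Lp_diff(1)[OF t(1) F(2)] _ F(3)]) auto
 then obtain r where r: "strict_mono r" "AE k in ZR. (%n. truncated_fourier (real (r n)) f k) \<longlonglongrightarrow> F k" by auto
 have "\<exists>s. strict_mono s \<and> (AE k in ZR. (%n. truncated_fourier (real (r (s n))) f k) \<longlonglongrightarrow> G k)"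
  using LIMSEQ_subseq_LIMSEQ[OF G(3) r(1)]
  by (intro Lp_subseq_AE[OF Lp_diff(1)[OF t(2) G(2)]]) (auto simp: comp_def)
 then obtain s where s: "strict_mono s" "AE k in ZR. (%n. truncated_fourier (real (r (s n))) f k) \<longlonglongrightarrow> G k" by auto
 show ?thesis
  using r(2) s(2)
 proof eventually_elim
  case (elim k)
  from LIMSEQ_subseq_LIMSEQ[OF elim(1) s(1)] elim(2) show ?case
   by (auto simp: comp_def intro: LIMSEQ_unique)
 qed
qed

declare TR_sections [measurable del] ZR_sections [measurable del] measurable_fst_circle [measurable del]

subsection \<open>The kernel of the weight \<open>exp (- \<bar>t\<bar>)\<close>\<close>

lemma nn_integral_exp_neg: "(NN t|lborel. ennreal (exp (- t)) * indicator {0..} t) = 1"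
proof -
 have "(NN t|lborel. ennreal (exp (- t)) * indicator {0..} t) = ennreal (0 - (- exp (- 0)))"
 proof (rule nn_integral_FTC_atLeast)
  show "((%t::real. - exp (- t)) \<longlongrightarrow> 0) at_top"
   using tendsto_minus[OF filterlim_compose[OF exp_at_bot filterlim_uminus_at_bot_at_top]] by simp
 qed (auto intro!: derivative_eq_intros)
 thus ?thesis by simp
qed

lemma integrable_exp_half: "integrable lborel (%t. indicator {0..} t *\<^sub>R exp (- t :: real))"
proof -
 have "(NN t|lborel. ennreal (norm (indicator {0..} t *\<^sub>R exp (- t :: real)))) =
   (NN t|lborel. ennreal (exp (- t)) * indicator {0..} t)"
  by (intro nn_integral_cong) (auto split: split_indicator)
 thus ?thesis by (simp add: integrable_iff_bounded nn_integral_exp_neg)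
qed

lemma integral_exp_cis_half:
 "integrable lborel (%t. indicator {0..} t *\<^sub>R (exp (- t) *\<^sub>R cis (- (t * \<tau>))))"
 "(LINT t|lborel. indicator {0..} t *\<^sub>R (exp (- t) *\<^sub>R cis (- (t * \<tau>)))) = 1 / (1 + \<i> * of_real \<tau>)"
proof -
 define z where "z = 1 + \<i> * complex_of_real \<tau>"
 have z: "z \<noteq> 0" "Re z = 1" by (auto simp: z_def complex_eq_iff)
 define E where "E = (%t::real. exp (- z * of_real t))"
 have E: "exp (- t) *\<^sub>R cis (- (t * \<tau>)) = E t" for t
 proof -
  have "- z * of_real t = of_real (- t) + \<i> * of_real (- (t * \<tau>))"
   by (simp add: z_def algebra_simps)
  thus ?thesis
   by (simp only: E_def exp_add cis_conv_exp scaleR_conv_of_real exp_of_real)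
 qed
 have En: "cmod (E t) = exp (- t)" for t
  using z by (simp add: E_def norm_exp_eq_Re)
 have [measurable]: "E \<in> bm borel"
  unfolding E_def by (intro borel_measurable_continuous_onI continuous_intros)
 show i: "integrable lborel (%t. indicator {0..} t *\<^sub>R (exp (- t) *\<^sub>R cis (- (t * \<tau>))))"
  unfolding E
  by (rule Bochner_Integration.integrable_bound[OF integrable_exp_half]) (auto simp: En split: split_indicator)
 have fin: "(LINT t|lborel. indicator {0..real n} t *\<^sub>R E t) = (1 - E (real n)) / z" for n :: nat
 proof -
  have "(LINT t|lborel. indicator {0..real n} t *\<^sub>R E t) = (- E (real n) / z) - (- E 0 / z)"
  proof (rule integral_FTC_Icc)
   fix x :: real
   show "((%t. - E t / z) has_vector_derivative E x) (at x within {0..real n})"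
    unfolding E_def using z
    by (auto intro!: derivative_eq_intros has_vector_derivative_real_field)
  qed (auto simp: E_def intro!: continuous_intros)
  thus ?thesis by (simp add: E_def diff_divide_distrib)
 qed
 have "(%n. LINT t|lborel. indicator {0..real n} t *\<^sub>R E t) \<longlonglongrightarrow> (LINT t|lborel. indicator {0..} t *\<^sub>R E t)"
 proof (rule integral_dominated_convergence[OF _ _ integrable_exp_half])
  show "AE t in lborel. (%n. indicator {0..real n} t *\<^sub>R E t) \<longlonglongrightarrow> indicator {0..} t *\<^sub>R E t"
  proof (intro AE_I2 tendsto_eventually)
   fix t :: real
   show "\<forall>\<^sub>F n in sequentially. indicator {0..real n} t *\<^sub>R E t = indicator {0..} t *\<^sub>R E t"
    by (intro eventually_mono[OF eventually_ge_at_top[of "nat \<lceil>t\<rceil>"]]) (auto simp: indicator_def)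
  qed
 qed (auto simp: En split: split_indicator)
 moreover have "(%n::nat. (1 - E (real n)) / z) \<longlonglongrightarrow> (1 - 0) / z"
 proof (intro tendsto_intros z)
  have "(%n::nat. exp (- real n)) \<longlonglongrightarrow> 0"
   by (rule filterlim_compose[OF exp_at_bot]) (simp add: filterlim_uminus_at_bot filterlim_real_sequentially)
  thus "(%n. E (real n)) \<longlonglongrightarrow> 0"
   by (subst tendsto_norm_zero_iff[symmetric]) (simp add: En)
 qed
 ultimately show "(LINT t|lborel. indicator {0..} t *\<^sub>R (exp (- t) *\<^sub>R cis (- (t * \<tau>)))) = 1 / (1 + \<i> * of_real \<tau>)"
  unfolding E fin z_def[symmetric] using LIMSEQ_unique by fastforce
qed

text \<open>The transform of \<open>exp (- \<bar>t\<bar>)\<close> is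
  \<open>2 / (1 + \<tau>^2)\<close>, the sum of the transforms of the two one-sided exponentials.
  Moving the centre to \<open>a\<close> only contributes a factor of modulus 1.\<close>

lemma exp_abs_kernel:
 "integrable lborel (%t. complex_of_real (exp (- \<bar>t - a\<bar>)))"
 "cmod (LINT t|lborel. of_real (exp (- \<bar>t - a\<bar>)) * cis (- (t * \<tau>))) <= 2 / (1 + \<tau>\<^sup>2)"
proof -
 let ?h = "%\<tau> t. indicator {0..} t *\<^sub>R (exp (- t) *\<^sub>R cis (- (t * \<tau>)))"
 note h = integral_exp_cis_half
 have rfl: "integrable lborel (%t. ?h (- \<tau>) (- t))" "(LINT t|lborel. ?h (- \<tau>) (- t)) = (LINT t|lborel. ?h (- \<tau>) t)" for \<tau>
  using lborel_integrable_real_affine[OF h(1)[of "- \<tau>"], of "-1" 0]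
   lborel_integral_real_affine[of "-1" "?h (- \<tau>)" 0] by auto
 have ae: "AE t in lborel. ?h \<tau> t + ?h (- \<tau>) (- t) = of_real (exp (- \<bar>t\<bar>)) * cis (- (t * \<tau>))" for \<tau>
 proof -
  have "AE t in lborel. t \<noteq> (0::real)" by (intro AE_I[of _ _ "{0}"]) auto
  thus ?thesis
   by eventually_elim (auto simp: indicator_def scaleR_conv_of_real)
 qed
 have i0: "integrable lborel (%t. of_real (exp (- \<bar>t\<bar>)) * cis (- (t * \<tau>)))" for \<tau>
  by (rule integrable_cong_AE_imp[OF Bochner_Integration.integrable_add[OF h(1) rfl(1)] _ ae]) measurable
 have I0: "(LINT t|lborel. of_real (exp (- \<bar>t\<bar>)) * cis (- (t * \<tau>))) = 1 / (1 + \<i> * of_real \<tau>) + 1 / (1 - \<i> * of_real \<tau>)"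
 proof -
  have "(LINT t|lborel. of_real (exp (- \<bar>t\<bar>)) * cis (- (t * \<tau>))) = (LINT t|lborel. ?h \<tau> t + ?h (- \<tau>) (- t))"
   using ae[of \<tau>] by (intro integral_cong_AE) (auto elim!: eventually_mono)
  also have "... = (LINT t|lborel. ?h \<tau> t) + (LINT t|lborel. ?h (- \<tau>) (- t))"
   by (rule Bochner_Integration.integral_add[OF h(1) rfl(1)])
  finally show ?thesis unfolding rfl(2) h(2) by simp
 qed
 have sum: "1 / (1 + \<i> * complex_of_real \<tau>) + 1 / (1 - \<i> * of_real \<tau>) = of_real (2 / (1 + \<tau>\<^sup>2))"
 proof -
  have nz: "1 + \<i> * complex_of_real \<tau> \<noteq> 0" "1 - \<i> * complex_of_real \<tau> \<noteq> 0"
   by (auto simp: complex_eq_iff)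
  have "(1 + \<i> * complex_of_real \<tau>) * (1 - \<i> * of_real \<tau>) = of_real (1 + \<tau>\<^sup>2)"
   by (simp add: complex_eq_iff power2_eq_square)
  thus ?thesis using nz by (simp add: add_frac_eq)
 qed
 show "integrable lborel (%t. complex_of_real (exp (- \<bar>t - a\<bar>)))"
  using lborel_integrable_real_affine[OF i0[of 0], of 1 "- a"] by (simp add: add.commute)
 have "(LINT t|lborel. of_real (exp (- \<bar>t - a\<bar>)) * cis (- (t * \<tau>))) =
   (LINT t|lborel. of_real (exp (- \<bar>t\<bar>)) * cis (- ((a + t) * \<tau>)))"
  by (subst lborel_integral_real_affine[of 1 _ a]) auto
 also have "... = (LINT t|lborel. cis (- (a * \<tau>)) * (of_real (exp (- \<bar>t\<bar>)) * cis (- (t * \<tau>))))"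
 proof (rule Bochner_Integration.integral_cong[OF refl])
  fix t
  have "- ((a + t) * \<tau>) = - (a * \<tau>) + - (t * \<tau>)" by (simp add: algebra_simps)
  thus "of_real (exp (- \<bar>t\<bar>)) * cis (- ((a + t) * \<tau>)) = cis (- (a * \<tau>)) * (of_real (exp (- \<bar>t\<bar>)) * cis (- (t * \<tau>)))"
   by (simp only: cis_mult[symmetric] mult_ac)
 qed
 also have "... = cis (- (a * \<tau>)) * of_real (2 / (1 + \<tau>\<^sup>2))"
  by (simp only: integral_mult_right_zero I0 sum)
 finally show "cmod (LINT t|lborel. of_real (exp (- \<bar>t - a\<bar>)) * cis (- (t * \<tau>))) <= 2 / (1 + \<tau>\<^sup>2)"
  by (simp add: norm_mult norm_divide del: of_real_divide)
qed

text \<open>Schur's test for the quadratic form obtained by integrating over \<open>t\<close> against \<open>exp (- \<bar>t - a\<bar>)\<close>.\<close>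

theorem oscillatory_square_bound:
 fixes \<Omega> :: "'a => real"
 assumes sf: "sigma_finite_measure M" and g: "integrable M g" and \<Omega> [measurable]: "\<Omega> \<in> bm M"
  and K: "\<And>c. (NN x|M. ennreal (1 / (1 + (c - \<Omega> x)\<^sup>2))) <= ennreal K" and K0: "K >= 0"
 shows "(NN t|lborel. ennreal ((cmod (LINT x|M. g x * cis (- (t * \<Omega> x))))\<^sup>2) * indicator {a..a + 1} t)
   <= ennreal (6 * K) * (NN x|M. ennreal ((cmod (g x))\<^sup>2))"
proof -
 interpret M: sigma_finite_measure M by fact
 interpret MM: pair_sigma_finite M M by (intro pair_sigma_finite.intro sf)
 have "sigma_finite_measure (M \<Otimes>\<^sub>M M)" by unfold_locales
 then interpret PP: pair_sigma_finite "M \<Otimes>\<^sub>M M" "lborel :: real measure"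
  by (rule pair_sigma_finite.intro) (rule sigma_finite_lborel)
 have [measurable]: "g \<in> bm M" using g by auto
 define w where "w = (%t. exp (- \<bar>t - a\<bar>))"
 have wi: "integrable lborel (%t. complex_of_real (w t))" unfolding w_def by (rule exp_abs_kernel(1))
 have [measurable]: "w \<in> bm borel" unfolding w_def by measurable
 define I where "I = (%t. LINT x|M. g x * cis (- (t * \<Omega> x)))"
 have [measurable]: "I \<in> bm borel" unfolding I_def by measurable
 define P where "P = (%(x, y). g x * cnj (g y))"
 define \<Phi> where "\<Phi> = (%p. \<Omega> (fst p) - \<Omega> (snd p))"
 have Pm [measurable]: "P \<in> bm (M \<Otimes>\<^sub>M M)" "\<Phi> \<in> bm (M \<Otimes>\<^sub>M M)"
  unfolding P_def \<Phi>_def by measurable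
 have Pi: "integrable (M \<Otimes>\<^sub>M M) P"
  by (rule integrable_pair_mult[OF sf g g Pm(1)]) (simp add: P_def norm_mult)
 have II: "I t * cnj (I t) = (LINT p|(M \<Otimes>\<^sub>M M). P p * cis (- (t * \<Phi> p)))" for t
 proof -
  have int: "integrable (M \<Otimes>\<^sub>M M) (%(x, y). g x * cis (- (t * \<Omega> x)) * cnj (g y * cis (- (t * \<Omega> y))))"
   by (rule integrable_pair_mult[OF sf g g]) (auto simp: norm_mult)
  have "(LINT p|(M \<Otimes>\<^sub>M M). P p * cis (- (t * \<Phi> p))) =
    (LINT p|(M \<Otimes>\<^sub>M M). (%(x, y). g x * cis (- (t * \<Omega> x)) * cnj (g y * cis (- (t * \<Omega> y)))) p)"
  proof (rule Bochner_Integration.integral_cong[OF refl])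
   fix p
   have "- (t * \<Phi> p) = - (t * \<Omega> (fst p)) + t * \<Omega> (snd p)" by (simp add: \<Phi>_def algebra_simps)
   hence "cis (- (t * \<Phi> p)) = cis (- (t * \<Omega> (fst p))) * cis (t * \<Omega> (snd p))"
    by (simp only: cis_mult)
   thus "P p * cis (- (t * \<Phi> p)) = (%(x, y). g x * cis (- (t * \<Omega> x)) * cnj (g y * cis (- (t * \<Omega> y)))) p"
    by (simp add: P_def split_beta' cis_cnj)
  qed
  also have "... = (LINT x|M. LINT y|M. g x * cis (- (t * \<Omega> x)) * cnj (g y * cis (- (t * \<Omega> y))))"
   using MM.integral_fst[OF int] by simp
  also have "... = (LINT x|M. g x * cis (- (t * \<Omega> x)) * cnj (I t))"
   by (simp only: integral_mult_right_zero Bochner_Integration.integral_cnj I_def)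
  also have "... = I t * cnj (I t)" by (simp add: I_def)
  finally show ?thesis by simp
 qed
 have int3: "integrable ((M \<Otimes>\<^sub>M M) \<Otimes>\<^sub>M lborel) (%(p, t). P p * cis (- (t * \<Phi> p)) * of_real (w t))"
  by (rule integrable_pair_mult[OF sigma_finite_lborel Pi wi]) (auto simp: norm_mult)
 let ?J = "%p. LINT t|lborel. of_real (w t) * cis (- (t * \<Phi> p))"
 let ?L = "LINT t|lborel. w t * (cmod (I t))\<^sup>2"
 have "complex_of_real ?L = (LINT t|lborel. complex_of_real (w t * (cmod (I t))\<^sup>2))"
  by (rule integral_complex_of_real[symmetric])
 also have "... = (LINT t|lborel. LINT p|(M \<Otimes>\<^sub>M M). P p * cis (- (t * \<Phi> p)) * of_real (w t))"
 proof (rule Bochner_Integration.integral_cong[OF refl])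
  fix t
  have "(LINT p|(M \<Otimes>\<^sub>M M). P p * cis (- (t * \<Phi> p)) * of_real (w t)) = I t * cnj (I t) * of_real (w t)"
   unfolding II by (rule integral_mult_left_zero)
  thus "complex_of_real (w t * (cmod (I t))\<^sup>2) = (LINT p|(M \<Otimes>\<^sub>M M). P p * cis (- (t * \<Phi> p)) * of_real (w t))"
   by (simp only: of_real_mult complex_norm_square mult.commute)
 qed
 also have "... = (LINT p|(M \<Otimes>\<^sub>M M). LINT t|lborel. P p * cis (- (t * \<Phi> p)) * of_real (w t))"
  by (rule PP.Fubini_integral[OF int3])
 also have "... = (LINT p|(M \<Otimes>\<^sub>M M). P p * (?J p))"
 proof (rule Bochner_Integration.integral_cong[OF refl])
  fix p
  have "(LINT t|lborel. P p * cis (- (t * \<Phi> p)) * of_real (w t)) = (LINT t|lborel. P p * (of_real (w t) * cis (- (t * \<Phi> p))))"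
   by (simp add: mult_ac)
  thus "(LINT t|lborel. P p * cis (- (t * \<Phi> p)) * of_real (w t)) = P p * (?J p)"
   by (simp only: integral_mult_right_zero)
 qed
 finally have R: "complex_of_real ?L =
   (LINT p|(M \<Otimes>\<^sub>M M). P p * (?J p))" .
 have nnR: "0 <= ?L"
  by (intro integral_nonneg_AE) (auto simp: w_def)
 have Ib: "cmod (I t) <= (LINT x|M. cmod (g x))" for t
  unfolding I_def by (rule order_trans[OF integral_norm_bound]) (simp add: norm_mult)
 have wI: "integrable lborel (%t. w t * (cmod (I t))\<^sup>2)"
 proof (rule Bochner_Integration.integrable_bound)
  show "integrable lborel (%t. complex_of_real (w t) * of_real ((LINT x|M. cmod (g x))\<^sup>2))"
   by (intro integrable_mult_left wi)
  show "AE t in lborel. norm (w t * (cmod (I t))\<^sup>2) <= norm (complex_of_real (w t) * of_real ((LINT x|M. cmod (g x))\<^sup>2))"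
   unfolding of_real_mult[symmetric] norm_of_real real_norm_def abs_mult abs_power2
   using Ib by (intro AE_I2 mult_left_mono power_mono) auto
 qed measurable
 let ?d = "%p. 1 + (\<Phi> p)\<^sup>2"
 have kern: "cmod (?J p) <= 2 / (?d p)" for p
  unfolding w_def by (rule exp_abs_kernel(2))
 let ?N = "NN x|M. ennreal ((cmod (g x))\<^sup>2)"
 have "ennreal ?L =
   ennreal (cmod (LINT p|(M \<Otimes>\<^sub>M M). P p * (?J p)))"
  unfolding R[symmetric] using nnR by simp
 also have "... <= (NN p|(M \<Otimes>\<^sub>M M). ennreal (cmod (P p * (?J p))))"
  by (cases "integrable (M \<Otimes>\<^sub>M M) (%p. P p * (?J p))")
    (auto intro!: integral_norm_bound_ennreal simp: not_integrable_integral_eq)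
 also have "... <= (NN p|(M \<Otimes>\<^sub>M M). ennreal ((cmod (g (fst p)))\<^sup>2 / (?d p)) + ennreal ((cmod (g (snd p)))\<^sup>2 / (?d p)))"
 proof (intro nn_integral_mono)
  fix p
  have pos: "1 + (\<Phi> p)\<^sup>2 > 0" by (simp add: add_pos_nonneg)
  have "cmod (P p * (?J p)) <= cmod (P p) * (2 / (?d p))"
   unfolding norm_mult by (intro mult_left_mono kern) auto
  also have "... = 2 * cmod (g (fst p)) * cmod (g (snd p)) / (?d p)"
   by (simp add: P_def split_beta' norm_mult)
  also have "... <= ((cmod (g (fst p)))\<^sup>2 + (cmod (g (snd p)))\<^sup>2) / (?d p)"
   using pos sum_squares_bound[of "cmod (g (fst p))" "cmod (g (snd p))"] by (intro divide_right_mono) auto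
  finally have "cmod (P p * (?J p)) <=
   (cmod (g (fst p)))\<^sup>2 / (?d p) + (cmod (g (snd p)))\<^sup>2 / (?d p)"
   by (simp only: add_divide_distrib)
  from ennreal_leI[OF this] show "ennreal (cmod (P p * (?J p))) <=
   ennreal ((cmod (g (fst p)))\<^sup>2 / (?d p)) + ennreal ((cmod (g (snd p)))\<^sup>2 / (?d p))"
   using pos by (subst (asm) ennreal_plus) auto
 qed
 also have "... = (NN p|(M \<Otimes>\<^sub>M M). ennreal ((cmod (g (fst p)))\<^sup>2 / (?d p)))
   + (NN p|(M \<Otimes>\<^sub>M M). ennreal ((cmod (g (snd p)))\<^sup>2 / (?d p)))"
  by (intro nn_integral_add) measurable
 also have "(NN p|(M \<Otimes>\<^sub>M M). ennreal ((cmod (g (fst p)))\<^sup>2 / (?d p)))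
   = (NN x|M. (NN y|M. ennreal ((cmod (g x))\<^sup>2) * ennreal (1 / (1 + (\<Omega> x - \<Omega> y)\<^sup>2))))"
  by (subst M.nn_integral_fst[symmetric]) (auto simp: \<Phi>_def simp flip: ennreal_mult)
 also have "... <= (NN x|M. ennreal ((cmod (g x))\<^sup>2) * ennreal K)"
  using K by (intro nn_integral_mono) (auto simp: nn_integral_cmult intro!: mult_left_mono)
 also have "(NN p|(M \<Otimes>\<^sub>M M). ennreal ((cmod (g (snd p)))\<^sup>2 / (?d p)))
   = (NN y|M. (NN x|M. ennreal ((cmod (g y))\<^sup>2) * ennreal (1 / (1 + (\<Omega> y - \<Omega> x)\<^sup>2))))"
 proof -
  have "(NN p|(M \<Otimes>\<^sub>M M). ennreal ((cmod (g (snd p)))\<^sup>2 / (?d p)))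
   = (NN y|M. (NN x|M. ennreal ((cmod (g y))\<^sup>2 / (1 + (\<Omega> x - \<Omega> y)\<^sup>2))))"
   by (subst MM.nn_integral_snd[symmetric]) (auto simp: \<Phi>_def)
  also have "... = (NN y|M. (NN x|M. ennreal ((cmod (g y))\<^sup>2) * ennreal (1 / (1 + (\<Omega> y - \<Omega> x)\<^sup>2))))"
  proof (intro nn_integral_cong)
   fix x y
   have "(\<Omega> x - \<Omega> y)\<^sup>2 = (\<Omega> y - \<Omega> x)\<^sup>2" by (rule power2_commute)
   thus "ennreal ((cmod (g y))\<^sup>2 / (1 + (\<Omega> x - \<Omega> y)\<^sup>2)) = ennreal ((cmod (g y))\<^sup>2) * ennreal (1 / (1 + (\<Omega> y - \<Omega> x)\<^sup>2))"
    by (simp flip: ennreal_mult)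
  qed
  finally show ?thesis .
 qed
 also have "... <= (NN x|M. ennreal ((cmod (g x))\<^sup>2) * ennreal K)"
  using K by (intro nn_integral_mono) (auto simp: nn_integral_cmult intro!: mult_left_mono)
 also have "(NN x|M. ennreal ((cmod (g x))\<^sup>2) * ennreal K) = ennreal K * ?N"
  by (simp add: nn_integral_cmult mult.commute[of _ "ennreal K"])
 finally have main: "ennreal ?L <=
   ennreal K * ?N + ennreal K * ?N"
  by (simp add: add_left_mono add_right_mono)
 \<comment> \<open>On this unit interval the weight is at least \<open>exp (-1)\<close>, hence at
   least \<open>1/3\<close>. With the two copies of \<open>K\<close> coming from Schur's test this
   makes the constant 6.\<close>
 have "(NN t|lborel. ennreal ((cmod (I t))\<^sup>2) * indicator {a..a + 1} t) <= (NN t|lborel. ennreal 3 * ennreal (w t * (cmod (I t))\<^sup>2))"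
 proof (intro nn_integral_mono)
  fix t :: real
  show "ennreal ((cmod (I t))\<^sup>2) * indicator {a..a + 1} t <= ennreal 3 * ennreal (w t * (cmod (I t))\<^sup>2)"
  proof (cases "t \<in> {a..a + 1}")
   case True
   hence "\<bar>t - a\<bar> <= 1" by auto
   hence "exp (- 1) <= w t" by (simp add: w_def)
   moreover have "1 <= 3 * exp (- 1 :: real)"
    using exp_le by (simp add: exp_minus field_simps)
   ultimately have "1 * (cmod (I t))\<^sup>2 <= (3 * w t) * (cmod (I t))\<^sup>2"
    by (intro mult_right_mono) auto
   hence "ennreal ((cmod (I t))\<^sup>2) <= ennreal (3 * (w t * (cmod (I t))\<^sup>2))"
    by (intro ennreal_leI) (simp add: mult.assoc)
   also have "... = ennreal 3 * ennreal (w t * (cmod (I t))\<^sup>2)"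
    by (rule ennreal_mult) (auto simp: w_def)
   finally show ?thesis using True by simp
  qed simp
 qed
 also have "... = ennreal 3 * ennreal ?L"
 proof -
  have "(NN t|lborel. ennreal (w t * (cmod (I t))\<^sup>2)) = ennreal ?L"
   by (rule nn_integral_eq_integral[OF wI]) (auto simp: w_def)
  thus ?thesis by (subst nn_integral_cmult) simp_all
 qed
 also have "... <= ennreal 3 * (ennreal K * ?N + ennreal K * ?N)"
  by (intro mult_left_mono main) auto
 also have "... = ennreal (6 * K) * ?N"
 proof -
  have "X + X = ennreal 2 * X" for X :: ennreal by (metis ennreal_numeral mult_2)
  thus ?thesis using K0 by (simp only: ennreal_mult_merge[of 2 K] ennreal_mult_merge[of 3 "2 * K"]) (simp add: mult.assoc[symmetric])
 qed
 finally show ?thesis by (simp add: I_def)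
qed

subsection \<open>The bilinear counting estimate\<close>

lemma nn_integral_cauchy_density:
 assumes "D > 0"
 shows "(NN x|lborel. ennreal (1 / (1 + D\<^sup>2 * (x - b)\<^sup>2))) = ennreal (pi / D)"
proof -
 let ?f = "%x::real. 1 / (1 + x\<^sup>2)"
 have half: "(NN x|lborel. ennreal (?f x) * indicator {0..} x) = ennreal (pi / 2)"
 proof -
  have "(NN x|lborel. ennreal (?f x) * indicator {0..} x) = ennreal (pi / 2 - arctan 0)"
   by (rule nn_integral_FTC_atLeast)
     (auto intro!: derivative_eq_intros tendsto_arctan_at_top simp: inverse_eq_divide)
  thus ?thesis by simp
 qed
 have "(NN x|lborel. ennreal (?f x)) = (NN x|lborel. ennreal (?f x) * indicator {0..} x + ennreal (?f (- x)) * indicator {0..} (- x))"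
 proof (intro nn_integral_cong_AE)
  have "AE t in lborel. t \<noteq> (0::real)" by (intro AE_I[of _ _ "{0}"]) auto
  thus "AE x in lborel. ennreal (?f x) = ennreal (?f x) * indicator {0..} x + ennreal (?f (- x)) * indicator {0..} (- x)"
   by eventually_elim (auto simp: indicator_def)
 qed
 also have "... = ennreal (pi / 2) + ennreal (pi / 2)"
  using nn_integral_reflect[of "%x. ennreal (?f x) * indicator {0..} x"]
  by (subst nn_integral_add) (auto simp: half)
 also have "... = ennreal pi" by (simp flip: ennreal_plus)
 finally have full: "(NN x|lborel. ennreal (?f x)) = ennreal pi" .
 have "(NN x|lborel. ennreal (1 / (1 + D\<^sup>2 * (x - b)\<^sup>2)))
   = ennreal (1 / D) * (NN x|lborel. ennreal (1 / (1 + D\<^sup>2 * (b + 1 / D * x - b)\<^sup>2)))"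
  using assms by (subst nn_integral_real_affine[where c = "1 / D" and t = b]) auto
 also have "(%x. ennreal (1 / (1 + D\<^sup>2 * (b + 1 / D * x - b)\<^sup>2))) = (%x. ennreal (?f x))"
  using assms by (simp add: power_mult_distrib power_divide)
 finally show ?thesis using assms unfolding full by (simp flip: ennreal_mult)
qed

text \<open>Around each zero \<open>b\<close>, \<open>-b\<close> of \<open>A - 2 * \<eta>^2\<close>
  the square grows at least like \<open>D^2\<close> times the squared distance, up to a factor 2.
  For negative \<open>A\<close> there is no zero and \<open>b = 0\<close> serves. Each of the two
  Cauchy densities contributes \<open>2 * pi / D\<close>.\<close>

lemma parabola_kernel_bound:
 "(NN \<eta>|lborel. ennreal (1 / (1 + (A - 2 * \<eta>\<^sup>2)\<^sup>2))) <= ennreal (4 * pi / sqrt (1 + \<bar>A\<bar>))"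
proof -
 define b where "b = sqrt (max A 0 / 2)"
 define D where "D = sqrt (1 + \<bar>A\<bar>)"
 have D: "D > 0" "D\<^sup>2 = 1 + \<bar>A\<bar>" by (auto simp: D_def)
 have b: "b >= 0" by (simp add: b_def)
 let ?d = "%\<eta>. 1 + (A - 2 * \<eta>\<^sup>2)\<^sup>2"
 have key: "1 + D\<^sup>2 * (\<eta> - b)\<^sup>2 <= 2 * (?d \<eta>)" if "\<eta> >= 0" for \<eta>
 proof (cases "A >= 0")
  case True
  hence A: "A = 2 * b\<^sup>2" by (simp add: b_def)
  define x where "x = \<eta> - b"
  \<comment> \<open>The polynomial factors as \<open>-2 * x * (\<eta> + b)\<close>, and for
    nonnegative \<eta> the second factor dominates both \<open>b\<close> and
    \<open>\<bar>x\<bar>\<close>.\<close>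
  have sq: "x\<^sup>2 <= (\<eta> + b)\<^sup>2" "b\<^sup>2 <= (\<eta> + b)\<^sup>2"
   using that b by (auto simp: x_def abs_le_square_iff[symmetric])
  have *: "x\<^sup>2 * x\<^sup>2 <= x\<^sup>2 * (\<eta> + b)\<^sup>2" "x\<^sup>2 * b\<^sup>2 <= x\<^sup>2 * (\<eta> + b)\<^sup>2" "0 <= x\<^sup>2 * (\<eta> + b)\<^sup>2"
   by (rule mult_left_mono[OF sq(1)], simp, rule mult_left_mono[OF sq(2)], simp, simp)
  have "(A - 2 * \<eta>\<^sup>2)\<^sup>2 = 4 * (x\<^sup>2 * (\<eta> + b)\<^sup>2)"
   by (simp add: A x_def power2_eq_square algebra_simps)
  moreover have "0 <= (2 * x\<^sup>2 - 1/4)\<^sup>2" by simp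
  hence "x\<^sup>2 <= 1 + 4 * (x\<^sup>2 * x\<^sup>2)" by (simp add: power2_eq_square algebra_simps)
  moreover have "D\<^sup>2 * (\<eta> - b)\<^sup>2 = x\<^sup>2 + 2 * (x\<^sup>2 * b\<^sup>2)"
   unfolding D x_def[symmetric] using A True by (simp add: algebra_simps)
  moreover have aux: "1 + P <= 2 * (1 + S)"
   if "S = 4 * X" "y <= 1 + 4 * Z" "P = y + 2 * W" "Z <= X" "W <= X" "0 <= X" for P S X y Z W :: real
   using that by simp
  ultimately show ?thesis using * by blast
 next
  case False
  hence b0: "b = 0" by (simp add: b_def)
  have "(A - 2 * \<eta>\<^sup>2)\<^sup>2 = A\<^sup>2 + 4 * (\<bar>A\<bar> * \<eta>\<^sup>2) + 4 * (\<eta>\<^sup>2 * \<eta>\<^sup>2)"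
   using False by (simp add: power2_eq_square algebra_simps)
  moreover have "0 <= (2 * \<eta>\<^sup>2 - 1/4)\<^sup>2" by simp
  hence "\<eta>\<^sup>2 <= 1 + 4 * (\<eta>\<^sup>2 * \<eta>\<^sup>2)" by (simp add: power2_eq_square algebra_simps)
  moreover have "0 <= \<bar>A\<bar> * \<eta>\<^sup>2" "0 <= A\<^sup>2" "0 <= \<eta>\<^sup>2 * \<eta>\<^sup>2" by auto
  moreover have "(1 + \<bar>A\<bar>) * (\<eta> - 0)\<^sup>2 = \<eta>\<^sup>2 + \<bar>A\<bar> * \<eta>\<^sup>2" by (simp add: algebra_simps)
  moreover have "1 + P <= 2 * (1 + S)"
   if "S = T + 4 * V + 4 * Z" "y <= 1 + 4 * Z" "0 <= V" "0 <= T" "0 <= Z" "P = y + V" for P S T V y Z :: real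
   using that by simp
  ultimately show ?thesis unfolding D(2) b0 by blast
 qed
 have pt: "1 / (?d \<eta>) <= 2 * (1 / (1 + D\<^sup>2 * (\<eta> - b)\<^sup>2)) + 2 * (1 / (1 + D\<^sup>2 * (\<eta> - (- b))\<^sup>2))" for \<eta>
 proof -
  have gen: "1 / (?d \<eta>) <= 2 * (1 / (1 + D\<^sup>2 * (\<eta> - b)\<^sup>2))" if "\<eta> >= 0" for \<eta>
  proof -
   have p: "0 < 1 + D\<^sup>2 * (\<eta> - b)\<^sup>2" "0 < 1 + (A - 2 * \<eta>\<^sup>2)\<^sup>2" by (auto simp: add_pos_nonneg)
   thus ?thesis using key[OF that] by (simp add: field_simps)
  qed
  have nn: "0 <= 1 / (1 + D\<^sup>2 * (\<eta> - c)\<^sup>2)" for c by (simp add: add_nonneg_nonneg)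
  show ?thesis
  proof (cases "\<eta> >= 0")
   case True
   thus ?thesis using gen[of \<eta>] nn[of "- b"] by linarith
  next
   case False
   have e: "(- \<eta> - b)\<^sup>2 = (\<eta> - (- b))\<^sup>2" by (simp add: power2_eq_square algebra_simps)
   have "- \<eta> >= 0" using False by simp
   from gen[OF this] have "1 / (?d \<eta>) <= 2 * (1 / (1 + D\<^sup>2 * (\<eta> - (- b))\<^sup>2))"
    unfolding e power2_minus .
   thus ?thesis using nn[of b] by linarith
  qed
 qed
 have "(NN \<eta>|lborel. ennreal (1 / (?d \<eta>))) <=
   (NN \<eta>|lborel. ennreal 2 * ennreal (1 / (1 + D\<^sup>2 * (\<eta> - b)\<^sup>2)) + ennreal 2 * ennreal (1 / (1 + D\<^sup>2 * (\<eta> - (- b))\<^sup>2)))"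
 proof (intro nn_integral_mono)
  fix \<eta> :: real
  have nn: "0 <= 1 / (1 + D\<^sup>2 * (\<eta> - c)\<^sup>2)" for c by (simp add: add_nonneg_nonneg)
  show "ennreal (1 / (?d \<eta>)) <=
    ennreal 2 * ennreal (1 / (1 + D\<^sup>2 * (\<eta> - b)\<^sup>2)) + ennreal 2 * ennreal (1 / (1 + D\<^sup>2 * (\<eta> - (- b))\<^sup>2))"
   using ennreal_leI[OF pt[of \<eta>]] nn[of b] nn[of "- b"]
   by (simp only: ennreal_mult ennreal_plus mult_nonneg_nonneg zero_le_numeral)
 qed
 also have "... = ennreal 2 * ennreal (pi / D) + ennreal 2 * ennreal (pi / D)"
  using nn_integral_cauchy_density[OF D(1), of "- b"]
  by (subst nn_integral_add) (auto simp: nn_integral_cmult nn_integral_cauchy_density[OF D(1)])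
 also have "... = ennreal (4 * pi / D)"
 proof -
  have "0 <= pi / D" using D by simp
  hence "ennreal 2 * ennreal (pi / D) + ennreal 2 * ennreal (pi / D) = ennreal (2 * (pi / D) + 2 * (pi / D))"
   by (simp only: ennreal_mult ennreal_plus mult_nonneg_nonneg zero_le_numeral)
  thus ?thesis by simp
 qed
 finally show ?thesis by (simp add: D_def)
qed

text \<open>Comparison with an integral: replacing \<open>2 * n - r\<close> by
  \<open>n - r / 2 + \<theta>\<close>, with \<theta> in \<open>[0, 1)\<close>, costs at most a
  factor 3, and integrating over \<theta> turns the sum into the integral of a Cauchy
  density.\<close>

lemma integer_sum_bound:
 "(NN n|count_space UNIV. ennreal (1 / (1 + (2 * real_of_int n - r)\<^sup>2))) <= ennreal (3 * pi)"
proof -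
 define F where "F = (%x::real. ennreal (3 * (1 / (1 + 1\<^sup>2 * (x - r / 2)\<^sup>2))))"
 have [measurable]: "F \<in> bm borel" unfolding F_def by measurable
 let ?S = "(NN n|count_space UNIV. ennreal (1 / (1 + (2 * real_of_int n - r)\<^sup>2)))"
 have le: "ennreal (1 / (1 + (2 * real_of_int n - r)\<^sup>2)) <= F (\<theta> + of_int n)" if "\<theta> \<in> {0..<1}" for \<theta> n
 proof -
  define u where "u = real_of_int n - r / 2"
  have "(\<theta> + u)\<^sup>2 <= 2 * \<theta>\<^sup>2 + 2 * u\<^sup>2"
   using zero_le_power2[of "\<theta> - u"] by (simp add: power2_eq_square algebra_simps)
  moreover have "\<theta>\<^sup>2 <= 1" using that by (simp add: power_le_one)
  moreover have "(2 * real_of_int n - r)\<^sup>2 = 4 * u\<^sup>2" by (simp add: u_def power2_eq_square algebra_simps)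
  moreover have "1 + X <= 3 * (1 + Y)" if "X <= 2 * T + 2 * U" "T <= 1" "Y = 4 * U" "0 <= U" for X Y T U :: real
   using that by simp
  ultimately have "1 + (\<theta> + u)\<^sup>2 <= 3 * (1 + (2 * real_of_int n - r)\<^sup>2)" using zero_le_power2 by blast
  moreover have "0 < 1 + (\<theta> + u)\<^sup>2" "0 < 1 + (2 * real_of_int n - r)\<^sup>2" by (auto simp: add_pos_nonneg)
  ultimately have "1 / (1 + (2 * real_of_int n - r)\<^sup>2) <= 3 * (1 / (1 + (\<theta> + u)\<^sup>2))"
   by (simp add: field_simps)
  thus ?thesis unfolding F_def u_def by (intro ennreal_leI) (simp add: algebra_simps)
 qed
 have "?S = (NN (\<theta>::real)|lborel. ?S * indicator {0..<1} \<theta>)"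
  by (subst nn_integral_cmult_indicator) auto
 also have "... <= (NN \<theta>|lborel. (NN n|count_space UNIV. F (\<theta> + of_int n)) * indicator {0..<1} \<theta>)"
  using le by (intro nn_integral_mono) (auto split: split_indicator intro!: nn_integral_mono)
 also have "... = (NN x|lborel. F x)" by (rule nn_integral_periodize[symmetric]) measurable
 also have "... = ennreal 3 * (NN x|lborel. ennreal (1 / (1 + 1\<^sup>2 * (x - r / 2)\<^sup>2)))"
  unfolding F_def
  by (subst nn_integral_cmult[symmetric], measurable, intro nn_integral_cong ennreal_mult)
    (auto intro: add_nonneg_nonneg)
 also have "... = ennreal (3 * pi)"
  by (subst nn_integral_cauchy_density) (simp_all add: ennreal_mult)
 finally show ?thesis .
qed

lemma fourth_power_diff:
 assumes "x >= 0" "y >= (0::real)"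
 shows "\<bar>x - y\<bar> ^ 4 <= \<bar>x ^ 4 - y ^ 4\<bar>"
proof -
 have gen: "(x - y) ^ 4 <= x ^ 4 - y ^ 4" if "0 <= y" "y <= x" for x y :: real
 proof -
  define d where "d = x - y"
  have x: "x = d + y" and d: "d >= 0" using that by (auto simp: d_def)
  have "x ^ 4 = d ^ 4 + y ^ 4 + (4 * (d ^ 3 * y) + 6 * (d\<^sup>2 * y\<^sup>2) + 4 * (d * y ^ 3))"
   unfolding x by (simp add: power4_eq_xxxx power3_eq_cube power2_eq_square algebra_simps)
  moreover have "0 <= 4 * (d ^ 3 * y) + 6 * (d\<^sup>2 * y\<^sup>2) + 4 * (d * y ^ 3)" using d that by simp
  ultimately show ?thesis by (simp add: d_def)
 qed
 show ?thesis
 proof (cases "y <= x")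
  case True
  thus ?thesis using gen[of y x] assms by simp
 next
  case False
  thus ?thesis using gen[of x y] assms by (simp add: abs_if)
 qed
qed

text \<open>Let \<open>M\<close> be the nonnegative root of \<open>Q M = c\<close>, or 0 when
  \<open>c < 0\<close>. Both terms of \<open>Q\<close> increase with \<open>\<bar>m\<bar>\<close>,
  so the quadratic one only helps, and \<open>\<bar>c - Q m\<bar>\<close> is at least
  \<open>a\<close> times the fourth power of \<open>\<bar>m\<bar> - M\<close>. The summand thus
  decays like an inverse square around \<open>M\<close> and \<open>-M\<close>, uniformly in
  \<open>c\<close> and \<beta>. The uniformity in \<beta> matters because \<beta> will grow with the
  frequency.\<close>

lemma quartic_sum_bound:
 assumes a: "a > 0" and \<beta>: "\<beta> >= 0"
 shows "(NN n|count_space UNIV. ennreal (1 / sqrt (1 + \<bar>c - (\<beta> * (2 * real_of_int n - l)\<^sup>2 + a * (2 * real_of_int n - l) ^ 4)\<bar>)))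
  <= ennreal (sqrt (2 * (1 + 1 / a)) * (6 * pi))"
proof -
 define Q where "Q = (%m::real. \<beta> * m\<^sup>2 + a * m ^ 4)"
 \<comment> \<open>Since \<open>(1 + y^2)^2 <= 2 + 2 * y^4\<close>, it is enough that
   \<open>\<kappa>^2\<close> dominates both 2 and \<open>2 / a\<close>.\<close>
 define \<kappa> where "\<kappa> = sqrt (2 * (1 + 1 / a))"
 have \<kappa>: "\<kappa> > 0" "\<kappa>\<^sup>2 = 2 * (1 + 1 / a)" using a by (auto simp: \<kappa>_def add_pos_pos)
 obtain M where M: "M >= 0" "\<And>m. a * (\<bar>m\<bar> - M) ^ 4 <= \<bar>c - Q m\<bar>"
 proof (cases "c >= 0")
  case True
  \<comment> \<open>As \<open>r >= 1\<close>, \<open>Q r >= a * r^4 >= a * r >= c\<close>, so the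
    intermediate value theorem finds the root below \<open>r\<close>.\<close>
  define r where "r = 1 + c / a"
  have r: "r >= 1" using True a by (simp add: r_def)
  have "c <= a * r" using a by (simp add: r_def field_simps)
  also have "... <= a * r ^ 4" using a power_increasing[of 1 4 r] r by (intro mult_left_mono) auto
  also have "... <= Q r" using \<beta> by (simp add: Q_def)
  finally have "c <= Q r" .
  moreover have "Q 0 <= c" using True by (simp add: Q_def)
  moreover have "continuous_on {0..r} Q" unfolding Q_def by (intro continuous_intros)
  ultimately obtain M where M: "0 <= M" "Q M = c"
   using IVT'[of Q 0 c r] r by auto
  have "a * (\<bar>m\<bar> - M) ^ 4 <= \<bar>c - Q m\<bar>" for m
  proof -
   have "a * (\<bar>m\<bar> - M) ^ 4 = a * \<bar>\<bar>m\<bar> - M\<bar> ^ 4" by simp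
   also have "... <= a * \<bar>\<bar>m\<bar> ^ 4 - M ^ 4\<bar>" using a M by (intro mult_left_mono fourth_power_diff) auto
   also have "... <= \<bar>\<beta> * (\<bar>m\<bar>\<^sup>2 - M\<^sup>2) + a * (\<bar>m\<bar> ^ 4 - M ^ 4)\<bar>"
   proof (cases "M <= \<bar>m\<bar>")
    case True
    hence "M\<^sup>2 <= \<bar>m\<bar>\<^sup>2" "M ^ 4 <= \<bar>m\<bar> ^ 4" using M by (auto intro!: power_mono simp del: power2_abs power_even_abs_numeral)
    hence "0 <= \<beta> * (\<bar>m\<bar>\<^sup>2 - M\<^sup>2)" "0 <= a * (\<bar>m\<bar> ^ 4 - M ^ 4)" "0 <= \<bar>m\<bar> ^ 4 - M ^ 4" using a \<beta> by auto
    thus ?thesis by linarith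
   next
    case False
    hence "\<bar>m\<bar>\<^sup>2 <= M\<^sup>2" "\<bar>m\<bar> ^ 4 <= M ^ 4" by (auto intro!: power_mono simp del: power2_abs power_even_abs_numeral)
    hence "\<beta> * (\<bar>m\<bar>\<^sup>2 - M\<^sup>2) <= 0" "a * (\<bar>m\<bar> ^ 4 - M ^ 4) <= 0" "\<bar>m\<bar> ^ 4 - M ^ 4 <= 0"
     using a \<beta> by (auto simp: mult_nonneg_nonpos)
    moreover hence "a * \<bar>\<bar>m\<bar> ^ 4 - M ^ 4\<bar> = - (a * (\<bar>m\<bar> ^ 4 - M ^ 4))" by (simp add: algebra_simps)
    ultimately show ?thesis by linarith
   qed
   also have "... = \<bar>c - Q m\<bar>" unfolding M(2)[symmetric] Q_def by (simp add: algebra_simps abs_minus_commute)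
   finally show ?thesis .
  qed
  thus ?thesis using M that by blast
 next
  case False
  have "a * (\<bar>m\<bar> - 0) ^ 4 <= \<bar>c - Q m\<bar>" for m
  proof -
   have "0 <= \<beta> * m\<^sup>2" "0 <= a * m ^ 4" using a \<beta> by auto
   thus ?thesis using False by (simp add: Q_def)
  qed
  thus ?thesis using that[of 0] by blast
 qed
 have pt: "1 / sqrt (1 + \<bar>c - Q m\<bar>) <= \<kappa> * (1 / (1 + (m - M)\<^sup>2)) + \<kappa> * (1 / (1 + (m + M)\<^sup>2))" for m
 proof -
  define y where "y = \<bar>m\<bar> - M"
  have "(1 + y\<^sup>2)\<^sup>2 <= \<kappa>\<^sup>2 * (1 + a * y ^ 4)"
  proof -
   have "0 <= (1 - y\<^sup>2)\<^sup>2" by simp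
   hence "(1 + y\<^sup>2)\<^sup>2 <= 2 + 2 * y ^ 4" by (simp add: power2_eq_square power4_eq_xxxx algebra_simps)
   also have "... <= 2 + 2 * y ^ 4 + 2 / a + 2 * a * y ^ 4" using a by simp
   also have "... = \<kappa>\<^sup>2 * (1 + a * y ^ 4)" unfolding \<kappa> using a by (simp add: field_simps)
   finally show ?thesis .
  qed
  also have "... <= \<kappa>\<^sup>2 * (1 + \<bar>c - Q m\<bar>)" using M(2)[of m] by (intro mult_left_mono) (auto simp: y_def)
  also have "... = (\<kappa> * sqrt (1 + \<bar>c - Q m\<bar>))\<^sup>2" by (simp add: power_mult_distrib)
  finally have "1 + y\<^sup>2 <= \<kappa> * sqrt (1 + \<bar>c - Q m\<bar>)"
   by (rule power2_le_imp_le) (use \<kappa> in auto)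
  moreover have "0 < 1 + y\<^sup>2" "0 < sqrt (1 + \<bar>c - Q m\<bar>)" by (auto simp: add_pos_nonneg)
  ultimately have 1: "1 / sqrt (1 + \<bar>c - Q m\<bar>) <= \<kappa> * (1 / (1 + y\<^sup>2))" by (simp add: field_simps)
  have nn: "0 <= \<kappa> * (1 / (1 + x\<^sup>2))" for x using \<kappa> by (simp add: add_nonneg_nonneg)
  show ?thesis
  proof (cases "m >= 0")
   case True
   thus ?thesis using 1 nn[of "m + M"] by (simp add: y_def)
  next
   case False
   hence "y\<^sup>2 = (m + M)\<^sup>2" by (simp add: y_def power2_eq_square algebra_simps)
   thus ?thesis using 1 nn[of "m - M"] by simp
  qed
 qed
 have "(NN n|count_space UNIV. ennreal (1 / sqrt (1 + \<bar>c - Q (2 * real_of_int n - l)\<bar>)))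
  <= (NN n|count_space UNIV. ennreal \<kappa> * ennreal (1 / (1 + (2 * real_of_int n - (l + M))\<^sup>2)) + ennreal \<kappa> * ennreal (1 / (1 + (2 * real_of_int n - (l - M))\<^sup>2)))"
 proof (intro nn_integral_mono)
  fix n :: int
  have nn: "0 <= 1 / (1 + x\<^sup>2)" for x :: real by (simp add: add_nonneg_nonneg)
  have eq: "2 * real_of_int n - l - M = 2 * real_of_int n - (l + M)" "2 * real_of_int n - l + M = 2 * real_of_int n - (l - M)" by auto
  show "ennreal (1 / sqrt (1 + \<bar>c - Q (2 * real_of_int n - l)\<bar>)) <= ennreal \<kappa> * ennreal (1 / (1 + (2 * real_of_int n - (l + M))\<^sup>2)) + ennreal \<kappa> * ennreal (1 / (1 + (2 * real_of_int n - (l - M))\<^sup>2))"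
   using ennreal_leI[OF pt[of "2 * real_of_int n - l", unfolded eq]] nn \<kappa>(1)
   by (simp only: ennreal_mult ennreal_plus mult_nonneg_nonneg less_imp_le)
 qed
 also have "... = ennreal \<kappa> * (NN n|count_space UNIV. ennreal (1 / (1 + (2 * real_of_int n - (l + M))\<^sup>2)))
   + ennreal \<kappa> * (NN n|count_space UNIV. ennreal (1 / (1 + (2 * real_of_int n - (l - M))\<^sup>2)))"
  by (subst nn_integral_add) (auto simp: nn_integral_cmult)
 also have "... <= ennreal \<kappa> * ennreal (3 * pi) + ennreal \<kappa> * ennreal (3 * pi)"
  by (intro add_mono mult_left_mono integer_sum_bound) auto
 also have "... = ennreal (\<kappa> * (6 * pi))"
 proof -
  have "0 <= 3 * pi" by simp
  hence "ennreal \<kappa> * ennreal (3 * pi) + ennreal \<kappa> * ennreal (3 * pi) = ennreal (\<kappa> * (3 * pi) + \<kappa> * (3 * pi))"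
   using \<kappa>(1) by (simp only: ennreal_mult ennreal_plus mult_nonneg_nonneg less_imp_le)
  thus ?thesis by (simp add: algebra_simps)
 qed
 finally show ?thesis by (simp add: Q_def \<kappa>_def)
qed

subsection \<open>Strichartz estimates\<close>

definition omega :: "real => real => int \<times> real => real" where
 "omega \<alpha> \<epsilon> k = \<epsilon> * (real_of_int (fst k))\<^sup>2 - \<alpha> * (real_of_int (fst k)) ^ 4 + (snd k)\<^sup>2"

lemma omega_measurable [measurable]: "omega \<alpha> \<epsilon> \<in> bm ZR"
 unfolding omega_def[abs_def] by measurable

lemma multiplier_eq: "multiplier \<alpha> \<epsilon> t k = cis (- (t * omega \<alpha> \<epsilon> k))"
 by (simp add: multiplier_def omega_def cis_conv_exp split_beta')

lemma norm_multiplier [simp]: "cmod (multiplier \<alpha> \<epsilon> t k) = 1"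
 by (simp add: multiplier_eq)

lemma multiplier_add: "multiplier \<alpha> \<epsilon> (s + t) k = multiplier \<alpha> \<epsilon> s k * multiplier \<alpha> \<epsilon> t k"
 by (simp add: multiplier_eq cis_mult distrib_right)

lemma multiplier_0 [simp]: "multiplier \<alpha> \<epsilon> 0 k = 1"
 by (simp add: multiplier_eq)

lemma cnj_multiplier [simp]: "cnj (multiplier \<alpha> \<epsilon> t k) = multiplier \<alpha> \<epsilon> (- t) k"
 by (simp add: multiplier_eq cis_cnj)

lemma multiplier_measurable [measurable (raw)]:
 assumes [measurable]: "f \<in> bm M" "g \<in> measurable M ZR"
 shows "(%w. multiplier \<alpha> \<epsilon> (f w) (g w)) \<in> bm M"
 unfolding multiplier_eq by measurable

locale dispersion =
 fixes \<alpha> \<epsilon> :: real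
 assumes alpha_neg: "\<alpha> < 0" and eps_nonneg: "0 <= \<epsilon>"
begin

abbreviation mul :: "real => int \<times> real => complex" where
 "mul \<equiv> multiplier \<alpha> \<epsilon>"

abbreviation om :: "int \<times> real => real" where
 "om \<equiv> omega \<alpha> \<epsilon>"

text \<open>The factor \<open>4 * pi\<close> comes from integrating out the continuous variable, the
  rest from \<open>quartic_sum_bound\<close> with leading coefficient
  \<open>- \<alpha> / 8\<close>.\<close>

definition kernel_const :: real where
 "kernel_const = 4 * pi * (sqrt (2 * (1 + 1 / (- \<alpha> / 8))) * (6 * pi))"

lemma kernel_const_nonneg: "0 <= kernel_const"
proof -
 have "0 < - \<alpha> / 8" using alpha_neg by simp
 hence "0 <= 1 / (- \<alpha> / 8)" by (intro divide_nonneg_pos) auto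
 hence "0 <= 2 * (1 + 1 / (- \<alpha> / 8))" by (intro mult_nonneg_nonneg add_nonneg_nonneg) auto
 thus ?thesis unfolding kernel_const_def by (intro mult_nonneg_nonneg real_sqrt_ge_zero) auto
qed

text \<open>With \<open>m = 2 n\<^sub>1 - n\<close> and \<open>\<eta> = \<xi>\<^sub>1 - \<xi> / 2\<close>, the phase is a constant plus
 \<open>(\<epsilon>/2 - 6\<alpha>n\<^sup>2/8) m\<^sup>2 - (\<alpha>/8) m\<^sup>4 + 2\<eta>\<^sup>2\<close>.\<close>

lemma bilinear_kernel_bound:
 "(NN l|ZR. ennreal (1 / (1 + (c - (om l + om (k - l)))\<^sup>2))) <= ennreal kernel_const"
proof -
 obtain n \<xi> where k: "k = (n, \<xi>)" by (cases k)
 define a where "a = - \<alpha> / 8"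
 define \<beta> where "\<beta> = \<epsilon> / 2 - 6 * \<alpha> * (real_of_int n)\<^sup>2 / 8"
 define c' where "c' = c - (\<epsilon> * (real_of_int n)\<^sup>2 / 2 - \<alpha> * (real_of_int n) ^ 4 / 8 + \<xi>\<^sup>2 / 2)"
 define Q where "Q = (%m::real. \<beta> * m\<^sup>2 + a * m ^ 4)"
 have a: "a > 0" using alpha_neg by (simp add: a_def)
 have \<beta>: "\<beta> >= 0" using alpha_neg eps_nonneg
  using mult_nonpos_nonneg[of \<alpha> "(real_of_int n)\<^sup>2"] by (simp add: \<beta>_def)
 have ph: "c - (om (m, x) + om (k - (m, x))) = (c' - Q (2 * real_of_int m - n)) - 2 * (- (\<xi> / 2) + x)\<^sup>2" for m x
 proof -
  define u where "u = real_of_int m"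
  define v where "v = real_of_int n"
  have "\<epsilon> * u\<^sup>2 - \<alpha> * u ^ 4 + x\<^sup>2 + (\<epsilon> * (v - u)\<^sup>2 - \<alpha> * (v - u) ^ 4 + (\<xi> - x)\<^sup>2) =
   \<epsilon> * v\<^sup>2 / 2 - \<alpha> * v ^ 4 / 8 + \<xi>\<^sup>2 / 2 + ((\<epsilon> / 2 - 6 * \<alpha> * v\<^sup>2 / 8) * (2 * u - v)\<^sup>2 + (- \<alpha> / 8) * (2 * u - v) ^ 4)
   + 2 * (- (\<xi> / 2) + x)\<^sup>2"
   by (simp add: power2_eq_square power4_eq_xxxx field_simps)
  thus ?thesis
   by (simp add: omega_def k c'_def Q_def \<beta>_def a_def u_def v_def)
 qed
 have m: "(%l. ennreal (1 / (1 + (c - (om l + om (k - l)))\<^sup>2))) \<in> bm (count_space UNIV \<Otimes>\<^sub>M lborel)"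
 proof -
  have "(%l. ennreal (1 / (1 + (c - (om l + om (k - l)))\<^sup>2))) \<in> bm ZR" by measurable
  thus ?thesis by (simp add: ZR_def)
 qed
 have "(NN l|ZR. ennreal (1 / (1 + (c - (om l + om (k - l)))\<^sup>2)))
   = (NN m|count_space UNIV. (NN x|lborel. ennreal (1 / (1 + (c - (om (m, x) + om (k - (m, x))))\<^sup>2))))"
  unfolding ZR_def using lborel.nn_integral_fst[OF m] by simp
 also have "... = (NN m|count_space UNIV. (NN x|lborel. ennreal (1 / (1 + ((c' - Q (2 * real_of_int m - n)) - 2 * x\<^sup>2)\<^sup>2))))"
 proof (rule nn_integral_cong)
  fix m
  show "(NN x|lborel. ennreal (1 / (1 + (c - (om (m, x) + om (k - (m, x))))\<^sup>2)))
   = (NN x|lborel. ennreal (1 / (1 + ((c' - Q (2 * real_of_int m - n)) - 2 * x\<^sup>2)\<^sup>2)))"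
   unfolding ph
   using nn_integral_real_affine[of "%x. ennreal (1 / (1 + ((c' - Q (2 * real_of_int m - n)) - 2 * x\<^sup>2)\<^sup>2))" 1 "- (\<xi> / 2)"]
   by simp
 qed
 also have "... <= (NN m|count_space UNIV. ennreal (4 * pi / sqrt (1 + \<bar>c' - Q (2 * real_of_int m - n)\<bar>)))"
  by (rule nn_integral_mono) (rule parabola_kernel_bound)
 also have "... = (NN m|count_space UNIV. ennreal (4 * pi) * ennreal (1 / sqrt (1 + \<bar>c' - Q (2 * real_of_int m - n)\<bar>)))"
  by (intro nn_integral_cong) (subst ennreal_mult[symmetric], auto)
 also have "... = ennreal (4 * pi) * (NN m|count_space UNIV. ennreal (1 / sqrt (1 + \<bar>c' - Q (2 * real_of_int m - n)\<bar>)))"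
  by (rule nn_integral_cmult) simp
 also have "... <= ennreal (4 * pi) * ennreal (sqrt (2 * (1 + 1 / a)) * (6 * pi))"
  unfolding Q_def by (intro mult_left_mono quartic_sum_bound a \<beta>) simp
 also have "... = ennreal kernel_const"
 proof -
  have "0 <= sqrt (2 * (1 + 1 / a)) * (6 * pi)" using a by simp
  hence "ennreal (4 * pi) * ennreal (sqrt (2 * (1 + 1 / a)) * (6 * pi)) = ennreal (4 * pi * (sqrt (2 * (1 + 1 / a)) * (6 * pi)))"
   by (intro ennreal_mult[symmetric]) auto
  thus ?thesis by (simp only: kernel_const_def a_def)
 qed
 finally show ?thesis .
qed

text \<open>A fourth root, because the estimate bounds a fourth power; the summand 1 keeps it
  strictly positive.\<close>

definition strich :: real where
 "strich = root 4 ((2 * pi)\<^sup>2 * (6 * kernel_const) + 1)"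

lemma strich: "strich > 0" "(2 * pi)\<^sup>2 * (6 * kernel_const) <= strich ^ 4"
proof -
 have "0 <= (2 * pi)\<^sup>2 * (6 * kernel_const)" using kernel_const_nonneg by simp
 hence p: "0 < (2 * pi)\<^sup>2 * (6 * kernel_const) + 1" by linarith
 thus "strich > 0" unfolding strich_def by (intro real_root_gt_zero) auto
 show "(2 * pi)\<^sup>2 * (6 * kernel_const) <= strich ^ 4"
  unfolding strich_def using p by (subst real_root_pow_pos2) auto
qed

text \<open>By \<open>synth_quartic\<close> the fourth power becomes the square of a convolution,
  which for fixed \<open>k\<close> is an oscillatory integral in \<open>l\<close> with phase
  \<open>om l + om (k - l)\<close>. Taking the time integral inside the one over \<open>k\<close>
  allows \<open>oscillatory_square_bound\<close> with one constant for all \<open>k\<close>; what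
  remains is the convolution of \<open>\<bar>G\<bar>^2\<close> with itself, of total mass
  \<open>X * X\<close>.\<close>

theorem strichartz_synth:
 assumes G: "G \<in> Lp_space 2 ZR" and supp: "\<And>k. k \<notin> band N ==> G k = 0" and N: "N > 0"
 shows "(NN t|lborel. pint 4 TR (synth (%k. mul t k * G k)) * indicator {a..a + 1} t)
  <= ennreal ((strich * Lp_norm 2 ZR G) ^ 4)"
proof -
 interpret Z2: pair_sigma_finite ZR ZR by (intro pair_sigma_finite.intro sigma_finite_ZR)
 have [measurable]: "G \<in> bm ZR" using G by (simp add: Lp_space_def)
 have Gi: "integrable ZR G" by (rule band_integrable[OF G _ supp]) auto
 define b where "b = (%k. ennreal ((cmod (G k))\<^sup>2))"
 have [measurable]: "b \<in> bm ZR" unfolding b_def by measurable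
 define X where "X = (NN k|ZR. b k)"
 have X: "X = ennreal ((Lp_norm 2 ZR G)\<^sup>2)" using pint_eq[OF G] by (simp add: X_def b_def pint_def)
 have shift: "(NN k|ZR. b (k - l)) = X" for l
  unfolding X_def by (subst (2) distr_ZR_shift[symmetric, of l]) (simp add: nn_integral_distr)
 have rfl: "(NN l|ZR. b (k - l)) = X" for k
  unfolding X_def by (subst (2) distr_ZR_reflect[symmetric, of k]) (simp add: nn_integral_distr)
 define g where "g = (%k l. G l * G (k - l))"
 have gi: "integrable ZR (g k)" for k
  unfolding integrable_iff_bounded
 proof
  have k: "k \<in> space ZR" by simp
  note k [measurable]
  show "g k \<in> bm ZR" unfolding g_def by measurable
  have "(NN l|ZR. ennreal (norm (g k l))) <= (NN l|ZR. b l + b (k - l))"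
  proof (intro nn_integral_mono)
   fix l
   have "cmod (G l) * cmod (G (k - l)) <= (cmod (G l))\<^sup>2 + (cmod (G (k - l)))\<^sup>2"
    using sum_squares_bound[of "cmod (G l)" "cmod (G (k - l))"] mult_nonneg_nonneg[OF norm_ge_zero[of "G l"] norm_ge_zero[of "G (k - l)"]]
    by linarith
   thus "ennreal (norm (g k l)) <= b l + b (k - l)"
    unfolding b_def g_def norm_mult using ennreal_leI by (subst ennreal_plus[symmetric]) fastforce+
  qed
  also have "... = X + X" by (subst nn_integral_add) (auto simp: rfl X_def)
  also have "... < \<infinity>" by (simp add: X)
  finally show "(NN l|ZR. ennreal (norm (g k l))) < \<infinity>" .
 qed
 let ?U = "%t. %k. mul t k * G k"
 have cv: "conv (?U t) (?U t) k = (LINT l|ZR. g k l * cis (- (t * (om l + om (k - l)))))" for t k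
 proof -
  have "cis (- (t * (om l + om (k - l)))) = mul t l * mul t (k - l)" for l
   by (simp add: multiplier_eq cis_mult distrib_left)
  thus ?thesis by (simp add: conv_def g_def mult_ac)
 qed
 have jm: "(%(t, k). ennreal ((cmod (conv (?U t) (?U t) k))\<^sup>2) * indicator {a..a + 1} t)
   \<in> bm LZ"
  unfolding conv_def by measurable
 have "(NN t|lborel. pint 4 TR (synth (?U t)) * indicator {a..a + 1} t)
  <= (NN t|lborel. ennreal ((2 * pi)\<^sup>2) * (pint 2 ZR (conv (?U t) (?U t)) * indicator {a..a + 1} t))"
 proof (intro nn_integral_mono)
  fix t
  have "integrable ZR (?U t)"
   by (rule Bochner_Integration.integrable_bound[OF Gi]) (auto simp: norm_mult)
  hence "pint 4 TR (synth (?U t)) <= ennreal ((2 * pi)\<^sup>2) * pint 2 ZR (conv (?U t) (?U t))"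
   by (rule synth_quartic[OF _ _ N]) (simp add: supp)
  thus "pint 4 TR (synth (?U t)) * indicator {a..a + 1} t
   <= ennreal ((2 * pi)\<^sup>2) * (pint 2 ZR (conv (?U t) (?U t)) * indicator {a..a + 1} t)"
   by (auto split: split_indicator)
 qed
 also have "... = ennreal ((2 * pi)\<^sup>2) * (NN t|lborel. (NN k|ZR. ennreal ((cmod (conv (?U t) (?U t) k))\<^sup>2) * indicator {a..a + 1} t))"
 proof -
  have "pint 2 ZR (conv (?U t) (?U t)) * indicator {a..a + 1} t
   = (NN k|ZR. ennreal ((cmod (conv (?U t) (?U t) k))\<^sup>2) * indicator {a..a + 1} t)" for t
   unfolding pint_def by (subst nn_integral_multc[symmetric]) auto
  thus ?thesis
   using ZR.borel_measurable_nn_integral_fst[OF jm] by (simp add: nn_integral_cmult)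
 qed
 also have "(NN t|lborel. (NN k|ZR. ennreal ((cmod (conv (?U t) (?U t) k))\<^sup>2) * indicator {a..a + 1} t))
   = (NN k|ZR. (NN t|lborel. ennreal ((cmod (conv (?U t) (?U t) k))\<^sup>2) * indicator {a..a + 1} t))"
  by (rule LZ.Fubini'[symmetric]) (use jm in simp)
 also have "... <= (NN k|ZR. ennreal (6 * kernel_const) * (NN l|ZR. b l * b (k - l)))"
 proof (rule nn_integral_mono)
  fix k
  have k: "k \<in> space ZR" by simp
  note k [measurable]
  have "(%l. om l + om (k - l)) \<in> bm ZR" by measurable
  from oscillatory_square_bound[OF sigma_finite_ZR gi[of k] this bilinear_kernel_bound kernel_const_nonneg, of a]
  show "(NN t|lborel. ennreal ((cmod (conv (?U t) (?U t) k))\<^sup>2) * indicator {a..a + 1} t)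
   <= ennreal (6 * kernel_const) * (NN l|ZR. b l * b (k - l))"
   unfolding cv by (simp add: g_def b_def norm_mult power_mult_distrib ennreal_mult)
 qed
 also have "... = ennreal (6 * kernel_const) * (NN k|ZR. (NN l|ZR. b l * b (k - l)))"
  by (rule nn_integral_cmult) measurable
 also have "(NN k|ZR. (NN l|ZR. b l * b (k - l))) = (NN l|ZR. (NN k|ZR. b l * b (k - l)))"
  by (rule Z2.Fubini') measurable
 also have "... = X * X"
  by (simp add: nn_integral_cmult nn_integral_multc shift) (simp add: X_def)
 also have "ennreal ((2 * pi)\<^sup>2) * (ennreal (6 * kernel_const) * (X * X)) = ennreal ((2 * pi)\<^sup>2 * (6 * kernel_const) * (Lp_norm 2 ZR G) ^ 4)"
  using kernel_const_nonneg
  by (subst ennreal_mult_merge) (auto simp: X power2_eq_square power4_eq_xxxx mult.assoc ennreal_mult[symmetric])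
 also have "... <= ennreal ((strich * Lp_norm 2 ZR G) ^ 4)"
  using strich(2) by (intro ennreal_leI) (auto simp: power_mult_distrib intro!: mult_right_mono)
 finally show ?thesis by (simp add: mult_left_mono)
qed

end

lemma norm_integral_le_nn:
 "ennreal (cmod (LINT x|M. f x)) <= (NN x|M. ennreal (cmod (f x)))"
 by (cases "integrable M f") (auto intro!: integral_norm_bound_ennreal simp: not_integrable_integral_eq)

subsection \<open>Space-time norms\<close>

abbreviation LT :: "(real \<times> real \<times> real) measure" where
 "LT \<equiv> lborel \<Otimes>\<^sub>M TR"

text \<open>Extension by zero outside the times in \<open>I\<close>, so that norms over different
  intervals live on the single measure space \<open>LT\<close> and can be compared and
  added.\<close>

definition slab :: "real set => (real => real \<times> real => complex) => real \<times> real \<times> real => complex" where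
 "slab I f w = indicator I (fst w) * f (fst w) (snd w)"

lemma slab_measurable [measurable]:
 assumes [measurable]: "(%(t, z). f t z) \<in> bm LT" "I \<in> sets borel"
 shows "slab I f \<in> bm LT"
proof -
 have [measurable]: "(%w. f (fst w) (snd w)) \<in> bm LT" using assms(1) by (simp add: split_beta')
 show ?thesis unfolding slab_def[abs_def] by measurable
qed

lemma section_measurable:
 assumes "(%(t, z). f t z) \<in> bm (lborel \<Otimes>\<^sub>M M)"
 shows "f t \<in> bm M"
 using measurable_Pair2[OF assms, of t] by simp

lemma pint_param_measurable [measurable]:
 assumes M: "sigma_finite_measure M" and f: "(%(t, z). f t z) \<in> bm (T \<Otimes>\<^sub>M M)"
 shows "(%t. pint p M (f t)) \<in> bm T"
proof -
 interpret sigma_finite_measure M by fact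
 have [measurable]: "(%w. f (fst w) (snd w)) \<in> bm (T \<Otimes>\<^sub>M M)" using f by (simp add: split_beta')
 show ?thesis unfolding pint_def by measurable
qed

lemma pint_slab:
 assumes f: "(%(t, z). f t z) \<in> bm LT" and I [measurable]: "I \<in> sets borel" and p: "p > 0"
 shows "pint p LT (slab I f) = (NN t|lborel. pint p TR (f t) * indicator I t)"
proof -
 have [measurable]: "slab I f \<in> bm LT" using f by measurable
 have "pint p LT (slab I f) = (NN t|lborel. (NN z|TR. ennreal (cmod (slab I f (t, z)) powr p)))"
  unfolding pint_def by (subst TR.nn_integral_fst[symmetric]) auto
 also have "... = (NN t|lborel. pint p TR (f t) * indicator I t)"
  by (rule nn_integral_cong) (use p in \<open>auto simp: slab_def pint_def norm_mult split: split_indicator\<close>)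
 finally show ?thesis .
qed

text \<open>Norm convergence gives pointwise convergence only along a subsequence; extracting it
  from a subsequence that realises the lower limit loses nothing.\<close>

lemma Lp_fatou_liminf:
 assumes fg: "\<And>n. (%x. f n x - g x) \<in> Lp_space p M" and p: "p > 0"
  and m: "\<And>n. f n \<in> bm M" "g \<in> bm M"
  and lim: "(%n. Lp_norm p M (%x. f n x - g x)) \<longlonglongrightarrow> 0" and q: "q > 0"
 shows "pint q M g <= liminf (%n. pint q M (f n))"
proof -
 obtain r where r: "strict_mono r" "((%n. pint q M (f n)) \<circ> r) \<longlonglongrightarrow> liminf (%n. pint q M (f n))"
  using liminf_subseq_lim by blast
 have "\<exists>s. strict_mono s \<and> (AE x in M. (%n. f (r (s n)) x) \<longlonglongrightarrow> g x)"
  using LIMSEQ_subseq_LIMSEQ[OF lim r(1)] by (intro Lp_subseq_AE[OF fg p]) (auto simp: comp_def)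
 then obtain s where s: "strict_mono s" "AE x in M. (%n. f (r (s n)) x) \<longlonglongrightarrow> g x" by auto
 have l: "(%n. pint q M (f (r (s n)))) \<longlonglongrightarrow> liminf (%n. pint q M (f n))"
  using LIMSEQ_subseq_LIMSEQ[OF r(2) s(1)] by (simp add: comp_def)
 show ?thesis
 proof (rule dense_ge)
  fix B assume B: "liminf (%n. pint q M (f n)) < B"
  have "\<forall>\<^sub>F n in sequentially. pint q M (f (r (s n))) <= B"
   by (rule eventually_mono[OF order_tendstoD(2)[OF l B]]) simp
  thus "pint q M g <= B"
   by (intro pint_fatou[where f = "%n. f (r (s n))"] m s(2) q)
 qed
qed

text \<open>Transfers \<open>L^4\<close> bounds that are uniform in the band to the function itself,
  which at each time is known only as an \<open>L^2\<close> limit of its band-limited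
  pieces.\<close>

lemma slab_fatou:
 assumes u: "(%(t, z). u t z) \<in> bm LT" and G: "(%(t, k). G t k) \<in> bm LZ"
  and uG: "\<And>t. t \<in> I ==> is_fourier 2 (u t) (G t)" and I [measurable]: "I \<in> sets borel"
  and B: "\<And>n::nat. n > 0 ==> (NN t|lborel. pint 4 TR (bandsynth n (G t)) * indicator I t) <= B"
 shows "pint 4 LT (slab I u) <= B"
proof -
 have bm: "(%(t, z). bandsynth n (G t) z) \<in> bm LT" for n
  by (rule bandsynth_param_measurable[OF G])
 note [measurable] = pint_param_measurable[OF sigma_finite_TR bm]
 have "pint 4 LT (slab I u) <= (NN t|lborel. liminf (%n. pint 4 TR (bandsynth n (G t)) * indicator I t))"
  unfolding pint_slab[OF u I zero_less_numeral]
 proof (rule nn_integral_mono)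
  fix t
  show "pint 4 TR (u t) * indicator I t <= liminf (%n. pint 4 TR (bandsynth n (G t)) * indicator I t)"
  proof (cases "t \<in> I")
   case True
   note f = uG[OF True]
   have GL: "G t \<in> Lp_space 2 ZR" using is_fourierD(2)[OF f] by simp
   have "pint 4 TR (u t) <= liminf (%n. pint 4 TR (bandsynth n (G t)))"
    using is_fourierD(1)[OF is_fourier_bandsynth[OF GL]] is_fourierD(1)[OF f] bandsynth_tendsto[OF f]
    by (intro Lp_fatou_liminf[where p = 2] Lp_diff(1)) (auto simp: Lp_space_def)
   thus ?thesis using True by simp
  qed simp
 qed
 also have "... <= liminf (%n. (NN t|lborel. pint 4 TR (bandsynth n (G t)) * indicator I t))"
  by (rule nn_integral_liminf) measurable
 also have "... <= B"
  using B by (intro Liminf_le eventually_mono[OF eventually_gt_at_top[of 0]]) auto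
 finally show ?thesis .
qed

lemma Lp_norm_pow4:
 assumes "f \<in> Lp_space 4 M" shows "pint 4 M f = ennreal ((Lp_norm 4 M f) ^ 4)"
 using pint_eq[OF assms] by simp

lemma Lp4I:
 assumes "f \<in> bm M" "0 <= B" "pint 4 M f <= ennreal (B ^ 4)"
 shows "f \<in> Lp_space 4 M" "Lp_norm 4 M f <= B"
 using Lp_normI[OF assms(1) _ assms(2), of 4] assms(2,3) by auto

lemma band_holder:
 assumes F: "F \<in> Lp_space 4 ZR"
 shows "(NN k|ZR. ennreal (cmod (F k)) * indicator (band N) k) <=
  ennreal (Lp_norm 4 ZR F * Lp_norm (4/3) ZR (indicator (band N)))"
proof -
 have i: "(indicator (band N) :: int \<times> real => complex) \<in> Lp_space (4/3) ZR"
  by (rule Lp_band_bounded[where B = 1 and N = N]) (auto split: split_indicator)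
 have "(NN k|ZR. ennreal (cmod (F k)) * indicator (band N) k) =
  (NN k|ZR. ennreal (cmod (F k) * cmod (indicator (band N) k :: complex)))"
  by (rule nn_integral_cong) (auto split: split_indicator)
 also have "... <= ennreal (Lp_norm 4 ZR F * Lp_norm (4/3) ZR (indicator (band N)))"
  by (rule holder_nn[OF F i]) auto
 finally show ?thesis .
qed

subsection \<open>The Duhamel integral on the Fourier side\<close>

text \<open>Forcing in \<open>L^(4/3)\<close> of space-time has slices in \<open>L^(4/3)\<close> at
  almost every time only, so \<open>H\<close> is tied to \<open>h\<close> at almost every
  time.\<close>

locale duhamel = dispersion +
 fixes h :: "real => real \<times> real => complex" and H :: "real => int \<times> real => complex"
 assumes h_meas: "(%(t, z). h t z) \<in> bm LT"
  and h_fin: "pint (4/3) LT (slab UNIV h) < \<infinity>"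
  and H_meas: "(%(t, k). H t k) \<in> bm LZ"
  and hH: "AE s in lborel. is_fourier (4/3) (h s) (H s)"
begin

lemma H_meas' [measurable]: "(%w. H (fst w) (snd w)) \<in> bm LZ"
 using H_meas by (simp add: split_beta')

lemma H_comp [measurable]:
 assumes [measurable]: "f \<in> bm M" "g \<in> measurable M ZR"
 shows "(%w. H (f w) (g w)) \<in> bm M"
proof -
 have "(%w. (f w, g w)) \<in> measurable M LZ" by measurable
 from measurable_compose[OF this H_meas] show ?thesis by simp
qed

lemma H_t_meas [measurable]: "H t \<in> bm ZR"
 by (rule section_measurable[OF H_meas])

lemma h_t_meas [measurable]: "h t \<in> bm TR"
 by (rule section_measurable[OF h_meas])

lemma pint_h_meas [measurable]: "(%t. pint (4/3) TR (h t)) \<in> bm borel"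
 using pint_param_measurable[OF sigma_finite_TR h_meas] by simp

definition \<theta> :: "real => real" where
 "\<theta> t = enn2real (pint (4/3) TR (h t))"

lemma \<theta>_meas [measurable]: "\<theta> \<in> bm borel"
 unfolding \<theta>_def[abs_def] by measurable

lemma \<theta>_nonneg: "0 <= \<theta> t" by (simp add: \<theta>_def)

lemma pint_h_AE: "AE t in lborel. pint (4/3) TR (h t) = ennreal (\<theta> t)"
proof -
 have "(NN t|lborel. pint (4/3) TR (h t)) < \<infinity>"
  using h_fin by (simp add: pint_slab[OF h_meas])
 hence "AE t in lborel. pint (4/3) TR (h t) \<noteq> \<infinity>"
  by (intro nn_integral_PInf_AE) auto
 thus ?thesis by eventually_elim (simp add: \<theta>_def less_top)
qed

lemma \<theta>_integrable: "integrable lborel \<theta>"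
proof -
 have "(NN t|lborel. ennreal (\<theta> t)) = (NN t|lborel. pint (4/3) TR (h t))"
  using pint_h_AE by (intro nn_integral_cong_AE) auto
 thus ?thesis
  using h_fin \<theta>_nonneg by (simp add: integrable_iff_bounded pint_slab[OF h_meas])
qed

text \<open>The power \<open>4/3\<close> of the forcing norm on \<open>[a, b]\<close> instead of the
  norm: the power is additive in the interval and continuous in its right end, so it can be halved.
  Norms reappear as \<open>Y a b powr (3/4)\<close>.\<close>

definition Y :: "real => real => real" where
 "Y a b = (LINT t|lborel. \<theta> t * indicator {a..b} t)"

lemma Y_integrable: "integrable lborel (%t. \<theta> t * indicator {a..b} t)"
 by (rule integrable_real_mult_indicator[OF _ \<theta>_integrable]) simp

lemma Y_nonneg: "0 <= Y a b"
 unfolding Y_def by (intro integral_nonneg_AE) (auto simp: \<theta>_nonneg)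

lemma Y_eq: "pint (4/3) LT (slab {a..b} h) = ennreal (Y a b)"
proof -
 have "pint (4/3) LT (slab {a..b} h) = (NN t|lborel. pint (4/3) TR (h t) * indicator {a..b} t)"
  by (rule pint_slab[OF h_meas]) auto
 also have "... = (NN t|lborel. ennreal (\<theta> t * indicator {a..b} t))"
  using pint_h_AE by (intro nn_integral_cong_AE) (auto elim!: eventually_mono split: split_indicator)
 also have "... = ennreal (Y a b)"
  unfolding Y_def by (intro nn_integral_eq_integral Y_integrable) (auto simp: \<theta>_nonneg)
 finally show ?thesis .
qed

lemma Y_add:
 assumes "a <= c" "c <= b"
 shows "Y a b = Y a c + Y c b"
proof -
 have "Y a c + Y c b = (LINT t|lborel. \<theta> t * indicator {a..c} t + \<theta> t * indicator {c..b} t)"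
  unfolding Y_def by (rule Bochner_Integration.integral_add[symmetric]) (rule Y_integrable)+
 also have "... = Y a b"
  unfolding Y_def
 proof (intro integral_cong_AE)
  have "AE t in lborel. t \<noteq> c" by (intro AE_I[of _ _ "{c}"]) auto
  thus "AE t in lborel. \<theta> t * indicator {a..c} t + \<theta> t * indicator {c..b} t = \<theta> t * indicator {a..b} t"
   by eventually_elim (use assms in \<open>auto split: split_indicator\<close>)
 qed auto
 finally show ?thesis by simp
qed

lemma Y_mono: "a <= a' ==> b' <= b ==> Y a' b' <= Y a b"
 unfolding Y_def
 by (intro integral_mono Y_integrable) (auto simp: \<theta>_nonneg split: split_indicator)

lemma Y_continuous: "continuous_on {a..b} (%x. Y a x)"
proof -
 have "set_integrable lborel {a..b} \<theta>"
  unfolding set_integrable_def using Y_integrable[of a b] by (simp add: mult.commute)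
 hence io: "\<theta> integrable_on {a..b}" by (rule set_borel_integral_eq_integral(1))
 have "Y a x = integral {a..x} \<theta>" if "x \<in> {a..b}" for x
 proof -
  have "set_integrable lborel {a..x} \<theta>"
   unfolding set_integrable_def using Y_integrable[of a x] by (simp add: mult.commute)
  from set_borel_integral_eq_integral(2)[OF this] show ?thesis
   by (simp add: Y_def set_lebesgue_integral_def mult.commute)
 qed
 thus ?thesis
  by (subst continuous_on_cong[OF refl, where g = "%x. integral {a..x} \<theta>"])
    (auto intro: indefinite_integral_continuous_1[OF io])
qed

lemma Y_same: "Y a a = 0"
 unfolding Y_def
proof (rule integral_eq_zero_AE)
 show "AE t in lborel. \<theta> t * indicator {a..a} t = 0"
  using AE_lborel_singleton[of a] by eventually_elim auto
qed

lemma Y_halve: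
 assumes "a <= b"
 obtains c where "a <= c" "c <= b" "Y a c = Y a b / 2" "Y c b = Y a b / 2"
proof -
 have "Y a a = 0" by (rule Y_same)
 then obtain c where c: "a <= c" "c <= b" "Y a c = Y a b / 2"
  using IVT'[of "%x. Y a x" a "Y a b / 2" b] assms Y_continuous[of a b] Y_nonneg[of a b] by auto
 with Y_add[of a c b] that show ?thesis by auto
qed

text \<open>The exact slice norm \<open>\<theta> s powr (3/4)\<close> is replaced by
  \<open>1 + \<theta> s\<close>, which is integrable on bounded time intervals; this crude bound is
  used for finiteness in Fubini, never in the final constants.\<close>

lemma h_norm_AE:
 "AE s in lborel. h s \<in> Lp_space (4/3) TR \<and> Lp_norm (4/3) TR (h s) <= 1 + \<theta> s \<and>
   H s \<in> Lp_space 4 ZR \<and> Lp_norm 4 ZR (H s) <= 2 * pi * (1 + \<theta> s)"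
 using hH pint_h_AE
proof eventually_elim
 case (elim s)
 note f = is_fourierD[OF elim(1), simplified]
 have "Lp_norm (4/3) TR (h s) powr (4/3) = \<theta> s"
  using pint_eq[OF f(1)] elim(2) \<theta>_nonneg[of s] by simp
 hence "(Lp_norm (4/3) TR (h s) powr (4/3)) powr (3/4) = \<theta> s powr (3/4)" by simp
 hence "Lp_norm (4/3) TR (h s) = \<theta> s powr (3/4)" by (simp add: powr_powr)
 also have "... <= 1 + \<theta> s"
 proof (cases "\<theta> s <= 1")
  case True
  hence "\<theta> s powr (3/4) <= 1" using \<theta>_nonneg[of s] by (intro powr_le1) auto
  thus ?thesis using \<theta>_nonneg[of s] by simp
 next
  case False
  hence "\<theta> s powr (3/4) <= \<theta> s powr 1" by (intro powr_mono) auto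
  thus ?thesis using False by simp
 qed
 finally have n: "Lp_norm (4/3) TR (h s) <= 1 + \<theta> s" .
 have "Lp_norm 4 ZR (H s) <= 2 * pi * Lp_norm (4/3) TR (h s)"
  using is_fourier_norm(1)[OF fexp_simps(2) elim(1)] by simp
 also have "... <= 2 * pi * (1 + \<theta> s)" using n by (intro mult_left_mono) auto
 finally show ?case using f n by simp
qed

text \<open>Frequencies at which the integrand is locally integrable in time. Elsewhere the Bochner
  integrals in \<open>W\<close> may take their default value 0, and additivity in time may
  fail.\<close>

definition good :: "int \<times> real => bool" where
 "good k \<longleftrightarrow> (\<forall>n::nat. (NN s|lborel. ennreal (cmod (H s k)) * indicator {- real n..real n} s) < \<infinity>)"

text \<open>On a band and a bounded time interval, Holder in the frequency against the indicator of
  the band and Tonelli make the double integral finite; countably many bands and intervals exhaust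
  everything.\<close>

lemma good_AE: "AE k in ZR. good k"
proof -
 have "AE k in ZR. k \<in> band (real N) --> (NN s|lborel. ennreal (cmod (H s k)) * indicator {- real n..real n} s) \<noteq> \<infinity>"
  for N n :: nat
 proof -
  let ?I = "indicator {- real n..real n} :: real => ennreal"
  define c where "c = Lp_norm (4/3) ZR (indicator (band (real N)))"
  have "(NN k|ZR. (NN s|lborel. ennreal (cmod (H s k)) * ?I s) * indicator (band (real N)) k)
   = (NN k|ZR. (NN s|lborel. ennreal (cmod (H s k)) * indicator (band (real N)) k * ?I s))"
   by (intro nn_integral_cong) (auto split: split_indicator)
  also have "... = (NN s|lborel. (NN k|ZR. ennreal (cmod (H s k)) * indicator (band (real N)) k * ?I s))"
   by (rule LZ.Fubini') measurable
  also have "... = (NN s|lborel. (NN k|ZR. ennreal (cmod (H s k)) * indicator (band (real N)) k) * ?I s)"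
   by (intro nn_integral_cong nn_integral_multc) measurable
  also have "... <= (NN s|lborel. ennreal (2 * pi * c) * (ennreal (1 + \<theta> s) * ?I s))"
  proof (rule nn_integral_mono_AE)
   show "AE s in lborel. (NN k|ZR. ennreal (cmod (H s k)) * indicator (band (real N)) k) * ?I s
    <= ennreal (2 * pi * c) * (ennreal (1 + \<theta> s) * ?I s)"
    using h_norm_AE
   proof eventually_elim
    case (elim s)
    have "(NN k|ZR. ennreal (cmod (H s k)) * indicator (band (real N)) k) <= ennreal (Lp_norm 4 ZR (H s) * c)"
     unfolding c_def by (rule band_holder) (use elim in simp)
    also have "... <= ennreal (2 * pi * (1 + \<theta> s) * c)"
     using elim by (intro ennreal_leI mult_right_mono) (auto simp: c_def)
    also have "... = ennreal (2 * pi * c) * ennreal (1 + \<theta> s)"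
     using \<theta>_nonneg[of s] by (subst ennreal_mult[symmetric]) (auto simp: c_def mult_ac)
    finally show ?case by (auto split: split_indicator)
   qed
  qed
  also have "... = ennreal (2 * pi * c) * (NN s|lborel. ennreal (1 + \<theta> s) * ?I s)"
   by (rule nn_integral_cmult) measurable
  also have "(NN s|lborel. ennreal (1 + \<theta> s) * ?I s) <= (NN s|lborel. ?I s + ennreal (\<theta> s))"
   using \<theta>_nonneg by (intro nn_integral_mono) (auto split: split_indicator)
  also have "... = (NN s|lborel. ?I s) + (NN s|lborel. ennreal (\<theta> s))"
   by (rule nn_integral_add) measurable
  also have "... = ennreal (real n - (- real n)) + ennreal (LINT s|lborel. \<theta> s)"
   using nn_integral_eq_integral[OF \<theta>_integrable] \<theta>_nonneg by simp
  finally have le: "(NN k|ZR. (NN s|lborel. ennreal (cmod (H s k)) * ?I s) * indicator (band (real N)) k)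
   <= ennreal (2 * pi * c) * (ennreal (real n - (- real n)) + ennreal (LINT s|lborel. \<theta> s))"
   by (simp add: mult_left_mono)
  also have "... < \<infinity>" by (simp add: ennreal_mult_less_top)
  finally have "(NN k|ZR. (NN s|lborel. ennreal (cmod (H s k)) * ?I s) * indicator (band (real N)) k) \<noteq> \<infinity>"
   by simp
  hence "AE k in ZR. (NN s|lborel. ennreal (cmod (H s k)) * ?I s) * indicator (band (real N)) k \<noteq> \<infinity>"
   by (intro nn_integral_PInf_AE) auto
  thus ?thesis by eventually_elim auto
 qed
 hence "AE k in ZR. \<forall>N n. k \<in> band (real N) --> (NN s|lborel. ennreal (cmod (H s k)) * indicator {- real n..real n} s) \<noteq> \<infinity>"
  unfolding AE_all_countable by blast
 thus ?thesis
 proof eventually_elim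
  case (elim k)
  obtain N :: nat where "k \<in> band (real N)"
  proof
   show "k \<in> band (real (nat \<lceil>max \<bar>real_of_int (fst k)\<bar> \<bar>snd k\<bar>\<rceil>))"
    unfolding band_def by auto linarith+
  qed
  with elim show ?case by (auto simp: good_def less_top)
 qed
qed

lemma integrand_measurable: "(%s. mul (- s) k * H s k) \<in> bm borel"
proof -
 have k: "(%s. k) \<in> measurable borel ZR" by (rule measurable_const) simp
 note k [measurable]
 show ?thesis by measurable
qed

lemma good_integrable:
 assumes k: "good k" and A [measurable]: "A \<in> sets borel" and bd: "A \<subseteq> {-r..r}"
 shows "integrable lborel (%s. indicator A s *\<^sub>R (mul (- s) k * H s k))"
proof -
 note integrand_measurable[of k, measurable]
 have "(NN s|lborel. ennreal (norm (indicator A s *\<^sub>R (mul (- s) k * H s k))))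
   <= (NN s|lborel. ennreal (cmod (H s k)) * indicator {- real (nat \<lceil>r\<rceil>)..real (nat \<lceil>r\<rceil>)} s)"
 proof (rule nn_integral_mono)
  fix s
  show "ennreal (norm (indicator A s *\<^sub>R (mul (- s) k * H s k))) <= ennreal (cmod (H s k)) * indicator {- real (nat \<lceil>r\<rceil>)..real (nat \<lceil>r\<rceil>)} s"
  proof (cases "s \<in> A")
   case True
   hence "s \<in> {-r..r}" using bd by auto
   hence "s \<in> {- real (nat \<lceil>r\<rceil>)..real (nat \<lceil>r\<rceil>)}" by auto linarith+
   thus ?thesis using True by (simp add: norm_mult)
  qed simp
 qed
 also have "... < \<infinity>" using k by (simp add: good_def)
 finally show ?thesis by (simp add: integrable_iff_bounded)
qed

text \<open>The sign convention of the oriented integral from 0 to \<open>t\<close>; at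
  \<open>t = 0\<close> the two indicators cancel.\<close>

definition sgt :: "real => real => real" where
 "sgt t s = indicator {0..t} s - indicator {t..0} s"

text \<open>The Duhamel integral with the outer group factor \<open>mul t\<close> stripped off. Its
  increments are integrals over the intermediate times alone, which would not hold with
  \<open>mul (t - s)\<close> under the integral.\<close>

definition W :: "real => int \<times> real => complex" where
 "W t k = (LINT s|lborel. sgt t s *\<^sub>R (mul (- s) k * H s k))"

lemma W_meas: "(%(t, k). W t k) \<in> bm LZ"
proof -
 have eq: "sgt t s = (if 0 <= s \<and> s <= t then 1 else 0) - (if t <= s \<and> s <= 0 then 1 else 0)" for t s
  by (auto simp: sgt_def)
 have "(%w. LINT s|lborel. sgt (fst w) s *\<^sub>R (mul (- s) (snd w) * H s (snd w))) \<in> bm LZ"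
  unfolding eq by measurable
 thus ?thesis by (simp add: W_def split_beta')
qed

lemma W_comp [measurable]:
 assumes [measurable]: "f \<in> bm M" "g \<in> measurable M ZR"
 shows "(%w. W (f w) (g w)) \<in> bm M"
proof -
 have "(%w. (f w, g w)) \<in> measurable M LZ" by measurable
 from measurable_compose[OF this W_meas] show ?thesis by simp
qed

lemma W_t_meas [measurable]: "W t \<in> bm ZR"
 by (rule section_measurable[OF W_meas])

lemma W_0: "W 0 k = 0"
 by (simp add: W_def sgt_def)

lemma sgt_integrable:
 assumes "good k"
 shows "integrable lborel (%s. sgt t s *\<^sub>R (mul (- s) k * H s k))"
proof -
 have "integrable lborel (%s. indicator {0..t} s *\<^sub>R (mul (- s) k * H s k))"
  "integrable lborel (%s. indicator {t..0} s *\<^sub>R (mul (- s) k * H s k))"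
  by (rule good_integrable[OF assms, where r = "\<bar>t\<bar>"]; auto)+
 thus ?thesis by (simp add: sgt_def scaleR_left_diff_distrib)
qed

lemma W_increment:
 assumes k: "good k" and ab: "a <= b"
 shows "W b k - W a k = (LINT s|lborel. indicator {a..b} s *\<^sub>R (mul (- s) k * H s k))"
proof -
 note integrand_measurable[of k, measurable]
 have "W b k - W a k = (LINT s|lborel. sgt b s *\<^sub>R (mul (- s) k * H s k) - sgt a s *\<^sub>R (mul (- s) k * H s k))"
  unfolding W_def by (rule Bochner_Integration.integral_diff[symmetric]) (rule sgt_integrable[OF k])+
 also have "... = (LINT s|lborel. indicator {a..b} s *\<^sub>R (mul (- s) k * H s k))"
 proof (intro integral_cong_AE)
  have "AE s in lborel. s \<noteq> 0 \<and> s \<noteq> a \<and> s \<noteq> b"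
   using AE_lborel_singleton[of 0] AE_lborel_singleton[of a] AE_lborel_singleton[of b]
   by eventually_elim auto
  thus "AE s in lborel. sgt b s *\<^sub>R (mul (- s) k * H s k) - sgt a s *\<^sub>R (mul (- s) k * H s k) =
    indicator {a..b} s *\<^sub>R (mul (- s) k * H s k)"
  proof eventually_elim
   case (elim s)
   hence "sgt b s - sgt a s = indicator {a..b} s"
    using ab by (auto simp: sgt_def split: split_indicator)
   thus ?case by (simp flip: scaleR_left_diff_distrib)
  qed
 qed (auto simp: sgt_def)
 finally show ?thesis .
qed

text \<open>Fubini moves the test function under the time integral, where
  \<open>is_fourier_pairing\<close> turns the frequency pairing into one of \<open>h\<close> with
  the free evolution of \<open>G\<close>. Holder with \<open>4/3\<close> and 4 and
  \<open>strichartz_synth\<close> finish.\<close>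

lemma dual_strichartz_test:
 assumes ab: "a <= b" "b <= a + 1"
  and G: "G \<in> Lp_space 2 ZR" and supp: "\<And>k. k \<notin> band N ==> G k = 0" and N: "N > 0"
 shows "cmod (LINT k|ZR. (W b k - W a k) * cnj (G k)) <= strich * Y a b powr (3/4) * Lp_norm 2 ZR G"
proof -
 have [measurable]: "G \<in> bm ZR" using G by (simp add: Lp_space_def)
 have G43: "G \<in> Lp_space (4/3) ZR" by (rule band_L2_L43(1)[OF G supp])
 define I where "I = (indicator {a..b} :: real => real)"
 have [measurable]: "I \<in> bm borel" unfolding I_def by measurable
 have Ii: "I s = 0 \<or> I s = 1" for s by (auto simp: I_def indicator_def)
 let ?g = "%s k. mul s k * G k"
 have gL: "?g s \<in> Lp_space 2 ZR" "Lp_norm 2 ZR (?g s) <= Lp_norm 2 ZR G" for s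
 proof -
  have m: "(%k. mul s k * G k) \<in> bm ZR" by measurable
  show "?g s \<in> Lp_space 2 ZR" by (rule Lp_mono(1)[OF _ _ G m]) (auto simp: norm_mult)
  show "Lp_norm 2 ZR (?g s) <= Lp_norm 2 ZR G" by (rule Lp_mono(2)[OF _ _ G m]) (auto simp: norm_mult)
 qed
 have gs: "?g s k = 0" if "k \<notin> band N" for s k using supp[OF that] by simp
 let ?P = "%s k. I s *\<^sub>R (mul (- s) k * H s k) * cnj (G k)"
 have pm: "(%w. ?P (fst w) (snd w)) \<in> bm LZ" by measurable
 have int: "integrable LZ (%(s, k). ?P s k)"
  unfolding integrable_iff_bounded
 proof
  show "(%(s, k). ?P s k) \<in> bm LZ" using pm by (simp add: split_beta')
  define c where "c = 2 * pi * Lp_norm (4/3) ZR G"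
  have "(NN w|LZ. ennreal (norm ((%(s, k). ?P s k) w)))
   = (NN s|lborel. (NN k|ZR. ennreal (norm (?P s k))))"
   using pm by (subst ZR.nn_integral_fst[symmetric]) (auto simp: split_beta')
  also have "... <= (NN s|lborel. ennreal (c * (I s + \<theta> s)))"
  proof (rule nn_integral_mono_AE)
   show "AE s in lborel. (NN k|ZR. ennreal (norm (?P s k))) <= ennreal (c * (I s + \<theta> s))"
    using h_norm_AE
   proof eventually_elim
    case (elim s)
    show ?case
    proof (cases "I s = 0")
     case False
     hence I1: "I s = 1" using Ii[of s] by simp
     have "(NN k|ZR. ennreal (norm (?P s k))) = (NN k|ZR. ennreal (cmod (H s k) * cmod (G k)))"
      by (simp add: I1 norm_mult)
     also have "... <= ennreal (Lp_norm 4 ZR (H s) * Lp_norm (4/3) ZR G)"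
      by (rule holder_nn[OF _ G43]) (use elim in auto)
     also have "... <= ennreal (2 * pi * (1 + \<theta> s) * Lp_norm (4/3) ZR G)"
      using elim by (intro ennreal_leI mult_right_mono) auto
     also have "2 * pi * (1 + \<theta> s) * Lp_norm (4/3) ZR G = c * (I s + \<theta> s)" by (simp add: c_def I1)
     finally show ?thesis .
    qed (simp add: zero_ennreal_def[symmetric])
   qed
  qed
  also have "... < \<infinity>"
  proof -
   have "integrable lborel (%s. c * (I s + \<theta> s))"
    unfolding I_def
    by (intro integrable_mult_right Bochner_Integration.integrable_add \<theta>_integrable integrable_real_indicator)
      (auto simp: emeasure_lborel_Icc_eq)
   moreover have "0 <= c * (I s + \<theta> s)" for s using \<theta>_nonneg[of s] Ii[of s] by (auto simp: c_def)
   ultimately show ?thesis by (subst nn_integral_eq_integral) auto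
  qed
  finally show "(NN w|LZ. ennreal (norm ((%(s, k). ?P s k) w))) < \<infinity>" .
 qed
 let ?S = "%s z. synth (?g s) z"
 have Sm: "(%(s, z). ?S s z) \<in> bm LT"
 proof -
  have "(%w. LINT k|ZR. mul (fst w) k * G k * cchar k (snd w)) \<in> bm LT" by measurable
  thus ?thesis by (simp add: synth_def split_beta')
 qed
 have "(LINT k|ZR. (W b k - W a k) * cnj (G k)) = (LINT k|ZR. LINT s|lborel. ?P s k)"
 proof (rule integral_cong_AE)
  show "AE k in ZR. (W b k - W a k) * cnj (G k) = (LINT s|lborel. ?P s k)"
   using good_AE
  proof eventually_elim
   case (elim k)
   show ?case unfolding W_increment[OF elim ab(1)] I_def by (rule integral_mult_left_zero[symmetric])
  qed
  show "(%k. LINT s|lborel. ?P s k) \<in> bm ZR" by measurable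
 qed measurable
 also have "... = (LINT s|lborel. LINT k|ZR. ?P s k)"
  by (rule LZ.Fubini_integral[OF int])
 finally have "ennreal (cmod (LINT k|ZR. (W b k - W a k) * cnj (G k))) = ennreal (cmod (LINT s|lborel. LINT k|ZR. ?P s k))" by simp
 also have "... <= (NN s|lborel. ennreal (cmod (LINT k|ZR. ?P s k)))"
  by (rule norm_integral_le_nn)
 also have "... <= (NN s|lborel. (NN z|TR. ennreal (cmod (slab {a..b} h (s, z)) * cmod (slab {a..b} ?S (s, z)))))"
 proof (rule nn_integral_mono_AE)
  show "AE s in lborel. ennreal (cmod (LINT k|ZR. ?P s k)) <= (NN z|TR. ennreal (cmod (slab {a..b} h (s, z)) * cmod (slab {a..b} ?S (s, z))))"
   using hH
  proof eventually_elim
   case (elim s)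
   show ?case
   proof (cases "s \<in> {a..b}")
    case True
    hence I1: "I s = 1" by (simp add: I_def)
    have "(LINT k|ZR. ?P s k) = (LINT k|ZR. H s k * cnj (?g s k))"
     by (simp add: I1 mult_ac)
    also have "... = (LINT z|TR. h s z * cnj (?S s z))"
     by (rule is_fourier_pairing[OF fexp_simps(2) elim gL(1) gs])
    finally have "ennreal (cmod (LINT k|ZR. ?P s k)) = ennreal (cmod (LINT z|TR. h s z * cnj (?S s z)))" by simp
    also have "... <= (NN z|TR. ennreal (cmod (h s z * cnj (?S s z))))"
     by (rule norm_integral_le_nn)
    finally show ?thesis using True by (simp add: slab_def norm_mult)
   qed (simp add: I_def slab_def)
  qed
 qed
 also have "... = (NN w|LT. ennreal (cmod (slab {a..b} h w) * cmod (slab {a..b} ?S w)))"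
 proof -
  have [measurable]: "slab {a..b} h \<in> bm LT" "slab {a..b} ?S \<in> bm LT"
   using h_meas Sm by (auto intro!: slab_measurable)
  show ?thesis by (rule TR.nn_integral_fst[of "%w. ennreal (cmod (slab {a..b} h w) * cmod (slab {a..b} ?S w))"]) measurable
 qed
 also have "... <= ennreal (Y a b powr (3/4) * (strich * Lp_norm 2 ZR G))"
 proof -
  have h1: "slab {a..b} h \<in> Lp_space (4/3) LT" "Lp_norm (4/3) LT (slab {a..b} h) <= Y a b powr (3/4)"
   using Lp_normI[OF slab_measurable[OF h_meas], of "{a..b}" "4/3" "Y a b powr (3/4)"] Y_nonneg[of a b]
   by (auto simp: Y_eq powr_powr)
  have "pint 4 LT (slab {a..b} ?S) = (NN t|lborel. pint 4 TR (?S t) * indicator {a..b} t)"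
   by (rule pint_slab[OF Sm]) auto
  also have "... <= (NN t|lborel. pint 4 TR (?S t) * indicator {a..a + 1} t)"
   using ab by (intro nn_integral_mono) (auto split: split_indicator)
  also have "... <= ennreal ((strich * Lp_norm 2 ZR G) ^ 4)"
   by (rule strichartz_synth[OF G supp N])
  finally have "pint 4 LT (slab {a..b} ?S) <= ennreal ((strich * Lp_norm 2 ZR G) ^ 4)" .
  moreover have "slab {a..b} ?S \<in> bm LT" by (rule slab_measurable[OF Sm]) simp
  moreover have "0 <= strich * Lp_norm 2 ZR G" using strich by simp
  ultimately have h2: "slab {a..b} ?S \<in> Lp_space 4 LT" "Lp_norm 4 LT (slab {a..b} ?S) <= strich * Lp_norm 2 ZR G"
   using Lp4I by blast+
  show ?thesis
   by (rule order_trans[OF holder_nn[OF h1(1) h2(1)]])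
     (use h1 h2 in \<open>auto intro!: ennreal_leI mult_mono\<close>)
 qed
 finally have "cmod (LINT k|ZR. (W b k - W a k) * cnj (G k)) <= Y a b powr (3/4) * (strich * Lp_norm 2 ZR G)"
  using strich by (subst (asm) ennreal_le_iff) auto
 thus ?thesis by (simp add: mult_ac)
qed

text \<open>The increment of \<open>W\<close> is tested against its own truncations.\<close>

theorem W_increment_L2:
 assumes ab: "a <= b" "b <= a + 1"
 shows "(%k. W b k - W a k) \<in> Lp_space 2 ZR"
  "Lp_norm 2 ZR (%k. W b k - W a k) <= strich * Y a b powr (3/4)"
proof -
 define D where "D = (%k. W b k - W a k)"
 have [measurable]: "D \<in> bm ZR" unfolding D_def by measurable
 define B where "B = strich * Y a b powr (3/4)"
 have B: "B >= 0" using strich by (simp add: B_def)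
 define G where "G = (%(n::nat) k. if k \<in> band (real n) \<and> cmod (D k) <= real n then D k else 0)"
 have [measurable]: "G n \<in> bm ZR" for n
  unfolding G_def by measurable
 have "pint 2 ZR D <= ennreal (B powr 2)"
 proof (rule pint_fatou[where f = G])
  show "AE k in ZR. (%n. G n k) \<longlonglongrightarrow> D k"
  proof (intro AE_I2 tendsto_eventually)
   fix k
   show "\<forall>\<^sub>F n in sequentially. G n k = D k"
    by (intro eventually_mono[OF eventually_ge_at_top[of "nat \<lceil>max (cmod (D k)) (max \<bar>real_of_int (fst k)\<bar> \<bar>snd k\<bar>)\<rceil>"]])
      (auto simp: band_def G_def)
  qed
  show "\<forall>\<^sub>F n in sequentially. pint 2 ZR (G n) <= ennreal (B powr 2)"
  proof (rule eventually_mono[OF eventually_gt_at_top[of 0]])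
   fix n :: nat assume n: "0 < n"
   have Gb: "cmod (G n k) <= real n" for k by (simp add: G_def)
   have G0: "G n k = 0" if "k \<notin> band (real n)" for k using that by (simp add: G_def)
   have GL: "G n \<in> Lp_space 2 ZR" by (rule Lp_band_bounded[OF _ Gb G0]) auto
   have sq: "(Lp_norm 2 ZR (G n))\<^sup>2 = (LINT k|ZR. (cmod (G n k))\<^sup>2)"
    by (simp add: Lp_norm_def powr_half_sqrt)
   have "complex_of_real ((Lp_norm 2 ZR (G n))\<^sup>2) = (LINT k|ZR. complex_of_real ((cmod (G n k))\<^sup>2))"
    unfolding sq by (rule integral_complex_of_real[symmetric])
   also have "... = (LINT k|ZR. D k * cnj (G n k))"
    unfolding complex_norm_square by (intro Bochner_Integration.integral_cong refl) (simp add: G_def)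
   finally have "(Lp_norm 2 ZR (G n))\<^sup>2 = cmod (LINT k|ZR. D k * cnj (G n k))"
    by (metis norm_of_real abs_power2)
   also have "... <= B * Lp_norm 2 ZR (G n)"
    unfolding D_def B_def by (rule dual_strichartz_test[OF ab GL G0]) (use n in auto)
   finally have "Lp_norm 2 ZR (G n) * Lp_norm 2 ZR (G n) <= B * Lp_norm 2 ZR (G n)"
    by (simp add: power2_eq_square)
   hence "Lp_norm 2 ZR (G n) <= B"
    using B Lp_norm_nonneg[of 2 ZR "G n"] by (metis mult_right_le_imp_le order_le_less)
   thus "pint 2 ZR (G n) <= ennreal (B powr 2)"
    using pint_eq[OF GL] B by (auto intro!: ennreal_leI power_mono)
  qed
 qed auto
 from Lp_normI[OF _ _ B this]
 show "(%k. W b k - W a k) \<in> Lp_space 2 ZR" "Lp_norm 2 ZR (%k. W b k - W a k) <= strich * Y a b powr (3/4)"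
  by (auto simp: D_def B_def)
qed

text \<open>The increment bound covers time steps of length at most 1, so larger times are reached
  by induction from \<open>W 0 = 0\<close>.\<close>

lemma W_L2: "W t \<in> Lp_space 2 ZR"
proof -
 have "\<bar>t\<bar> <= real n ==> W t \<in> Lp_space 2 ZR" for n t
 proof (induction n arbitrary: t)
  case 0
  hence "W t = (%k. 0)" by (auto simp: W_0)
  thus ?case by simp
 next
  case (Suc n)
  consider "\<bar>t\<bar> <= real n" | "t > real n" | "t < - real n" by linarith
  thus ?case
  proof cases
   case 1
   thus ?thesis by (rule Suc.IH)
  next
   case 2
   have "(%k. (W t k - W (real n) k) + W (real n) k) \<in> Lp_space 2 ZR"
    using 2 Suc.prems by (intro Lp_add(1) W_increment_L2(1) Suc.IH) auto
   thus ?thesis by simp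
  next
   case 3
   have "(%k. W (- real n) k - (W (- real n) k - W t k)) \<in> Lp_space 2 ZR"
    using 3 Suc.prems by (intro Lp_diff(1) W_increment_L2(1) Suc.IH) auto
   thus ?thesis by simp
  qed
 qed
 from this[of t "nat \<lceil>\<bar>t\<bar>\<rceil>"] show ?thesis by simp
qed

end

subsection \<open>The retarded Strichartz estimate\<close>

context dispersion
begin

lemma strichartz_bandsynth:
 assumes F: "F \<in> Lp_space 2 ZR" and n: "n > 0"
 shows "(NN t|lborel. pint 4 TR (bandsynth n (%k. mul t k * F k)) * indicator {a..a + 1} t)
  <= ennreal ((strich * Lp_norm 2 ZR F) ^ 4)"
proof -
 have [measurable]: "F \<in> bm ZR" using F by (simp add: Lp_space_def)
 let ?G = "%k. indicator (band (real n)) k * F k"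
 have GL: "?G \<in> Lp_space 2 ZR" "Lp_norm 2 ZR ?G <= Lp_norm 2 ZR F"
  by (rule Lp_mono[OF _ _ F]; auto split: split_indicator)+
 have "pint 4 TR (bandsynth n (%k. mul t k * F k)) <= pint 4 TR (synth (%k. mul t k * ?G k))" for t
 proof (rule pint_mono_AE, intro AE_I2)
  fix z
  have "bandsynth n (%k. mul t k * F k) z = synth (%k. mul t k * ?G k) z / (2 * pi)\<^sup>2"
   by (simp add: bandsynth_def mult_ac)
  moreover have "1 <= (2 * pi)\<^sup>2" using pi_gt3 by (intro one_le_power) auto
  ultimately show "cmod (bandsynth n (%k. mul t k * F k) z) <= cmod (synth (%k. mul t k * ?G k) z)"
   by (simp add: norm_divide norm_mult norm_power divide_le_eq mult_left_le_imp_le) (simp add: mult_le_cancel_left1)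
 qed simp
 hence "(NN t|lborel. pint 4 TR (bandsynth n (%k. mul t k * F k)) * indicator {a..a + 1} t)
  <= (NN t|lborel. pint 4 TR (synth (%k. mul t k * ?G k)) * indicator {a..a + 1} t)"
  by (intro nn_integral_mono mult_right_mono) auto
 also have "... <= ennreal ((strich * Lp_norm 2 ZR ?G) ^ 4)"
  by (rule strichartz_synth[OF GL(1), where N = "real n"]) (use n in auto)
 also have "... <= ennreal ((strich * Lp_norm 2 ZR F) ^ 4)"
  using GL(2) strich by (intro ennreal_leI power_mono mult_left_mono) auto
 finally show ?thesis .
qed

text \<open>A Bernstein bound, whose constant grows with the band. It only starts the bisection,
  which then removes the constant.\<close>

lemma bandsynth_L4:
 assumes F: "F \<in> Lp_space 2 ZR" and n: "n > 0"
 shows "pint 4 TR (bandsynth n F) <= ennreal ((sqrt (2 * pi) * measure ZR (band (real n)) powr (1/4) * Lp_norm 2 ZR F) ^ 4)"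
proof -
 have [measurable]: "F \<in> bm ZR" using F by (simp add: Lp_space_def)
 let ?G = "%k. indicator (band (real n)) k * F k"
 let ?m = "measure ZR (band (real n)) powr (1/4)"
 have GL: "?G \<in> Lp_space 2 ZR" "Lp_norm 2 ZR ?G <= Lp_norm 2 ZR F"
  by (rule Lp_mono[OF _ _ F]; auto split: split_indicator)+
 have G0: "?G k = 0" if "k \<notin> band (real n)" for k using that by simp
 have n': "real n > 0" using n by simp
 note g = band_L2_L43[OF GL(1) G0]
 note hy = hausdorff_young_synth[OF g(1) G0 n']
 have le: "Lp_norm 4 TR (synth ?G) <= sqrt (2 * pi) * ?m * Lp_norm 2 ZR F"
 proof -
  have "Lp_norm 4 TR (synth ?G) <= sqrt (2 * pi) * Lp_norm (4/3) ZR ?G" by (rule hy(2))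
  also have "... <= sqrt (2 * pi) * (Lp_norm 2 ZR ?G * ?m)" by (intro mult_left_mono g(2)) auto
  also have "... <= sqrt (2 * pi) * (Lp_norm 2 ZR F * ?m)" by (intro mult_left_mono mult_right_mono GL(2)) auto
  finally show ?thesis by (simp add: mult_ac)
 qed
 have "pint 4 TR (bandsynth n F) <= pint 4 TR (synth ?G)"
 proof (rule pint_mono_AE, intro AE_I2)
  fix z
  have "1 <= (2 * pi)\<^sup>2" using pi_gt3 by (intro one_le_power) auto
  thus "cmod (bandsynth n F z) <= cmod (synth ?G z)"
   by (simp add: bandsynth_def norm_divide norm_mult norm_power divide_le_eq) (simp add: mult_le_cancel_left1)
 qed simp
 also have "... = ennreal ((Lp_norm 4 TR (synth ?G)) ^ 4)" by (rule Lp_norm_pow4[OF hy(1)])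
 also have "... <= ennreal ((sqrt (2 * pi) * ?m * Lp_norm 2 ZR F) ^ 4)"
  using le by (intro ennreal_leI power_mono) auto
 finally show ?thesis .
qed

lemma mul_Lp:
 assumes "F \<in> Lp_space 2 ZR"
 shows "(%k. mul t k * F k) \<in> Lp_space 2 ZR" "Lp_norm 2 ZR (%k. mul t k * F k) = Lp_norm 2 ZR F"
proof -
 have [measurable]: "F \<in> bm ZR" using assms by (simp add: Lp_space_def)
 show "(%k. mul t k * F k) \<in> Lp_space 2 ZR" "Lp_norm 2 ZR (%k. mul t k * F k) = Lp_norm 2 ZR F"
  using assms by (auto simp: Lp_space_def Lp_norm_def norm_mult)
qed

lemma bandsynth_add:
 assumes "F \<in> Lp_space 2 ZR" "G \<in> Lp_space 2 ZR" and z: "z \<in> space TR"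
 shows "bandsynth n (%k. F k + G k) z = bandsynth n F z + bandsynth n G z"
proof -
 note z [measurable]
 have i: "integrable ZR (%k. indicator (band (real n)) k * F k * cchar k z)" if "F \<in> Lp_space 2 ZR" for F
 proof -
  have [measurable]: "F \<in> bm ZR" using that by (simp add: Lp_space_def)
  have "integrable ZR (%k. indicator (band (real n)) k * F k)"
   by (rule band_integrable[where N = "real n", OF band_cut_Lp[OF that]]) auto
  thus ?thesis
   by (rule Bochner_Integration.integrable_bound) (auto simp: norm_mult)
 qed
 show ?thesis
  using i[OF assms(1)] i[OF assms(2)]
  by (simp add: bandsynth_def synth_def distrib_left distrib_right add_divide_distrib)
qed

end

context duhamel
begin

text \<open>The band-limited response at time \<open>t\<close> to the forcing between
  \<open>a\<close> and \<open>t\<close>; subtracting \<open>W a\<close> discards what was forced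
  before.\<close>

definition dN :: "nat => real => real => real \<times> real => complex" where
 "dN n a t = bandsynth n (%k. mul t k * (W t k - W a k))"

lemma dN_meas: "(%(t, z). dN n a t z) \<in> bm LT"
 unfolding dN_def by (rule bandsynth_param_measurable) measurable

lemma W_diff_L2: "(%k. W t k - W a k) \<in> Lp_space 2 ZR"
 by (intro Lp_diff(1) W_L2) simp

text \<open>Seen from after \<open>c\<close>, the forcing between \<open>a\<close> and
  \<open>c\<close> acts like data given at \<open>c\<close>, that is through a free evolution. This
  is the interaction term of the bisection.\<close>

lemma dN_split:
 assumes "z \<in> space TR"
 shows "dN n a t z = dN n c t z + bandsynth n (%k. mul t k * (W c k - W a k)) z"
 unfolding dN_def bandsynth_add[OF mul_Lp(1)[OF W_diff_L2] mul_Lp(1)[OF W_diff_L2] assms, symmetric]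
 by (rule arg_cong[where f = "%F. bandsynth n F z"]) (auto simp: algebra_simps)

lemma dN_crude:
 assumes ab: "a <= b" "b <= a + 1" and n: "n > 0"
 shows "pint 4 LT (slab {a..b} (dN n a)) <=
  ennreal ((sqrt (2 * pi) * measure ZR (band (real n)) powr (1/4) * strich * Y a b powr (3/4)) ^ 4)"
proof -
 define c where "c = sqrt (2 * pi) * measure ZR (band (real n)) powr (1/4)"
 have c: "c >= 0" by (simp add: c_def)
 have "pint 4 LT (slab {a..b} (dN n a)) = (NN t|lborel. pint 4 TR (dN n a t) * indicator {a..b} t)"
  by (rule pint_slab[OF dN_meas]) auto
 also have "... <= (NN t|lborel. ennreal ((c * strich * Y a b powr (3/4)) ^ 4) * indicator {a..b} t)"
 proof (rule nn_integral_mono)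
  fix t
  show "pint 4 TR (dN n a t) * indicator {a..b} t <= ennreal ((c * strich * Y a b powr (3/4)) ^ 4) * indicator {a..b} t"
  proof (cases "t \<in> {a..b}")
   case True
   hence t: "a <= t" "t <= a + 1" using ab by auto
   have "pint 4 TR (dN n a t) <= ennreal ((c * Lp_norm 2 ZR (%k. mul t k * (W t k - W a k))) ^ 4)"
    unfolding dN_def c_def by (rule bandsynth_L4[OF mul_Lp(1)[OF W_diff_L2] n])
   also have "... = ennreal ((c * Lp_norm 2 ZR (%k. W t k - W a k)) ^ 4)"
    by (simp only: mul_Lp(2)[OF W_diff_L2])
   also have "... <= ennreal ((c * (strich * Y a b powr (3/4))) ^ 4)"
   proof (intro ennreal_leI power_mono mult_left_mono)
    have "Lp_norm 2 ZR (%k. W t k - W a k) <= strich * Y a t powr (3/4)"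
     by (rule W_increment_L2(2)[OF t])
    also have "... <= strich * Y a b powr (3/4)"
     using True strich by (intro mult_left_mono powr_mono2 Y_mono Y_nonneg) auto
    finally show "Lp_norm 2 ZR (%k. W t k - W a k) <= strich * Y a b powr (3/4)" .
   qed (use c in auto)
   finally show ?thesis using True by (simp add: mult_ac)
  qed simp
 qed
 also have "... = ennreal ((c * strich * Y a b powr (3/4)) ^ 4) * ennreal (b - a)"
  using ab by (subst nn_integral_cmult_indicator) auto
 also have "... <= ennreal ((c * strich * Y a b powr (3/4)) ^ 4) * ennreal 1"
  using ab by (intro mult_left_mono ennreal_leI) auto
 finally show ?thesis by (simp add: c_def)
qed

text \<open>
 Bisection of the forcing. With \<open>c\<close> halving \<open>Y\<close>, the pieces on \<open>[a, c]\<close> and \<open>[c, b]\<close> contribute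
 \<open>2\<^sup>1\<^sup>/\<^sup>4 2\<^sup>-\<^sup>3\<^sup>/\<^sup>4 = 2\<^sup>-\<^sup>1\<^sup>/\<^sup>2\<close> times the constant, and the interaction is a free evolution. Iterating, the
 band-dependent constant of the crude bound disappears.
\<close>

lemma dN_bisect:
 assumes "a <= b" "b <= a + 1" and n: "n > 0"
 shows "pint 4 LT (slab {a..b} (dN n a)) <=
  ennreal ((((1 / sqrt 2) ^ j * (sqrt (2 * pi) * measure ZR (band (real n)) powr (1/4) * strich)
   + 4 * strich\<^sup>2) * Y a b powr (3/4)) ^ 4)"
 using assms(1,2)
proof (induction j arbitrary: a b)
 case 0
 have S: "strich > 0" by (rule strich)
 have "pint 4 LT (slab {a..b} (dN n a)) <= ennreal ((sqrt (2 * pi) * measure ZR (band (real n)) powr (1/4) * strich * Y a b powr (3/4)) ^ 4)"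
  by (rule dN_crude[OF 0 n])
 also have "... <= ennreal ((((1 / sqrt 2) ^ 0 * (sqrt (2 * pi) * measure ZR (band (real n)) powr (1/4) * strich)
   + 4 * strich\<^sup>2) * Y a b powr (3/4)) ^ 4)"
  using S by (intro ennreal_leI power_mono mult_right_mono) auto
 finally show ?case .
next
 case (Suc j)
 have S: "strich > 0" by (rule strich)
 define \<kappa> where "\<kappa> = (1 / sqrt 2) ^ j * (sqrt (2 * pi) * measure ZR (band (real n)) powr (1/4) * strich) + 4 * strich\<^sup>2"
 have \<kappa>: "\<kappa> >= 0" using S by (simp add: \<kappa>_def)
 obtain c where c: "a <= c" "c <= b" "Y a c = Y a b / 2" "Y c b = Y a b / 2"
  using Y_halve[OF Suc.prems(1)] .
 define y where "y = Y a b powr (3/4)"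
 have y: "y >= 0" by (simp add: y_def)
 have half: "(Y a b / 2) powr (3/4) = y / 2 powr (3/4)"
  using Y_nonneg[of a b] by (simp add: y_def powr_divide)
 let ?E = "%t. bandsynth n (%k. mul t k * (W c k - W a k))"
 \<comment> \<open>The response restarted at \<open>c\<close>: each half sees only its own forcing,
   so the induction hypothesis applies to both.\<close>
 define f1 where "f1 = (%t z. if t <= c then dN n a t z else dN n c t z)"
 have Em: "(%(t, z). ?E t z) \<in> bm LT"
  by (rule bandsynth_param_measurable) measurable
 have f1m: "(%(t, z). f1 t z) \<in> bm LT"
 proof -
  have [measurable]: "(%w. dN n a (fst w) (snd w)) \<in> bm LT" for a
   using dN_meas[of n a] by (simp add: split_beta')
  have "(%w. if fst w <= c then dN n a (fst w) (snd w) else dN n c (fst w) (snd w)) \<in> bm LT" by measurable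
  thus ?thesis by (simp add: f1_def split_beta')
 qed
 have p1: "pint 4 LT (slab {a..b} f1) <= ennreal ((1 / sqrt 2 * \<kappa> * y) ^ 4)"
 proof -
  have pm: "(%t. pint 4 TR (dN n a t)) \<in> bm lborel" for a
   by (rule pint_param_measurable[OF sigma_finite_TR dN_meas])
  note [measurable] = pm[simplified]
  have "pint 4 LT (slab {a..b} f1) = (NN t|lborel. pint 4 TR (f1 t) * indicator {a..b} t)"
   by (rule pint_slab[OF f1m]) auto
  also have "... <= (NN t|lborel. pint 4 TR (dN n a t) * indicator {a..c} t + pint 4 TR (dN n c t) * indicator {c..b} t)"
   by (intro nn_integral_mono) (auto simp: f1_def split: split_indicator)
  also have "... = pint 4 LT (slab {a..c} (dN n a)) + pint 4 LT (slab {c..b} (dN n c))"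
   by (subst nn_integral_add) (auto simp: pint_slab[OF dN_meas])
  also have "... <= ennreal ((\<kappa> * Y a c powr (3/4)) ^ 4) + ennreal ((\<kappa> * Y c b powr (3/4)) ^ 4)"
   unfolding \<kappa>_def using Suc.prems c by (intro add_mono Suc.IH) auto
  also have "... = ennreal (2 * (\<kappa> * (y / 2 powr (3/4))) ^ 4)"
   using \<kappa> y unfolding c half by (simp flip: ennreal_plus)
  also have "2 * (\<kappa> * (y / 2 powr (3/4))) ^ 4 = (1 / sqrt 2 * \<kappa> * y) ^ 4"
  proof -
   have "(2 powr (3/4)) ^ 4 = (8::real)"
    by (simp add: powr_power)
   moreover have "(sqrt 2) ^ 4 = (4::real)" by (simp add: power4_eq_xxxx)
   ultimately show ?thesis by (simp add: power_mult_distrib power_divide)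
  qed
  finally show ?thesis .
 qed
 have p2: "pint 4 LT (slab {a..b} ?E) <= ennreal ((strich\<^sup>2 * y) ^ 4)"
 proof -
  have "pint 4 LT (slab {a..b} ?E) = (NN t|lborel. pint 4 TR (?E t) * indicator {a..b} t)"
   by (rule pint_slab[OF Em]) auto
  also have "... <= (NN t|lborel. pint 4 TR (?E t) * indicator {a..a + 1} t)"
   using Suc.prems by (intro nn_integral_mono) (auto split: split_indicator)
  also have "... <= ennreal ((strich * Lp_norm 2 ZR (%k. W c k - W a k)) ^ 4)"
   by (rule strichartz_bandsynth[OF W_diff_L2 n])
  also have "... <= ennreal ((strich * (strich * y)) ^ 4)"
  proof (intro ennreal_leI power_mono mult_left_mono)
   have "Lp_norm 2 ZR (%k. W c k - W a k) <= strich * Y a c powr (3/4)"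
    using c Suc.prems by (intro W_increment_L2(2)) auto
   also have "... <= strich * y"
    unfolding y_def using S c by (intro mult_left_mono powr_mono2 Y_mono Y_nonneg) auto
   finally show "Lp_norm 2 ZR (%k. W c k - W a k) <= strich * y" .
  qed (use S in auto)
  finally show ?thesis by (simp add: power2_eq_square mult_ac)
 qed
 have m1: "slab {a..b} f1 \<in> bm LT" by (rule slab_measurable[OF f1m]) simp
 have m2: "slab {a..b} ?E \<in> bm LT" by (rule slab_measurable[OF Em]) simp
 have n1: "0 <= 1 / sqrt 2 * \<kappa> * y" using \<kappa> y by simp
 have n2: "0 <= strich\<^sup>2 * y" using y by simp
 note l1 = Lp4I[OF m1 n1 p1] and l2 = Lp4I[OF m2 n2 p2]
 have "Lp_norm 4 LT (%w. slab {a..b} f1 w + slab {a..b} ?E w) <= 1 / sqrt 2 * \<kappa> * y + strich\<^sup>2 * y"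
  using Lp_add(2)[OF l1(1) l2(1)] l1(2) l2(2) by simp
 \<comment> \<open>The recursion for the constant is \<open>C -> C / sqrt 2 + strich^2\<close>.
   Since \<open>4 / sqrt 2 + 1 <= 4\<close>, the term \<open>4 * strich^2\<close> absorbs the free
   evolution at every level.\<close>
 moreover have mono: "1 / sqrt 2 * \<kappa> * y + strich\<^sup>2 * y <=
  ((1 / sqrt 2) ^ Suc j * (sqrt (2 * pi) * measure ZR (band (real n)) powr (1/4) * strich) + 4 * strich\<^sup>2) * y"
 proof -
  have s2: "4 / sqrt 2 <= (3::real)"
  proof -
   have "(4/3)\<^sup>2 <= (2::real)" by (simp add: power2_eq_square)
   hence "4/3 <= sqrt 2" by (rule real_le_rsqrt)
   thus ?thesis by (simp add: field_simps)
  qed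
  have "4 / sqrt 2 * strich\<^sup>2 <= 3 * strich\<^sup>2"
   by (rule mult_right_mono[OF s2]) simp
  hence "1 / sqrt 2 * \<kappa> + strich\<^sup>2 <=
   (1 / sqrt 2) ^ Suc j * (sqrt (2 * pi) * measure ZR (band (real n)) powr (1/4) * strich) + 4 * strich\<^sup>2"
   unfolding \<kappa>_def by (simp add: distrib_left)
  from mult_right_mono[OF this y] show ?thesis by (simp only: distrib_right)
 qed
 ultimately have fin: "Lp_norm 4 LT (%w. slab {a..b} f1 w + slab {a..b} ?E w) <=
  ((1 / sqrt 2) ^ Suc j * (sqrt (2 * pi) * measure ZR (band (real n)) powr (1/4) * strich) + 4 * strich\<^sup>2) * y"
  by (rule order_trans)
 \<comment> \<open>The free part is added only for times after \<open>c\<close>, where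
   \<open>dN_split\<close> is used; up to \<open>c\<close> the response already equals
   \<open>f1\<close>.\<close>
 have "pint 4 LT (slab {a..b} (dN n a)) <= pint 4 LT (%w. slab {a..b} f1 w + (if fst w <= c then 0 else slab {a..b} ?E w))"
 proof (rule pint_mono_AE, intro AE_I2)
  fix w assume "w \<in> space LT"
  hence "snd w \<in> space TR" by (auto simp: space_pair_measure)
  from dN_split[OF this, of n a "fst w" c]
  show "cmod (slab {a..b} (dN n a) w) <= cmod (slab {a..b} f1 w + (if fst w <= c then 0 else slab {a..b} ?E w))"
   by (auto simp: slab_def f1_def split: split_indicator)
 qed simp
 also have "... <= ennreal ((((1 / sqrt 2) ^ Suc j * (sqrt (2 * pi) * measure ZR (band (real n)) powr (1/4) * strich)
   + 4 * strich\<^sup>2) * y) ^ 4)"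
 proof -
  have [measurable]: "slab {a..b} ?E \<in> bm LT" by (rule m2)
  have m3: "(%w. if fst w <= c then 0 else slab {a..b} ?E w) \<in> bm LT" by measurable
  have l3: "(%w. if fst w <= c then 0 else slab {a..b} ?E w) \<in> Lp_space 4 LT"
   "Lp_norm 4 LT (%w. if fst w <= c then 0 else slab {a..b} ?E w) <= Lp_norm 4 LT (slab {a..b} ?E)"
   by (rule Lp_mono[OF _ _ l2(1) m3]; auto)+
  have l4: "(%w. slab {a..b} f1 w + (if fst w <= c then 0 else slab {a..b} ?E w)) \<in> Lp_space 4 LT"
   by (rule Lp_add(1)[OF l1(1) l3(1)]) simp
  have "Lp_norm 4 LT (%w. slab {a..b} f1 w + (if fst w <= c then 0 else slab {a..b} ?E w)) <=
   1 / sqrt 2 * \<kappa> * y + strich\<^sup>2 * y"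
   using Lp_add(2)[OF l1(1) l3(1)] l1(2) l2(2) l3(2) by simp
  also note mono
  finally show ?thesis
   unfolding Lp_norm_pow4[OF l4] by (intro ennreal_leI power_mono) auto
 qed
 finally show ?case by (simp only: y_def)
qed

lemma dN_uniform:
 assumes "a <= b" "b <= a + 1" and n: "n > 0"
 shows "pint 4 LT (slab {a..b} (dN n a)) <= ennreal ((4 * strich\<^sup>2 * Y a b powr (3/4)) ^ 4)"
proof (rule LIMSEQ_le_const)
 let ?c = "sqrt (2 * pi) * measure ZR (band (real n)) powr (1/4) * strich"
 have lim: "(%j. (1 / sqrt 2 :: real) ^ j) \<longlonglongrightarrow> 0"
  by (rule LIMSEQ_power_zero) (simp add: norm_divide)
 have "(%j. ennreal ((((1 / sqrt 2) ^ j * ?c + 4 * strich\<^sup>2) * Y a b powr (3/4)) ^ 4))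
   \<longlonglongrightarrow> ennreal (((0 * ?c + 4 * strich\<^sup>2) * Y a b powr (3/4)) ^ 4)"
  by (intro tendsto_ennrealI tendsto_power[where n = 4] tendsto_mult tendsto_add tendsto_const lim)
 thus "(%j. ennreal ((((1 / sqrt 2) ^ j * ?c + 4 * strich\<^sup>2) * Y a b powr (3/4)) ^ 4))
   \<longlonglongrightarrow> ennreal ((4 * strich\<^sup>2 * Y a b powr (3/4)) ^ 4)" by simp
 show "\<exists>N. \<forall>j\<ge>N. pint 4 LT (slab {a..b} (dN n a)) <= ennreal ((((1 / sqrt 2) ^ j * ?c + 4 * strich\<^sup>2) * Y a b powr (3/4)) ^ 4)"
  using dN_bisect[OF assms] by blast
qed

theorem retarded_strichartz:
 assumes ab: "a <= b" "b <= a + 1"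
  and d: "(%(t, z). d t z) \<in> bm LT" "\<And>t. t \<in> {a..b} ==> is_fourier 2 (d t) (%k. mul t k * (W t k - W a k))"
 shows "slab {a..b} d \<in> Lp_space 4 LT" "Lp_norm 4 LT (slab {a..b} d) <= 4 * strich\<^sup>2 * Y a b powr (3/4)"
proof -
 have m: "(%(t, k). mul t k * (W t k - W a k)) \<in> bm LZ" by measurable
 have "pint 4 LT (slab {a..b} d) <= ennreal ((4 * strich\<^sup>2 * Y a b powr (3/4)) ^ 4)"
 proof (rule slab_fatou[OF d(1) m d(2)])
  fix n :: nat assume "n > 0"
  from dN_uniform[OF ab this]
  show "(NN t|lborel. pint 4 TR (bandsynth n (%k. mul t k * (W t k - W a k))) * indicator {a..b} t)
   <= ennreal ((4 * strich\<^sup>2 * Y a b powr (3/4)) ^ 4)"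
   unfolding dN_def[symmetric] by (simp add: pint_slab[OF dN_meas])
 qed auto
 moreover have "slab {a..b} d \<in> bm LT" by (rule slab_measurable[OF d(1)]) simp
 moreover have "0 <= 4 * strich\<^sup>2 * Y a b powr (3/4)" by simp
 ultimately show "slab {a..b} d \<in> Lp_space 4 LT" "Lp_norm 4 LT (slab {a..b} d) <= 4 * strich\<^sup>2 * Y a b powr (3/4)"
  using Lp4I by blast+
qed

end

context dispersion
begin

theorem free_strichartz:
 assumes F: "F \<in> Lp_space 2 ZR"
  and w: "(%(t, z). w t z) \<in> bm LT" "\<And>t. t \<in> {a..b} ==> is_fourier 2 (w t) (%k. mul t k * F k)"
  and ab: "b <= a + 1"
 shows "slab {a..b} w \<in> Lp_space 4 LT" "Lp_norm 4 LT (slab {a..b} w) <= strich * Lp_norm 2 ZR F"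
proof -
 have [measurable]: "F \<in> bm ZR" using F by (simp add: Lp_space_def)
 have m: "(%(t, k). mul t k * F k) \<in> bm LZ" by measurable
 have "pint 4 LT (slab {a..b} w) <= ennreal ((strich * Lp_norm 2 ZR F) ^ 4)"
 proof (rule slab_fatou[OF w(1) m w(2)])
  fix n :: nat assume n: "n > 0"
  have "(NN t|lborel. pint 4 TR (bandsynth n (%k. mul t k * F k)) * indicator {a..b} t)
   <= (NN t|lborel. pint 4 TR (bandsynth n (%k. mul t k * F k)) * indicator {a..a + 1} t)"
   using ab by (intro nn_integral_mono) (auto split: split_indicator)
  also note strichartz_bandsynth[OF F n]
  finally show "(NN t|lborel. pint 4 TR (bandsynth n (%k. mul t k * F k)) * indicator {a..b} t)
   <= ennreal ((strich * Lp_norm 2 ZR F) ^ 4)" .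
 qed auto
 moreover have "slab {a..b} w \<in> bm LT" by (rule slab_measurable[OF w(1)]) simp
 moreover have "0 <= strich * Lp_norm 2 ZR F" using strich by simp
 ultimately show "slab {a..b} w \<in> Lp_space 4 LT" "Lp_norm 4 LT (slab {a..b} w) <= strich * Lp_norm 2 ZR F"
  using Lp4I by blast+
qed

end

subsection \<open>The inhomogeneous linear equation\<close>

context dispersion
begin

text \<open>The same profile as \<open>W\<close>, which depends on \<open>H\<close> but not on
  \<open>h\<close>, made available outside the locale so that different forcings can be
  compared.\<close>

definition DW :: "(real => int \<times> real => complex) => real => int \<times> real => complex" where
 "DW H t k = (LINT s|lborel. (indicator {0..t} s - indicator {t..0} s) *\<^sub>R (mul (- s) k * H s k))"

lemma duhamel_W: "duhamel \<alpha> \<epsilon> h H ==> duhamel.W \<alpha> \<epsilon> H = DW H"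
 by (rule ext, rule ext) (simp add: duhamel.W_def duhamel.sgt_def DW_def)

text \<open>\<open>F\<close> is the transform at time 0. Forcing and solution live on the whole
  line, and the transform is prescribed at every \<open>t\<close>, not only at almost every one, so
  that values at single times and continuity make sense.\<close>

definition lin :: "(int \<times> real => complex) => (real => real \<times> real => complex) => (real => real \<times> real => complex) => bool" where
 "lin F h u \<longleftrightarrow> F \<in> Lp_space 2 ZR \<and> (%(t, z). u t z) \<in> bm LT \<and>
   (\<exists>H. duhamel \<alpha> \<epsilon> h H \<and> (\<forall>t. is_fourier 2 (u t) (%k. mul t k * (F k + DW H t k))))"

definition forcing :: "(real => real \<times> real => complex) => bool" where
 "forcing h \<longleftrightarrow> (%(t, z). h t z) \<in> bm LT \<and> pint (4/3) LT (slab UNIV h) < \<infinity>"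

lemma slab_UNIV: "slab UNIV h = (%(t, z). h t z)"
 by (rule ext) (simp add: slab_def split_beta')

lemma forcing_iff: "forcing h \<longleftrightarrow> (%(t, z). h t z) \<in> Lp_space (4/3) LT"
 by (simp add: forcing_def slab_UNIV Lp_space_iff)

lemma AE_LT_sections:
 assumes "AE w in LT. P (fst w) (snd w)"
 shows "AE t in lborel. AE z in TR. P t z"
proof -
 have "AE w in LT. (%(t, z). P t z) w" using assms by (simp add: split_beta')
 from LT.AE_pair[OF this] show ?thesis by simp
qed

lemma duhamel_exists:
 assumes "forcing h"
 shows "\<exists>H. duhamel \<alpha> \<epsilon> h H"
proof -
 have hm: "(%(t, z). h t z) \<in> bm LT" and fin: "pint (4/3) LT (slab UNIV h) < \<infinity>"
  using assms by (auto simp: forcing_def)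
 have [measurable]: "(%t. pint (4/3) TR (h t)) \<in> bm lborel"
  by (rule pint_param_measurable[OF sigma_finite_TR hm])
 obtain H where H: "(%(t, k). H t k) \<in> bm LZ"
  "\<And>t. t \<in> space lborel ==> h t \<in> Lp_space (4/3) TR ==> is_fourier (4/3) (h t) (H t)"
  by (rule is_fourier_param[OF fexp_simps(2) hm]) blast
 have "(NN t|lborel. pint (4/3) TR (h t)) < \<infinity>"
  using fin by (simp add: pint_slab[OF hm])
 hence "AE t in lborel. pint (4/3) TR (h t) \<noteq> \<infinity>"
  by (intro nn_integral_PInf_AE) auto
 hence "AE t in lborel. is_fourier (4/3) (h t) (H t)"
  by eventually_elim (use H(2) section_measurable[OF hm] in \<open>auto simp: Lp_space_iff less_top\<close>)
 hence "duhamel \<alpha> \<epsilon> h H"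
  using hm fin H(1) by unfold_locales auto
 thus ?thesis by blast
qed

lemma DW_meas:
 assumes "duhamel \<alpha> \<epsilon> h H"
 shows "(%(t, k). DW H t k) \<in> bm LZ"
 using duhamel.W_meas[OF assms] by (simp add: duhamel_W[OF assms])

lemma DW_L2: "duhamel \<alpha> \<epsilon> h H ==> DW H t \<in> Lp_space 2 ZR"
 using duhamel.W_L2 duhamel_W by metis

lemma lin_from_duhamel:
 assumes D: "duhamel \<alpha> \<epsilon> h H" and F: "F \<in> Lp_space 2 ZR"
 shows "\<exists>u. lin F h u \<and> (\<forall>t. is_fourier 2 (u t) (%k. mul t k * (F k + DW H t k)))"
proof -
 have [measurable]: "F \<in> bm ZR" using F by (simp add: Lp_space_def)
 have [measurable]: "(%w. DW H (fst w) (snd w)) \<in> bm LZ"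
  using DW_meas[OF D] by (simp add: split_beta')
 have m: "(%(t, k). mul t k * (F k + DW H t k)) \<in> bm LZ"
  unfolding split_beta' by measurable
 obtain u where u: "(%(t, z). u t z) \<in> bm LT"
  "\<And>t. t \<in> space lborel ==> (%k. mul t k * (F k + DW H t k)) \<in> Lp_space 2 ZR ==> is_fourier 2 (u t) (%k. mul t k * (F k + DW H t k))"
  by (rule inverse_fourier_param[OF m]) blast
 have "is_fourier 2 (u t) (%k. mul t k * (F k + DW H t k))" for t
  by (intro u(2) mul_Lp(1) Lp_add(1) F DW_L2[OF D]) auto
 thus ?thesis using u(1) F D unfolding lin_def by blast
qed

text \<open>Solving \<open>mul c k * (F k + DW H c k) = G k\<close> for \<open>F\<close> prescribes
  the value at an arbitrary time. The energy identity uses this for approximations that share their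
  value at the left end.\<close>

lemma lin_exists_at:
 assumes h: "forcing h" and f: "f \<in> Lp_space 2 TR"
 shows "\<exists>F u. lin F h u \<and> (AE z in TR. u c z = f z)"
proof -
 obtain H where D: "duhamel \<alpha> \<epsilon> h H" using duhamel_exists[OF h] by blast
 obtain G where G: "is_fourier 2 f G" using is_fourier_exists[OF fexp_simps(1) f] by blast
 have GL: "G \<in> Lp_space 2 ZR" using is_fourierD(2)[OF G] by simp
 define F where "F = (%k. mul (- c) k * G k - DW H c k)"
 have F: "F \<in> Lp_space 2 ZR" unfolding F_def by (intro Lp_diff(1) mul_Lp(1) GL DW_L2[OF D]) simp
 obtain u where u: "lin F h u" "\<And>t. is_fourier 2 (u t) (%k. mul t k * (F k + DW H t k))"
  using lin_from_duhamel[OF D F] by blast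
 have "(%k. mul c k * (F k + DW H c k)) = G"
  by (rule ext) (simp add: F_def mult.assoc[symmetric] multiplier_add[symmetric])
 with u(2)[of c] have "is_fourier 2 (u c) G" by simp
 from is_fourier_inject[OF this G] u(1) show ?thesis by auto
qed

lemma lin_exists:
 assumes "forcing h" "F \<in> Lp_space 2 ZR"
 shows "\<exists>u. lin F h u"
 using duhamel_exists[OF assms(1)] lin_from_duhamel[OF _ assms(2)] by blast

section \<open>Locality and linearity of the linear solution\<close>

lemma lin_forcing: "lin F h u ==> forcing h"
 unfolding lin_def forcing_def by (auto dest: duhamel.h_meas duhamel.h_fin)

lemma lin_meas: "lin F h u ==> (%(t, z). u t z) \<in> bm LT"
 by (simp add: lin_def)

lemma lin_L2: "lin F h u ==> u t \<in> Lp_space 2 TR"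
 unfolding lin_def by (auto dest: is_fourierD(1))

text \<open>The exceptional frequencies may depend on the time; Fubini exchanges the two
  quantifiers, after which the time integrals agree at almost every frequency.\<close>

lemma DW_local:
 assumes m: "(%(t, k). H t k) \<in> bm LZ"
  "(%(t, k). H' t k) \<in> bm LZ"
  and eq: "AE s in lborel. s \<in> closed_segment 0 t --> (AE k in ZR. H s k = H' s k)"
 shows "AE k in ZR. AE s in lborel. s \<in> closed_segment 0 t --> H s k = H' s k"
  "AE k in ZR. DW H t k = DW H' t k"
proof -
 have [measurable]: "(%w. H (fst w) (snd w)) \<in> bm LZ"
  "(%w. H' (fst w) (snd w)) \<in> bm LZ"
  using m by (simp_all add: split_beta')
 have [measurable]: "closed_segment 0 t \<in> sets borel" by simp
 have S: "{w \<in> space LZ. fst w \<in> closed_segment 0 t --> H (fst w) (snd w) = H' (fst w) (snd w)} \<in> sets LZ"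
  by measurable
 have "AE s in lborel. AE k in ZR. s \<in> closed_segment 0 t --> H s k = H' s k"
  using eq by eventually_elim auto
 thus 1: "AE k in ZR. AE s in lborel. s \<in> closed_segment 0 t --> H s k = H' s k"
  using LZ.AE_commute[OF S] by simp
 have sec: "(%s. mul (- s) k * H s k) \<in> bm borel" if "(%(t, k). H t k) \<in> bm LZ" for H k
 proof -
  have k: "(%s. k) \<in> measurable borel ZR" by (rule measurable_const) simp
  note k [measurable]
  have [measurable]: "(%s. H s k) \<in> bm borel" using measurable_Pair1[OF that, of k] by simp
  show ?thesis by measurable
 qed
 show "AE k in ZR. DW H t k = DW H' t k"
  using 1
 proof eventually_elim
  case (elim k)
  note [measurable] = sec[OF m(1)] sec[OF m(2)]
  show ?case
   unfolding DW_def
  proof (intro integral_cong_AE)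
   show "AE s in lborel. (indicator {0..t} s - indicator {t..0} s) *\<^sub>R (mul (- s) k * H s k) =
    (indicator {0..t} s - indicator {t..0} s) *\<^sub>R (mul (- s) k * H' s k)"
    using elim by eventually_elim (auto simp: closed_segment_eq_real_ivl split: split_indicator)
  qed measurable
 qed
qed

lemma duhamel_diff:
 assumes D: "duhamel \<alpha> \<epsilon> h H" and D': "duhamel \<alpha> \<epsilon> h' H'"
 shows "duhamel \<alpha> \<epsilon> (%t z. h t z - h' t z) (%t k. H t k - H' t k)"
  "AE k in ZR. \<forall>t. DW (%t k. H t k - H' t k) t k = DW H t k - DW H' t k"
proof -
 interpret A: duhamel \<alpha> \<epsilon> h H by fact
 interpret B: duhamel \<alpha> \<epsilon> h' H' by fact
 show "duhamel \<alpha> \<epsilon> (%t z. h t z - h' t z) (%t k. H t k - H' t k)"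
 proof unfold_locales
  have [measurable]: "(%w. h (fst w) (snd w)) \<in> bm LT" "(%w. h' (fst w) (snd w)) \<in> bm LT"
   using A.h_meas B.h_meas by (simp_all add: split_beta')
  show "(%(t, z). h t z - h' t z) \<in> bm LT" unfolding split_beta' by measurable
  show "(%(t, k). H t k - H' t k) \<in> bm LZ"
   using A.H_meas' B.H_meas' unfolding split_beta' by measurable
  have "(%(t, z). h t z) \<in> Lp_space (4/3) LT" "(%(t, z). h' t z) \<in> Lp_space (4/3) LT"
   using A.h_meas B.h_meas A.h_fin B.h_fin by (auto simp: slab_UNIV Lp_space_iff)
  from Lp_diff(1)[OF this] show "pint (4/3) LT (slab UNIV (%t z. h t z - h' t z)) < \<infinity>"
   by (simp add: slab_UNIV Lp_space_iff split_beta')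
  show "AE s in lborel. is_fourier (4/3) (%z. h s z - h' s z) (%k. H s k - H' s k)"
   using A.hH B.hH by eventually_elim (rule is_fourier_diff[OF fexp_simps(2)])
 qed
 show "AE k in ZR. \<forall>t. DW (%t k. H t k - H' t k) t k = DW H t k - DW H' t k"
  using A.good_AE B.good_AE
 proof eventually_elim
  case (elim k)
  show ?case
  proof
   fix t
   show "DW (%t k. H t k - H' t k) t k = DW H t k - DW H' t k"
    using A.sgt_integrable[OF elim(1), of t] B.sgt_integrable[OF elim(2), of t]
    unfolding DW_def A.sgt_def B.sgt_def
    by (simp add: right_diff_distrib scaleR_right_diff_distrib flip: Bochner_Integration.integral_diff)
  qed
 qed
qed

lemma lin_diff:
 assumes "lin F h u" "lin F' h' u'"
 shows "lin (%k. F k - F' k) (%t z. h t z - h' t z) (%t z. u t z - u' t z)"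
proof -
 obtain H where H: "duhamel \<alpha> \<epsilon> h H" "\<And>t. is_fourier 2 (u t) (%k. mul t k * (F k + DW H t k))"
  using assms(1) unfolding lin_def by blast
 obtain H' where H': "duhamel \<alpha> \<epsilon> h' H'" "\<And>t. is_fourier 2 (u' t) (%k. mul t k * (F' k + DW H' t k))"
  using assms(2) unfolding lin_def by blast
 have L: "F \<in> Lp_space 2 ZR" "F' \<in> Lp_space 2 ZR" using assms by (auto simp: lin_def)
 note D = duhamel_diff[OF H(1) H'(1)]
 let ?F = "%k. F k - F' k" and ?H = "%t k. H t k - H' t k"
 have [measurable]: "(%w. u (fst w) (snd w)) \<in> bm LT" "(%w. u' (fst w) (snd w)) \<in> bm LT"
  using assms by (simp_all add: lin_def split_beta')
 have "is_fourier 2 (%z. u t z - u' t z) (%k. mul t k * (?F k + DW ?H t k))" for t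
 proof (rule is_fourier_cong_AE[OF fexp_simps(1) is_fourier_diff[OF fexp_simps(1) H(2)[of t] H'(2)[of t]]])
  show "(%z. u t z - u' t z) \<in> bm TR"
   using lin_L2[OF assms(1), of t] lin_L2[OF assms(2), of t] by (auto simp: Lp_space_def)
  show "AE k in ZR. mul t k * (F k + DW H t k) - mul t k * (F' k + DW H' t k) = mul t k * (?F k + DW ?H t k)"
   using D(2)
  proof eventually_elim
   case (elim k)
   show ?case by (simp only: elim[rule_format, of t]) (simp add: algebra_simps)
  qed
  show "(%k. mul t k * (?F k + DW ?H t k)) \<in> bm ZR"
   by (rule Lp_measurable[OF mul_Lp(1)]) (intro Lp_add(1) Lp_diff(1) L DW_L2[OF D(1)]; simp)
 qed auto
 moreover have "(%(t, z). u t z - u' t z) \<in> bm LT" unfolding split_beta' by measurable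
 ultimately show ?thesis unfolding lin_def using D(1) Lp_diff(1)[OF L] by auto
qed

lemma lin_cong_forcing:
 assumes l: "lin F h u" and m: "(%(t, z). h' t z) \<in> bm LT"
  and eq: "AE w in LT. h (fst w) (snd w) = h' (fst w) (snd w)"
 shows "lin F h' u"
proof -
 obtain H where H: "duhamel \<alpha> \<epsilon> h H" "\<And>t. is_fourier 2 (u t) (%k. mul t k * (F k + DW H t k))"
  using l unfolding lin_def by blast
 interpret duhamel \<alpha> \<epsilon> h H by fact
 have "duhamel \<alpha> \<epsilon> h' H"
 proof unfold_locales
  show "(%(t, z). h' t z) \<in> bm LT" by fact
  show "(%(t, k). H t k) \<in> bm LZ" by (rule H_meas)
  have "pint (4/3) LT (slab UNIV h') = pint (4/3) LT (slab UNIV h)"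
   using eq by (intro pint_cong_AE) (auto simp: slab_def)
  thus "pint (4/3) LT (slab UNIV h') < \<infinity>" using h_fin by simp
  show "AE s in lborel. is_fourier (4/3) (h' s) (H s)"
   using hH AE_LT_sections[OF eq]
  proof eventually_elim
   case (elim s)
   show ?case
    using is_fourier_cong_AE[OF fexp_simps(2) elim(1) elim(2) section_measurable[OF m]]
     is_fourierD(2)[OF elim(1)] by (auto simp: Lp_space_def)
  qed
 qed
 thus ?thesis using l H(2) unfolding lin_def by auto
qed

text \<open>Causality in both time directions. It allows the forcing to be changed beyond an
  interval around 0 without disturbing the solution already built there.\<close>

lemma lin_local:
 assumes l: "lin F h u" and l': "lin F h' u'"
  and eq: "AE s in lborel. s \<in> closed_segment 0 t --> (AE z in TR. h s z = h' s z)"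
 shows "AE z in TR. u t z = u' t z"
proof -
 obtain H where H: "duhamel \<alpha> \<epsilon> h H" "\<And>t. is_fourier 2 (u t) (%k. mul t k * (F k + DW H t k))"
  using l unfolding lin_def by blast
 obtain H' where H': "duhamel \<alpha> \<epsilon> h' H'" "\<And>t. is_fourier 2 (u' t) (%k. mul t k * (F k + DW H' t k))"
  using l' unfolding lin_def by blast
 have "AE s in lborel. s \<in> closed_segment 0 t --> (AE k in ZR. H s k = H' s k)"
  using duhamel.hH[OF H(1)] duhamel.hH[OF H'(1)] eq
  by eventually_elim (auto intro: is_fourier_unique[OF fexp_simps(2)])
 from DW_local(2)[OF duhamel.H_meas[OF H(1)] duhamel.H_meas[OF H'(1)] this]
 have "AE k in ZR. mul t k * (F k + DW H t k) = mul t k * (F k + DW H' t k)"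
  by eventually_elim simp
 from is_fourier_inject[OF H(2) H'(2) this] show ?thesis .
qed

text \<open>A sum, so as to dominate every coefficient that occurs: \<open>2 * pi * strich\<close>
  for data and \<open>5 = 4 + 1\<close> times \<open>strich^2\<close> for forcing in the
  \<open>L^4\<close> bound, 1 and \<open>strich\<close> in the bound at fixed times.\<close>

definition lin_const :: real where
 "lin_const = 1 + 2 * pi * strich + 5 * strich\<^sup>2 + strich"

lemma lin_const: "lin_const >= 1" "lin_const >= 2 * pi * strich" "lin_const >= 5 * strich\<^sup>2" "lin_const >= strich"
 using strich(1) by (auto simp: lin_const_def)

lemma forcing_slab:
 assumes "forcing h" and [measurable]: "I \<in> sets borel"
 shows "slab I h \<in> Lp_space (4/3) LT" "Lp_norm (4/3) LT (slab I h) <= Lp_norm (4/3) LT (slab UNIV h)"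
proof -
 have m: "slab I h \<in> bm LT" using assms by (intro slab_measurable) (auto simp: forcing_def)
 have L: "slab UNIV h \<in> Lp_space (4/3) LT" using assms by (simp add: forcing_iff slab_UNIV)
 show "slab I h \<in> Lp_space (4/3) LT" "Lp_norm (4/3) LT (slab I h) <= Lp_norm (4/3) LT (slab UNIV h)"
  by (rule Lp_mono[OF _ _ L m]; auto simp: slab_def norm_mult split: split_indicator)+
qed

lemma lin_profile_norm:
 assumes "is_fourier 2 f (%k. mul t k * G k)" "G \<in> Lp_space 2 ZR"
 shows "Lp_norm 2 ZR G = 2 * pi * Lp_norm 2 TR f"
 using is_fourier_norm(2)[OF fexp_simps(1) assms(1) refl] mul_Lp(2)[OF assms(2)] by simp

text \<open>Data may be taken at any \<open>c\<close> of the interval, so the estimate serves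
  forward and backward. The profile at \<open>a\<close> is recovered from the one at
  \<open>c\<close> by an increment of \<open>W\<close>; from \<open>a\<close> on, the solution is a
  free evolution plus a retarded integral.\<close>

theorem lin_estimate:
 assumes l: "lin F h u" and c: "a <= c" "c <= b" and ab: "b <= a + 1"
 shows "slab {a..b} u \<in> Lp_space 4 LT"
  "Lp_norm 4 LT (slab {a..b} u) <= lin_const * (Lp_norm 2 TR (u c) + Lp_norm (4/3) LT (slab {a..b} h))"
  "\<And>t. t \<in> {a..b} ==> Lp_norm 2 TR (u t) <= lin_const * (Lp_norm 2 TR (u c) + Lp_norm (4/3) LT (slab {a..b} h))"
proof -
 obtain H where H: "duhamel \<alpha> \<epsilon> h H" "\<And>t. is_fourier 2 (u t) (%k. mul t k * (F k + DW H t k))"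
  using l unfolding lin_def by blast
 interpret duhamel \<alpha> \<epsilon> h H by fact
 have W: "DW H = W" by (rule duhamel_W[OF H(1), symmetric])
 have F: "F \<in> Lp_space 2 ZR" using l by (simp add: lin_def)
 have [measurable]: "F \<in> bm ZR" using F by (simp add: Lp_space_def)
 define S where "S = strich"
 have S: "S > 0" unfolding S_def by (rule strich)
 define y where "y = Lp_norm (4/3) LT (slab {a..b} h)"
 have yY: "Y a b powr (3/4) = y"
 proof -
  have L: "slab {a..b} h \<in> Lp_space (4/3) LT" by (rule forcing_slab(1)[OF lin_forcing[OF l]]) simp
  have "y powr (4/3) = Y a b" using pint_eq[OF L] Y_eq[of a b] Y_nonneg[of a b] by (simp add: y_def)
  hence "(y powr (4/3)) powr (3/4) = Y a b powr (3/4)" by simp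
  thus ?thesis by (simp add: powr_powr y_def)
 qed
 have y: "y >= 0" by (simp add: y_def)
 define N where "N = Lp_norm 2 TR (u c)"
 have N: "N >= 0" by (simp add: N_def)
 have inc: "Lp_norm 2 ZR (%k. W t k - W s k) <= S * y" if "a <= s" "s <= t" "t <= b" for s t
 proof -
  have "Lp_norm 2 ZR (%k. W t k - W s k) <= S * Y s t powr (3/4)"
   unfolding S_def using that ab by (intro W_increment_L2(2)) auto
  also have "... <= S * Y a b powr (3/4)"
   using that S by (intro mult_left_mono powr_mono2 Y_mono Y_nonneg) auto
  finally show ?thesis by (simp add: yY)
 qed
 have inc': "Lp_norm 2 ZR (%k. W t k - W s k) <= S * y" if "s \<in> {a..b}" "t \<in> {a..b}" for s t
  using inc[of s t] inc[of t s] that Lp_norm_minus_commute[of 2 ZR "W t" "W s"] by (cases "s <= t") auto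
 define V where "V = (%t k. F k + W t k)"
 have VL: "V t \<in> Lp_space 2 ZR" for t unfolding V_def by (intro Lp_add(1) F W_L2) simp
 have uV: "is_fourier 2 (u t) (%k. mul t k * V t k)" for t using H(2)[of t] by (simp add: V_def W)
 have Vn: "Lp_norm 2 ZR (V t) = 2 * pi * Lp_norm 2 TR (u t)" for t by (rule lin_profile_norm[OF uV VL])
 have WL: "(%k. W t k - W s k) \<in> Lp_space 2 ZR" for s t by (rule W_diff_L2)
 define G where "G = (%k. V c k - (W c k - W a k))"
 have GL: "G \<in> Lp_space 2 ZR" unfolding G_def by (intro Lp_diff(1) VL W_L2) auto
 have Gn: "Lp_norm 2 ZR G <= 2 * pi * N + S * y"
  unfolding G_def using Lp_diff(2)[OF VL[of c] WL[of c a]] inc'[of a c] c Vn[of c] by (simp add: N_def)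
 have [measurable]: "G \<in> bm ZR" using GL by (simp add: Lp_space_def)
 have m1: "(%(t, k). mul t k * G k) \<in> bm LZ" by measurable
 have m2: "(%(t, k). mul t k * (W t k - W a k)) \<in> bm LZ" by measurable
 obtain w where w: "(%(t, z). w t z) \<in> bm LT"
  "\<And>t. t \<in> space lborel ==> (%k. mul t k * G k) \<in> Lp_space 2 ZR ==> is_fourier 2 (w t) (%k. mul t k * G k)"
  by (rule inverse_fourier_param[OF m1]) blast
 have wf: "is_fourier 2 (w t) (%k. mul t k * G k)" for t by (rule w(2)) (auto intro: mul_Lp GL)
 obtain d where d: "(%(t, z). d t z) \<in> bm LT"
  "\<And>t. t \<in> space lborel ==> (%k. mul t k * (W t k - W a k)) \<in> Lp_space 2 ZR ==> is_fourier 2 (d t) (%k. mul t k * (W t k - W a k))"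
  by (rule inverse_fourier_param[OF m2]) blast
 have df: "is_fourier 2 (d t) (%k. mul t k * (W t k - W a k))" for t by (rule d(2)) (auto intro: mul_Lp WL)
 have "a <= b" using c by simp
 note fs = free_strichartz[OF GL w(1) wf ab] and rs = retarded_strichartz[OF \<open>a <= b\<close> ab d(1) df]
 have um: "(%(t, z). u t z) \<in> bm LT" by (rule lin_meas[OF l])
 have eq: "AE x in LT. slab {a..b} u x = slab {a..b} w x + slab {a..b} d x"
 proof -
  have [measurable]: "(%w. u (fst w) (snd w)) \<in> bm LT" "(%x. w (fst x) (snd x)) \<in> bm LT"
   "(%w. d (fst w) (snd w)) \<in> bm LT"
   using um w(1) d(1) by (simp_all add: split_beta')
  have "AE z in TR. u t z = w t z + d t z" for t
  proof (rule is_fourier_inject[OF uV is_fourier_add[OF fexp_simps(1) wf df]])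
   show "AE k in ZR. mul t k * V t k = mul t k * G k + mul t k * (W t k - W a k)"
    by (auto simp: G_def V_def algebra_simps)
  qed
  hence "AE t in lborel. AE z in TR. (%p. u (fst p) (snd p) = w (fst p) (snd p) + d (fst p) (snd p)) (t, z)" by simp
  hence "AE p in LT. u (fst p) (snd p) = w (fst p) (snd p) + d (fst p) (snd p)"
   by (intro LT.AE_pair_measure) measurable
  thus ?thesis by eventually_elim (simp add: slab_def distrib_left)
 qed
 have sm: "slab {a..b} u \<in> bm LT" by (rule slab_measurable[OF um]) simp
 have sumL: "(%x. slab {a..b} w x + slab {a..b} d x) \<in> Lp_space 4 LT"
  by (rule Lp_add(1)[OF fs(1) rs(1)]) simp
 show L4: "slab {a..b} u \<in> Lp_space 4 LT"
  by (rule Lp_space_cong_AE[OF _ sumL sm]) (use eq in \<open>auto elim!: eventually_mono\<close>)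
 have "Lp_norm 4 LT (slab {a..b} u) = Lp_norm 4 LT (%x. slab {a..b} w x + slab {a..b} d x)"
  by (rule Lp_norm_cong_AE[OF eq sm Lp_measurable[OF sumL]])
 also have "... <= Lp_norm 4 LT (slab {a..b} w) + Lp_norm 4 LT (slab {a..b} d)"
  by (rule Lp_add(2)[OF fs(1) rs(1)]) simp
 also have "... <= S * Lp_norm 2 ZR G + 4 * S\<^sup>2 * y"
  using fs(2) rs(2) by (simp add: S_def yY)
 also have "... <= S * (2 * pi * N + S * y) + 4 * S\<^sup>2 * y"
  using Gn S by (intro add_right_mono mult_left_mono) auto
 also have "... = (2 * pi * S) * N + (5 * S\<^sup>2) * y" by (simp add: power2_eq_square algebra_simps)
 also have "... <= lin_const * N + lin_const * y"
  using lin_const N y by (intro add_mono mult_right_mono) (auto simp: S_def)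
 finally show "Lp_norm 4 LT (slab {a..b} u) <= lin_const * (Lp_norm 2 TR (u c) + Lp_norm (4/3) LT (slab {a..b} h))"
  by (simp add: N_def y_def distrib_left)
 fix t assume t: "t \<in> {a..b}"
 have "V t = (%k. V c k + (W t k - W c k))" by (auto simp: V_def)
 hence "Lp_norm 2 ZR (V t) <= Lp_norm 2 ZR (V c) + Lp_norm 2 ZR (%k. W t k - W c k)"
  using Lp_add(2)[OF VL[of c] WL[of t c]] by simp
 also have "... <= 2 * pi * N + S * y"
  using inc'[of c t] t c Vn[of c] by (simp add: N_def)
 finally have "2 * pi * Lp_norm 2 TR (u t) <= 2 * pi * N + S * y" by (simp add: Vn)
 also have "S * y <= 2 * pi * (S * y)"
  using mult_right_mono[of 1 "2 * pi" "S * y"] mult_nonneg_nonneg[OF less_imp_le[OF S] y] pi_gt3 by simp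
 finally have "2 * pi * Lp_norm 2 TR (u t) <= 2 * pi * (N + S * y)" by (simp add: distrib_left)
 hence "Lp_norm 2 TR (u t) <= 1 * N + S * y" by simp
 also have "... <= lin_const * N + lin_const * y"
  using lin_const N y by (intro add_mono mult_right_mono) (auto simp: S_def)
 finally show "Lp_norm 2 TR (u t) <= lin_const * (Lp_norm 2 TR (u c) + Lp_norm (4/3) LT (slab {a..b} h))"
  by (simp add: N_def y_def distrib_left)
qed

end

section \<open>Continuity in time of the linear solution\<close>

context duhamel
begin

lemma Y_tendsto:
 assumes "X \<longlonglongrightarrow> s"
 shows "(%n. Y (min s (X n)) (max s (X n))) \<longlonglongrightarrow> 0"
proof -
 have "(%n. LINT t|lborel. \<theta> t * indicator {min s (X n)..max s (X n)} t) \<longlonglongrightarrow> (LINT t|(lborel :: real measure). 0)"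
 proof (rule integral_dominated_convergence[where w = \<theta>])
  have "AE t in lborel. t \<noteq> s" by (rule AE_lborel_singleton)
  thus "AE t in lborel. (%n. \<theta> t * indicator {min s (X n)..max s (X n)} t) \<longlonglongrightarrow> 0"
  proof eventually_elim
   case (elim t)
   have "\<bar>t - s\<bar> > 0" using elim by simp
   from LIMSEQ_D[OF assms this] obtain N where "\<And>n. n >= N ==> \<bar>X n - s\<bar> < \<bar>t - s\<bar>" by auto
   hence "\<theta> t * indicator {min s (X n)..max s (X n)} t = 0" if "n >= N" for n
    using that by (fastforce split: split_indicator)
   thus ?case by (intro tendsto_eventually) (auto simp: eventually_sequentially)
  qed
 qed (auto simp: \<theta>_nonneg \<theta>_integrable split: split_indicator)
 thus ?thesis by (simp add: Y_def)
qed

end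

text \<open>Two effects are separated: the profile moves by an increment of \<open>W\<close>,
  controlled by the forcing between the two times, and the group is strongly continuous on a fixed
  profile by dominated convergence.\<close>

lemma (in dispersion) lin_continuous:
 assumes l: "lin F h u" and X: "X \<longlonglongrightarrow> s"
 shows "(%n. Lp_norm 2 TR (%z. u (X n) z - u s z)) \<longlonglongrightarrow> 0"
proof -
 obtain H where H: "duhamel \<alpha> \<epsilon> h H" "\<And>t. is_fourier 2 (u t) (%k. mul t k * (F k + DW H t k))"
  using l unfolding lin_def by blast
 interpret duhamel \<alpha> \<epsilon> h H by fact
 have W: "DW H = W" by (rule duhamel_W[OF H(1), symmetric])
 have F: "F \<in> Lp_space 2 ZR" using l by (simp add: lin_def)
 define V where "V = (%t k. F k + W t k)"
 have VL: "V t \<in> Lp_space 2 ZR" for t unfolding V_def by (intro Lp_add(1) F W_L2) simp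
 have [measurable]: "V t \<in> bm ZR" for t using VL by (auto simp: Lp_space_def)
 have uV: "is_fourier 2 (u t) (%k. mul t k * V t k)" for t using H(2)[of t] by (simp add: V_def W)
 define A where "A = (%n. Lp_norm 2 ZR (%k. V (X n) k - V s k))"
 define B where "B = (%n. Lp_norm 2 ZR (%k. mul s k * V s k - mul (X n) k * V s k))"
 have le: "2 * pi * Lp_norm 2 TR (%z. u (X n) z - u s z) <= A n + B n" for n
 proof -
  have "2 * pi * Lp_norm 2 TR (%z. u (X n) z - u s z) = Lp_norm 2 ZR (%k. mul (X n) k * V (X n) k - mul s k * V s k)"
   using is_fourier_norm(2)[OF fexp_simps(1) is_fourier_diff[OF fexp_simps(1) uV[of "X n"] uV[of s]] refl] by simp
  also have "... <= Lp_norm 2 ZR (%k. mul (X n) k * V (X n) k - mul (X n) k * V s k) + Lp_norm 2 ZR (%k. mul (X n) k * V s k - mul s k * V s k)"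
   by (intro Lp_norm_triangle mul_Lp(1) VL) simp
  also have "Lp_norm 2 ZR (%k. mul (X n) k * V (X n) k - mul (X n) k * V s k) = A n"
   unfolding A_def using mul_Lp(2)[OF Lp_diff(1)[OF VL VL], of "X n" "X n" s] by (simp add: right_diff_distrib)
  finally show ?thesis by (simp add: B_def Lp_norm_minus_commute[of 2 ZR "%k. mul s k * V s k"])
 qed
 have "B \<longlonglongrightarrow> 0"
  unfolding B_def
 proof (rule Lp_dominated[where w = "%k. 2 * V s k"])
  show "(%k. 2 * V s k) \<in> Lp_space 2 ZR" by (rule Lp_cmult(1)[OF VL]) simp
  show "AE k in ZR. cmod (mul s k * V s k - mul (X n) k * V s k) <= cmod (2 * V s k)" for n
  proof (intro AE_I2)
   fix k
   show "cmod (mul s k * V s k - mul (X n) k * V s k) <= cmod (2 * V s k)"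
    using norm_triangle_ineq4[of "mul s k * V s k" "mul (X n) k * V s k"] by (simp add: norm_mult)
  qed
  show "AE k in ZR. (%n. mul (X n) k * V s k) \<longlonglongrightarrow> mul s k * V s k"
   unfolding multiplier_eq by (intro AE_I2 tendsto_intros X)
 qed auto
 moreover have "A \<longlonglongrightarrow> 0"
 proof (rule Lim_null_comparison)
  show "\<forall>\<^sub>F n in sequentially. norm (A n) <= strich * Y (min s (X n)) (max s (X n)) powr (3/4)"
  proof -
   from LIMSEQ_D[OF X, of 1] obtain N where N: "\<And>n. n >= N ==> \<bar>X n - s\<bar> < 1" by auto
   have "norm (A n) <= strich * Y (min s (X n)) (max s (X n)) powr (3/4)" if "n >= N" for n
   proof -
    have "A n = Lp_norm 2 ZR (%k. W (X n) k - W s k)" by (simp add: A_def V_def)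
    moreover have "... = Lp_norm 2 ZR (%k. W (max s (X n)) k - W (min s (X n)) k)"
     by (cases "s <= X n") (auto simp: max_def min_def Lp_norm_minus_commute[of 2 ZR "W s"])
    moreover have "... <= strich * Y (min s (X n)) (max s (X n)) powr (3/4)"
     using N[OF that] by (intro W_increment_L2(2)) auto
    ultimately show ?thesis by (simp add: A_def)
   qed
   thus ?thesis by (auto simp: eventually_sequentially)
  qed
  have "(%n. Y (min s (X n)) (max s (X n)) powr (3/4)) \<longlonglongrightarrow> 0 powr (3/4)"
   by (intro tendsto_powr2[OF Y_tendsto[OF X]]) (auto simp: Y_nonneg)
  from tendsto_mult_left[OF this, of strich]
  show "(%n. strich * Y (min s (X n)) (max s (X n)) powr (3/4)) \<longlonglongrightarrow> 0" by simp
 qed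
 ultimately have AB: "(%n. (A n + B n) / (2 * pi)) \<longlonglongrightarrow> 0"
  using tendsto_divide[OF tendsto_add, of A 0 sequentially B 0 "%_. 2 * pi" "2 * pi"] by simp
 show ?thesis
  by (rule Lim_null_comparison[OF _ AB]) (use le in \<open>auto simp: field_simps\<close>)
qed

subsection \<open>The energy identity\<close>

text \<open>By Fubini the contributions of the triangles \<open>r <= s\<close> and
  \<open>r >= s\<close> are conjugate to each other. This is the chain rule for the squared modulus
  of an absolutely continuous function, without derivatives.\<close>

lemma square_of_primitive:
 fixes f :: "real => complex"
 assumes f: "integrable lborel f"
 shows "complex_of_real ((cmod (LINT s|lborel. f s))\<^sup>2) =
  of_real (2 * Re (LINT s|lborel. f s * cnj (LINT r|lborel. indicator {..s} r *\<^sub>R f r)))"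
proof -
 interpret pair_sigma_finite "lborel :: real measure" "lborel :: real measure"
  by (intro pair_sigma_finite.intro sigma_finite_lborel)
 have [measurable]: "f \<in> bm borel" using f by auto
 have ir: "integrable lborel (%r. indicator A r *\<^sub>R f r)" if "A \<in> sets borel" for A
  using integrable_mult_indicator[OF _ f, of A] that by simp
 let ?P = "%s. LINT r|lborel. indicator {..s} r *\<^sub>R f r"
 define T where "T = (LINT s|lborel. f s * cnj (?P s))"
 have int: "integrable (lborel \<Otimes>\<^sub>M lborel) (%(s, r). f s * cnj (indicator {s..} r *\<^sub>R f r))"
  by (rule integrable_pair_mult[OF sigma_finite_lborel f f])
    (measurable, auto simp: norm_mult split: split_indicator)
 let ?Q = "%s. LINT r|lborel. indicator {s..} r *\<^sub>R f r"
 have "(LINT s|lborel. f s * cnj (?Q s))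
   = (LINT s|lborel. LINT r|lborel. f s * cnj (indicator {s..} r *\<^sub>R f r))"
  by (simp only: Bochner_Integration.integral_cnj integral_mult_right_zero)
 also have "... = (LINT r|lborel. LINT s|lborel. f s * cnj (indicator {s..} r *\<^sub>R f r))"
  by (rule lborel_pair.Fubini_integral[OF int, symmetric])
 also have "... = (LINT r|lborel. LINT s|lborel. cnj (f r * cnj (indicator {..r} s *\<^sub>R f s)))"
  by (intro Bochner_Integration.integral_cong HOL.refl) (auto split: split_indicator)
 also have "... = cnj T"
  unfolding T_def by (simp only: Bochner_Integration.integral_cnj integral_mult_right_zero)
 finally have T': "(LINT s|lborel. f s * cnj (?Q s)) = cnj T" .
 have split: "(LINT r|lborel. f r) = (?P s) + (?Q s)" for s
 proof -
  have "(?P s) + (?Q s)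
   = (LINT r|lborel. indicator {..s} r *\<^sub>R f r + indicator {s..} r *\<^sub>R f r)"
   by (rule Bochner_Integration.integral_add[symmetric]; rule ir; simp)
  also have "... = (LINT r|lborel. f r)"
  proof (intro integral_cong_AE)
   show "AE r in lborel. indicator {..s} r *\<^sub>R f r + indicator {s..} r *\<^sub>R f r = f r"
    using AE_lborel_singleton[of s] by eventually_elim (auto split: split_indicator)
  qed auto
  finally show ?thesis by simp
 qed
 have bd: "cmod (LINT r|lborel. indicator A r *\<^sub>R f r) <= (LINT r|lborel. cmod (f r))" if "A \<in> sets borel" for A
 proof -
  have "cmod (LINT r|lborel. indicator A r *\<^sub>R f r) <= (LINT r|lborel. cmod (indicator A r *\<^sub>R f r))" by (rule integral_norm_bound)
  also have "... <= (LINT r|lborel. cmod (f r))"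
   using integrable_norm[OF ir[OF that]] integrable_norm[OF f] by (intro integral_mono) (auto split: split_indicator)
  finally show ?thesis .
 qed
 have is1: "integrable lborel (%s. f s * cnj (?P s))"
 proof (rule Bochner_Integration.integrable_bound)
  show "integrable lborel (%s. f s * of_real (LINT r|lborel. cmod (f r)))" by (intro integrable_mult_left f)
  have [measurable]: "(%s. LINT r|lborel. indicator {..s} r *\<^sub>R f r) \<in> bm borel"
  proof -
   have "(%s. LINT r|lborel. (if r <= s then 1 else 0) *\<^sub>R f r) \<in> bm borel" by measurable
   moreover have "(%s. LINT r|lborel. (if r <= s then 1 else 0) *\<^sub>R f r) = (%s. LINT r|lborel. indicator {..s} r *\<^sub>R f r)"
    by (intro ext Bochner_Integration.integral_cong HOL.refl) (auto split: split_indicator)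
   ultimately show ?thesis by simp
  qed
  show "(%s. f s * cnj (?P s)) \<in> bm lborel" by measurable
  show "AE s in lborel. norm (f s * cnj (?P s)) <= norm (f s * of_real (LINT r|lborel. cmod (f r)))"
  proof (intro AE_I2)
   fix s
   have "0 <= (LINT r|lborel. cmod (f r))" by simp
   thus "norm (f s * cnj (?P s)) <= norm (f s * of_real (LINT r|lborel. cmod (f r)))"
    using bd[of "{..s}"] unfolding norm_mult complex_mod_cnj norm_of_real by (intro mult_left_mono) auto
  qed
 qed
 have is0: "integrable lborel (%s. f s * cnj (LINT r|lborel. f r))" by (intro integrable_mult_left f)
 have "(LINT s|lborel. f s) * cnj (LINT r|lborel. f r) = (LINT s|lborel. f s * cnj (LINT r|lborel. f r))"
  by simp
 also have "... = (LINT s|lborel. f s * cnj (?P s)) + (LINT s|lborel. f s * cnj (?Q s))"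
 proof -
  have eq: "f s * cnj (?Q s) = f s * cnj (LINT r|lborel. f r) - f s * cnj (?P s)" for s
   using split[of s] by (simp add: algebra_simps)
  show ?thesis unfolding eq Bochner_Integration.integral_diff[OF is0 is1] by simp
 qed
 also have "... = T + cnj T" unfolding T' by (simp add: T_def)
 also have "... = of_real (2 * Re T)" by (simp add: complex_add_cnj)
 finally show ?thesis by (simp only: complex_norm_square T_def)
qed

text \<open>Writing \<open>V\<close> as \<open>V a\<close> plus a primitive, the primitive
  contributes its own square by \<open>square_of_primitive\<close>, and \<open>V a\<close> the cross
  term.\<close>

lemma energy_pointwise:
 fixes g :: "real => complex"
 assumes g: "integrable lborel (%s. indicator {a..b} s *\<^sub>R g s)" and ab: "a <= b"
  and V: "\<And>s. s \<in> {a..b} ==> V s = V a + (LINT r|lborel. indicator {a..s} r *\<^sub>R g r)"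
 shows "integrable lborel (%s. indicator {a..b} s *\<^sub>R (g s * cnj (V s)))"
  "(cmod (V b))\<^sup>2 - (cmod (V a))\<^sup>2 = 2 * Re (LINT s|lborel. indicator {a..b} s *\<^sub>R (g s * cnj (V s)))"
proof -
 define f where "f = (%s. indicator {a..b} s *\<^sub>R g s)"
 have f: "integrable lborel f" using g by (simp add: f_def)
 have [measurable]: "f \<in> bm borel" using f by auto
 define P where "P = (%s. LINT r|lborel. indicator {..s} r *\<^sub>R f r)"
 have Vs: "V s = V a + P s" if "s \<in> {a..b}" for s
 proof -
  have "P s = (LINT r|lborel. indicator {a..s} r *\<^sub>R g r)"
   unfolding P_def f_def using that by (intro Bochner_Integration.integral_cong HOL.refl) (auto split: split_indicator)
  thus ?thesis using V[OF that] by simp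
 qed
 have eq: "indicator {a..b} s *\<^sub>R (g s * cnj (V s)) = f s * cnj (V a) + f s * cnj (P s)" for s
  using Vs[of s] by (auto simp: f_def distrib_left split: split_indicator)
 have bd: "cmod (P s) <= (LINT r|lborel. cmod (f r))" for s
 proof -
  have "cmod (P s) <= (LINT r|lborel. cmod (indicator {..s} r *\<^sub>R f r))" unfolding P_def by (rule integral_norm_bound)
  also have "... <= (LINT r|lborel. cmod (f r))"
   using integrable_norm[OF integrable_mult_indicator[OF _ f, of "{..s}"]] integrable_norm[OF f] by (intro integral_mono) (auto split: split_indicator)
  finally show ?thesis .
 qed
 have [measurable]: "P \<in> bm borel"
 proof -
  have "(%s. LINT r|lborel. (if r <= s then 1 else 0) *\<^sub>R f r) \<in> bm borel" by measurable
  moreover have "(%s. LINT r|lborel. (if r <= s then 1 else 0) *\<^sub>R f r) = P"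
   unfolding P_def by (intro ext Bochner_Integration.integral_cong HOL.refl) (auto split: split_indicator)
  ultimately show ?thesis by simp
 qed
 have i1: "integrable lborel (%s. f s * cnj (V a))" by (intro integrable_mult_left f)
 have i2: "integrable lborel (%s. f s * cnj (P s))"
 proof (rule Bochner_Integration.integrable_bound)
  show "integrable lborel (%s. f s * of_real (LINT r|lborel. cmod (f r)))" by (intro integrable_mult_left f)
  show "AE s in lborel. norm (f s * cnj (P s)) <= norm (f s * of_real (LINT r|lborel. cmod (f r)))"
  proof (intro AE_I2)
   fix s
   have "0 <= (LINT r|lborel. cmod (f r))" by simp
   thus "norm (f s * cnj (P s)) <= norm (f s * of_real (LINT r|lborel. cmod (f r)))"
    using bd[of s] unfolding norm_mult complex_mod_cnj norm_of_real by (intro mult_left_mono) auto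
  qed
 qed measurable
 show "integrable lborel (%s. indicator {a..b} s *\<^sub>R (g s * cnj (V s)))"
  unfolding eq by (rule Bochner_Integration.integrable_add[OF i1 i2])
 have Pb: "P b = (LINT s|lborel. f s)"
  unfolding P_def by (intro Bochner_Integration.integral_cong HOL.refl) (auto simp: f_def split: split_indicator)
 have "(LINT s|lborel. indicator {a..b} s *\<^sub>R (g s * cnj (V s))) = P b * cnj (V a) + (LINT s|lborel. f s * cnj (P s))"
  unfolding eq Bochner_Integration.integral_add[OF i1 i2] Pb by simp
 moreover have "(cmod (P b))\<^sup>2 = 2 * Re (LINT s|lborel. f s * cnj (P s))"
  using square_of_primitive[OF f] unfolding Pb unfolding P_def by (simp only: of_real_eq_iff)
 moreover have "(cmod (V b))\<^sup>2 = (cmod (V a))\<^sup>2 + (cmod (P b))\<^sup>2 + 2 * Re (P b * cnj (V a))"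
  unfolding Vs[of b, simplified, OF ab] by (simp only: cmod_power2) (simp add: power2_eq_square algebra_simps)
 ultimately show "(cmod (V b))\<^sup>2 - (cmod (V a))\<^sup>2 = 2 * Re (LINT s|lborel. indicator {a..b} s *\<^sub>R (g s * cnj (V s)))"
  by (simp del: times_complex.simps)
qed

text \<open>Square integrable forcing makes the product of \<open>H\<close> and the conjugate
  profile integrable in time and frequency, so the identity at single frequencies can be integrated
  and Fubini applied. \<open>is_fourier_consistent\<close> shows that \<open>H s\<close> is also the
  \<open>L^2\<close> transform of \<open>h s\<close>, and Plancherel leads back to physical
  space.\<close>

lemma (in dispersion) energy_L2:
 assumes l: "lin F h u" and h2: "pint 2 LT (slab UNIV h) < \<infinity>" and ab: "a <= b" "b <= a + 1"
 shows "(Lp_norm 2 TR (u b))\<^sup>2 - (Lp_norm 2 TR (u a))\<^sup>2 =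
  2 * Re (LINT w|LT. slab {a..b} h w * cnj (slab {a..b} u w))"
proof -
 obtain H where H: "duhamel \<alpha> \<epsilon> h H" "\<And>t. is_fourier 2 (u t) (%k. mul t k * (F k + DW H t k))"
  using l unfolding lin_def by blast
 interpret duhamel \<alpha> \<epsilon> h H by fact
 have W: "DW H = W" by (rule duhamel_W[OF H(1), symmetric])
 have F: "F \<in> Lp_space 2 ZR" using l by (simp add: lin_def)
 have [measurable]: "F \<in> bm ZR" using F by (simp add: Lp_space_def)
 define V where "V = (%t k. F k + W t k)"
 have Vm [measurable]: "(%w. V (f w) (g w)) \<in> bm M"
  if [measurable]: "f \<in> bm M" "g \<in> measurable M ZR" for f g and M :: "'c measure"
  unfolding V_def by measurable
 have Vm1 [measurable]: "V t \<in> bm ZR" for t unfolding V_def by measurable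
 have VL: "V t \<in> Lp_space 2 ZR" for t unfolding V_def by (intro Lp_add(1) F W_L2) simp
 have uV: "is_fourier 2 (u t) (%k. mul t k * V t k)" for t using H(2)[of t] by (simp add: V_def W)
 have Vn: "Lp_norm 2 ZR (V t) = 2 * pi * Lp_norm 2 TR (u t)" for t by (rule lin_profile_norm[OF uV VL])
 have hm: "(%(t, z). h t z) \<in> bm LT" by (rule h_meas)
 have [measurable]: "(%t. pint 2 TR (h t)) \<in> bm borel"
  using pint_param_measurable[OF sigma_finite_TR hm] by simp
 have "(NN t|lborel. pint 2 TR (h t)) < \<infinity>" using h2 by (simp add: pint_slab[OF hm])
 hence "AE t in lborel. pint 2 TR (h t) \<noteq> \<infinity>" by (intro nn_integral_PInf_AE) auto
 hence hL: "AE s in lborel. h s \<in> Lp_space 2 TR" by eventually_elim (auto simp: Lp_space_iff less_top)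
 have HF: "AE s in lborel. is_fourier 2 (h s) (H s)"
  using hL hH
 proof eventually_elim
  case (elim s)
  obtain G where G: "is_fourier 2 (h s) G" using is_fourier_exists[OF fexp_simps(1) elim(1)] by auto
  have "AE k in ZR. G k = H s k" using is_fourier_consistent[OF elim(2) G] by eventually_elim simp
  thus ?case by (intro is_fourier_cong_AE[OF fexp_simps(1) G]) auto
 qed
 define \<nu> where "\<nu> = (%s. enn2real (pint 2 TR (h s)))"
 have [measurable]: "\<nu> \<in> bm borel" unfolding \<nu>_def by measurable
 have \<nu>i: "integrable lborel \<nu>"
 proof -
  have "(NN s|lborel. ennreal (norm (\<nu> s))) <= (NN s|lborel. pint 2 TR (h s))"
   using \<open>AE t in lborel. pint 2 TR (h t) \<noteq> \<infinity>\<close>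
   by (intro nn_integral_mono_AE) (auto simp: \<nu>_def less_top elim!: eventually_mono)
  also have "... < \<infinity>" by fact
  finally show ?thesis by (simp add: integrable_iff_bounded)
 qed
 have H\<nu>: "AE s in lborel. H s \<in> Lp_space 2 ZR \<and> Lp_norm 2 ZR (H s) <= 2 * pi * (1 + \<nu> s)"
  using HF
 proof eventually_elim
  case (elim s)
  note f = is_fourierD[OF elim, simplified]
  have "(Lp_norm 2 TR (h s))\<^sup>2 = \<nu> s" using pint_eq[OF f(1)] by (simp add: \<nu>_def)
  moreover have "0 <= (Lp_norm 2 TR (h s) - 1)\<^sup>2 + 1" by simp
  moreover have "0 <= \<nu> s" by (simp add: \<nu>_def)
  ultimately have "Lp_norm 2 TR (h s) <= 1 + \<nu> s" by (simp add: power2_eq_square algebra_simps)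
  thus ?case using f(2) is_fourier_norm(2)[OF fexp_simps(1) elim refl] by simp
 qed
 define I where "I = (indicator {a..b} :: real => real)"
 have [measurable]: "I \<in> bm borel" unfolding I_def by measurable
 have Ii: "I s = 0 \<or> I s = 1" for s by (auto simp: I_def indicator_def)
 have uc: "Lp_norm 2 TR (u t) <= lin_const * (Lp_norm 2 TR (u a) + Lp_norm (4/3) LT (slab {a..b} h))" if "t \<in> {a..b}" for t
  using lin_estimate(3)[OF l _ ab(1) ab(2) that] by simp
 define M where "M = 2 * pi * (lin_const * (Lp_norm 2 TR (u a) + Lp_norm (4/3) LT (slab {a..b} h)))"
 have M: "M >= 0" using lin_const by (simp add: M_def)
 have VM: "Lp_norm 2 ZR (V t) <= M" if "t \<in> {a..b}" for t
  unfolding Vn M_def using uc[OF that] by (intro mult_left_mono) auto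
 let ?P = "%s k. I s *\<^sub>R (mul (- s) k * H s k * cnj (V s k))"
 have pm: "(%w. ?P (fst w) (snd w)) \<in> bm LZ" by measurable
 have VcL: "(%k. cnj (mul s k * V s k)) \<in> Lp_space 2 ZR" "Lp_norm 2 ZR (%k. cnj (mul s k * V s k)) = Lp_norm 2 ZR (V s)" for s
  using mul_Lp[OF VL[of s], of s] by (auto simp: Lp_space_def Lp_norm_def norm_mult)
 have Pe: "?P s k = I s *\<^sub>R (H s k * cnj (mul s k * V s k))" for s k by (simp add: mult_ac)
 have int: "integrable LZ (%(s, k). ?P s k)"
  unfolding integrable_iff_bounded
 proof
  show "(%(s, k). ?P s k) \<in> bm LZ" using pm by (simp add: split_beta')
  have "(NN w|LZ. ennreal (norm ((%(s, k). ?P s k) w)))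
   = (NN s|lborel. (NN k|ZR. ennreal (norm (?P s k))))"
   using pm by (subst ZR.nn_integral_fst[symmetric]) (auto simp: split_beta')
  also have "... <= (NN s|lborel. ennreal (2 * pi * M * (I s + \<nu> s)))"
  proof (rule nn_integral_mono_AE)
   show "AE s in lborel. (NN k|ZR. ennreal (norm (?P s k))) <= ennreal (2 * pi * M * (I s + \<nu> s))"
    using H\<nu>
   proof eventually_elim
    case (elim s)
    show ?case
    proof (cases "I s = 0")
     case False
     hence I1: "I s = 1" using Ii[of s] by simp
     hence s: "s \<in> {a..b}" by (auto simp: I_def indicator_def split: if_splits)
     have "(NN k|ZR. ennreal (norm (?P s k))) = (NN k|ZR. ennreal (cmod (H s k) * cmod (cnj (mul s k * V s k))))"
      unfolding Pe by (simp add: I1 norm_mult)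
     also have "... <= ennreal (Lp_norm 2 ZR (H s) * Lp_norm 2 ZR (%k. cnj (mul s k * V s k)))"
      by (rule holder_nn[OF _ VcL(1)]) (use elim in auto)
     also have "... <= ennreal ((2 * pi * (1 + \<nu> s)) * M)"
      unfolding VcL(2) using elim VM[OF s] by (intro ennreal_leI mult_mono) (auto simp: \<nu>_def)
     also have "(2 * pi * (1 + \<nu> s)) * M = 2 * pi * M * (I s + \<nu> s)" by (simp add: I1)
     finally show ?thesis .
    qed (simp add: zero_ennreal_def[symmetric])
   qed
  qed
  also have "... < \<infinity>"
  proof -
   have "integrable lborel (%s. 2 * pi * M * (I s + \<nu> s))"
    unfolding I_def
    by (intro integrable_mult_right Bochner_Integration.integrable_add \<nu>i integrable_real_indicator)
      (auto simp: emeasure_lborel_Icc_eq)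
   moreover have "0 <= 2 * pi * M * (I s + \<nu> s)" for s using M Ii[of s] by (auto simp: \<nu>_def)
   ultimately show ?thesis by (subst nn_integral_eq_integral) auto
  qed
  finally show "(NN w|LZ. ennreal (norm ((%(s, k). ?P s k) w))) < \<infinity>" .
 qed
 have pw: "AE k in ZR. (cmod (V b k))\<^sup>2 - (cmod (V a k))\<^sup>2 = 2 * Re (LINT s|lborel. ?P s k)"
  using good_AE
 proof eventually_elim
  case (elim k)
  have gi: "integrable lborel (%s. indicator {a..b} s *\<^sub>R (mul (- s) k * H s k))"
   by (rule good_integrable[OF elim, where r = "\<bar>a\<bar> + \<bar>b\<bar>"]) auto
  have "V s k = V a k + (LINT r|lborel. indicator {a..s} r *\<^sub>R (mul (- r) k * H r k))" if "s \<in> {a..b}" for s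
   using W_increment[OF elim, of a s] that by (simp add: V_def algebra_simps)
  from energy_pointwise(2)[OF gi ab(1), of "%s. V s k", OF this] show ?case by (simp add: I_def)
 qed
 have sq: "(Lp_norm 2 M' f)\<^sup>2 = (LINT x|M'. (cmod (f x))\<^sup>2)" for M' :: "'d measure" and f
  by (simp add: Lp_norm_def powr_half_sqrt)
 have V2: "integrable ZR (%k. (cmod (V t k))\<^sup>2)" for t using VL[of t] by (simp add: Lp_space_def)
 have ki: "integrable ZR (%k. LINT s|lborel. ?P s k)" using LZ.integrable_snd[OF int] by simp
 have "(2 * pi)\<^sup>2 * ((Lp_norm 2 TR (u b))\<^sup>2 - (Lp_norm 2 TR (u a))\<^sup>2) = (Lp_norm 2 ZR (V b))\<^sup>2 - (Lp_norm 2 ZR (V a))\<^sup>2"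
  unfolding Vn by (simp add: power_mult_distrib algebra_simps)
 also have "... = (LINT k|ZR. (cmod (V b k))\<^sup>2 - (cmod (V a k))\<^sup>2)"
  unfolding Lp_norm_def using V2 by (simp add: powr_half_sqrt)
 also have "... = (LINT k|ZR. 2 * Re (LINT s|lborel. ?P s k))"
  using pw ki by (intro integral_cong_AE) auto
 also have "... = 2 * Re (LINT k|ZR. LINT s|lborel. ?P s k)" using ki by (simp add: integral_Re)
 also have "(LINT k|ZR. LINT s|lborel. ?P s k) = (LINT s|lborel. LINT k|ZR. ?P s k)"
  by (rule LZ.Fubini_integral[OF int])
 also have "Re ... = (LINT s|lborel. Re (LINT k|ZR. ?P s k))"
  by (rule integral_Re[OF LZ.integrable_fst[OF int], symmetric])
 finally have eq1: "(2 * pi)\<^sup>2 * ((Lp_norm 2 TR (u b))\<^sup>2 - (Lp_norm 2 TR (u a))\<^sup>2) = 2 * (LINT s|lborel. Re (LINT k|ZR. ?P s k))" .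
 let ?Q = "%w. slab {a..b} h w * cnj (slab {a..b} u w)"
 have Qi: "integrable LT ?Q"
 proof -
  have 1: "slab {a..b} h \<in> Lp_space (4/3) LT" by (rule forcing_slab(1)[OF lin_forcing[OF l]]) simp
  have "slab {a..b} u \<in> Lp_space 4 LT" using lin_estimate(1)[OF l _ ab(1) ab(2)] by simp
  hence 2: "(%w. cnj (slab {a..b} u w)) \<in> Lp_space 4 LT" by (auto simp: Lp_space_def)
  show ?thesis by (rule holder(1)[OF 1 2]) auto
 qed
 have si: "integrable lborel (%s. LINT z|TR. ?Q (s, z))"
  using LT.integrable_fst[of "%s z. ?Q (s, z)"] Qi by (simp add: split_beta')
 have "(LINT s|lborel. Re (LINT k|ZR. ?P s k)) = (LINT s|lborel. (2 * pi)\<^sup>2 * Re (LINT z|TR. ?Q (s, z)))"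
 proof (intro integral_cong_AE)
  show "(%s. Re (LINT k|ZR. ?P s k)) \<in> bm lborel" by measurable
  show "(%s. (2 * pi)\<^sup>2 * Re (LINT z|TR. ?Q (s, z))) \<in> bm lborel" using si by auto
  show "AE s in lborel. Re (LINT k|ZR. ?P s k) = (2 * pi)\<^sup>2 * Re (LINT z|TR. ?Q (s, z))"
   using HF
  proof eventually_elim
   case (elim s)
   show ?case
   proof (cases "s \<in> {a..b}")
    case True
    hence "(LINT k|ZR. ?P s k) = (LINT k|ZR. H s k * cnj (mul s k * V s k))"
     unfolding Pe by (simp add: I_def)
    moreover have "(LINT z|TR. ?Q (s, z)) = (LINT z|TR. h s z * cnj (u s z))"
     using True by (simp add: slab_def)
    ultimately show ?thesis using is_fourier_inner[OF elim uV[of s]] by simp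
   qed (simp add: I_def slab_def)
  qed
 qed
 also have "... = (2 * pi)\<^sup>2 * Re (LINT s|lborel. LINT z|TR. ?Q (s, z))"
  using si by (simp add: integral_Re)
 also have "(LINT s|lborel. LINT z|TR. ?Q (s, z)) = (LINT w|LT. ?Q w)"
  using LT.integral_fst[of "%s z. ?Q (s, z)"] Qi by (simp add: split_beta')
 finally show ?thesis using eq1 by simp
qed

text \<open>Where \<open>\<bar>h\<bar> <= n\<close>, the square of \<open>\<bar>h\<bar>\<close> is
  at most \<open>n^(2/3)\<close> times its power \<open>4/3\<close>, so cutting off at height
  \<open>n\<close> gives square integrable forcing. The solutions with the same value at
  \<open>a\<close> converge by \<open>lin_estimate\<close>, in \<open>L^4\<close> of the slab and in
  \<open>L^2\<close> at time \<open>b\<close>, which suffices for both sides.\<close>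

theorem (in dispersion) energy_identity:
 assumes l: "lin F h u" and ab: "a <= b" "b <= a + 1"
 shows "(Lp_norm 2 TR (u b))\<^sup>2 - (Lp_norm 2 TR (u a))\<^sup>2 =
  2 * Re (LINT w|LT. slab {a..b} h w * cnj (slab {a..b} u w))"
proof -
 note hf = lin_forcing[OF l]
 have hm: "(%(t, z). h t z) \<in> bm LT" using hf by (simp add: forcing_def)
 have [measurable]: "(%w. h (fst w) (snd w)) \<in> bm LT" using hm by (simp add: split_beta')
 have hL: "(%w. h (fst w) (snd w)) \<in> Lp_space (4/3) LT" using hf by (simp add: forcing_iff split_beta')
 define hn where "hn = (%(n::nat) t z. if cmod (h t z) <= real n then h t z else 0)"
 have hnm: "(%(t, z). hn n t z) \<in> bm LT" for n unfolding hn_def split_beta' by measurable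
 have [measurable]: "(%w. hn n (fst w) (snd w)) \<in> bm LT" for n using hnm[of n] by (simp add: split_beta')
 have hnL: "(%w. hn n (fst w) (snd w)) \<in> Lp_space (4/3) LT" for n
  by (rule Lp_mono(1)[OF _ _ hL]) (auto simp: hn_def)
 have hnf: "forcing (hn n)" for n using hnL[of n] by (simp add: forcing_iff split_beta')
 have hn2: "pint 2 LT (slab UNIV (hn n)) < \<infinity>" for n
 proof -
  have "pint 2 LT (slab UNIV (hn n)) <= (NN w|LT. ennreal (real n powr (2/3)) * ennreal (cmod (h (fst w) (snd w)) powr (4/3)))"
   unfolding pint_def
  proof (rule nn_integral_mono)
   fix w
   show "ennreal (cmod (slab UNIV (hn n) w) powr 2) <= ennreal (real n powr (2/3)) * ennreal (cmod (h (fst w) (snd w)) powr (4/3))"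
   proof (cases "cmod (h (fst w) (snd w)) <= real n")
    case True
    have "cmod (h (fst w) (snd w)) powr 2 = cmod (h (fst w) (snd w)) powr (2/3) * cmod (h (fst w) (snd w)) powr (4/3)"
     by (simp add: powr_add[symmetric] del: powr_numeral)
    also have "... <= real n powr (2/3) * cmod (h (fst w) (snd w)) powr (4/3)"
     using True by (intro mult_right_mono powr_mono2) auto
    finally show ?thesis using True by (simp add: slab_def hn_def ennreal_mult[symmetric] ennreal_leI)
   qed (simp add: slab_def hn_def)
  qed
  also have "... = ennreal (real n powr (2/3)) * pint (4/3) LT (%w. h (fst w) (snd w))"
   unfolding pint_def by (rule nn_integral_cmult) measurable
  also have "... < \<infinity>" using hL by (simp add: Lp_space_iff ennreal_mult_less_top)
  finally show ?thesis .
 qed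
 have "\<forall>n. \<exists>p. lin (fst p) (hn n) (snd p) \<and> (AE z in TR. snd p a z = u a z)"
  using lin_exists_at[OF hnf lin_L2[OF l]] by simp
 then obtain p where p: "\<And>n. lin (fst (p n)) (hn n) (snd (p n))" "\<And>n. AE z in TR. snd (p n) a z = u a z"
  by metis
 define v where "v = (%n. snd (p n))"
 have v: "lin (fst (p n)) (hn n) (v n)" "AE z in TR. v n a z = u a z" for n using p by (auto simp: v_def)
 define \<delta> where "\<delta> = (%n. Lp_norm (4/3) LT (slab {a..b} (%t z. hn n t z - h t z)))"
 have \<delta>: "\<delta> \<longlonglongrightarrow> 0"
 proof -
  have sL: "slab {a..b} h \<in> Lp_space (4/3) LT" by (rule forcing_slab(1)[OF hf]) simp
  have "(%n. Lp_norm (4/3) LT (%w. slab {a..b} h w - slab {a..b} (hn n) w)) \<longlonglongrightarrow> 0"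
  proof (rule Lp_dominated[OF _ _ sL])
   show "slab {a..b} (hn n) \<in> bm LT" for n by (rule slab_measurable[OF hnm]) simp
   show "slab {a..b} h \<in> bm LT" by (rule slab_measurable[OF hm]) simp
   show "AE w in LT. cmod (slab {a..b} h w - slab {a..b} (hn n) w) <= cmod (slab {a..b} h w)" for n
    by (auto simp: slab_def hn_def split: split_indicator)
   show "AE w in LT. (%n. slab {a..b} (hn n) w) \<longlonglongrightarrow> slab {a..b} h w"
   proof (intro AE_I2 tendsto_eventually)
    fix w
    show "\<forall>\<^sub>F n in sequentially. slab {a..b} (hn n) w = slab {a..b} h w"
     by (intro eventually_mono[OF eventually_ge_at_top[of "nat \<lceil>cmod (h (fst w) (snd w))\<rceil>"]])
       (auto simp: slab_def hn_def)
   qed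
  qed simp
  moreover have "(%w. slab {a..b} h w - slab {a..b} (hn n) w) = (%w. - slab {a..b} (%t z. hn n t z - h t z) w)" for n
   by (auto simp: slab_def algebra_simps)
  ultimately show ?thesis by (simp add: \<delta>_def Lp_uminus(2))
 qed
 have va: "Lp_norm 2 TR (v n a) = Lp_norm 2 TR (u a)" for n
  by (rule Lp_norm_cong_AE[OF v(2) Lp_measurable[OF lin_L2[OF v(1)]] Lp_measurable[OF lin_L2[OF l]]])
 have d0: "Lp_norm 2 TR (%z. v n a z - u a z) = 0" for n
 proof (rule Lp_norm_zero_AE(2))
  show "AE z in TR. v n a z - u a z = 0" using v(2)[of n] by eventually_elim simp
  show "(%z. v n a z - u a z) \<in> bm TR"
   using Lp_measurable[OF lin_L2[OF v(1)], of n a] Lp_measurable[OF lin_L2[OF l], of a] by measurable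
 qed
 note est = lin_estimate[OF lin_diff[OF v(1) l] order_refl ab, unfolded d0, folded \<delta>_def, simplified]
 have vu4: "(%n. Lp_norm 4 LT (slab {a..b} (%t z. v n t z - u t z))) \<longlonglongrightarrow> 0"
 proof (rule Lim_null_comparison)
  show "\<forall>\<^sub>F n in sequentially. norm (Lp_norm 4 LT (slab {a..b} (%t z. v n t z - u t z))) <= lin_const * \<delta> n"
   using est(2) by (simp add: \<delta>_def)
  show "(%n. lin_const * \<delta> n) \<longlonglongrightarrow> 0" using tendsto_mult_left[OF \<delta>, of lin_const] by simp
 qed
 have vb: "(%n. Lp_norm 2 TR (v n b)) \<longlonglongrightarrow> Lp_norm 2 TR (u b)"
 proof (rule Lim_null_comparison[THEN LIM_zero_cancel])
  show "\<forall>\<^sub>F n in sequentially. norm (Lp_norm 2 TR (v n b) - Lp_norm 2 TR (u b)) <= lin_const * \<delta> n"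
  proof (intro always_eventually allI)
   fix n
   have "norm (Lp_norm 2 TR (v n b) - Lp_norm 2 TR (u b)) <= Lp_norm 2 TR (%z. v n b z - u b z)"
    using Lp_norm_rev_triangle[OF lin_L2[OF v(1)] lin_L2[OF l]] by simp
   also have "... <= lin_const * \<delta> n" using est(3)[of b n] ab by (simp add: \<delta>_def)
   finally show "norm (Lp_norm 2 TR (v n b) - Lp_norm 2 TR (u b)) <= lin_const * \<delta> n" .
  qed
  show "(%n. lin_const * \<delta> n) \<longlonglongrightarrow> 0" using tendsto_mult_left[OF \<delta>, of lin_const] by simp
 qed
 have sdiff: "slab {a..b} (%t z. f t z - g t z) w = slab {a..b} f w - slab {a..b} g w" for f g w
  by (simp add: slab_def right_diff_distrib)
 define B where "B = (%f g. LINT w|LT. slab {a..b} f w * cnj (slab {a..b} g w))"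
 have cn: "(%w. cnj (f w)) \<in> Lp_space 4 LT" "Lp_norm 4 LT (%w. cnj (f w)) = Lp_norm 4 LT f" if "f \<in> Lp_space 4 LT" for f
  using that by (auto simp: Lp_space_def Lp_norm_def)
 have sv: "slab {a..b} (v n) \<in> Lp_space 4 LT" for n using lin_estimate(1)[OF v(1) order_refl ab] .
 have su: "slab {a..b} u \<in> Lp_space 4 LT" using lin_estimate(1)[OF l order_refl ab] .
 have shn: "slab {a..b} (hn n) \<in> Lp_space (4/3) LT" for n by (rule forcing_slab(1)[OF hnf]) simp
 have sh: "slab {a..b} h \<in> Lp_space (4/3) LT" by (rule forcing_slab(1)[OF hf]) simp
 define e where "e = (%n. Lp_norm 4 LT (slab {a..b} (%t z. v n t z - u t z)))"
 have e: "e \<longlonglongrightarrow> 0" using vu4 by (simp add: e_def)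
 have Bd: "cmod (B (hn n) (v n) - B h u) <= \<delta> n * (Lp_norm 4 LT (slab {a..b} u) + e n) + Lp_norm (4/3) LT (slab {a..b} h) * e n" for n
 proof -
  have ev: "Lp_norm 4 LT (slab {a..b} (v n)) <= Lp_norm 4 LT (slab {a..b} u) + e n"
   using Lp_norm_rev_triangle[OF sv[of n] su] by (simp add: e_def sdiff[abs_def])
  have dv: "slab {a..b} (%t z. v n t z - u t z) \<in> Lp_space 4 LT"
   using Lp_diff(1)[OF sv[of n] su] by (simp add: sdiff[abs_def])
  have dh: "slab {a..b} (%t z. hn n t z - h t z) \<in> Lp_space (4/3) LT"
   using Lp_diff(1)[OF shn[of n] sh] by (simp add: sdiff[abs_def])
  have ii: "integrable LT (%w. f w * cnj (g w))" if "f \<in> Lp_space (4/3) LT" "g \<in> Lp_space 4 LT" for f g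
   by (rule holder(1)[OF that(1) cn(1)[OF that(2)]]) auto
  have bb: "cmod (LINT w|LT. f w * cnj (g w)) <= Lp_norm (4/3) LT f * Lp_norm 4 LT g" if "f \<in> Lp_space (4/3) LT" "g \<in> Lp_space 4 LT" for f g
   using holder(3)[OF that(1) cn(1)[OF that(2)]] cn(2)[OF that(2)] by simp
  have "B (hn n) (v n) - B h u = (LINT w|LT. slab {a..b} (%t z. hn n t z - h t z) w * cnj (slab {a..b} (v n) w)) +
   (LINT w|LT. slab {a..b} h w * cnj (slab {a..b} (%t z. v n t z - u t z) w))"
  proof -
   have "(LINT w|LT. slab {a..b} (%t z. hn n t z - h t z) w * cnj (slab {a..b} (v n) w)) = B (hn n) (v n) - B h (v n)"
    unfolding B_def sdiff left_diff_distrib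
    by (rule Bochner_Integration.integral_diff[OF ii[OF shn sv] ii[OF sh sv]])
   moreover have "(LINT w|LT. slab {a..b} h w * cnj (slab {a..b} (%t z. v n t z - u t z) w)) = B h (v n) - B h u"
    unfolding B_def sdiff complex_cnj_diff right_diff_distrib
    by (rule Bochner_Integration.integral_diff[OF ii[OF sh sv] ii[OF sh su]])
   ultimately show ?thesis by simp
  qed
  hence "cmod (B (hn n) (v n) - B h u) <= \<delta> n * Lp_norm 4 LT (slab {a..b} (v n)) + Lp_norm (4/3) LT (slab {a..b} h) * e n"
   using norm_triangle_mono[OF bb[OF dh sv[of n]] bb[OF sh dv]] by (simp add: \<delta>_def e_def)
  also have "... <= \<delta> n * (Lp_norm 4 LT (slab {a..b} u) + e n) + Lp_norm (4/3) LT (slab {a..b} h) * e n"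
   using ev by (intro add_right_mono mult_left_mono) (auto simp: \<delta>_def)
  finally show ?thesis .
 qed
 have Bl: "(%n. B (hn n) (v n)) \<longlonglongrightarrow> B h u"
 proof (rule Lim_null_comparison[THEN LIM_zero_cancel])
  show "\<forall>\<^sub>F n in sequentially. norm (B (hn n) (v n) - B h u) <= \<delta> n * (Lp_norm 4 LT (slab {a..b} u) + e n) + Lp_norm (4/3) LT (slab {a..b} h) * e n"
   using Bd by simp
  have "(%n. \<delta> n * (Lp_norm 4 LT (slab {a..b} u) + e n) + Lp_norm (4/3) LT (slab {a..b} h) * e n) \<longlonglongrightarrow>
   0 * (Lp_norm 4 LT (slab {a..b} u) + 0) + Lp_norm (4/3) LT (slab {a..b} h) * 0"
   by (intro tendsto_intros \<delta> e)
  thus "(%n. \<delta> n * (Lp_norm 4 LT (slab {a..b} u) + e n) + Lp_norm (4/3) LT (slab {a..b} h) * e n) \<longlonglongrightarrow> 0" by simp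
 qed
 show ?thesis
 proof (rule LIMSEQ_unique)
  show "(%n. (Lp_norm 2 TR (v n b))\<^sup>2 - (Lp_norm 2 TR (v n a))\<^sup>2) \<longlonglongrightarrow> (Lp_norm 2 TR (u b))\<^sup>2 - (Lp_norm 2 TR (u a))\<^sup>2"
   unfolding va by (intro tendsto_intros vb)
  have "(%n. 2 * Re (B (hn n) (v n))) \<longlonglongrightarrow> 2 * Re (B h u)" by (intro tendsto_intros Bl)
  thus "(%n. (Lp_norm 2 TR (v n b))\<^sup>2 - (Lp_norm 2 TR (v n a))\<^sup>2) \<longlonglongrightarrow> 2 * Re (LINT w|LT. slab {a..b} h w * cnj (slab {a..b} u w))"
   unfolding energy_L2[OF v(1) hn2 ab] B_def .
 qed
qed

subsection \<open>The cubic nonlinearity\<close>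

definition cubic :: "complex => complex" where
 "cubic z = complex_of_real ((cmod z)\<^sup>2) * z"

lemma cubic_measurable [measurable]: "cubic \<in> bm borel"
 unfolding cubic_def[abs_def] by measurable

lemma cubic_0 [simp]: "cubic 0 = 0"
 by (simp add: cubic_def)

lemma norm_cubic: "cmod (cubic z) = cmod z ^ 3"
 by (simp add: cubic_def norm_mult norm_power power2_eq_square power3_eq_cube)

text \<open>The difference splits as \<open>\<bar>a\<bar>^2 * (a - b) + (\<bar>a\<bar>^2 -
  \<bar>b\<bar>^2) * b\<close>. Mixed products of moduli are traded for squares, so that
  \<open>holder_cubic\<close> can be applied to each of the two terms.\<close>

lemma cubic_diff:
 "cmod (cubic a - cubic b) <= 2 * ((cmod a)\<^sup>2 * cmod (a - b)) + 2 * ((cmod b)\<^sup>2 * cmod (a - b))"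
proof -
 define A B D where "A = cmod a" and "B = cmod b" and "D = cmod (a - b)"
 have AB: "A >= 0" "B >= 0" "D >= 0" by (simp_all add: A_def B_def D_def)
 have "cubic a - cubic b = of_real (A\<^sup>2) * (a - b) + of_real (A\<^sup>2 - B\<^sup>2) * b"
  by (simp add: cubic_def A_def B_def algebra_simps)
 hence "cmod (cubic a - cubic b) <= cmod (of_real (A\<^sup>2) * (a - b)) + cmod (of_real (A\<^sup>2 - B\<^sup>2) * b)"
  by (simp only: norm_triangle_ineq)
 also have "... = A\<^sup>2 * D + \<bar>A\<^sup>2 - B\<^sup>2\<bar> * B"
  unfolding norm_mult norm_of_real by (simp add: B_def D_def)
 also have "\<bar>A\<^sup>2 - B\<^sup>2\<bar> = \<bar>A - B\<bar> * (A + B)"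
  using AB by (simp add: power2_eq_square square_diff_square_factored abs_mult)
 also have "\<bar>A - B\<bar> * (A + B) * B <= D * (A + B) * B"
  using AB by (intro mult_right_mono) (auto simp: A_def B_def D_def norm_triangle_ineq3)
 also have "... = D * ((A + B) * B)" by simp
 also have "... <= D * (A\<^sup>2 + 2 * B\<^sup>2)"
 proof (rule mult_left_mono)
  have "0 <= (A - B)\<^sup>2 + A\<^sup>2 + B\<^sup>2" by simp
  thus "(A + B) * B <= A\<^sup>2 + 2 * B\<^sup>2" by (simp add: power2_eq_square algebra_simps)
 qed (rule AB)
 finally show ?thesis by (simp add: A_def B_def D_def algebra_simps)
qed

lemma Lp_abs:
 assumes "f \<in> Lp_space p M"
 shows "(%x. complex_of_real (cmod (f x))) \<in> Lp_space p M"
  "Lp_norm p M (%x. complex_of_real (cmod (f x))) = Lp_norm p M f"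
 using assms by (auto simp: Lp_space_def Lp_norm_def)

lemma cubic_pint: "pint (4/3) M (%x. cubic (f x)) = pint 4 M f"
proof -
 have "(cmod z ^ 3) powr (4/3) = cmod z powr 4" for z :: complex
 proof -
  have "cmod z ^ 3 = cmod z powr 3" by simp
  thus ?thesis by (simp only: powr_powr) simp
 qed
 thus ?thesis by (simp add: pint_def norm_cubic)
qed

lemma cubic_Lp:
 assumes "f \<in> Lp_space 4 M"
 shows "(%x. cubic (f x)) \<in> Lp_space (4/3) M" "Lp_norm (4/3) M (%x. cubic (f x)) <= Lp_norm 4 M f ^ 3"
proof -
 let ?X = "Lp_norm 4 M f"
 have [measurable]: "f \<in> bm M" using assms by (simp add: Lp_space_def)
 have m: "(%x. cubic (f x)) \<in> bm M" by measurable
 have "?X ^ 3 = ?X powr 3" by simp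
 hence "(?X ^ 3) powr (4/3) = ?X powr 4" by (simp only: powr_powr) simp
 hence "pint (4/3) M (%x. cubic (f x)) <= ennreal ((?X ^ 3) powr (4/3))"
  using pint_eq[OF assms] by (simp only: cubic_pint)
 from Lp_normI[OF m _ _ this]
 show "(%x. cubic (f x)) \<in> Lp_space (4/3) M" "Lp_norm (4/3) M (%x. cubic (f x)) <= ?X ^ 3" by auto
qed

text \<open>Holder with \<open>3/2\<close> and 3 after raising to the power \<open>4/3\<close>: the
  factors \<open>\<bar>f\<bar>^(8/3)\<close> and \<open>\<bar>g\<bar>^(4/3)\<close> then have the
  integrals of \<open>\<bar>f\<bar>^4\<close> and \<open>\<bar>g\<bar>^4\<close>.\<close>

lemma holder_cubic:
 assumes f: "f \<in> Lp_space 4 M" and g: "g \<in> Lp_space 4 M"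
 shows "(%x. complex_of_real ((cmod (f x))\<^sup>2) * g x) \<in> Lp_space (4/3) M"
  "Lp_norm (4/3) M (%x. complex_of_real ((cmod (f x))\<^sup>2) * g x) <= (Lp_norm 4 M f)\<^sup>2 * Lp_norm 4 M g"
proof -
 have [measurable]: "f \<in> bm M" "g \<in> bm M" using f g by (simp_all add: Lp_space_def)
 define X Y where "X = Lp_norm 4 M f" and "Y = Lp_norm 4 M g"
 have XY: "X >= 0" "Y >= 0" by (simp_all add: X_def Y_def)
 let ?P = "%x. complex_of_real (cmod (f x) powr (8/3))" and ?Q = "%x. complex_of_real (cmod (g x) powr (4/3))"
 have pm: "?P \<in> bm M" "?Q \<in> bm M" by measurable
 have "pint (3/2) M ?P = pint 4 M f" by (simp add: pint_def powr_powr)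
 hence "pint (3/2) M ?P <= ennreal ((X powr (8/3)) powr (3/2))"
  using pint_eq[OF f] by (simp add: powr_powr X_def)
 from Lp_normI[OF pm(1) _ _ this] have P: "?P \<in> Lp_space (3/2) M" "Lp_norm (3/2) M ?P <= X powr (8/3)" by auto
 have "pint 3 M ?Q = pint 4 M g" by (simp add: pint_def powr_powr)
 hence "pint 3 M ?Q <= ennreal ((Y powr (4/3)) powr 3)"
  using pint_eq[OF g] by (simp only: powr_powr) (simp add: Y_def)
 from Lp_normI[OF pm(2) _ _ this] have Q: "?Q \<in> Lp_space 3 M" "Lp_norm 3 M ?Q <= Y powr (4/3)" by auto
 have pw: "(a\<^sup>2 * b) powr (4/3) = a powr (8/3) * b powr (4/3)" if "a >= 0" "b >= 0" for a b :: real
 proof -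
  have "a\<^sup>2 = a powr 2" using that by simp
  hence "(a\<^sup>2) powr (4/3) = a powr (8/3)" by (simp only: powr_powr) simp
  thus ?thesis using that by (subst powr_mult) auto
 qed
 let ?h = "%x. complex_of_real ((cmod (f x))\<^sup>2) * g x"
 have "pint (4/3) M ?h = (NN x|M. ennreal (cmod (?P x) * cmod (?Q x)))"
  unfolding pint_def by (rule nn_integral_cong) (simp add: norm_mult norm_power pw)
 also have "... <= ennreal (Lp_norm (3/2) M ?P * Lp_norm 3 M ?Q)"
  by (rule holder_nn[OF P(1) Q(1)]) auto
 also have "... <= ennreal (X powr (8/3) * Y powr (4/3))"
  using P(2) Q(2) by (intro ennreal_leI mult_mono) auto
 also have "X powr (8/3) * Y powr (4/3) = (X\<^sup>2 * Y) powr (4/3)" by (rule pw[OF XY, symmetric])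
 finally have le: "pint (4/3) M ?h <= ennreal ((X\<^sup>2 * Y) powr (4/3))" .
 have m: "?h \<in> bm M" by measurable
 from Lp_normI[OF m _ _ le] XY
 show "?h \<in> Lp_space (4/3) M"
  "Lp_norm (4/3) M ?h <= (Lp_norm 4 M f)\<^sup>2 * Lp_norm 4 M g"
  by (auto simp: X_def Y_def)
qed

lemma cubic_Lp_diff:
 assumes f: "f \<in> Lp_space 4 M" and g: "g \<in> Lp_space 4 M"
 shows "(%x. cubic (f x) - cubic (g x)) \<in> Lp_space (4/3) M"
  "Lp_norm (4/3) M (%x. cubic (f x) - cubic (g x)) <=
   2 * ((Lp_norm 4 M f)\<^sup>2 + (Lp_norm 4 M g)\<^sup>2) * Lp_norm 4 M (%x. f x - g x)"
proof -
 note cf = cubic_Lp(1)[OF f] and cg = cubic_Lp(1)[OF g]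
 show 1: "(%x. cubic (f x) - cubic (g x)) \<in> Lp_space (4/3) M" by (rule Lp_diff(1)[OF cf cg]) simp
 have d: "(%x. f x - g x) \<in> Lp_space 4 M" by (rule Lp_diff(1)[OF f g]) simp
 define e where "e = (%x. complex_of_real (cmod (f x - g x)))"
 note e = Lp_abs[OF d, folded e_def]
 note hf = holder_cubic[OF f e(1)] and hg = holder_cubic[OF g e(1)]
 note hf2 = Lp_cmult[OF hf(1), of 2] and hg2 = Lp_cmult[OF hg(1), of 2]
 let ?G = "%x. 2 * (complex_of_real ((cmod (f x))\<^sup>2) * e x) + 2 * (complex_of_real ((cmod (g x))\<^sup>2) * e x)"
 have G: "?G \<in> Lp_space (4/3) M" "Lp_norm (4/3) M ?G <=
  Lp_norm (4/3) M (%x. 2 * (complex_of_real ((cmod (f x))\<^sup>2) * e x)) + Lp_norm (4/3) M (%x. 2 * (complex_of_real ((cmod (g x))\<^sup>2) * e x))"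
  by (rule Lp_add[OF hf2(1) hg2(1)]; simp)+
 have "Lp_norm (4/3) M (%x. cubic (f x) - cubic (g x)) <= Lp_norm (4/3) M ?G"
 proof (rule Lp_mono(2)[OF _ _ G(1) Lp_measurable[OF 1]])
  show "AE x in M. cmod (cubic (f x) - cubic (g x)) <= cmod (?G x)"
  proof (rule AE_I2)
   fix x
   have "?G x = complex_of_real (2 * ((cmod (f x))\<^sup>2 * cmod (f x - g x)) + 2 * ((cmod (g x))\<^sup>2 * cmod (f x - g x)))"
    by (simp add: e_def)
   hence "cmod (?G x) = 2 * ((cmod (f x))\<^sup>2 * cmod (f x - g x)) + 2 * ((cmod (g x))\<^sup>2 * cmod (f x - g x))"
    by (simp only: norm_of_real) simp
   thus "cmod (cubic (f x) - cubic (g x)) <= cmod (?G x)" using cubic_diff[of "f x" "g x"] by simp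
  qed
 qed simp
 also have "... <= 2 * ((Lp_norm 4 M f)\<^sup>2 * Lp_norm 4 M e) + 2 * ((Lp_norm 4 M g)\<^sup>2 * Lp_norm 4 M e)"
  using G(2) hf(2) hg(2) hf2(2) hg2(2) by simp
 finally show "Lp_norm (4/3) M (%x. cubic (f x) - cubic (g x)) <=
   2 * ((Lp_norm 4 M f)\<^sup>2 + (Lp_norm 4 M g)\<^sup>2) * Lp_norm 4 M (%x. f x - g x)"
  by (simp add: e(2) algebra_simps)
qed

section \<open>Slabs over unions of time sets, and induction by unit time steps\<close>

lemma slab_mono:
 assumes "slab A f \<in> Lp_space p LT" "J \<subseteq> A" "slab J f \<in> bm LT" "p > 0"
 shows "slab J f \<in> Lp_space p LT" "Lp_norm p LT (slab J f) <= Lp_norm p LT (slab A f)"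
proof -
 have "AE w in LT. cmod (slab J f w) <= cmod (slab A f w)"
  using assms(2) by (intro AE_I2) (auto simp: slab_def split: split_indicator)
 from Lp_mono[OF this assms(4,1,3)]
 show "slab J f \<in> Lp_space p LT" "Lp_norm p LT (slab J f) <= Lp_norm p LT (slab A f)" by auto
qed

lemma slab_Un:
 assumes f: "slab A f \<in> Lp_space p LT" and g: "slab B f \<in> Lp_space p LT"
  and J: "J \<subseteq> A \<union> B" "slab J f \<in> bm LT" and p: "p >= 1"
 shows "slab J f \<in> Lp_space p LT" "Lp_norm p LT (slab J f) <= Lp_norm p LT (slab A f) + Lp_norm p LT (slab B f)"
proof -
 note a = Lp_abs[OF f] and b = Lp_abs[OF g]
 note s = Lp_add[OF a(1) b(1) p]
 have le: "AE w in LT. cmod (slab J f w) <= cmod (complex_of_real (cmod (slab A f w)) + complex_of_real (cmod (slab B f w)))"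
 proof (rule AE_I2)
  fix w
  have "complex_of_real (cmod (slab A f w)) + complex_of_real (cmod (slab B f w)) =
   complex_of_real (cmod (slab A f w) + cmod (slab B f w))" by simp
  hence "cmod (complex_of_real (cmod (slab A f w)) + complex_of_real (cmod (slab B f w))) = cmod (slab A f w) + cmod (slab B f w)"
   by (simp only: norm_of_real) simp
  thus "cmod (slab J f w) <= cmod (complex_of_real (cmod (slab A f w)) + complex_of_real (cmod (slab B f w)))"
   using J(1) by (auto simp: slab_def split: split_indicator)
 qed
 have p0: "p > 0" using p by simp
 from Lp_mono[OF le p0 s(1) J(2)] s(2)
 show "slab J f \<in> Lp_space p LT" "Lp_norm p LT (slab J f) <= Lp_norm p LT (slab A f) + Lp_norm p LT (slab B f)"
  by (auto simp: a(2) b(2))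
qed

lemma unit_steps:
 assumes pq: "p <= 0" "0 <= q" and base: "Q 0 (0::real)"
  and step: "\<And>n s t. Q n s ==> s \<in> {p..q} ==> t \<in> {p..q} ==> \<bar>s - t\<bar> <= 1 ==> Q (Suc n) t"
 shows "t \<in> {p..q} ==> \<bar>t\<bar> <= real n ==> Q n t"
proof (induction n arbitrary: t)
 case 0
 thus ?case using base by simp
next
 case (Suc n)
 define r where "r = real n / real (Suc n)"
 have r: "0 <= r" "r <= 1" by (simp_all add: r_def)
 define s where "s = r * t"
 have s1: "p <= s" "s <= q"
 proof -
  have "r * p <= s" "s <= r * q" using Suc.prems r unfolding s_def by (auto intro: mult_left_mono)
  moreover have "p <= r * p" using pq r mult_right_mono_neg[of r 1 p] by simp
  moreover have "r * q <= q" using pq r mult_right_mono[of r 1 q] by simp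
  ultimately show "p <= s" "s <= q" by auto
 qed
 have "\<bar>s\<bar> = r * \<bar>t\<bar>" using r by (simp add: s_def abs_mult)
 also have "... <= r * real (Suc n)" using Suc.prems r by (intro mult_left_mono) auto
 finally have s2: "\<bar>s\<bar> <= real n" by (simp add: r_def)
 have "s - t = - ((1 - r) * t)" by (simp add: s_def algebra_simps)
 hence "\<bar>s - t\<bar> = (1 - r) * \<bar>t\<bar>" using r by (simp add: abs_mult)
 also have "... <= (1 - r) * real (Suc n)" using Suc.prems r by (intro mult_left_mono) auto
 also have "... = 1" by (simp add: r_def field_simps)
 finally have "\<bar>s - t\<bar> <= 1" .
 from step[OF Suc.IH[OF _ s2] _ Suc.prems(1) this] s1 show ?case by simp
qed

subsection \<open>Small solutions\<close>

locale nls = dispersion +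
 fixes \<sigma> :: real
 assumes sigma: "\<sigma> \<in> {1, -1}"
begin

abbreviation \<kappa> :: complex where "\<kappa> \<equiv> - (\<i> * complex_of_real \<sigma>)"

text \<open>The nonlinearity is switched off outside \<open>A\<close>. A solution on the time set
  \<open>A\<close> is thus again a linear solution on the whole line, with forcing in
  \<open>L^(4/3)\<close>, and the linear theory applies to it unchanged. The factor \<kappa> is the
  one in front of the Duhamel integral.\<close>

definition cnl :: "real set => (real => real \<times> real => complex) => real => real \<times> real => complex" where
 "cnl A u s z = \<kappa> * (indicator A s * cubic (u s z))"

definition nsol :: "real set => (int \<times> real => complex) => (real => real \<times> real => complex) => bool" where
 "nsol A F u \<longleftrightarrow> A \<in> sets borel \<and> lin F (cnl A u) u"

text \<open>Chosen together with \<open>R0\<close>: the linear estimate spends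
  \<open>lin_const * \<delta>0 = R0 / 2\<close> on the data and at most \<open>R0 / 16\<close> on
  the cube, so the ball of radius \<open>R0\<close> is preserved, while
  \<open>4 * lin_const * R0^2\<close> is at most \<open>1/4\<close> and contracts.\<close>

definition \<delta>0 :: real where "\<delta>0 = 1 / (8 * lin_const\<^sup>2)"

definition R0 :: real where "R0 = 1 / (4 * lin_const)"

lemma lin_const_pos: "0 < lin_const" using lin_const by simp

lemma \<delta>0: "0 < \<delta>0" "lin_const * \<delta>0 = R0 / 2"
 using lin_const_pos by (simp_all add: \<delta>0_def R0_def power2_eq_square)

lemma R0: "0 < R0" "4 * lin_const * R0\<^sup>2 <= 1 / 4 * 1" "lin_const * R0 ^ 3 <= R0 / 16"
proof -
 show "0 < R0" using lin_const_pos by (simp add: R0_def)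
 have 1: "lin_const * R0 = 1 / 4" using lin_const_pos by (simp add: R0_def)
 have 2: "R0 <= 1 / 4" using lin_const by (simp add: R0_def field_simps)
 have "4 * lin_const * R0\<^sup>2 = 4 * (lin_const * R0) * R0" by (simp add: power2_eq_square)
 hence 3: "4 * lin_const * R0\<^sup>2 = R0" using 1 by simp
 thus "4 * lin_const * R0\<^sup>2 <= 1 / 4 * 1" using 2 by simp
 have "lin_const * R0 ^ 3 = (lin_const * R0) * (R0 * R0)" by (simp add: power3_eq_cube)
 also have "... = 1 / 4 * (R0 * R0)" by (simp only: 1)
 also have "... <= 1 / 4 * (1 / 4 * R0)" using 2 \<open>0 < R0\<close> by (intro mult_left_mono mult_right_mono) auto
 finally show "lin_const * R0 ^ 3 <= R0 / 16" by simp
qed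

lemma norm_sigma: "cmod \<kappa> = 1"
 using sigma by (auto simp: norm_mult)

lemma cnl_measurable:
 assumes "(%(t, z). u t z) \<in> bm LT" and [measurable]: "A \<in> sets borel"
 shows "(%(t, z). cnl A u t z) \<in> bm LT"
proof -
 have [measurable]: "(%w. u (fst w) (snd w)) \<in> bm LT" using assms by (simp add: split_beta')
 show ?thesis unfolding cnl_def split_beta' by measurable
qed

lemma slab_cnl: "J \<subseteq> A ==> slab J (cnl A u) w = \<kappa> * cubic (slab J u w)"
 by (auto simp: slab_def cnl_def split: split_indicator)

lemma slab_UNIV_cnl: "slab UNIV (cnl A u) w = \<kappa> * cubic (slab A u w)"
 by (auto simp: slab_def cnl_def split: split_indicator)

lemma pint_sigma: "pint p M (%w. \<kappa> * f w) = pint p M f"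
 unfolding pint_def norm_mult[of \<kappa>] norm_sigma by simp

lemma sigma_Lp:
 assumes "f \<in> Lp_space p M" "p > 0"
 shows "(%w. \<kappa> * f w) \<in> Lp_space p M"
  "Lp_norm p M (%w. \<kappa> * f w) = Lp_norm p M f"
 using Lp_cmult[OF assms, of \<kappa>] unfolding norm_sigma by simp_all

lemma forcing_cnl:
 assumes m: "(%(t, z). u t z) \<in> bm LT" and A: "A \<in> sets borel"
 shows "forcing (cnl A u) \<longleftrightarrow> slab A u \<in> Lp_space 4 LT"
proof -
 have "pint (4/3) LT (slab UNIV (cnl A u)) = pint 4 LT (slab A u)"
  unfolding slab_UNIV_cnl[abs_def] pint_sigma cubic_pint ..
 thus ?thesis
  using cnl_measurable[OF m A] slab_measurable[OF m A] by (simp add: forcing_def Lp_space_iff)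
qed

section \<open>Conservation of mass, a priori smallness and dependence on the data\<close>

lemma nsol_L4: "nsol A F u ==> slab A u \<in> Lp_space 4 LT"
 unfolding nsol_def using forcing_cnl lin_forcing lin_meas by blast

lemma nsol_slab:
 assumes n: "nsol A F u" and J: "J \<subseteq> A" "J \<in> sets borel"
 shows "slab J u \<in> Lp_space 4 LT" "slab J (cnl A u) \<in> Lp_space (4/3) LT"
  "Lp_norm (4/3) LT (slab J (cnl A u)) <= Lp_norm 4 LT (slab J u) ^ 3"
  "pint (4/3) LT (slab J (cnl A u)) = ennreal (Lp_norm 4 LT (slab J u) ^ 4)"
proof -
 have "slab J u \<in> bm LT"
  using n J(2) by (intro slab_measurable) (auto simp: nsol_def dest: lin_meas)
 from slab_mono(1)[OF nsol_L4[OF n] J(1) this] show 1: "slab J u \<in> Lp_space 4 LT" by simp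
 have e: "slab J (cnl A u) = (%w. \<kappa> * cubic (slab J u w))"
  by (rule ext) (rule slab_cnl[OF J(1)])
 note c = cubic_Lp[OF 1]
 show "slab J (cnl A u) \<in> Lp_space (4/3) LT" unfolding e by (rule sigma_Lp(1)[OF c(1)]) simp
 have "Lp_norm (4/3) LT (slab J (cnl A u)) = Lp_norm (4/3) LT (%w. cubic (slab J u w))"
  unfolding e by (rule sigma_Lp(2)[OF c(1)]) simp
 thus "Lp_norm (4/3) LT (slab J (cnl A u)) <= Lp_norm 4 LT (slab J u) ^ 3" using c(2) by simp
 show "pint (4/3) LT (slab J (cnl A u)) = ennreal (Lp_norm 4 LT (slab J u) ^ 4)"
  unfolding e pint_sigma cubic_pint by (rule Lp_norm_pow4[OF 1])
qed

text \<open>In the energy identity the integrand is \<kappa> times a nonnegative real function, and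
  \<kappa> is purely imaginary, so the real part vanishes for either sign of the
  nonlinearity.\<close>

lemma nsol_mass_step:
 assumes n: "nsol A F u" and J: "{a..b} \<subseteq> A" and ab: "a <= b" "b <= a + 1"
 shows "Lp_norm 2 TR (u a) = Lp_norm 2 TR (u b)"
proof -
 have l: "lin F (cnl A u) u" using n by (simp add: nsol_def)
 have "slab {a..b} (cnl A u) w * cnj (slab {a..b} u w) =
   \<kappa> * complex_of_real (cmod (slab {a..b} u w) ^ 4)" for w
 proof -
  have "cubic z * cnj z = complex_of_real (cmod z ^ 4)" for z
  proof -
   have "cubic z * cnj z = complex_of_real ((cmod z)\<^sup>2) * (z * cnj z)" by (simp add: cubic_def mult.assoc)
   also have "z * cnj z = complex_of_real ((cmod z)\<^sup>2)" by (rule complex_norm_square[symmetric])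
   finally show ?thesis by (simp add: power2_eq_square power4_eq_xxxx mult_ac)
  qed
  thus ?thesis unfolding slab_cnl[OF J] mult.assoc by simp
 qed
 hence "(LINT w|LT. slab {a..b} (cnl A u) w * cnj (slab {a..b} u w)) =
  \<kappa> * complex_of_real (LINT w|LT. cmod (slab {a..b} u w) ^ 4)"
  by (simp only: integral_mult_right_zero integral_complex_of_real)
 hence "Re (LINT w|LT. slab {a..b} (cnl A u) w * cnj (slab {a..b} u w)) = 0" by simp
 hence "(Lp_norm 2 TR (u b))\<^sup>2 = (Lp_norm 2 TR (u a))\<^sup>2"
  using energy_identity[OF l ab] by simp
 thus ?thesis by (metis Lp_norm_nonneg power2_eq_imp_eq)
qed

lemma nsol_mass:
 assumes n: "nsol A F u" and J: "{p..q} \<subseteq> A" and pq: "p <= 0" "0 <= q" and t: "t \<in> {p..q}"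
 shows "Lp_norm 2 TR (u t) = Lp_norm 2 TR (u 0)"
proof -
 obtain m :: nat where m: "\<bar>t\<bar> <= real m" using real_arch_simple by blast
 show ?thesis
 proof (rule unit_steps[OF pq, where Q = "%n t. Lp_norm 2 TR (u t) = Lp_norm 2 TR (u 0)", OF HOL.refl _ t m])
  fix n s t assume a: "Lp_norm 2 TR (u s) = Lp_norm 2 TR (u 0)" "s \<in> {p..q}" "t \<in> {p..q}" "\<bar>s - t\<bar> <= 1"
  have "{min s t..max s t} \<subseteq> {p..q}"
   using a by (intro atLeastatMost_subset_iff[THEN iffD2]) auto
  hence "{min s t..max s t} \<subseteq> A" using J by (rule subset_trans)
  hence "Lp_norm 2 TR (u (min s t)) = Lp_norm 2 TR (u (max s t))"
   using a(4) by (intro nsol_mass_step[OF n]) auto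
  thus "Lp_norm 2 TR (u t) = Lp_norm 2 TR (u 0)" using a(1) by (cases "s <= t") (auto simp: min_def max_def)
 qed
qed

text \<open>Continuity argument. The fourth power of the norm is \<open>Y\<close>, which depends
  continuously on the interval; if the norm exceeded \<open>R0\<close>, some smaller interval still
  ending or starting at \<open>c\<close> would have norm exactly \<open>R0\<close>. There the linear
  estimate gives \<open>R0 <= R0 / 2 + R0 / 16\<close>.\<close>

lemma nsol_small:
 assumes n: "nsol A F u" and J: "{a..b} \<subseteq> A" and ab: "a <= b" "b <= a + 1"
  and c: "c = a \<or> c = b" and small: "Lp_norm 2 TR (u c) <= \<delta>0"
 shows "Lp_norm 4 LT (slab {a..b} u) <= R0"
proof (rule ccontr)
 assume big: "\<not> Lp_norm 4 LT (slab {a..b} u) <= R0"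
 have l: "lin F (cnl A u) u" using n by (simp add: nsol_def)
 then obtain H where "duhamel \<alpha> \<epsilon> (cnl A u) H" unfolding lin_def by blast
 then interpret duhamel \<alpha> \<epsilon> "cnl A u" H .
 have Yn: "Y a' b' = Lp_norm 4 LT (slab {a'..b'} u) ^ 4" if "a <= a'" "b' <= b" for a' b'
 proof -
  have "{a'..b'} \<subseteq> A" using that J by auto
  hence "ennreal (Y a' b') = ennreal (Lp_norm 4 LT (slab {a'..b'} u) ^ 4)"
   using nsol_slab(4)[OF n, of "{a'..b'}"] Y_eq[of a' b'] by simp
  thus ?thesis by (simp add: Y_nonneg)
 qed
 have "R0 ^ 4 <= Lp_norm 4 LT (slab {a..b} u) ^ 4" using big R0(1) by (intro power_mono) auto
 hence Yb: "R0 ^ 4 <= Y a b" using Yn[of a b] by simp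
 have "\<exists>a' b'. a <= a' \<and> a' <= c \<and> c <= b' \<and> b' <= b \<and> Y a' b' = R0 ^ 4"
  using c
 proof
  assume c: "c = a"
  obtain x where "a <= x" "x <= b" "Y a x = R0 ^ 4"
   using IVT'[of "%x. Y a x" a "R0 ^ 4" b] Yb Y_same[of a] Y_continuous[of a b] ab(1) R0(1) by auto
  with c show ?thesis by auto
 next
  assume c: "c = b"
  obtain x where x: "a <= x" "x <= b" "Y a x = Y a b - R0 ^ 4"
   using IVT'[of "%x. Y a x" a "Y a b - R0 ^ 4" b] Yb Y_same[of a] Y_continuous[of a b] ab(1) R0(1) by auto
  hence "Y x b = R0 ^ 4" using Y_add[of a x b] by simp
  with x c show ?thesis by auto
 qed
 then obtain a' b' where ab': "a <= a'" "a' <= c" "c <= b'" "b' <= b" "Y a' b' = R0 ^ 4" by blast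
 have sub: "{a'..b'} \<subseteq> A" using ab' J by auto
 have "Lp_norm 4 LT (slab {a'..b'} u) ^ 4 = R0 ^ 4" using Yn[of a' b'] ab' by simp
 hence eq: "Lp_norm 4 LT (slab {a'..b'} u) = R0"
  using R0(1) by (metis Lp_norm_nonneg less_imp_le power_eq_imp_eq_base zero_less_numeral)
 have "b' <= a' + 1" using ab' ab by simp
 from lin_estimate(2)[OF l ab'(2,3) this]
 have "R0 <= lin_const * (Lp_norm 2 TR (u c) + Lp_norm (4/3) LT (slab {a'..b'} (cnl A u)))" by (simp add: eq)
 also have "... <= lin_const * (\<delta>0 + R0 ^ 3)"
  using small nsol_slab(3)[OF n sub] lin_const_pos by (intro mult_left_mono add_mono) (auto simp: eq)
 also have "... <= R0 / 2 + R0 / 16" using \<delta>0(2) R0(3) by (simp add: distrib_left)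
 finally show False using R0(1) by simp
qed

lemma slab_diff: "slab J (%t z. u t z - v t z) w = slab J u w - slab J v w"
 by (simp add: slab_def right_diff_distrib)

lemma cubic_contract:
 assumes "f \<in> Lp_space 4 M" "g \<in> Lp_space 4 M" "Lp_norm 4 M f <= R0" "Lp_norm 4 M g <= R0"
 shows "lin_const * Lp_norm (4/3) M (%x. cubic (f x) - cubic (g x)) <= 1 / 4 * Lp_norm 4 M (%x. f x - g x)"
proof -
 have "lin_const * Lp_norm (4/3) M (%x. cubic (f x) - cubic (g x)) <=
  lin_const * (2 * ((Lp_norm 4 M f)\<^sup>2 + (Lp_norm 4 M g)\<^sup>2) * Lp_norm 4 M (%x. f x - g x))"
  using cubic_Lp_diff(2)[OF assms(1,2)] lin_const_pos by (intro mult_left_mono) auto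
 also have "... <= lin_const * (2 * (R0\<^sup>2 + R0\<^sup>2) * Lp_norm 4 M (%x. f x - g x))"
  using assms(3,4) lin_const_pos by (intro mult_left_mono mult_right_mono add_mono power_mono) auto
 also have "... = (4 * lin_const * R0\<^sup>2) * Lp_norm 4 M (%x. f x - g x)" by simp
 also have "... <= 1 / 4 * Lp_norm 4 M (%x. f x - g x)" using R0(2) by (intro mult_right_mono) auto
 finally show ?thesis .
qed

text \<open>By \<open>nsol_small\<close> both solutions lie in the ball of radius \<open>R0\<close>,
  so the difference of their cubic terms costs a quarter of the difference itself and is
  absorbed.\<close>

lemma nsol_diff_step:
 assumes n: "nsol A F u" and n': "nsol A' F' u'" and J: "{a..b} \<subseteq> A" "{a..b} \<subseteq> A'"
  and ab: "a <= b" "b <= a + 1" and c: "c = a \<or> c = b"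
  and small: "Lp_norm 2 TR (u c) <= \<delta>0" "Lp_norm 2 TR (u' c) <= \<delta>0"
 defines "N \<equiv> Lp_norm 2 TR (%z. u c z - u' c z)"
 shows "slab {a..b} (%t z. u t z - u' t z) \<in> Lp_space 4 LT"
  "Lp_norm 4 LT (slab {a..b} (%t z. u t z - u' t z)) <= 2 * lin_const * N"
  "t \<in> {a..b} ==> Lp_norm 2 TR (%z. u t z - u' t z) <= 2 * lin_const * N"
proof -
 let ?S = "slab {a..b}" and ?d = "%t z. u t z - u' t z"
 define X where "X = Lp_norm 4 LT (?S ?d)"
 define D where "D = Lp_norm (4/3) LT (?S (%t z. cnl A u t z - cnl A' u' t z))"
 have l: "lin F (cnl A u) u" "lin F' (cnl A' u') u'" using n n' by (simp_all add: nsol_def)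
 note ld = lin_diff[OF l]
 have ac: "a <= c" "c <= b" using c ab by auto
 note est = lin_estimate[OF ld ac ab(2)]
 show "?S ?d \<in> Lp_space 4 LT" by (rule est(1))
 have su: "?S u \<in> Lp_space 4 LT" "?S u' \<in> Lp_space 4 LT"
  by (rule nsol_slab(1)[OF n J(1)] nsol_slab(1)[OF n' J(2)]; simp)+
 note dc = cubic_Lp_diff(1)[OF su]
 have "?S (%t z. cnl A u t z - cnl A' u' t z) = (%w. \<kappa> * (cubic (?S u w) - cubic (?S u' w)))"
  by (rule ext) (simp only: slab_diff slab_cnl[OF J(1)] slab_cnl[OF J(2)] right_diff_distrib)
 hence D: "D = Lp_norm (4/3) LT (%w. cubic (?S u w) - cubic (?S u' w))"
  unfolding D_def using sigma_Lp(2)[OF dc] by simp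
 have "lin_const * D <= 1 / 4 * Lp_norm 4 LT (%w. ?S u w - ?S u' w)"
  unfolding D by (rule cubic_contract[OF su nsol_small[OF n J(1) ab c small(1)] nsol_small[OF n' J(2) ab c small(2)]])
 hence CD: "lin_const * D <= 1 / 4 * X" by (simp add: X_def slab_diff[abs_def])
 have "X <= lin_const * (N + D)" unfolding X_def N_def D_def by (rule est(2))
 hence X: "X <= lin_const * N + lin_const * D" by (simp add: distrib_left)
 have "0 <= lin_const * N" using lin_const_pos by (simp add: N_def)
 with X CD show "Lp_norm 4 LT (?S ?d) <= 2 * lin_const * N" by (simp add: X_def)
 assume t: "t \<in> {a..b}"
 have "Lp_norm 2 TR (%z. u t z - u' t z) <= lin_const * N + lin_const * D"
  using est(3)[OF t] unfolding N_def D_def by (simp add: distrib_left)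
 with X CD \<open>0 <= lin_const * N\<close> show "Lp_norm 2 TR (%z. u t z - u' t z) <= 2 * lin_const * N" by simp
qed

text \<open>One unit step multiplies the distance by \<open>2 * lin_const\<close>. The smallness
  required at the start of each step comes from conservation of mass for the two solutions
  separately, not from the preceding step.\<close>

lemma nsol_lipschitz:
 assumes n: "nsol A F u" and n': "nsol A' F' u'" and J: "{p..q} \<subseteq> A" "{p..q} \<subseteq> A'"
  and pq: "p <= 0" "0 <= q" and small: "Lp_norm 2 TR (u 0) <= \<delta>0" "Lp_norm 2 TR (u' 0) <= \<delta>0"
  and t: "t \<in> {p..q}" "\<bar>t\<bar> <= real m"
 defines "N \<equiv> Lp_norm 2 TR (%z. u 0 z - u' 0 z)"
 shows "Lp_norm 2 TR (%z. u t z - u' t z) <= (2 * lin_const) ^ m * N"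
  "slab (closed_segment 0 t) (%t z. u t z - u' t z) \<in> Lp_space 4 LT"
  "Lp_norm 4 LT (slab (closed_segment 0 t) (%t z. u t z - u' t z)) <= real m * (2 * lin_const) ^ m * N"
proof -
 let ?S = "%t. slab (closed_segment 0 t) (%t z. u t z - u' t z)" and ?C = "2 * lin_const"
 have l: "lin F (cnl A u) u" "lin F' (cnl A' u') u'" using n n' by (simp_all add: nsol_def)
 have dm: "(%(t, z). u t z - u' t z) \<in> bm LT" by (rule lin_meas[OF lin_diff[OF l]])
 have Sm: "slab (closed_segment s t) (%t z. u t z - u' t z) \<in> bm LT" for s t
  by (rule slab_measurable[OF dm]) simp
 have N: "0 <= N" by (simp add: N_def)
 define Q where "Q = (%m t. Lp_norm 2 TR (%z. u t z - u' t z) <= ?C ^ m * N \<and>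
  ?S t \<in> Lp_space 4 LT \<and> Lp_norm 4 LT (?S t) <= real m * ?C ^ m * N)"
 have "Q m t"
 proof (rule unit_steps[OF pq, where Q = Q, OF _ _ t])
  have "AE w in LT. ?S 0 w = 0"
  proof -
   have "AE s in lborel. AE z in TR. (%w. ?S 0 w = 0) (s, z)"
    using AE_lborel_singleton[of "0::real"] by eventually_elim (simp add: slab_def)
   moreover have [measurable]: "?S 0 \<in> bm LT" by (rule Sm)
   ultimately show ?thesis by (intro LT.AE_pair_measure) measurable
  qed
  from Lp_norm_zero_AE[OF this Sm] show "Q 0 0" by (simp add: Q_def N_def)
 next
  fix k s t assume a: "Q k s" "s \<in> {p..q}" "t \<in> {p..q}" "\<bar>s - t\<bar> <= 1"
  have seg: "closed_segment s t = {min s t..max s t}" by (auto simp: closed_segment_eq_real_ivl)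
  have sub: "{min s t..max s t} \<subseteq> A" "{min s t..max s t} \<subseteq> A'"
  proof -
   have "{min s t..max s t} \<subseteq> {p..q}"
    using a by (intro atLeastatMost_subset_iff[THEN iffD2]) auto
   thus "{min s t..max s t} \<subseteq> A" "{min s t..max s t} \<subseteq> A'" using J by (blast intro: subset_trans)+
  qed
  have sm: "Lp_norm 2 TR (u s) <= \<delta>0" "Lp_norm 2 TR (u' s) <= \<delta>0"
   using nsol_mass[OF n J(1) pq a(2)] nsol_mass[OF n' J(2) pq a(2)] small by auto
  have ab: "min s t <= max s t" "max s t <= min s t + 1" "s = min s t \<or> s = max s t" using a(4) by auto
  note st = nsol_diff_step[OF n n' sub ab sm]
  have C1: "1 <= ?C" using lin_const by simp
  have Ns: "?C * Lp_norm 2 TR (%z. u s z - u' s z) <= ?C ^ Suc k * N"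
   using mult_left_mono[of "Lp_norm 2 TR (%z. u s z - u' s z)" "?C ^ k * N" ?C] a(1) C1 by (simp add: Q_def)
  have 1: "Lp_norm 2 TR (%z. u t z - u' t z) <= ?C ^ Suc k * N"
   using st(3)[of t] Ns by simp
  have B: "slab (closed_segment s t) (%t z. u t z - u' t z) \<in> Lp_space 4 LT"
   "Lp_norm 4 LT (slab (closed_segment s t) (%t z. u t z - u' t z)) <= ?C ^ Suc k * N"
   using st(1,2) Ns unfolding seg by auto
  have sub2: "closed_segment 0 t \<subseteq> closed_segment 0 s \<union> closed_segment s t"
   by (auto simp: closed_segment_eq_real_ivl split: if_splits)
  have A: "?S s \<in> Lp_space 4 LT" "Lp_norm 4 LT (?S s) <= real k * ?C ^ k * N" using a(1) by (auto simp: Q_def)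
  note Un = slab_Un[OF A(1) B(1) sub2 Sm one_le_numeral]
  have "Lp_norm 4 LT (?S t) <= real k * ?C ^ k * N + ?C ^ Suc k * N" using Un(2) A(2) B(2) by simp
  also have "real k * ?C ^ k * N <= real k * ?C ^ Suc k * N"
   using C1 N by (intro mult_right_mono mult_left_mono power_increasing) auto
  finally have "Lp_norm 4 LT (?S t) <= real (Suc k) * ?C ^ Suc k * N" by (simp add: algebra_simps)
  thus "Q (Suc k) t" using 1 Un(1) unfolding Q_def by blast
 qed
 thus "Lp_norm 2 TR (%z. u t z - u' t z) <= ?C ^ m * N" "?S t \<in> Lp_space 4 LT" "Lp_norm 4 LT (?S t) <= real m * ?C ^ m * N"
  by (auto simp: Q_def)
qed

end

lemma Lp_complete:
 fixes f :: "nat => 'a => complex"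
 assumes M: "sigma_finite_measure M" and p: "p >= 1" and f: "\<And>n. f n \<in> Lp_space p M"
  and c: "\<And>e. e > 0 ==> \<exists>N. \<forall>m\<ge>N. \<forall>n\<ge>N. Lp_norm p M (%x. f m x - f n x) < e"
 obtains g where "g \<in> Lp_space p M" "(%n. Lp_norm p M (%x. f n x - g x)) \<longlonglongrightarrow> 0"
proof -
 have m: "(%(t, x). f n x) \<in> bm (count_space (UNIV :: unit set) \<Otimes>\<^sub>M M)" for n
 proof -
  have [measurable]: "f n \<in> bm M" using f by (simp add: Lp_space_def)
  show ?thesis by measurable
 qed
 obtain g where g: "(%(t, x). g t x) \<in> bm (count_space (UNIV :: unit set) \<Otimes>\<^sub>M M)"
  "\<And>t. t \<in> space (count_space (UNIV :: unit set)) ==> (\<And>n. f n \<in> Lp_space p M) ==>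
   (\<And>e. e > 0 ==> \<exists>N. \<forall>m\<ge>N. \<forall>n\<ge>N. Lp_norm p M (%x. f m x - f n x) < e) ==>
   g t \<in> Lp_space p M \<and> (%n. Lp_norm p M (%x. f n x - g t x)) \<longlonglongrightarrow> 0"
  by (rule Lp_limit_param[where f = "%n _. f n" and T = "count_space (UNIV :: unit set)", OF M p m]) blast
 have "g () \<in> Lp_space p M \<and> (%n. Lp_norm p M (%x. f n x - g () x)) \<longlonglongrightarrow> 0"
  by (rule g(2)) (auto intro: f c)
 thus ?thesis using that by blast
qed

lemma AE_LT_I:
 assumes "\<And>t. AE z in TR. P t z" "{w \<in> space LT. P (fst w) (snd w)} \<in> sets LT"
 shows "AE w in LT. P (fst w) (snd w)"
proof -
 show ?thesis by (rule LT.AE_pair_measure[OF assms(2)]) (use assms(1) in simp)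
qed

context nls
begin

subsection \<open>Global existence\<close>

text \<open>The new piece \<open>{a..b}\<close> meets the old interval only at \<open>c\<close>, on
  its right or on its left. All iterates are linear solutions with the same profile \<open>F\<close>
  at time 0, so by \<open>lin_local\<close> they coincide with \<open>u\<close> on the old interval
  and two solutions never have to be glued.\<close>

lemma nsol_extend:
 assumes n: "nsol {p..q} F u" and pq: "p <= 0" "0 <= q" and small: "Lp_norm 2 TR (u 0) <= \<delta>0"
  and ab: "a <= b" "b <= a + 1" and c: "c = a \<or> c = b" "{p..q} \<inter> {a..b} = {c}"
 shows "\<exists>w. nsol ({p..q} \<union> {a..b}) F w"
proof -
 let ?J = "{a..b}"
 have l: "lin F (cnl {p..q} u) u" using n by (simp add: nsol_def)
 have F: "F \<in> Lp_space 2 ZR" using l by (simp add: lin_def)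
 have um: "(%(t, z). u t z) \<in> bm LT" by (rule lin_meas[OF l])
 have um' [measurable]: "(%w. u (fst w) (snd w)) \<in> bm LT" using um by (simp add: split_beta')
 have cpq: "c \<in> {p..q}" and cJ: "a <= c" "c <= b" using c by auto
 have uc: "Lp_norm 2 TR (u c) <= \<delta>0" using nsol_mass[OF n order_refl pq cpq] small by simp
 define g where "g = (%v s z. \<kappa> * (if s \<in> ?J then cubic (v s z) else indicator {p..q} s * cubic (u s z)))"
 define good where "good = (%v. (%(t, z). v t z) \<in> bm LT \<and> slab ?J v \<in> Lp_space 4 LT \<and> Lp_norm 4 LT (slab ?J v) <= R0)"
 have gm: "(%(t, z). g v t z) \<in> bm LT" if "(%(t, z). v t z) \<in> bm LT" for v
 proof -
  have [measurable]: "(%w. v (fst w) (snd w)) \<in> bm LT" using that by (simp add: split_beta')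
  show ?thesis unfolding g_def split_beta' by measurable
 qed
 have gf: "forcing (g v)" if "good v" for v
 proof -
  have v: "slab ?J v \<in> Lp_space 4 LT" using that by (simp add: good_def)
  have u: "slab ({p..q} - ?J) u \<in> Lp_space 4 LT" by (rule nsol_slab(1)[OF n]) auto
  have e: "(%(t, z). g v t z) = (%w. \<kappa> * (cubic (slab ?J v w) + cubic (slab ({p..q} - ?J) u w)))"
   by (rule ext) (auto simp: g_def slab_def split: split_indicator)
  show ?thesis
   unfolding forcing_iff e by (rule sigma_Lp(1)[OF Lp_add(1)[OF cubic_Lp(1)[OF v] cubic_Lp(1)[OF u]]]) auto
 qed
 have gs: "slab ?J (g v) w = \<kappa> * cubic (slab ?J v w)" for v w
  by (auto simp: slab_def g_def split: split_indicator)
 have wu: "AE z in TR. w t z = u t z" if "lin F (g v) w" "t \<in> {p..q}" for v w t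
 proof (rule lin_local[OF that(1) l])
  have "AE s in lborel. s \<noteq> c" by (rule AE_lborel_singleton)
  thus "AE s in lborel. s \<in> closed_segment 0 t --> (AE z in TR. g v s z = cnl {p..q} u s z)"
  proof eventually_elim
   case (elim s)
   show ?case
   proof
    assume "s \<in> closed_segment 0 t"
    hence "s \<in> {p..q}" using that(2) pq by (auto simp: closed_segment_eq_real_ivl split: if_splits)
    hence sJ: "s \<notin> ?J" using elim c(2) by blast
    have "g v s z = cnl {p..q} u s z" for z by (simp only: g_def cnl_def if_not_P[OF sJ])
    thus "AE z in TR. g v s z = cnl {p..q} u s z" by simp
   qed
  qed
 qed
 have wc: "Lp_norm 2 TR (w c) <= \<delta>0" if "lin F (g v) w" for v w
  using Lp_norm_cong_AE[OF wu[OF that cpq] Lp_measurable[OF lin_L2[OF that]] Lp_measurable[OF lin_L2[OF l]]] uc by simp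
 have step: "good w" if v: "good v" and w: "lin F (g v) w" for v w
 proof -
  note est = lin_estimate[OF w cJ ab(2)]
  have vL: "slab ?J v \<in> Lp_space 4 LT" "Lp_norm 4 LT (slab ?J v) <= R0" using v by (auto simp: good_def)
  note cv = cubic_Lp[OF vL(1)]
  have "Lp_norm (4/3) LT (slab ?J (g v)) = Lp_norm (4/3) LT (%w. cubic (slab ?J v w))"
   unfolding gs[abs_def] by (rule sigma_Lp(2)[OF cv(1)]) simp
  also have "... <= R0 ^ 3" using cv(2) power_mono[OF vL(2), of 3] by simp
  finally have g3: "Lp_norm (4/3) LT (slab ?J (g v)) <= R0 ^ 3" .
  have "Lp_norm 4 LT (slab ?J w) <= lin_const * (\<delta>0 + R0 ^ 3)"
   by (rule order_trans[OF est(2) mult_left_mono[OF add_mono[OF wc[OF w] g3] less_imp_le[OF lin_const_pos]]])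
  also have "... <= R0" using \<delta>0(2) R0(1,3) by (simp add: distrib_left)
  finally show ?thesis using est(1) lin_meas[OF w] by (simp add: good_def)
 qed
 have contr: "Lp_norm 4 LT (slab ?J (%t z. w t z - w' t z)) <= 1 / 4 * Lp_norm 4 LT (slab ?J (%t z. v t z - v' t z))"
  if v: "good v" "good v'" and w: "lin F (g v) w" "lin F (g v') w'" for v v' w w'
 proof -
  have sv: "slab ?J v \<in> Lp_space 4 LT" "slab ?J v' \<in> Lp_space 4 LT" "Lp_norm 4 LT (slab ?J v) <= R0" "Lp_norm 4 LT (slab ?J v') <= R0"
   using v by (auto simp: good_def)
  note est = lin_estimate(2)[OF lin_diff[OF w] cJ ab(2)]
  have "AE z in TR. w c z - w' c z = 0" using wu[OF w(1) cpq] wu[OF w(2) cpq] by eventually_elim simp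
  hence z: "Lp_norm 2 TR (%z. w c z - w' c z) = 0"
   by (rule Lp_norm_zero_AE) (intro borel_measurable_diff Lp_measurable[OF lin_L2[OF w(1)]] Lp_measurable[OF lin_L2[OF w(2)]])
  have "slab ?J (%t z. g v t z - g v' t z) = (%w. \<kappa> * (cubic (slab ?J v w) - cubic (slab ?J v' w)))"
   by (rule ext) (simp only: slab_diff gs right_diff_distrib)
  hence "Lp_norm (4/3) LT (slab ?J (%t z. g v t z - g v' t z)) = Lp_norm (4/3) LT (%w. cubic (slab ?J v w) - cubic (slab ?J v' w))"
   using sigma_Lp(2)[OF cubic_Lp_diff(1)[OF sv(1,2)]] by simp
  with est z cubic_contract[OF sv] show ?thesis by (simp add: slab_diff[abs_def])
 qed
 have ex: "\<exists>w. lin F (g v) w" if "good v" for v by (rule lin_exists[OF gf[OF that] F])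
 \<comment> \<open>Picard iteration from 0. A linear solution is determined only up to null sets at
   each time, so every iterate is a choice.\<close>
 define v where "v = rec_nat (%_ _. 0) (%_ v. SOME w. lin F (g v) w)"
 have vS: "lin F (g (v j)) (v (Suc j))" if "good (v j)" for j
  unfolding v_def using someI_ex[OF ex[OF that]] by (simp add: v_def)
 have v0: "slab ?J (v 0) = (%w. 0)" by (rule ext) (simp add: v_def slab_def)
 have good: "good (v j)" for j
 proof (induction j)
  case 0
  show ?case using R0(1) by (simp add: good_def v0) (simp add: v_def)
 next
  case (Suc j)
  show ?case by (rule step[OF Suc vS[OF Suc]])
 qed
 note vl = vS[OF good]
 define f where "f = (%j. slab ?J (v j))"
 have fL: "f j \<in> Lp_space 4 LT" "Lp_norm 4 LT (f j) <= R0" for j using good[of j] by (auto simp: f_def good_def)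
 have D: "Lp_norm 4 LT (%w. f (j + k) w - f j w) <= (1 / 4) ^ j * R0" for j k
 proof (induction j)
  case 0
  show ?case using fL(2)[of k] by (simp add: f_def v0)
 next
  case (Suc j)
  have "Lp_norm 4 LT (%w. f (Suc j + k) w - f (Suc j) w) <= 1 / 4 * Lp_norm 4 LT (%w. f (j + k) w - f j w)"
   using contr[OF good good vl vl, of "j + k" j] by (simp add: f_def slab_diff[abs_def])
  thus ?case using Suc by simp
 qed
 have lim0: "(%j. (1 / 4) ^ j * R0) \<longlonglongrightarrow> 0"
  using tendsto_mult_right[OF LIMSEQ_power_zero[of "1 / 4 :: real"], of R0] by simp
 have cauchy: "\<exists>N. \<forall>m\<ge>N. \<forall>n\<ge>N. Lp_norm 4 LT (%x. f m x - f n x) < e" if "e > 0" for e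
 proof -
  obtain N where "\<And>j. j >= N ==> norm ((1 / 4) ^ j * R0 - 0) < e / 2" using LIMSEQ_D[OF lim0, of "e / 2"] \<open>e > 0\<close> by auto
  hence "\<bar>(1 / 4) ^ N * R0\<bar> < e / 2" by fastforce
  hence N: "(1 / 4) ^ N * R0 < e / 2" by simp
  have dN: "Lp_norm 4 LT (%x. f m x - f N x) < e / 2" if "m >= N" for m
   using D[of N "m - N"] that N by simp
  show ?thesis
  proof (intro exI allI impI)
   fix m n assume "N <= m" "N <= n"
   thus "Lp_norm 4 LT (%x. f m x - f n x) < e"
    using Lp_norm_triangle[OF fL(1)[of m] fL(1)[of N] fL(1)[of n]] dN[of m] dN[of n] Lp_norm_minus_commute[of 4 LT "f N" "f n"] by simp
  qed
 qed
 obtain G where G: "G \<in> Lp_space 4 LT" "(%j. Lp_norm 4 LT (%w. f j w - G w)) \<longlonglongrightarrow> 0"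
  using Lp_complete[where p = 4 and f = f, OF LT.sigma_finite_measure_axioms _ fL(1) cauchy] by auto
 \<comment> \<open>The \<open>L^4\<close> limit carries no values at single times. It only serves to
   drive a linear solution \<open>w\<close>, which agrees with it almost everywhere on the new piece
   and is the function that is kept.\<close>
 define V where "V = (%s z. G (s, z))"
 have GV: "(%(t, z). V t z) = G" by (auto simp: V_def)
 have Gm [measurable]: "G \<in> bm LT" using G by (simp add: Lp_space_def)
 have Vm: "(%(t, z). V t z) \<in> bm LT" unfolding GV by (rule Gm)
 have sUV: "slab UNIV V = G" by (simp add: slab_UNIV GV)
 have VL: "slab ?J V \<in> Lp_space 4 LT"
  by (rule slab_mono(1)[of UNIV]) (auto simp: sUV G slab_measurable[OF Vm])
 have fV: "(%j. Lp_norm 4 LT (%w. f j w - slab ?J V w)) \<longlonglongrightarrow> 0"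
 proof (rule Lim_null_comparison[OF _ G(2)])
  have "Lp_norm 4 LT (%w. f j w - slab ?J V w) <= Lp_norm 4 LT (%w. f j w - G w)" for j
  proof (rule Lp_mono(2))
   show "AE w in LT. cmod (f j w - slab ?J V w) <= cmod (f j w - G w)"
    by (rule AE_I2) (auto simp: f_def slab_def V_def split: split_indicator)
   show "(%w. f j w - G w) \<in> Lp_space 4 LT" by (rule Lp_diff(1)[OF fL(1) G(1)]) simp
   show "(%w. f j w - slab ?J V w) \<in> bm LT"
    by (rule Lp_measurable[OF Lp_diff(1)[OF fL(1) VL]]) simp
  qed simp
  thus "\<forall>\<^sub>F j in sequentially. norm (Lp_norm 4 LT (%w. f j w - slab ?J V w)) <= Lp_norm 4 LT (%w. f j w - G w)" by simp
 qed
 have goodV: "good V"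
 proof -
  have "Lp_norm 4 LT (slab ?J V) <= R0 + 0"
  proof (rule LIMSEQ_le_const)
   show "(%j. R0 + Lp_norm 4 LT (%w. f j w - slab ?J V w)) \<longlonglongrightarrow> R0 + 0" by (intro tendsto_intros fV)
   have "Lp_norm 4 LT (slab ?J V) <= R0 + Lp_norm 4 LT (%w. f j w - slab ?J V w)" for j
    using Lp_norm_rev_triangle[OF fL(1)[of j] VL] fL(2)[of j] by simp
   thus "\<exists>N. \<forall>n\<ge>N. Lp_norm 4 LT (slab ?J V) <= R0 + Lp_norm 4 LT (%w. f n w - slab ?J V w)" by blast
  qed
  thus ?thesis using Vm VL by (simp add: good_def)
 qed
 obtain w where w: "lin F (g V) w" using ex[OF goodV] by blast
 have wL: "slab ?J w \<in> Lp_space 4 LT" using step[OF goodV w] by (simp add: good_def)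
 have dL: "(%x. slab ?J w x - slab ?J V x) \<in> Lp_space 4 LT" by (rule Lp_diff(1)[OF wL VL]) simp
 have "Lp_norm 4 LT (%x. slab ?J w x - slab ?J V x) <= 0 + 0"
 proof (rule LIMSEQ_le_const)
  have "(%j. Lp_norm 4 LT (%w. f j w - slab ?J V w) + Lp_norm 4 LT (%w. f (Suc j) w - slab ?J V w)) \<longlonglongrightarrow> 0 + 0"
   by (intro tendsto_add fV LIMSEQ_Suc[OF fV])
  thus "(%j. Lp_norm 4 LT (%w. f j w - slab ?J V w) + Lp_norm 4 LT (%w. f (Suc j) w - slab ?J V w)) \<longlonglongrightarrow> 0 + 0" .
  have "Lp_norm 4 LT (%x. slab ?J w x - slab ?J V x) <= Lp_norm 4 LT (%w. f j w - slab ?J V w) + Lp_norm 4 LT (%w. f (Suc j) w - slab ?J V w)" for j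
  proof -
   have "Lp_norm 4 LT (%x. f (Suc j) x - slab ?J w x) <= 1 / 4 * Lp_norm 4 LT (%x. f j x - slab ?J V x)"
    using contr[OF good goodV vl w, of j] by (simp add: f_def slab_diff[abs_def])
   also have "... <= Lp_norm 4 LT (%x. f j x - slab ?J V x)" by simp
   finally show ?thesis
    using Lp_norm_triangle[OF wL fL(1)[of "Suc j"] VL] Lp_norm_minus_commute[of 4 LT "slab ?J w" "f (Suc j)"] by simp
  qed
  thus "\<exists>N. \<forall>n\<ge>N. Lp_norm 4 LT (%x. slab ?J w x - slab ?J V x) <=
   Lp_norm 4 LT (%w. f n w - slab ?J V w) + Lp_norm 4 LT (%w. f (Suc n) w - slab ?J V w)" by blast
 qed
 hence "Lp_norm 4 LT (%x. slab ?J w x - slab ?J V x) = 0" by (simp add: order_antisym)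
 from Lp_norm_eq_0_AE[OF dL _ this] have wV: "AE x in LT. slab ?J w x - slab ?J V x = 0" by simp
 have wm: "(%(t, z). w t z) \<in> bm LT" by (rule lin_meas[OF w])
 have wm' [measurable]: "(%x. w (fst x) (snd x)) \<in> bm LT" using wm by (simp add: split_beta')
 have wU: "AE x in LT. fst x \<in> {p..q} --> w (fst x) (snd x) = u (fst x) (snd x)"
 proof (rule AE_LT_I)
  show "AE z in TR. t \<in> {p..q} --> w t z = u t z" for t
   using wu[OF w, of t] by (cases "t \<in> {p..q}") auto
 qed measurable
 have Am: "{p..q} \<union> ?J \<in> sets borel" by simp
 have "AE x in LT. g V (fst x) (snd x) = cnl ({p..q} \<union> ?J) w (fst x) (snd x)"
  using wV wU
 proof eventually_elim
  case (elim x)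
  show ?case
   using elim by (auto simp: g_def cnl_def slab_def split: split_indicator)
 qed
 from lin_cong_forcing[OF w cnl_measurable[OF wm Am] this]
 show ?thesis using Am by (auto simp: nsol_def)
qed

lemma lin_initial:
 assumes "lin F h u"
 shows "is_fourier 2 (u 0) F"
proof -
 obtain H where H: "is_fourier 2 (u 0) (%k. mul 0 k * (F k + DW H 0 k))"
  using assms unfolding lin_def by blast
 have "DW H 0 = (%k. 0)" by (rule ext) (simp add: DW_def)
 hence "(%k. mul 0 k * (F k + DW H 0 k)) = F" by simp
 with H show ?thesis by simp
qed

lemma nsol_initial:
 assumes "nsol A F u" "Lp_norm 2 ZR F <= 2 * pi * \<delta>0"
 shows "Lp_norm 2 TR (u 0) <= \<delta>0"
 using is_fourier_norm(2)[OF fexp_simps(1) lin_initial, of F "cnl A u" u] assms by (simp add: nsol_def)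

text \<open>One unit is added on the right and one on the left in turn; mass conservation inside
  \<open>nsol_extend\<close> keeps the step length fixed. The start is the single time 0, a null
  set, where the free evolution qualifies.\<close>

lemma nsol_exists:
 assumes F: "F \<in> Lp_space 2 ZR" and small: "Lp_norm 2 ZR F <= 2 * pi * \<delta>0"
 shows "\<exists>u. nsol {- real n..real n} F u"
proof (induction n)
 case 0
 have "forcing (%s z. 0)" by (simp add: forcing_iff split_beta')
 from lin_exists[OF this F] obtain u where u: "lin F (%s z. 0) u" by blast
 have "AE w in LT. fst w \<noteq> (0 :: real)"
 proof -
  show ?thesis
  proof (rule LT.AE_pair_measure)
   show "AE x in lborel. AE y in TR. fst (x, y) \<noteq> (0 :: real)"
    using AE_lborel_singleton[of "0::real"] by eventually_elim simp
  qed measurable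
 qed
 hence "AE w in LT. 0 = cnl {0..0} u (fst w) (snd w)"
  by eventually_elim (simp add: cnl_def)
 from lin_cong_forcing[OF u cnl_measurable[OF lin_meas[OF u]] this] have "nsol {0..0} F u"
  by (simp add: nsol_def)
 thus ?case by auto
next
 case (Suc n)
 then obtain u where u: "nsol {- real n..real n} F u" by blast
 have "{- real n..real n} \<inter> {real n..real n + 1} = {real n}" by auto
 from nsol_extend[OF u _ _ nsol_initial[OF u small] _ _ _ this]
 obtain v where v: "nsol ({- real n..real n} \<union> {real n..real n + 1}) F v" by auto
 have "{- real n..real n} \<union> {real n..real n + 1} = {- real n..real n + 1}" by auto
 with v have v: "nsol {- real n..real n + 1} F v" by simp
 have "{- real n..real n + 1} \<inter> {- real n - 1..- real n} = {- real n}" by auto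
 from nsol_extend[OF v _ _ nsol_initial[OF v small] _ _ _ this]
 obtain w where w: "nsol ({- real n..real n + 1} \<union> {- real n - 1..- real n}) F w" by auto
 have "{- real n..real n + 1} \<union> {- real n - 1..- real n} = {- real (Suc n)..real (Suc n)}" by auto
 with w show ?case by auto
qed

end

subsection \<open>Solutions of the integral equation\<close>

lemma slab_cong_AE:
 assumes "slab I f \<in> bm LT" "slab I g \<in> bm LT"
  "\<And>t. t \<in> I ==> AE z in TR. f t z = g t z"
 shows "AE w in LT. slab I f w = slab I g w"
proof -
 note [measurable] = assms(1,2)
 have "AE w in LT. slab I f (fst w, snd w) = slab I g (fst w, snd w)"
 proof (rule AE_LT_I[where P = "%t z. slab I f (t, z) = slab I g (t, z)"])
  show "AE z in TR. slab I f (t, z) = slab I g (t, z)" for t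
   using assms(3)[of t] by (cases "t \<in> I") (auto simp: slab_def)
  have "{w \<in> space LT. slab I f w = slab I g w} \<in> sets LT" by measurable
  thus "{w \<in> space LT. slab I f (fst w, snd w) = slab I g (fst w, snd w)} \<in> sets LT" by simp
 qed
 thus ?thesis by simp
qed

abbreviation RT :: "real set => (real \<times> real \<times> real) measure" where
 "RT I \<equiv> restrict_space lborel I \<Otimes>\<^sub>M TR"

lemma restrict_slab:
 assumes I [measurable]: "I \<in> sets borel" and I0: "0 \<in> I"
 defines "R \<equiv> RT I"
 shows "(%(t, z). f t z) \<in> bm R \<longleftrightarrow> slab I f \<in> bm LT"
  "slab I f \<in> bm LT ==> p > 0 ==> pint p R (%(t, z). f t z) = pint p LT (slab I f)"
proof -
 have fm: "(%(t, z). f t z) \<in> bm R" if s [measurable]: "slab I f \<in> bm LT"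
 proof -
  have "(%w. w) \<in> measurable R LT"
   unfolding R_def
  proof (rule measurable_pair)
   show "fst \<circ> (%w. w) \<in> measurable (RT I) lborel"
    using measurable_compose[OF measurable_fst measurable_restrict_space1[OF measurable_ident_sets[OF HOL.refl], of lborel I]]
    by (simp add: comp_def)
   show "snd \<circ> (%w. w) \<in> measurable (RT I) TR"
    by (simp add: comp_def)
  qed
  from measurable_compose[OF this s] have "slab I f \<in> bm R" by simp
  moreover have "slab I f w = (%(t, z). f t z) w" if "w \<in> space R" for w
   using that by (auto simp: R_def space_pair_measure space_restrict_space slab_def split_beta')
  ultimately show ?thesis by (subst measurable_cong[of _ _ "slab I f"]) auto
 qed
 have sm: "slab I f \<in> bm LT" if s: "(%(t, z). f t z) \<in> bm R"
 proof -
  \<comment> \<open>Times outside \<open>I\<close> are sent to 0, which belongs to \<open>I\<close>,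
    so that measurability over \<open>I\<close> can be pulled back to the whole line before the
    indicator erases the substituted values.\<close>
  have "(%w. (if fst w \<in> I then fst w else 0, snd w)) \<in> measurable LT R"
   unfolding R_def
  proof (rule measurable_Pair)
   show "(%w. if fst w \<in> I then fst w else 0) \<in> measurable LT (restrict_space lborel I)"
    by (rule measurable_restrict_space2) (use I0 in \<open>auto\<close>)
  qed measurable
  from measurable_compose[OF this s]
  have [measurable]: "(%w. f (if fst w \<in> I then fst w else 0) (snd w)) \<in> bm LT" by simp
  have "slab I f = (%w. indicator I (fst w) * f (if fst w \<in> I then fst w else 0) (snd w))"
   by (rule ext) (simp add: slab_def split: split_indicator)
  also have "... \<in> bm LT" by measurable
  finally show ?thesis .
 qed
 show "(%(t, z). f t z) \<in> bm R \<longleftrightarrow> slab I f \<in> bm LT" using fm sm by blast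
 assume s: "slab I f \<in> bm LT" and p: "p > 0"
 note [measurable] = s fm[OF s, unfolded R_def]
 have "pint p R (%(t, z). f t z) = (NN t|(restrict_space lborel I). (NN z|TR. ennreal (cmod (f t z) powr p)))"
  unfolding pint_def R_def by (subst TR.nn_integral_fst[symmetric]) (auto simp: split_beta')
 also have "... = (NN t|lborel. (NN z|TR. ennreal (cmod (f t z) powr p)) * indicator I t)"
  by (rule nn_integral_restrict_space) simp
 also have "... = (NN t|lborel. (NN z|TR. ennreal (cmod (slab I f (t, z)) powr p)))"
  by (rule nn_integral_cong) (use p in \<open>auto simp: slab_def split: split_indicator\<close>)
 also have "... = pint p LT (slab I f)"
  unfolding pint_def by (subst TR.nn_integral_fst[symmetric]) auto
 finally show "pint p R (%(t, z). f t z) = pint p LT (slab I f)" .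
qed

lemma restrict_Lp4:
 assumes I: "I \<in> sets borel" and I0: "0 \<in> I"
 shows "(%(t, z). f t z) \<in> Lp_space 4 (RT I) \<longleftrightarrow> slab I f \<in> Lp_space 4 LT"
  "slab I f \<in> Lp_space 4 LT ==>
   Lp_norm 4 (RT I) (%(t, z). f t z) = Lp_norm 4 LT (slab I f)"
proof -
 note r = restrict_slab[OF I I0, of f]
 show eq: "(%(t, z). f t z) \<in> Lp_space 4 (RT I) \<longleftrightarrow> slab I f \<in> Lp_space 4 LT"
  using r(1) r(2)[of 4] by (auto simp: Lp_space_iff)
 assume s: "slab I f \<in> Lp_space 4 LT"
 have "ennreal (Lp_norm 4 (RT I) (%(t, z). f t z) ^ 4) = ennreal (Lp_norm 4 LT (slab I f) ^ 4)"
  using Lp_norm_pow4[OF s] Lp_norm_pow4[OF eq[THEN iffD2, OF s]] r(2)[of 4] s by (simp add: Lp_space_def)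
 hence "Lp_norm 4 (RT I) (%(t, z). f t z) ^ 4 = Lp_norm 4 LT (slab I f) ^ 4" by simp
 thus "Lp_norm 4 (RT I) (%(t, z). f t z) = Lp_norm 4 LT (slab I f)"
  by (rule power_eq_imp_eq_base) auto
qed

lemma time_interval_borel: "time_interval I ==> I \<in> sets borel"
 by (simp add: time_interval_def real_interval_borel_measurable)

lemma time_interval_bound:
 assumes "time_interval I"
 shows "\<exists>m::nat. \<forall>t\<in>I. \<bar>t\<bar> <= real m"
proof -
 obtain B where B: "\<forall>t\<in>I. \<bar>t\<bar> <= B" using assms unfolding time_interval_def bounded_iff by auto
 obtain m :: nat where "B <= real m" using real_arch_simple by blast
 with B have "\<forall>t\<in>I. \<bar>t\<bar> <= real m" using order_trans by blast
 thus ?thesis by blast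
qed

lemma time_interval_segment:
 assumes "time_interval I" "t \<in> I"
 shows "closed_segment 0 t \<subseteq> I"
 using assms unfolding time_interval_def by (intro closed_segment_subset) (auto simp: is_interval_convex)

text \<open>An interval may lack its endpoints, while the estimates are on closed intervals; the two
  differ by a null set of times.\<close>

lemma time_interval_hull:
 assumes "time_interval I"
 shows "I \<subseteq> {Inf I..Sup I}" "Inf I <= 0" "0 <= Sup I" "AE s in lborel. s \<in> I \<longleftrightarrow> s \<in> {Inf I..Sup I}"
proof -
 have I: "bdd_below I" "bdd_above I" "0 \<in> I" "is_interval I"
  using assms by (auto simp: time_interval_def bounded_imp_bdd_above bounded_imp_bdd_below)
 show 1: "I \<subseteq> {Inf I..Sup I}" using I by (auto intro: cInf_lower cSup_upper)
 thus "Inf I <= 0" "0 <= Sup I" using I(3) by auto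
 show "AE s in lborel. s \<in> I \<longleftrightarrow> s \<in> {Inf I..Sup I}"
  using AE_lborel_singleton[of "Inf I"] AE_lborel_singleton[of "Sup I"]
 proof eventually_elim
  case (elim s)
  show ?case
  proof
   assume "s \<in> {Inf I..Sup I}"
   with elim have "Inf I < s" "s < Sup I" by auto
   then obtain x y where "x \<in> I" "x < s" "y \<in> I" "s < y"
    using cInf_less_iff[of I s] less_cSup_iff[of I s] I by blast
   with I(4) show "s \<in> I" unfolding is_interval_1 by (meson less_imp_le)
  qed (use 1 in blast)
 qed
qed

context dispersion
begin

text \<open>For \<open>t < 0\<close> the oriented integral changes sign, as does the difference of
  indicators in \<open>DW\<close>; the factor \<open>mul t\<close> leaves the integral by the group
  law.\<close>

lemma interval_DW:
 assumes m: "(%(s, k). H s k) \<in> bm LZ"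
 shows "(LBINT s=ereal 0..ereal t. mul (t - s) k * H s k) = mul t k * DW H t k"
proof -
 have kk: "(%s. k) \<in> measurable borel ZR" by (rule measurable_const) simp
 note kk [measurable]
 have [measurable]: "(%s. H s k) \<in> bm borel" using measurable_Pair1[OF m, of k] by simp
 have mm: "mul (t - s) k = mul t k * mul (- s) k" for s
  using multiplier_add[of \<alpha> \<epsilon> t "- s" k] by simp
 let ?S = "%s. (indicator {0..t} s - indicator {t..0} s) *\<^sub>R (mul (- s) k * H s k)"
 have "(LBINT s=ereal 0..ereal t. mul (t - s) k * H s k) =
  (LINT s|lborel. mul t k * (?S s))"
 proof (cases "0 <= t")
  case True
  hence "(LBINT s=ereal 0..ereal t. mul (t - s) k * H s k) = (LINT s|lborel. indicator {0<..<t} s *\<^sub>R (mul (t - s) k * H s k))"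
   by (simp add: interval_lebesgue_integral_def set_lebesgue_integral_def)
  also have "... = (LINT s|lborel. mul t k * (?S s))"
  proof (intro integral_cong_AE)
   show "AE s in lborel. indicator {0<..<t} s *\<^sub>R (mul (t - s) k * H s k) =
     mul t k * (?S s)"
    using AE_lborel_singleton[of "0::real"] AE_lborel_singleton[of t]
   proof eventually_elim
    case (elim s)
    thus ?case using True by (auto simp: mm indicator_def)
   qed
  qed measurable
  finally show ?thesis .
 next
  case False
  hence "(LBINT s=ereal 0..ereal t. mul (t - s) k * H s k) = - (LINT s|lborel. indicator {t<..<0} s *\<^sub>R (mul (t - s) k * H s k))"
   by (simp add: interval_lebesgue_integral_def set_lebesgue_integral_def)
  also have "... = (LINT s|lborel. - (indicator {t<..<0} s *\<^sub>R (mul (t - s) k * H s k)))" by simp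
  also have "... = (LINT s|lborel. mul t k * (?S s))"
  proof (intro integral_cong_AE)
   show "AE s in lborel. - (indicator {t<..<0} s *\<^sub>R (mul (t - s) k * H s k)) =
     mul t k * (?S s)"
    using AE_lborel_singleton[of "0::real"] AE_lborel_singleton[of t]
   proof eventually_elim
    case (elim s)
    thus ?case using False by (auto simp: mm indicator_def)
   qed
  qed measurable
  finally show ?thesis .
 qed
 thus ?thesis by (simp only: integral_mult_right_zero DW_def)
qed

lemma DW_cmult: "DW (%s k. c * H s k) t k = c * DW H t k"
proof -
 have "DW (%s k. c * H s k) t k = (LINT s|lborel. c * ((indicator {0..t} s - indicator {t..0} s) *\<^sub>R (mul (- s) k * H s k)))"
  unfolding DW_def by (rule Bochner_Integration.integral_cong) auto
 thus ?thesis by (simp only: integral_mult_right_zero DW_def)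
qed

end

context nls
begin

text \<open>A given solution is controlled only at times in \<open>I\<close>, so it is extended by
  zero. The linear solution driven by its cubic term then agrees with it at every time of
  \<open>I\<close>. This brings arbitrary solutions, not only constructed ones, under the a priori
  bound and the Lipschitz estimate.\<close>

lemma solution_nsol:
 assumes sol: "is_solution \<alpha> \<epsilon> \<sigma> I \<phi> u" and I: "time_interval I"
 shows "\<exists>F v. is_fourier 2 \<phi> F \<and> nsol {Inf I..Sup I} F v \<and> (\<forall>t\<in>I. AE z in TR. u t z = v t z)"
proof -
 note Ib = time_interval_borel[OF I]
 have I0: "0 \<in> I" using I by (simp add: time_interval_def)
 have uL: "slab I u \<in> Lp_space 4 LT"
  using sol restrict_Lp4(1)[OF Ib I0, of u] by (simp add: is_solution_def solution_space_def)
 define uI where "uI = (%s z. slab I u (s, z))"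
 have suI: "slab I uI = slab I u" by (rule ext) (simp add: uI_def slab_def split: split_indicator)
 have uIm: "(%(t, z). uI t z) \<in> bm LT"
  using uL by (simp add: uI_def Lp_space_def)
 have fo: "forcing (cnl I uI)" using forcing_cnl[OF uIm Ib] uL suI by simp
 have h: "cnl I uI s z = \<kappa> * cubic (u s z)" if "s \<in> I" for s z using that by (simp add: cnl_def uI_def slab_def)
 obtain F where F: "is_fourier 2 \<phi> F"
  using sol I0 unfolding is_solution_def is_group_def by blast
 have FL: "F \<in> Lp_space 2 ZR" using is_fourierD(2)[OF F] by simp
 obtain H where D: "duhamel \<alpha> \<epsilon> (cnl I uI) H" using duhamel_exists[OF fo] by blast
 obtain v where v: "lin F (cnl I uI) v" "\<And>t. is_fourier 2 (v t) (%k. mul t k * (F k + DW H t k))"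
  using lin_from_duhamel[OF D FL] by blast
 have uv: "AE z in TR. u t z = v t z" if t: "t \<in> I" for t
 proof -
  obtain w d where w: "is_group \<alpha> \<epsilon> t \<phi> w"
   and d: "is_duhamel \<alpha> \<epsilon> t (%s z. complex_of_real ((cmod (u s z))\<^sup>2) * u s z) d"
   and ut: "AE z in TR. u t z = w z - complex_of_real \<sigma> * \<i> * d z"
   using sol t unfolding is_solution_def by blast
  obtain F' where F': "is_fourier 2 \<phi> F'" "is_fourier 2 w (%k. mul t k * F' k)"
   using w unfolding is_group_def by blast
  have FF: "AE k in ZR. F' k = F k" by (rule is_fourier_unique[OF fexp_simps(1) F'(1) F]) simp
  obtain H' where H': "(%(s, k). H' s k) \<in> bm LZ"
   "AE s in lborel. s \<in> closed_segment 0 t --> is_fourier (4/3) (%z. cubic (u s z)) (H' s)"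
   "is_fourier 2 d (%k. LBINT s=ereal 0..ereal t. mul (t - s) k * H' s k)"
   using d unfolding is_duhamel_def cubic_def by blast
  have m': "(%(s, k). \<kappa> * H' s k) \<in> bm LZ"
  proof -
   have [measurable]: "(%w. H' (fst w) (snd w)) \<in> bm LZ" using H'(1) by (simp add: split_beta')
   show ?thesis unfolding split_beta' by measurable
  qed
  have "AE s in lborel. s \<in> closed_segment 0 t --> (AE k in ZR. H s k = \<kappa> * H' s k)"
   using H'(2) duhamel.hH[OF D]
  proof eventually_elim
   case (elim s)
   show ?case
   proof
    assume s: "s \<in> closed_segment 0 t"
    hence "s \<in> I" using time_interval_segment[OF I t] by blast
    from h[OF this] show "AE k in ZR. H s k = \<kappa> * H' s k"
     by (intro is_fourier_unique[OF fexp_simps(2) elim(2) is_fourier_cmult[OF fexp_simps(2) elim(1)[rule_format, OF s]]]) auto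
   qed
  qed
  from DW_local(2)[OF duhamel.H_meas[OF D] m' this]
  have "AE k in ZR. DW H t k = \<kappa> * DW H' t k" by (simp only: DW_cmult)
  with FF have "AE k in ZR. mul t k * F' k - complex_of_real \<sigma> * \<i> * (mul t k * DW H' t k) = mul t k * (F k + DW H t k)"
   by eventually_elim (simp add: algebra_simps)
  moreover have "is_fourier 2 (%z. w z - complex_of_real \<sigma> * \<i> * d z) (%k. mul t k * F' k - complex_of_real \<sigma> * \<i> * (mul t k * DW H' t k))"
   by (intro is_fourier_diff is_fourier_cmult fexp_simps F'(2)) (use H'(3) in \<open>simp only: interval_DW[OF H'(1)]\<close>)
  ultimately have "AE z in TR. w z - complex_of_real \<sigma> * \<i> * d z = v t z"
   by (intro is_fourier_inject[OF _ v(2)])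
  with ut show ?thesis by eventually_elim simp
 qed
 let ?A = "{Inf I..Sup I}"
 have vm: "(%(t, z). v t z) \<in> bm LT" by (rule lin_meas[OF v(1)])
 have sv: "AE w in LT. slab I u w = slab I v w"
  by (rule slab_cong_AE[OF Lp_measurable[OF uL] slab_measurable[OF vm Ib] uv])
 have IA: "AE w in LT. fst w \<in> I \<longleftrightarrow> fst w \<in> ?A"
 proof -
  note Ib [measurable]
  show ?thesis
  proof (rule LT.AE_pair_measure)
   show "AE x in lborel. AE y in TR. fst (x, y) \<in> I \<longleftrightarrow> fst (x, y) \<in> ?A"
    using time_interval_hull(4)[OF I] by eventually_elim simp
  qed measurable
 qed
 have "AE w in LT. cnl I uI (fst w) (snd w) = cnl ?A v (fst w) (snd w)"
  using sv IA
 proof eventually_elim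
  case (elim w)
  show ?case
  proof (cases "fst w \<in> I")
   case True
   have "u (fst w) (snd w) = v (fst w) (snd w)" using elim(1) True by (simp add: slab_def)
   thus ?thesis using True elim(2) by (simp only: h[OF True]) (simp add: cnl_def)
  next
   case False
   hence "fst w \<notin> ?A" using elim(2) by blast
   with False show ?thesis by (simp add: cnl_def indicator_def)
  qed
 qed
 from lin_cong_forcing[OF v(1) cnl_measurable[OF vm] this] have "nsol ?A F v" by (simp add: nsol_def)
 thus ?thesis using F uv by blast
qed

lemma nsol_solution:
 assumes n: "nsol A F v" and I: "time_interval I" "I \<subseteq> A" and F: "is_fourier 2 \<phi> F"
  and um: "(%(t, z). u t z) \<in> bm LT" and uv: "\<And>t. t \<in> I ==> AE z in TR. u t z = v t z"
 shows "is_solution \<alpha> \<epsilon> \<sigma> I \<phi> u"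
proof -
 note Ib = time_interval_borel[OF I(1)]
 have I0: "0 \<in> I" using I(1) by (simp add: time_interval_def)
 have l: "lin F (cnl A v) v" using n by (simp add: nsol_def)
 have FL: "F \<in> Lp_space 2 ZR" using l by (simp add: lin_def)
 have vm: "(%(t, z). v t z) \<in> bm LT" by (rule lin_meas[OF l])
 have ut: "u t \<in> bm TR" for t by (rule section_measurable[OF um])
 have uL: "u t \<in> Lp_space 2 TR" if "t \<in> I" for t
  by (rule Lp_space_cong_AE[OF _ lin_L2[OF l] ut]) (use uv[OF that] in \<open>auto elim!: eventually_mono\<close>)
 have cont: "tendsto_Lp 2 TR u (u t) (at t within I)" if t: "t \<in> I" for t
  unfolding tendsto_Lp_def
 proof
  show "\<forall>\<^sub>F i in at t within I. (%x. u i x - u t x) \<in> Lp_space 2 TR"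
   unfolding eventually_at_filter by (rule always_eventually) (auto intro!: Lp_diff(1) uL t)
  show "((%i. Lp_norm 2 TR (%x. u i x - u t x)) \<longlongrightarrow> 0) (at t within I)"
   unfolding tendsto_at_iff_sequentially
  proof (intro allI impI)
   fix X assume X: "\<forall>i. X i \<in> I - {t}" "X \<longlonglongrightarrow> t"
   have "Lp_norm 2 TR (%x. u (X i) x - u t x) = Lp_norm 2 TR (%x. v (X i) x - v t x)" for i
   proof (rule Lp_norm_cong_AE)
    have "X i \<in> I" using X(1) by blast
    from uv[OF this] uv[OF t] show "AE x in TR. u (X i) x - u t x = v (X i) x - v t x" by eventually_elim simp
   qed (intro borel_measurable_diff ut Lp_measurable[OF lin_L2[OF l]])+
   thus "((%i. Lp_norm 2 TR (%x. u i x - u t x)) \<circ> X) \<longlonglongrightarrow> 0"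
    using lin_continuous[OF l X(2)] by (simp add: comp_def)
  qed
 qed
 have sv: "slab I v \<in> Lp_space 4 LT" by (rule nsol_slab(1)[OF n I(2) Ib])
 have su: "slab I u \<in> Lp_space 4 LT"
 proof (rule Lp_space_cong_AE[OF _ sv slab_measurable[OF um Ib]])
  show "AE w in LT. slab I v w = slab I u w"
  proof (rule slab_cong_AE[OF slab_measurable[OF vm Ib] slab_measurable[OF um Ib]])
   fix t assume "t \<in> I"
   from uv[OF this] show "AE z in TR. v t z = u t z" by eventually_elim simp
  qed
 qed
 have space: "u \<in> solution_space I"
  using restrict_Lp4(1)[OF Ib I0, of u] su uL cont by (simp add: solution_space_def)
 obtain H where D: "duhamel \<alpha> \<epsilon> (cnl A v) H" and vf: "\<And>t. is_fourier 2 (v t) (%k. mul t k * (F k + DW H t k))"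
  using l unfolding lin_def by blast
 interpret D: duhamel \<alpha> \<epsilon> "cnl A v" H by (rule D)
 \<comment> \<open>The inverse of \<kappa>. It undoes the factor built into \<open>cnl\<close>,
   because \<open>is_duhamel\<close> takes the bare cubic term as its forcing.\<close>
 let ?j = "\<i> * complex_of_real \<sigma>"
 have jj: "?j * (- ?j * x) = x" "?j * ?j = - 1" for x using sigma by auto
 have "\<exists>w d. is_group \<alpha> \<epsilon> t \<phi> w \<and> is_duhamel \<alpha> \<epsilon> t (%s z. complex_of_real ((cmod (u s z))\<^sup>2) * u s z) d \<and>
   (AE z in TR. u t z = w z - complex_of_real \<sigma> * \<i> * d z)" if t: "t \<in> I" for t
 proof -
  obtain w where w: "is_fourier 2 w (%k. mul t k * F k)" using inverse_fourier_exists[OF mul_Lp(1)[OF FL]] by blast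
  have "(%k. mul t k * (?j * DW H t k)) \<in> Lp_space 2 ZR"
   by (intro mul_Lp(1) Lp_cmult(1) DW_L2[OF D]) simp
  from inverse_fourier_exists[OF this] obtain d where d: "is_fourier 2 d (%k. mul t k * (?j * DW H t k))" by blast
  have Hm: "(%(s, k). ?j * H s k) \<in> bm LZ" unfolding split_beta' by measurable
  have "is_duhamel \<alpha> \<epsilon> t (%s z. complex_of_real ((cmod (u s z))\<^sup>2) * u s z) d"
   unfolding is_duhamel_def
  proof (intro exI conjI)
   show "(%(s, k). ?j * H s k) \<in> bm LZ" by (rule Hm)
   show "AE s in lborel. s \<in> closed_segment 0 t --> is_fourier (4 / 3) (%z. complex_of_real ((cmod (u s z))\<^sup>2) * u s z) (%k. ?j * H s k)"
    using D.hH
   proof eventually_elim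
    case (elim s)
    show ?case
    proof
     assume "s \<in> closed_segment 0 t"
     hence s: "s \<in> I" using time_interval_segment[OF I(1) t] by blast
     hence sA: "s \<in> A" using I(2) by blast
     note f = is_fourier_cmult[OF fexp_simps(2) elim, of ?j]
     have "is_fourier (4/3) (%z. cubic (u s z)) (%k. ?j * H s k)"
     proof (rule is_fourier_cong_AE[OF fexp_simps(2) f])
      show "AE z in TR. ?j * cnl A v s z = cubic (u s z)"
       using uv[OF s] by eventually_elim (use sA jj in \<open>simp add: cnl_def\<close>)
      show "(%z. cubic (u s z)) \<in> bm TR"
       using ut[of s] cubic_measurable by (rule measurable_compose)
      show "(%k. ?j * H s k) \<in> bm ZR" by measurable
     qed simp
     thus "is_fourier (4 / 3) (%z. complex_of_real ((cmod (u s z))\<^sup>2) * u s z) (%k. ?j * H s k)"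
      by (simp only: cubic_def)
    qed
   qed
   show "AE k in ZR. interval_lebesgue_integrable lborel (ereal 0) (ereal t) (%s. mul (t - s) k * (?j * H s k))"
    using D.good_AE
   proof eventually_elim
    case (elim k)
    have ig: "integrable lborel (%s. indicator {a<..<b} s *\<^sub>R (mul (t - s) k * (?j * H s k)))" for a b
    proof -
     have "{a<..<b} \<subseteq> {- max \<bar>a\<bar> \<bar>b\<bar>..max \<bar>a\<bar> \<bar>b\<bar>}" by auto
     from D.good_integrable[OF elim _ this]
     have "integrable lborel (%s. (mul t k * ?j) * (indicator {a<..<b} s *\<^sub>R (mul (- s) k * H s k)))"
      by (intro integrable_mult_right) simp
     moreover have "(mul t k * ?j) * (indicator {a<..<b} s *\<^sub>R (mul (- s) k * H s k)) = indicator {a<..<b} s *\<^sub>R (mul (t - s) k * (?j * H s k))" for s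
      using multiplier_add[of \<alpha> \<epsilon> t "- s" k] by simp
     ultimately show ?thesis by (simp only:)
    qed
    show ?case
     unfolding interval_lebesgue_integrable_def set_integrable_def using ig by simp
   qed
   show "is_fourier 2 d (%k. LBINT s=ereal 0..ereal t. mul (t - s) k * (?j * H s k))"
    unfolding interval_DW[OF Hm] DW_cmult by (rule d)
  qed
  moreover have "is_group \<alpha> \<epsilon> t \<phi> w" using F w unfolding is_group_def by blast
  moreover have "AE z in TR. v t z = w z - complex_of_real \<sigma> * \<i> * d z"
  proof (rule is_fourier_inject[OF vf is_fourier_diff[OF fexp_simps(1) w is_fourier_cmult[OF fexp_simps(1) d]]])
   show "AE k in ZR. mul t k * (F k + DW H t k) = mul t k * F k - complex_of_real \<sigma> * \<i> * (mul t k * (?j * DW H t k))"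
   proof (rule AE_I2)
    fix k
    have "complex_of_real \<sigma> * \<i> * (mul t k * (?j * DW H t k)) = (?j * ?j) * (mul t k * DW H t k)" by (simp only: mult_ac)
    thus "mul t k * (F k + DW H t k) = mul t k * F k - complex_of_real \<sigma> * \<i> * (mul t k * (?j * DW H t k))"
     unfolding jj by (simp only: distrib_left) simp
   qed
  qed
  hence "AE z in TR. u t z = w z - complex_of_real \<sigma> * \<i> * d z" using uv[OF t] by eventually_elim simp
  ultimately show ?thesis by blast
 qed
 thus ?thesis using space unfolding is_solution_def by blast
qed

section \<open>Existence, comparison of arbitrary solutions, and well-posedness\<close>

lemma nsol_compare:
 assumes n: "nsol A F u" and n': "nsol A' F' u'" and J: "{p..q} \<subseteq> A" "{p..q} \<subseteq> A'" and pq: "p <= 0" "0 <= q"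
  and \<phi>: "is_fourier 2 \<phi> F" "is_fourier 2 \<psi> F'" and small: "Lp_norm 2 TR \<phi> <= \<delta>0" "Lp_norm 2 TR \<psi> <= \<delta>0"
  and t: "t \<in> {p..q}" "\<bar>t\<bar> <= real m"
 defines "N \<equiv> Lp_norm 2 TR (%z. \<phi> z - \<psi> z)"
 shows "Lp_norm 2 TR (%z. u t z - u' t z) <= (2 * lin_const) ^ m * N"
  "slab (closed_segment 0 t) (%t z. u t z - u' t z) \<in> Lp_space 4 LT"
  "Lp_norm 4 LT (slab (closed_segment 0 t) (%t z. u t z - u' t z)) <= real m * (2 * lin_const) ^ m * N"
proof -
 have l: "lin F (cnl A u) u" "lin F' (cnl A' u') u'" using n n' by (simp_all add: nsol_def)
 have 0: "is_fourier 2 (u 0) F" "is_fourier 2 (u' 0) F'" by (rule lin_initial[OF l(1)]) (rule lin_initial[OF l(2)])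
 have "2 * pi * Lp_norm 2 TR (u 0) = 2 * pi * Lp_norm 2 TR \<phi>" "2 * pi * Lp_norm 2 TR (u' 0) = 2 * pi * Lp_norm 2 TR \<psi>"
  using is_fourier_norm(2)[OF fexp_simps(1)] 0 \<phi> by metis+
 hence s: "Lp_norm 2 TR (u 0) <= \<delta>0" "Lp_norm 2 TR (u' 0) <= \<delta>0" using small by auto
 have "2 * pi * Lp_norm 2 TR (%z. u 0 z - u' 0 z) = 2 * pi * N"
  using is_fourier_norm(2)[OF fexp_simps(1)] is_fourier_diff[OF fexp_simps(1)] 0 \<phi> unfolding N_def by metis
 hence "Lp_norm 2 TR (%z. u 0 z - u' 0 z) = N" by simp
 from nsol_lipschitz[OF n n' J pq s t, unfolded this]
 show "Lp_norm 2 TR (%z. u t z - u' t z) <= (2 * lin_const) ^ m * N"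
  "slab (closed_segment 0 t) (%t z. u t z - u' t z) \<in> Lp_space 4 LT"
  "Lp_norm 4 LT (slab (closed_segment 0 t) (%t z. u t z - u' t z)) <= real m * (2 * lin_const) ^ m * N" .
qed

lemma solution_exists:
 assumes \<phi>: "\<phi> \<in> Lp_space 2 TR" and small: "Lp_norm 2 TR \<phi> <= \<delta>0"
 shows "\<exists>u. \<forall>I. time_interval I --> is_solution \<alpha> \<epsilon> \<sigma> I \<phi> u"
proof -
 obtain F where F: "is_fourier 2 \<phi> F" using is_fourier_exists[OF fexp_simps(1) \<phi>] by blast
 have FL: "F \<in> Lp_space 2 ZR" using is_fourierD(2)[OF F] by simp
 have "Lp_norm 2 ZR F <= 2 * pi * \<delta>0" using is_fourier_norm(2)[OF fexp_simps(1) F HOL.refl] small by simp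
 from nsol_exists[OF FL this] obtain U where U: "\<And>n. nsol {- real n..real n} F (U n)" by metis
 \<comment> \<open>By comparison with equal data, all \<open>U n\<close> with
   \<open>n >= \<bar>t\<bar>\<close> agree at \<open>t\<close> up to a null set. Taking the first of
   them makes \<open>u\<close> a measurable countable selection.\<close>
 define u where "u = (%t. U (nat \<lceil>\<bar>t\<bar>\<rceil>) t)"
 have um: "(%(t, z). u t z) \<in> bm LT"
 proof -
  have "(%(t, z). U n t z) \<in> bm LT" for n using U[of n] by (auto simp: nsol_def dest: lin_meas)
  hence 1: "(%w. U n (fst w) (snd w)) \<in> bm LT" for n by (simp add: split_beta')
  have "(%w. U (nat \<lceil>\<bar>fst w\<bar>\<rceil>) (fst w) (snd w)) \<in> bm LT"
   by (rule measurable_compose_countable[where f = "%n w. U n (fst w) (snd w)", OF 1]) measurable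
  thus ?thesis by (simp add: u_def split_beta')
 qed
 have "is_solution \<alpha> \<epsilon> \<sigma> I \<phi> u" if I: "time_interval I" for I
 proof -
  obtain m :: nat where B: "\<And>t. t \<in> I ==> \<bar>t\<bar> <= real m" using time_interval_bound[OF I] by blast
  show ?thesis
  proof (rule nsol_solution[OF U[of m] I _ F um])
   show "I \<subseteq> {- real m..real m}" using B by (fastforce simp: abs_le_iff)
   fix t assume t: "t \<in> I"
   define k where "k = nat \<lceil>\<bar>t\<bar>\<rceil>"
   have k: "\<bar>t\<bar> <= real k" "k <= m" using B[OF t] by (auto simp: k_def nat_le_iff ceiling_le_iff)
   have tk: "t \<in> {- real k..real k}" using k by auto
   have sub: "{- real k..real k} \<subseteq> {- real m..real m}" using k by auto
   have "Lp_norm 2 TR (%z. U k t z - U m t z) <= (2 * lin_const) ^ k * Lp_norm 2 TR (%z. \<phi> z - \<phi> z)"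
    by (rule nsol_compare(1)[OF U[of k] U[of m] order_refl sub _ _ F F small small tk k(1)]) auto
   hence "Lp_norm 2 TR (%z. U k t z - U m t z) = 0" by (simp add: order_antisym)
   moreover have "(%z. U k t z - U m t z) \<in> Lp_space 2 TR"
    using U[of k] U[of m] unfolding nsol_def by (intro Lp_diff(1)) (auto intro: lin_L2)
   ultimately have "AE z in TR. U k t z - U m t z = 0" by (intro Lp_norm_eq_0_AE[where p = 2]) auto
   thus "AE z in TR. u t z = U m t z" by eventually_elim (simp add: u_def k_def)
  qed
 qed
 thus ?thesis by blast
qed

lemma solution_compare:
 assumes I: "time_interval I" and m: "\<forall>t\<in>I. \<bar>t\<bar> <= real m"
  and u: "is_solution \<alpha> \<epsilon> \<sigma> I \<phi> u" and v: "is_solution \<alpha> \<epsilon> \<sigma> I \<psi> v"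
  and small: "Lp_norm 2 TR \<phi> <= \<delta>0" "Lp_norm 2 TR \<psi> <= \<delta>0"
 defines "N \<equiv> Lp_norm 2 TR (%z. \<phi> z - \<psi> z)"
 shows "t \<in> I ==> Lp_norm 2 TR (%z. u t z - v t z) <= (2 * lin_const) ^ m * N"
  "Lp_norm 4 (RT I) (%(t, z). u t z - v t z) <= 2 * (real m * (2 * lin_const) ^ m * N)"
proof -
 obtain F u' where U: "is_fourier 2 \<phi> F" "nsol {Inf I..Sup I} F u'" "\<And>t. t \<in> I ==> AE z in TR. u t z = u' t z"
  using solution_nsol[OF u I] by blast
 obtain G v' where V: "is_fourier 2 \<psi> G" "nsol {Inf I..Sup I} G v'" "\<And>t. t \<in> I ==> AE z in TR. v t z = v' t z"
  using solution_nsol[OF v I] by blast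
 note hull = time_interval_hull[OF I]
 note Ib = time_interval_borel[OF I]
 have I0: "0 \<in> I" using I by (simp add: time_interval_def)
 have bd: "\<bar>t\<bar> <= real m" if "t \<in> {Inf I..Sup I}" for t
 proof -
  have "Sup I <= real m" using I0 m by (intro cSup_least) (auto simp: abs_le_iff)
  moreover have "- real m <= Inf I" using I0 m by (intro cInf_greatest) (force simp: abs_le_iff)+
  ultimately show ?thesis using that by auto
 qed
 have cmp: "Lp_norm 2 TR (%z. u' t z - v' t z) <= (2 * lin_const) ^ m * N"
  "slab (closed_segment 0 t) (%t z. u' t z - v' t z) \<in> Lp_space 4 LT"
  "Lp_norm 4 LT (slab (closed_segment 0 t) (%t z. u' t z - v' t z)) <= real m * (2 * lin_const) ^ m * N"
  if "t \<in> {Inf I..Sup I}" for t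
  using nsol_compare[OF U(2) V(2) order_refl order_refl hull(2,3) U(1) V(1) small that bd[OF that]] by (auto simp: N_def)
 have uS: "u \<in> solution_space I" "v \<in> solution_space I" using u v by (auto simp: is_solution_def)
 have l: "lin F (cnl {Inf I..Sup I} u') u'" "lin G (cnl {Inf I..Sup I} v') v'" using U V by (simp_all add: nsol_def)
 have dm: "(%(t, z). u' t z - v' t z) \<in> bm LT" by (rule lin_meas[OF lin_diff[OF l]])
 {
  assume t: "t \<in> I"
  have "Lp_norm 2 TR (%z. u t z - v t z) = Lp_norm 2 TR (%z. u' t z - v' t z)"
  proof (rule Lp_norm_cong_AE)
   show "AE z in TR. u t z - v t z = u' t z - v' t z" using U(3)[OF t] V(3)[OF t] by eventually_elim simp
   show "(%z. u t z - v t z) \<in> bm TR"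
    using uS t by (intro borel_measurable_diff) (auto simp: solution_space_def Lp_space_def)
   show "(%z. u' t z - v' t z) \<in> bm TR" by (rule section_measurable[OF dm])
  qed
  thus "Lp_norm 2 TR (%z. u t z - v t z) <= (2 * lin_const) ^ m * N"
   using cmp(1)[of t] t hull(1) by auto
 }
 have sI: "slab I u \<in> Lp_space 4 LT" "slab I v \<in> Lp_space 4 LT"
  using uS restrict_Lp4(1)[OF Ib I0] by (auto simp: solution_space_def)
 have sd: "slab I (%t z. u t z - v t z) \<in> Lp_space 4 LT"
  using Lp_diff(1)[OF sI] by (simp add: slab_diff[abs_def])
 have s': "slab I (%t z. u' t z - v' t z) \<in> bm LT" by (rule slab_measurable[OF dm Ib])
 have pq: "Inf I \<in> {Inf I..Sup I}" "Sup I \<in> {Inf I..Sup I}" using hull by auto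
 \<comment> \<open>The comparison is stated on segments starting at 0; two of them cover
   \<open>I\<close>, whence the factor 2.\<close>
 have "I \<subseteq> closed_segment 0 (Inf I) \<union> closed_segment 0 (Sup I)"
  using hull by (auto simp: closed_segment_eq_real_ivl subset_iff)
 note Un = slab_Un[OF cmp(2)[OF pq(1)] cmp(2)[OF pq(2)] this s' one_le_numeral]
 have "Lp_norm 4 (RT I) (%(t, z). u t z - v t z) = Lp_norm 4 LT (slab I (%t z. u t z - v t z))"
  by (rule restrict_Lp4(2)[OF Ib I0 sd])
 also have "... = Lp_norm 4 LT (slab I (%t z. u' t z - v' t z))"
 proof (rule Lp_norm_cong_AE[OF slab_cong_AE[OF Lp_measurable[OF sd] s'] Lp_measurable[OF sd] s'])
  fix t assume t: "t \<in> I"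
  show "AE z in TR. u t z - v t z = u' t z - v' t z" using U(3)[OF t] V(3)[OF t] by eventually_elim simp
 qed
 also have "... <= 2 * (real m * (2 * lin_const) ^ m * N)" using Un(2) cmp(3)[OF pq(1)] cmp(3)[OF pq(2)] by simp
 finally show "Lp_norm 4 (RT I) (%(t, z). u t z - v t z) <= 2 * (real m * (2 * lin_const) ^ m * N)" .
qed

theorem well_posed: "globally_well_posed \<alpha> \<epsilon> \<sigma> {\<phi> \<in> Lp_space 2 TR. Lp_norm 2 TR \<phi> <= \<delta>0}"
proof -
 have uniq: "AE z in TR. u t z = v t z"
  if s: "Lp_norm 2 TR \<phi> <= \<delta>0" and I: "time_interval I" and u: "is_solution \<alpha> \<epsilon> \<sigma> I \<phi> u" and v: "is_solution \<alpha> \<epsilon> \<sigma> I \<phi> v"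
   and t: "t \<in> I" for \<phi> I u v t
 proof -
  obtain m :: nat where m: "\<forall>t\<in>I. \<bar>t\<bar> <= real m" using time_interval_bound[OF I] by blast
  have "Lp_norm 2 TR (%z. u t z - v t z) = 0"
   using solution_compare(1)[OF I m u v s s t] by (simp add: order_antisym)
  moreover have "(%z. u t z - v t z) \<in> Lp_space 2 TR"
   using u v t by (intro Lp_diff(1)) (auto simp: is_solution_def solution_space_def)
  ultimately have "AE z in TR. u t z - v t z = 0" by (intro Lp_norm_eq_0_AE[where p = 2]) auto
  thus ?thesis by eventually_elim simp
 qed
 have cont: "\<exists>d>0. \<forall>\<psi>. Lp_norm 2 TR \<psi> <= \<delta>0 --> Lp_norm 2 TR (%z. \<psi> z - \<phi> z) < d -->
   (\<forall>u v. is_solution \<alpha> \<epsilon> \<sigma> I \<phi> u --> is_solution \<alpha> \<epsilon> \<sigma> I \<psi> v -->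
    (\<forall>t\<in>I. Lp_norm 2 TR (%z. v t z - u t z) < e) \<and>
    Lp_norm 4 (RT I) (%(t, z). v t z - u t z) < e)"
  if s: "Lp_norm 2 TR \<phi> <= \<delta>0" and I: "time_interval I" and e: "e > 0" for \<phi> I e
 proof -
  obtain m :: nat where m: "\<forall>t\<in>I. \<bar>t\<bar> <= real m" using time_interval_bound[OF I] by blast
  define C where "C = (2 * lin_const) ^ m"
  \<comment> \<open>Dominates the constants of both estimates and is positive, so that
    \<open>e / K\<close> serves for the two norms at once.\<close>
  define K where "K = 1 + C + 2 * (real m * C)"
  have C: "C >= 0" using lin_const_pos by (simp add: C_def)
  hence K: "K > 0" "C <= K" "2 * (real m * C) <= K" by (simp_all add: K_def add_pos_nonneg)
  show ?thesis
  proof (intro exI conjI allI impI ballI)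
   show "e / K > 0" using e K by simp
   fix \<psi> u v
   assume a: "Lp_norm 2 TR \<psi> <= \<delta>0" "Lp_norm 2 TR (%z. \<psi> z - \<phi> z) < e / K"
    "is_solution \<alpha> \<epsilon> \<sigma> I \<phi> u" "is_solution \<alpha> \<epsilon> \<sigma> I \<psi> v"
   note cmp = solution_compare[OF I m a(4,3) a(1) s, folded C_def]
   let ?N = "Lp_norm 2 TR (%z. \<psi> z - \<phi> z)"
   have KN: "K * ?N < e" using a(2) K(1) by (simp add: field_simps)
   show "Lp_norm 2 TR (%z. v t z - u t z) < e" if "t \<in> I" for t
    using cmp(1)[OF that] mult_right_mono[OF K(2), of ?N] KN by simp
   show "Lp_norm 4 (RT I) (%(t, z). v t z - u t z) < e"
    using cmp(2) mult_right_mono[OF K(3), of ?N] KN by (simp add: mult.assoc)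
  qed
 qed
 show ?thesis
  unfolding globally_well_posed_def
 proof (intro conjI ballI)
  fix \<phi> assume \<phi>: "\<phi> \<in> {\<phi> \<in> Lp_space 2 TR. Lp_norm 2 TR \<phi> <= \<delta>0}"
  show "\<exists>u. \<forall>I. time_interval I --> is_solution \<alpha> \<epsilon> \<sigma> I \<phi> u" using \<phi> by (intro solution_exists) auto
  show "\<forall>I u v. time_interval I --> is_solution \<alpha> \<epsilon> \<sigma> I \<phi> u --> is_solution \<alpha> \<epsilon> \<sigma> I \<phi> v --> (\<forall>t\<in>I. AE z in TR. u t z = v t z)"
   using \<phi> uniq by blast
  show "\<forall>I. time_interval I --> (\<forall>e>0. \<exists>d>0. \<forall>\<psi>\<in>{\<phi> \<in> Lp_space 2 TR. Lp_norm 2 TR \<phi> <= \<delta>0}.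
    Lp_norm 2 TR (%z. \<psi> z - \<phi> z) < d --> (\<forall>u v. is_solution \<alpha> \<epsilon> \<sigma> I \<phi> u --> is_solution \<alpha> \<epsilon> \<sigma> I \<psi> v -->
     (\<forall>t\<in>I. Lp_norm 2 TR (%z. v t z - u t z) < e) \<and>
     Lp_norm 4 (RT I) (%(t, z). v t z - u t z) < e))"
  proof (intro allI impI)
   fix I and e :: real assume I: "time_interval I" and e: "0 < e"
   have "Lp_norm 2 TR \<phi> <= \<delta>0" using \<phi> by simp
   from cont[OF this I e]
   show "\<exists>d>0. \<forall>\<psi>\<in>{\<phi> \<in> Lp_space 2 TR. Lp_norm 2 TR \<phi> <= \<delta>0}.
    Lp_norm 2 TR (%z. \<psi> z - \<phi> z) < d --> (\<forall>u v. is_solution \<alpha> \<epsilon> \<sigma> I \<phi> u --> is_solution \<alpha> \<epsilon> \<sigma> I \<psi> v -->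
     (\<forall>t\<in>I. Lp_norm 2 TR (%z. v t z - u t z) < e) \<and>
     Lp_norm 4 (RT I) (%(t, z). v t z - u t z) < e)"
    by (rule ex_forward) (simp only: Ball_def mem_Collect_eq, blast)
  qed
 qed
qed

end

theorem theorem2p2:
  fixes \<alpha> \<epsilon> \<sigma> :: real
  assumes "\<alpha> < 0" and "\<epsilon> \<in> {0, 1}" and "\<sigma> \<in> {1, -1}"
  shows "\<exists>\<delta>>0. globally_well_posed \<alpha> \<epsilon> \<sigma> {\<phi> \<in> Lp_space 2 TR. Lp_norm 2 TR \<phi> \<le> \<delta>}"
proof -
 interpret nls \<alpha> \<epsilon> \<sigma> using assms by unfold_locales auto
 show ?thesis using \<delta>0(1) well_posed by blast
qed

end
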